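(* Let $\varphi$ be a growth function on $\mathbb R^n\times[0,\infty)$ satisfying $np(\varphi)<(n+1)i(\varphi)$ and $$\frac{2np(\varphi)}{i(\varphi)}-\frac{n[r(\varphi)-1]}{r(\varphi)}<n+1.$$ Suppose in addition that either there exists a positive constant $C$ such that $\frac{\|\chi_{B_1}\|_{L^\varphi(\mathbb R^n)}}{|B_1|}\le C\frac{\|\chi_{B_2}\|_{L^\varphi(\mathbb R^n)}}{|B_2|}$ for all balls $B_1\subset B_2$ in $\mathbb R^n$, or $p(\varphi)[r(\varphi)]'\in(1,2)$. Then (with the spaces $\widetilde{\mathrm{BMO}}$ formed with suitable admissible parameters, as described in the context, which exist) the spaces $$\mathrm{BMO}^{\varphi}(\mathbb R^n),\ \mathrm{BMO}^{\varphi}_{\sqrt\Delta}(\mathbb R^n),\ \mathrm{BMO}^{\varphi}_{\sqrt\Delta,\max}(\mathbb R^n),\ \widetilde{\mathrm{BMO}}^{\varphi}_{\sqrt\Delta}(\mathbb R^n),\ \mathrm{BMO}^{\varphi}_{\Delta}(\mathbb R^n),\ \mathrm{BMO}^{\varphi}_{\Delta,\max}(\mathbb R^n),\ \widetilde{\mathrm{BMO}}^{\varphi}_{\Delta}(\mathbb R^n)$$ coincide with equivalent norms.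
   Context: $\mathbb R^n$ carries the Euclidean metric and Lebesgue measure; $|E|$ is the Lebesgue measure of $E$; balls are Euclidean; $s'$ is the conjugate index of $s$ ($1/s+1/s'=1$). **Growth functions.** $\varphi:\mathbb R^n\times[0,\infty)\to[0,\infty)$ is of uniformly upper type $p$ (resp. uniformly lower type $p$) if $\exists C$ with $\varphi(x,st)\le Cs^p\varphi(x,t)$ for all $x$, $t\ge0$ and $s\ge1$ (resp. $s\in(0,1)$). For $p\in(1,\infty)$, $\varphi\in\mathbb A_p(\mathbb R^n)$ means $\sup_{t>0}\sup_B\frac1{|B|}\int_B\varphi(x,t)dx\{\frac1{|B|}\int_B[\varphi(x,t)]^{-1/(p-1)}dx\}^{p-1}<\infty$; $\varphi\in\mathbb A_1(\mathbb R^n)$ means $\sup_{t>0}\sup_B\frac1{|B|}\int_B\varphi(x,t)dx\{\mathrm{ess\,sup}_{y\in B}[\varphi(y,t)]^{-1}\}<\infty$; $\mathbb A_\infty=\bigcup_{p\in[1,\infty)}\mathbb A_p$. For $q\in(1,\infty)$, $\varphi\in\mathbb{RH}_q(\mathbb R^n)$ means $\sup_{t>0}\sup_B\{\frac1{|B|}\int_B[\varphi(x,t)]^qdx\}^{1/q}\{\frac1{|B|}\int_B\varphi(x,t)dx\}^{-1}<\infty$; for $q=\infty$ the first factor is replaced by $\mathrm{ess\,sup}_{y\in B}\varphi(y,t)$. $\varphi$ is a growth function if: for each $x$, $\varphi(x,\cdot)$ is nondecreasing, $\varphi(x,0)=0$, $\varphi(x,t)>0$ for $t>0$, $\lim_{t\to\infty}\varphi(x,t)=\infty$;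 $\varphi(\cdot,t)$ is measurable for each $t$; $\varphi\in\mathbb A_\infty(\mathbb R^n)$; $\varphi$ is of uniformly upper type $1$ and of uniformly lower type $p$ for some $p\in(0,1]$. $i(\varphi)=\sup\{p>0:\varphi$ of uniformly lower type $p\}$; $p(\varphi)=\inf\{p\in[1,\infty):\varphi\in\mathbb A_p(\mathbb R^n)\}$; $r(\varphi)=\sup\{q\in(1,\infty]:\varphi\in\mathbb{RH}_q(\mathbb R^n)\}$, with $(r-1)/r:=1$ if $r=\infty$. $\|f\|_{L^\varphi(\mathbb R^n)}=\inf\{\lambda>0:\int_{\mathbb R^n}\varphi(x,|f(x)|/\lambda)dx\le1\}$. **Space $\mathrm{BMO}^\varphi(\mathbb R^n)$.** Locally integrable $f$ with $\|f\|_{\mathrm{BMO}^\varphi(\mathbb R^n)}=\sup_B\frac1{\|\chi_B\|_{L^\varphi(\mathbb R^n)}}\int_B|f(x)-f_B|dx<\infty$, $f_B=\frac1{|B|}\int_Bf$. **Semigroups.** $\Delta=-\sum_{i=1}^n\partial_{x_i}^2$. Poisson case (subscript $\sqrt\Delta$): $m=1$, $\mathcal M=\{f\in L^1_{\rm loc}(\mathbb R^n): f(x)(1+|x|^{n+1})^{-1}\in L^1(\mathbb R^n)\}$, $A_tf(x)=\int_{\mathbb R^n}\frac{c_nt}{(t^2+|x-y|^2)^{(n+1)/2}}f(y)dy$ with $c_n=\Gamma[(n+1)/2]/\pi^{(n+1)/2}$. Heat case (subscript $\Delta$): $m=2$, $\mathcal M=\{f:\int_{\mathbb R^n}|f(x)|e^{-|x|}dx<\infty\}$,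 $A_tf(x)=\int_{\mathbb R^n}(4\pi t)^{-n/2}e^{-|x-y|^2/(4t)}f(y)dy$. **Spaces associated with $\{A_t\}$** (subscript $A$ is $\sqrt\Delta$ or $\Delta$; $t_B:=r_B^m$, $r_B$ the radius of $B$): $\mathrm{BMO}^\varphi_A$: $f\in\mathcal M$ with $\sup_B\frac1{\|\chi_B\|_{L^\varphi}}\int_B|f-A_{t_B}f|\,dx<\infty$ (this supremum is the norm). $\mathrm{BMO}^\varphi_{A,\max}$: $f\in\mathcal M$ with $\sup_{t>0,\,x\in\mathbb R^n}\frac{|B(x,t^{1/m})|}{\|\chi_{B(x,t^{1/m})}\|_{L^\varphi}}|A_t(|f-A_tf|)(x)|<\infty$ (this supremum is the norm). $\widetilde{\mathrm{BMO}}^\varphi_A$: $f\in\mathcal M$ for which there are $C>0$ and functions $\{f^B\}_B$, one for each ball $B$, with (1) $\sup_B\frac1{\|\chi_B\|_{L^\varphi}}\int_B|f-f^B|dx\le C$; (2) $|f^{B_2}(x)-f^{B_1}(x)|\le C\frac{\|\chi_{B(x,r_{B_1})}\|_{L^\varphi}}{|B(x,r_{B_1})|}\big(\frac{r_{B_2}}{r_{B_1}}\big)^{\frac{\nu p_1}p-\alpha}$ for all balls $B_1\subset B_2$ and a.e. $x$; (3) $|f^B(x)-A_{t_B}f^B(x)|\le C\frac{\|\chi_{B(x,r_B)}\|_{L^\varphi}}{|B(x,r_B)|}$ for all $B$ and a.e. $x$; the norm is the infimum of such $C$ over all such families. Here $(\nu,N,\alpha,p_1,p,q)$ are admissible parameters: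 $\nu\ge n$, $N\ge0$, $\alpha\in[0,n]$, $p_1\in[p(\varphi),\infty)$ with $\varphi\in\mathbb A_{p_1}(\mathbb R^n)$, $p\in(0,i(\varphi)]$ with $\varphi$ of uniformly lower type $p$, $q\in(1,r(\varphi)]$ with $\varphi\in\mathbb{RH}_q(\mathbb R^n)$, and $\nu+\frac{2\nu p_1}p+N-\frac{\nu(q-1)}q-\alpha<M$ for some decay order $M$ of the kernel (some $M<n+1$ in the Poisson case; some finite $M$ in the heat case). **Convention.** Spaces associated with $\{A_t\}$ are considered modulo $\mathcal K_A=\{f\in\mathcal M: A_tf=f$ a.e. for all $t>0\}$, on which the seminorm of $\mathrm{BMO}^\varphi_A$ vanishes (functions differing by an element of $\mathcal K_A$ are identified). *)

theory Defs
  imports "HOL-Analysis.Analysis" "HOL-Probability.Essential_Supremum"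
begin

definition avg_on :: "(real^'n) set \<Rightarrow> (real^'n \<Rightarrow> real) \<Rightarrow> real" where
  "avg_on B g = (LINT x:B|lebesgue. g x) / measure lebesgue B"

definition uniformly_lower_type :: "real \<Rightarrow> (real^'n \<Rightarrow> real \<Rightarrow> real) \<Rightarrow> bool" where
  "uniformly_lower_type p \<phi> \<longleftrightarrow>
     (\<exists>C. \<forall>x. \<forall>t\<ge>0. \<forall>s. 0 < s \<and> s < 1 \<longrightarrow> \<phi> x (s * t) \<le> C * s powr p * \<phi> x t)"

definition uniformly_upper_type :: "real \<Rightarrow> (real^'n \<Rightarrow> real \<Rightarrow> real) \<Rightarrow> bool" where
  "uniformly_upper_type p \<phi> \<longleftrightarrow>
     (\<exists>C. \<forall>x. \<forall>t\<ge>0. \<forall>s\<ge>1. \<phi> x (s * t) \<le> C * s powr p * \<phi> x t)"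

text \<open>Finiteness of the suprema below is spelled out with a uniform bound. All averages involved
  are averages of positive functions, so they have to be finite; as the Bochner integral of a
  non-integrable function is \<open>0\<close>, this is required separately.\<close>

definition Muckenhoupt :: "real \<Rightarrow> (real^'n \<Rightarrow> real \<Rightarrow> real) \<Rightarrow> bool" where
  "Muckenhoupt p \<phi> \<longleftrightarrow>
     (if p = 1 then
        (\<exists>C. \<forall>t>0. \<forall>c. \<forall>r>0.
           set_integrable lebesgue (ball c r) (\<lambda>x. \<phi> x t) \<and>
           ereal (avg_on (ball c r) (\<lambda>x. \<phi> x t))
             * esssup (restrict_space lebesgue (ball c r)) (\<lambda>y. ereal (inverse (\<phi> y t)))
           \<le> ereal C)
      else
        1 < p \<and>
        (\<exists>C. \<forall>t>0. \<forall>c. \<forall>r>0.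
           set_integrable lebesgue (ball c r) (\<lambda>x. \<phi> x t) \<and>
           set_integrable lebesgue (ball c r) (\<lambda>x. \<phi> x t powr (- 1 / (p - 1))) \<and>
           avg_on (ball c r) (\<lambda>x. \<phi> x t)
             * avg_on (ball c r) (\<lambda>x. \<phi> x t powr (- 1 / (p - 1))) powr (p - 1)
           \<le> C))"

definition Muckenhoupt_infinity :: "(real^'n \<Rightarrow> real \<Rightarrow> real) \<Rightarrow> bool" where
  "Muckenhoupt_infinity \<phi> \<longleftrightarrow> (\<exists>p\<ge>1. Muckenhoupt p \<phi>)"

definition reverse_Hoelder :: "ereal \<Rightarrow> (real^'n \<Rightarrow> real \<Rightarrow> real) \<Rightarrow> bool" where
  "reverse_Hoelder q \<phi> \<longleftrightarrow>
     (if q = \<infinity> then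
        (\<exists>C. \<forall>t>0. \<forall>c. \<forall>r>0.
           set_integrable lebesgue (ball c r) (\<lambda>x. \<phi> x t) \<and>
           esssup (restrict_space lebesgue (ball c r)) (\<lambda>y. ereal (\<phi> y t))
             * ereal (inverse (avg_on (ball c r) (\<lambda>x. \<phi> x t)))
           \<le> ereal C)
      else
        1 < q \<and>
        (\<exists>C. \<forall>t>0. \<forall>c. \<forall>r>0.
           set_integrable lebesgue (ball c r) (\<lambda>x. \<phi> x t) \<and>
           set_integrable lebesgue (ball c r) (\<lambda>x. \<phi> x t powr real_of_ereal q) \<and>
           avg_on (ball c r) (\<lambda>x. \<phi> x t powr real_of_ereal q) powr (1 / real_of_ereal q)
             * inverse (avg_on (ball c r) (\<lambda>x. \<phi> x t))
           \<le> C))"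

definition growth_function :: "(real^'n \<Rightarrow> real \<Rightarrow> real) \<Rightarrow> bool" where
  "growth_function \<phi> \<longleftrightarrow>
     (\<forall>x. mono_on {0..} (\<phi> x) \<and> \<phi> x 0 = 0 \<and> (\<forall>t>0. \<phi> x t > 0)
          \<and> filterlim (\<phi> x) at_top at_top) \<and>
     (\<forall>t\<ge>0. (\<lambda>x. \<phi> x t) \<in> borel_measurable lebesgue) \<and>
     Muckenhoupt_infinity \<phi> \<and>
     uniformly_upper_type 1 \<phi> \<and>
     (\<exists>p. 0 < p \<and> p \<le> 1 \<and> uniformly_lower_type p \<phi>)"

text \<open>For a growth function the three sets below are nonempty (the last one by the reverse
  Hoelder property of Muckenhoupt weights); the first is bounded above by \<open>1\<close>, because
  \<open>\<phi>\<close> is of uniformly upper type \<open>1\<close>.\<close>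

definition lower_type_index :: "(real^'n \<Rightarrow> real \<Rightarrow> real) \<Rightarrow> real" where
  "lower_type_index \<phi> = Sup {p. 0 < p \<and> uniformly_lower_type p \<phi>}"

definition weight_index :: "(real^'n \<Rightarrow> real \<Rightarrow> real) \<Rightarrow> real" where
  "weight_index \<phi> = Inf {p. 1 \<le> p \<and> Muckenhoupt p \<phi>}"

definition reverse_Hoelder_index :: "(real^'n \<Rightarrow> real \<Rightarrow> real) \<Rightarrow> ereal" where
  "reverse_Hoelder_index \<phi> = Sup {q. 1 < q \<and> reverse_Hoelder q \<phi>}"

text \<open>\<open>(r - 1) / r\<close> and the conjugate index \<open>r'\<close>, with their limits at \<open>r = \<infinity>\<close>.\<close>

definition minus_one_ratio :: "ereal \<Rightarrow> real" where
  "minus_one_ratio r = (if r = \<infinity> then 1 else (real_of_ereal r - 1) / real_of_ereal r)"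

definition conjugate_index :: "ereal \<Rightarrow> real" where
  "conjugate_index r = (if r = \<infinity> then 1 else real_of_ereal r / (real_of_ereal r - 1))"

text \<open>Used only for characteristic functions of balls, for which the set is nonempty
  whenever \<open>\<phi>\<close> is a growth function.\<close>

definition Lphi_norm :: "(real^'n \<Rightarrow> real \<Rightarrow> real) \<Rightarrow> (real^'n \<Rightarrow> real) \<Rightarrow> real" where
  "Lphi_norm \<phi> f = Inf {s. 0 < s \<and> (\<integral>\<^sup>+x. ennreal (\<phi> x (\<bar>f x\<bar> / s)) \<partial>lebesgue) \<le> 1}"

definition chi_norm :: "(real^'n \<Rightarrow> real \<Rightarrow> real) \<Rightarrow> real^'n \<Rightarrow> real \<Rightarrow> real" where
  "chi_norm \<phi> c r = Lphi_norm \<phi> (indicator (ball c r))"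

definition locally_integrable :: "(real^'n \<Rightarrow> complex) \<Rightarrow> bool" where
  "locally_integrable f \<longleftrightarrow> (\<forall>S. compact S \<longrightarrow> f absolutely_integrable_on S)"

text \<open>A space of functions, given by its members together with its (semi)norm. Norms take values
  in the extended nonnegative reals, so that a divergent integral or an infinite supremum
  is \<open>\<infinity>\<close>.\<close>

type_synonym 'n fspace = "(real^'n \<Rightarrow> complex) set \<times> ((real^'n \<Rightarrow> complex) \<Rightarrow> ennreal)"

definition ball_mean :: "(real^'n \<Rightarrow> complex) \<Rightarrow> real^'n \<Rightarrow> real \<Rightarrow> complex" where
  "ball_mean f c r = (1 / measure lebesgue (ball c r)) *\<^sub>R (LINT x:ball c r|lebesgue. f x)"

definition BMO_norm :: "(real^'n \<Rightarrow> real \<Rightarrow> real) \<Rightarrow> (real^'n \<Rightarrow> complex) \<Rightarrow> ennreal" where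
  "BMO_norm \<phi> f =
     (SUP (c, r) \<in> UNIV \<times> {0<..}.
        (\<integral>\<^sup>+x\<in>ball c r. ennreal (norm (f x - ball_mean f c r)) \<partial>lebesgue)
          / ennreal (chi_norm \<phi> c r))"

definition BMO :: "(real^'n \<Rightarrow> real \<Rightarrow> real) \<Rightarrow> 'n fspace" where
  "BMO \<phi> = ({f. locally_integrable f \<and> BMO_norm \<phi> f < \<infinity>}, BMO_norm \<phi>)"

text \<open>The operator \<open>A\<close> indexing the semigroup: \<open>Sqrt_Laplacian\<close> generates the Poisson semigroup,
  \<open>Laplacian\<close> (the nonnegative Laplacian) the heat semigroup.\<close>

datatype generator = Sqrt_Laplacian | Laplacian

fun gen_order :: "generator \<Rightarrow> nat" where
  "gen_order Sqrt_Laplacian = 1"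
| "gen_order Laplacian = 2"

fun kernel :: "generator \<Rightarrow> real \<Rightarrow> real^'n \<Rightarrow> real^'n \<Rightarrow> real" where
  "kernel Sqrt_Laplacian t x y =
     Gamma ((real CARD('n) + 1) / 2) / pi powr ((real CARD('n) + 1) / 2) * t
       / (t\<^sup>2 + (norm (x - y))\<^sup>2) powr ((real CARD('n) + 1) / 2)"
| "kernel Laplacian t x y =
     (4 * pi * t) powr (- real CARD('n) / 2) * exp (- (norm (x - y))\<^sup>2 / (4 * t))"

fun dom_class :: "generator \<Rightarrow> (real^'n \<Rightarrow> complex) set" where
  "dom_class Sqrt_Laplacian =
     {f. locally_integrable f \<and>
         integrable lebesgue (\<lambda>x. inverse (1 + norm x ^ (CARD('n) + 1)) *\<^sub>R f x)}"
| "dom_class Laplacian = {f. integrable lebesgue (\<lambda>x. exp (- norm x) *\<^sub>R f x)}"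

definition semigroup_op ::
    "generator \<Rightarrow> real \<Rightarrow> (real^'n \<Rightarrow> complex) \<Rightarrow> real^'n \<Rightarrow> complex" where
  "semigroup_op A t f x = (LINT y|lebesgue. kernel A t x y *\<^sub>R f y)"

text \<open>The semigroup on nonnegative functions; unlike the Bochner integral it is \<open>\<infinity>\<close> when
  the integral diverges.\<close>

definition semigroup_nn ::
    "generator \<Rightarrow> real \<Rightarrow> (real^'n \<Rightarrow> real) \<Rightarrow> real^'n \<Rightarrow> ennreal" where
  "semigroup_nn A t g x = (\<integral>\<^sup>+y. ennreal (kernel A t x y * g y) \<partial>lebesgue)"

definition invariant_class :: "generator \<Rightarrow> (real^'n \<Rightarrow> complex) set" where
  "invariant_class A =
     {f \<in> dom_class A. \<forall>t>0. AE x in lebesgue. semigroup_op A t f x = f x}"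

definition BMO_gen_norm ::
    "generator \<Rightarrow> (real^'n \<Rightarrow> real \<Rightarrow> real) \<Rightarrow> (real^'n \<Rightarrow> complex) \<Rightarrow> ennreal" where
  "BMO_gen_norm A \<phi> f =
     (SUP (c, r) \<in> UNIV \<times> {0<..}.
        (\<integral>\<^sup>+x\<in>ball c r. ennreal (norm (f x - semigroup_op A (r ^ gen_order A) f x)) \<partial>lebesgue)
          / ennreal (chi_norm \<phi> c r))"

definition BMO_gen :: "generator \<Rightarrow> (real^'n \<Rightarrow> real \<Rightarrow> real) \<Rightarrow> 'n fspace" where
  "BMO_gen A \<phi> = ({f \<in> dom_class A. BMO_gen_norm A \<phi> f < \<infinity>}, BMO_gen_norm A \<phi>)"

definition BMO_max_norm ::
    "generator \<Rightarrow> (real^'n \<Rightarrow> real \<Rightarrow> real) \<Rightarrow> (real^'n \<Rightarrow> complex) \<Rightarrow> ennreal" where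
  "BMO_max_norm A \<phi> f =
     (SUP (t, x) \<in> {0<..} \<times> UNIV.
        ennreal (measure lebesgue (ball x (root (gen_order A) t))
                  / chi_norm \<phi> x (root (gen_order A) t))
          * semigroup_nn A t (\<lambda>y. norm (f y - semigroup_op A t f y)) x)"

definition BMO_max :: "generator \<Rightarrow> (real^'n \<Rightarrow> real \<Rightarrow> real) \<Rightarrow> 'n fspace" where
  "BMO_max A \<phi> = ({f \<in> dom_class A. BMO_max_norm A \<phi> f < \<infinity>}, BMO_max_norm A \<phi>)"

record params =
  par_nu :: real
  par_N :: real
  par_alpha :: real
  par_p1 :: real
  par_p :: real
  par_q :: ereal

text \<open>The decay orders \<open>M\<close> that may be used for the kernel in dimension \<open>n\<close>: the Gaussian
  has decay of every finite order.\<close>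

fun decay_order :: "generator \<Rightarrow> nat \<Rightarrow> real \<Rightarrow> bool" where
  "decay_order Sqrt_Laplacian n M \<longleftrightarrow> M < real n + 1"
| "decay_order Laplacian n M \<longleftrightarrow> True"

definition admissible :: "generator \<Rightarrow> (real^'n \<Rightarrow> real \<Rightarrow> real) \<Rightarrow> params \<Rightarrow> bool" where
  "admissible A \<phi> P \<longleftrightarrow>
     real CARD('n) \<le> par_nu P \<and> 0 \<le> par_N P \<and>
     0 \<le> par_alpha P \<and> par_alpha P \<le> real CARD('n) \<and>
     weight_index \<phi> \<le> par_p1 P \<and> Muckenhoupt (par_p1 P) \<phi> \<and>
     0 < par_p P \<and> par_p P \<le> lower_type_index \<phi> \<and> uniformly_lower_type (par_p P) \<phi> \<and>
     1 < par_q P \<and> par_q P \<le> reverse_Hoelder_index \<phi> \<and> reverse_Hoelder (par_q P) \<phi> \<and>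
     (\<exists>M. decay_order A CARD('n) M \<and>
        par_nu P + 2 * par_nu P * par_p1 P / par_p P + par_N P
          - par_nu P * minus_one_ratio (par_q P) - par_alpha P < M)"

text \<open>The family \<open>{f\<^sup>B}\<close> is indexed by centre and radius, which a Euclidean ball
  determines. Its members lie in the domain of the semigroup, so that \<open>A\<^sub>t f\<^sup>B\<close> makes sense.\<close>

definition tilde_family ::
    "generator \<Rightarrow> (real^'n \<Rightarrow> real \<Rightarrow> real) \<Rightarrow> params \<Rightarrow> (real^'n \<Rightarrow> complex) \<Rightarrow> real
      \<Rightarrow> (real^'n \<Rightarrow> real \<Rightarrow> real^'n \<Rightarrow> complex) \<Rightarrow> bool" where
  "tilde_family A \<phi> P f C F \<longleftrightarrow>
     (\<forall>c. \<forall>r>0. F c r \<in> dom_class A) \<and>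
     (SUP (c, r) \<in> UNIV \<times> {0<..}.
        (\<integral>\<^sup>+x\<in>ball c r. ennreal (norm (f x - F c r x)) \<partial>lebesgue) / ennreal (chi_norm \<phi> c r))
       \<le> ennreal C \<and>
     (\<forall>c\<^sub>1 c\<^sub>2. \<forall>r\<^sub>1>0. \<forall>r\<^sub>2>0. ball c\<^sub>1 r\<^sub>1 \<subseteq> ball c\<^sub>2 r\<^sub>2 \<longrightarrow>
        (AE x in lebesgue. norm (F c\<^sub>2 r\<^sub>2 x - F c\<^sub>1 r\<^sub>1 x)
           \<le> C * (chi_norm \<phi> x r\<^sub>1 / measure lebesgue (ball x r\<^sub>1))
               * (r\<^sub>2 / r\<^sub>1) powr (par_nu P * par_p1 P / par_p P - par_alpha P))) \<and>
     (\<forall>c. \<forall>r>0. AE x in lebesgue.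
        norm (F c r x - semigroup_op A (r ^ gen_order A) (F c r) x)
          \<le> C * (chi_norm \<phi> x r / measure lebesgue (ball x r)))"

definition BMO_tilde_norm ::
    "generator \<Rightarrow> (real^'n \<Rightarrow> real \<Rightarrow> real) \<Rightarrow> params \<Rightarrow> (real^'n \<Rightarrow> complex) \<Rightarrow> ennreal" where
  "BMO_tilde_norm A \<phi> P f = Inf {ennreal C | C. 0 < C \<and> (\<exists>F. tilde_family A \<phi> P f C F)}"

definition BMO_tilde ::
    "generator \<Rightarrow> (real^'n \<Rightarrow> real \<Rightarrow> real) \<Rightarrow> params \<Rightarrow> 'n fspace" where
  "BMO_tilde A \<phi> P =
     ({f \<in> dom_class A. \<exists>C>0. \<exists>F. tilde_family A \<phi> P f C F}, BMO_tilde_norm A \<phi> P)"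

text \<open>Two spaces coincide modulo \<open>K\<close> if they have the same image in the quotient by \<open>K\<close>;
  their norms are equivalent if they are comparable, with uniform constants, on all pairs of
  functions that are identified.\<close>

definition coincide_modulo :: "(real^'n \<Rightarrow> complex) set \<Rightarrow> 'n fspace \<Rightarrow> 'n fspace \<Rightarrow> bool" where
  "coincide_modulo K X Y \<longleftrightarrow>
     (\<forall>f \<in> fst X. \<exists>g \<in> fst Y. (\<lambda>x. f x - g x) \<in> K) \<and>
     (\<forall>g \<in> fst Y. \<exists>f \<in> fst X. (\<lambda>x. f x - g x) \<in> K) \<and>
     (\<exists>C>0. \<forall>f \<in> fst X. \<forall>g \<in> fst Y. (\<lambda>x. f x - g x) \<in> K \<longrightarrow>
        snd X f \<le> ennreal C * snd Y g \<and> snd Y g \<le> ennreal C * snd X f)"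

end

theory Submission
  imports Defs "HOL-Probability.Distributions"
begin

text \<open>Only elementary kernel estimates are needed. Write \<open>X(B)\<close> for the norm of \<open>\<chi>\<^sub>B\<close>. With \<open>\<nu> = \<alpha> = n\<close>
  and \<open>p\<^sub>1\<close>, \<open>p\<close> close to the indices, put \<open>\<beta> = n p\<^sub>1 / p - n\<close>; the second index condition leaves room for
  \<open>0 < \<beta> < 1 / 2\<close>. The Muckenhoupt condition and the lower type give
  \<open>X(B\<^sub>2) \<le> D (r\<^sub>2 / r\<^sub>1)\<^sup>n\<^sup>+\<^sup>\<beta> X(B\<^sub>1)\<close> for \<open>B\<^sub>1 \<subseteq> B\<^sub>2\<close>, and upper type 1 bounds the integral of \<open>y \<mapsto> X(B(y, r))\<close>
  over \<open>B(x, R)\<close> by \<open>D r\<^sup>n X(B(x, R + r))\<close>, which replaces covering arguments.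

  At time \<open>r\<^sup>m\<close> both kernels are dominated by \<open>r / (r + |x - y|)\<^sup>n\<^sup>+\<^sup>1\<close>, which is integrated against functions
  of controlled growth on balls layer by layer. This yields the inclusions except the one from
  \<open>BMO\<^sup>\<phi>\<^sub>A\<close> to \<open>BMO\<^sup>\<phi>\<close>. For that one, \<open>A\<^sub>t f - A\<^sub>t f(0)\<close> converges locally uniformly to a function \<open>h\<close> as \<open>t \<rightarrow> \<infinity>\<close>,
  and \<open>f - h\<close> lies in \<open>BMO\<^sup>\<phi>\<close>. In the Poisson case \<open>h = 0\<close> because of the decay required of \<open>f\<close>; in the heat
  case \<open>h\<close> is invariant under the semigroup, hence vanishes in the quotient.\<close>

text \<open>The proof lives on the gap between the growth exponent n + \<beta> of X and the decay
  order n + 1 of the majorant: a function whose integrals over balls of radius R grow like R^(n +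
  \<gamma>) can be integrated against the majorant as soon as \<gamma> < 1. Most comparisons use
  \<gamma> = \<beta>. The families of \<open>BMO_tilde\<close> cost two factors (R / r)^\<beta>, one
  from their compatibility condition and one from the growth of X, and this is why \<beta> < 1 / 2
  is arranged.

  The obstacle is that small differences f - A_t f do not force f to be close to constants on balls:
  f may contain an invariant part, such as a coordinate function in the heat case. The function h
  isolates this part. It exists because after time \<rho>^m the difference A_t f(x) - A_t f(x')
  changes by at most a multiple of |x - x'| X(B(x, \<rho>)) / \<rho>^(n + 1), which decays like
  \<rho>^(\<beta> - 1). If f already lies in BMO, a Lipschitz estimate for A_t f gives h = 0, and
  this makes the norms comparable on representatives and not only on classes.\<close>

section \<open>Gaussian integrals on the half line\<close>

text \<open>Nonnegative integrals allow later identities to be chained by additivity and Fubini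
  without integrability side conditions. The second claim keeps the integrability of the transformed
  integrand, which serves as a dominating function later on.\<close>

lemma nn_integral_change_of_variables:
  fixes f g :: "real \<Rightarrow> real"
  assumes S: "S \<in> sets lebesgue"
    and der: "\<And>x. x \<in> S \<Longrightarrow> (g has_field_derivative g' x) (at x within S)"
    and inj: "inj_on g S"
    and f: "f absolutely_integrable_on g ` S"
    and nonneg: "\<And>x. x \<in> S \<Longrightarrow> 0 \<le> f (g x)"
  shows "(\<integral>\<^sup>+x\<in>S. ennreal (\<bar>g' x\<bar> * f (g x)) \<partial>lborel) = ennreal (integral (g ` S) f)"
    and "(\<lambda>x. \<bar>g' x\<bar> * f (g x)) absolutely_integrable_on S"
proof -
  have *: "(\<lambda>x. \<bar>g' x\<bar> * f (g x)) absolutely_integrable_on S \<and>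
        integral S (\<lambda>x. \<bar>g' x\<bar> * f (g x)) = integral (g ` S) f"
    using has_absolute_integral_change_of_variables_1'[OF S der inj, of f "integral (g ` S) f"] f by simp
  then show abs: "(\<lambda>x. \<bar>g' x\<bar> * f (g x)) absolutely_integrable_on S" by simp
  have "(\<integral>\<^sup>+x\<in>S. ennreal (\<bar>g' x\<bar> * f (g x)) \<partial>lebesgue)
      = (\<integral>\<^sup>+x. ennreal (indicator S x *\<^sub>R (\<bar>g' x\<bar> * f (g x))) \<partial>lebesgue)"
    by (intro nn_integral_cong) (auto simp: indicator_def)
  also have "\<dots> = ennreal (LINT x:S|lebesgue. \<bar>g' x\<bar> * f (g x))"
    unfolding set_lebesgue_integral_def
    using abs nonneg by (intro nn_integral_eq_integral) (auto simp: set_integrable_def indicator_def)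
  also have "\<dots> = ennreal (integral (g ` S) f)"
    using set_lebesgue_integral_eq_integral(2)[OF abs] * by simp
  finally show "(\<integral>\<^sup>+x\<in>S. ennreal (\<bar>g' x\<bar> * f (g x)) \<partial>lborel) = ennreal (integral (g ` S) f)"
    by (simp add: nn_integral_completion)
qed

lemma nn_integral_half_line_scale:
  fixes F :: "real \<Rightarrow> ennreal"
  assumes [measurable]: "F \<in> borel_measurable borel" and x: "x > 0"
  shows "(\<integral>\<^sup>+y\<in>{0<..}. F y \<partial>lborel) = (\<integral>\<^sup>+c\<in>{0<..}. ennreal x * F (x * c) \<partial>lborel)"
proof -
  have "(\<integral>\<^sup>+y\<in>{0<..}. F y \<partial>lborel)
      = ennreal \<bar>x\<bar> * (\<integral>\<^sup>+c. F (0 + x * c) * indicator {0<..} (0 + x * c) \<partial>lborel)"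
    by (rule nn_integral_real_affine) (use x in auto)
  also have "\<dots> = (\<integral>\<^sup>+c. ennreal \<bar>x\<bar> * (F (0 + x * c) * indicator {0<..} (0 + x * c)) \<partial>lborel)"
    by (rule nn_integral_cmult[symmetric]) simp
  also have "\<dots> = (\<integral>\<^sup>+c\<in>{0<..}. ennreal x * F (x * c) \<partial>lborel)"
    using x by (intro nn_integral_cong) (auto simp: indicator_def zero_less_mult_iff)
  finally show ?thesis .
qed

lemma gaussian_integral_real:
  assumes "q > (0::real)"
  shows "(\<lambda>y. exp (- (q^2 * y^2))) absolutely_integrable_on UNIV"
    and "integral UNIV (\<lambda>y. exp (- (q^2 * y^2))) = sqrt pi / q"
proof -
  \<comment> \<open>The standard deviation with 1 / (2 s^2) = q^2, so that the Gaussian becomes a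
    multiple of a normal density of total mass 1.\<close>
  define s where "s = 1 / (sqrt 2 * q)"
  have s: "s > 0" using assms by (simp add: s_def)
  have eq: "exp (- (q^2 * y^2)) = (sqrt pi / q) * normal_density 0 s y" for y
  proof -
    have "sqrt (2 * pi * s^2) = sqrt pi / q"
      using assms by (simp add: s_def power_mult_distrib power_divide real_sqrt_divide)
    moreover have "- ((y - 0)\<^sup>2) / (2 * s\<^sup>2) = - (q\<^sup>2 * y\<^sup>2)"
      using assms by (simp add: s_def power_mult_distrib power_divide)
    ultimately show ?thesis using assms unfolding normal_density_def by simp
  qed
  have i: "integrable lborel (\<lambda>y. exp (- (q^2 * y^2)))"
    unfolding eq using s by simp
  then show "(\<lambda>y. exp (- (q^2 * y^2))) absolutely_integrable_on UNIV"
    by (simp add: set_integrable_def integrable_completion)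
  then have "integral UNIV (\<lambda>y. exp (- (q^2 * y^2))) = (LINT y|lborel. exp (- (q^2 * y^2)))"
    by (subst set_lebesgue_integral_eq_integral(2)[symmetric])
       (auto simp: set_lebesgue_integral_def integral_completion)
  also have "\<dots> = sqrt pi / q"
    unfolding eq using s by simp
  finally show "integral UNIV (\<lambda>y. exp (- (q^2 * y^2))) = sqrt pi / q" .
qed

text \<open>The substitution \<open>y = b c - a / c\<close> maps the half line onto the line and the substitution
  \<open>c \<mapsto> a / (b c)\<close> preserves \<open>(b c - a / c)\<^sup>2\<close>; together they determine both parts of the integral.\<close>

lemma nn_integral_Cauchy_Schloemilch:
  fixes a b q :: real
  assumes a: "a > 0" and b: "b > 0" and q: "q > 0"
  shows "(\<integral>\<^sup>+c\<in>{0<..}. ennreal ((1 + 1 / c^2) * exp (- (q^2 * (b * c - a / c)^2))) \<partial>lborel)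
       = ennreal ((1 / a + 1 / b) * (sqrt pi / (2 * q)))"
proof -
  let ?f = "\<lambda>c. exp (- (q^2 * (b * c - a / c)^2))"
  have inj: "inj_on (\<lambda>c. b * c - a / c) {0<..}"
  proof (rule strict_mono_on_imp_inj_on, rule strict_mono_onI)
    fix x y :: real assume "x \<in> {0<..}" "y \<in> {0<..}" "x < y"
    then have "b * x < b * y" "a / y < a / x"
      using a b by (auto intro: divide_strict_left_mono)
    then show "b * x - a / x < b * y - a / y" by linarith
  qed
  have img: "(\<lambda>c. b * c - a / c) ` {0<..} = UNIV"
  proof -
    have "y \<in> (\<lambda>c. b * c - a / c) ` {0<..}" for y
    proof -
      \<comment> \<open>Square root of the discriminant of b c^2 - y c - a = 0, the equation for a
        preimage c of y; the root (y + d) / (2 b) is the positive one.\<close>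
      define d where "d = sqrt (y^2 + 4 * a * b)"
      have "\<bar>y\<bar> < d" unfolding d_def using a b by (intro real_less_rsqrt) (auto simp: power2_abs)
      then have d: "y + d > 0" by linarith
      have d2: "d^2 = y^2 + 4 * a * b" unfolding d_def using a b by (intro real_sqrt_pow2) (auto simp: add_nonneg_nonneg)
      define c where "c = (y + d) / (2 * b)"
      have "b * c * c - a = y * c"
        using b d2 by (simp add: c_def field_simps power2_eq_square)
      moreover have c: "c > 0" using d b by (simp add: c_def)
      ultimately have "b * c - a / c = y"
        by (simp add: field_simps)
      then show ?thesis using c by (intro image_eqI[of _ _ c]) auto
    qed
    then show ?thesis by auto
  qed
  have 1: "(\<integral>\<^sup>+c\<in>{0<..}. ennreal (\<bar>b + a / c^2\<bar> * ?f c) \<partial>lborel) = ennreal (sqrt pi / q)"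
    "(\<lambda>c. \<bar>b + a / c^2\<bar> * ?f c) absolutely_integrable_on {0<..}"
  proof -
    have d: "((\<lambda>c. b * c - a / c) has_field_derivative (b + a / c^2)) (at c within {0<..})"
      if "c \<in> {0<..}" for c
      using that by (auto intro!: derivative_eq_intros simp: power2_eq_square field_simps)
    show "(\<integral>\<^sup>+c\<in>{0<..}. ennreal (\<bar>b + a / c^2\<bar> * ?f c) \<partial>lborel) = ennreal (sqrt pi / q)"
      using nn_integral_change_of_variables(1)[of "{0<..}" "\<lambda>c. b * c - a / c", OF _ d inj, of "\<lambda>y. exp (- (q^2 * y^2))"]
        gaussian_integral_real[OF q] by (simp add: img)
    show "(\<lambda>c. \<bar>b + a / c^2\<bar> * ?f c) absolutely_integrable_on {0<..}"
      using nn_integral_change_of_variables(2)[of "{0<..}" "\<lambda>c. b * c - a / c", OF _ d inj, of "\<lambda>y. exp (- (q^2 * y^2))"]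
        gaussian_integral_real[OF q] by (simp add: img)
  qed
  have cont: "continuous_on {0<..} ?f"
    by (intro continuous_intros) auto
  \<comment> \<open>Integrability of the Gaussian factor alone: it is at most 1 / b times the
    integrand of the first substitution, because b + a / c^2 is at least b.\<close>
  have fint: "?f absolutely_integrable_on {0<..}"
  proof (rule measurable_bounded_by_integrable_imp_absolutely_integrable)
    show "?f \<in> borel_measurable (lebesgue_on {0<..})"
      using cont by (rule continuous_imp_measurable_on_sets_lebesgue) auto
    show "(\<lambda>c. (1 / b) * (\<bar>b + a / c^2\<bar> * ?f c)) integrable_on {0<..}"
      using 1(2) by (intro integrable_on_mult_right) (auto simp: absolutely_integrable_on_def)
    fix c :: real assume "c \<in> {0<..}"
    then have "0 \<le> a / c^2" using a by simp
    then have "b \<le> \<bar>b + a / c^2\<bar>" by linarith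
    then have "1 \<le> (1/b) * \<bar>b + a / c^2\<bar>" using b by (simp add: field_simps)
    then show "norm (?f c) \<le> (1 / b) * (\<bar>b + a / c^2\<bar> * ?f c)"
      using mult_right_mono[of 1 "(1/b) * \<bar>b + a / c^2\<bar>" "?f c"] by (simp add: mult.assoc)
  qed auto
  have img2: "(\<lambda>c. a / (b * c)) ` {0<..} = {0<..}"
  proof -
    have "y \<in> (\<lambda>c. a / (b * c)) ` {0<..}" if "y > 0" for y
      using that a b by (intro image_eqI[of _ _ "a / (b * y)"]) (auto simp: field_simps)
    then show ?thesis using a b by auto
  qed
  have ieq: "integral {0<..} ?f \<ge> 0" by (intro Henstock_Kurzweil_Integration.integral_nonneg) (use fint in \<open>auto simp: absolutely_integrable_on_def\<close>)
  define I where "I = integral {0<..} ?f"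
  have I0: "I \<ge> 0" using ieq by (simp add: I_def)
  have I1: "(\<integral>\<^sup>+c\<in>{0<..}. ennreal (?f c) \<partial>lborel) = ennreal I"
    using nn_integral_change_of_variables(1)[of "{0<..}" "\<lambda>c. c" "\<lambda>_. 1" ?f] fint
    by (simp add: I_def)
  have d2: "((\<lambda>c. a / (b * c)) has_field_derivative (- a / (b * c^2))) (at c within {0<..})"
      if "c \<in> {0<..}" for c
      using that b by (auto intro!: derivative_eq_intros simp: power2_eq_square field_simps)
  have inj2: "inj_on (\<lambda>c. a / (b * c)) {0<..}"
    using a b by (auto intro!: inj_onI simp: field_simps)
  have sym: "?f (a / (b * c)) = ?f c" if "c > 0" for c
  proof -
    have "b * (a / (b * c)) - a / (a / (b * c)) = - (b * c - a / c)"
      using a b that by (simp add: field_simps)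
    then show ?thesis by (simp only: power2_minus)
  qed
  have I2: "(\<integral>\<^sup>+c\<in>{0<..}. ennreal (\<bar>- a / (b * c^2)\<bar> * ?f (a / (b * c))) \<partial>lborel) = ennreal I"
    using nn_integral_change_of_variables(1)[of "{0<..}" "\<lambda>c. a / (b * c)", OF _ d2 inj2, of ?f] fint
    by (simp add: img2 I_def)
  \<comment> \<open>Since the exponent is unchanged by the second substitution, only its Jacobian a
    / (b c^2) is visible; multiplying by b / a leaves the weight 1 / c^2.\<close>
  have I2': "(\<integral>\<^sup>+c\<in>{0<..}. ennreal (?f c / c^2) \<partial>lborel) = ennreal (b / a * I)"
  proof -
    have "ennreal (b / a * I) = ennreal (b/a) * (\<integral>\<^sup>+c\<in>{0<..}. ennreal (\<bar>- a / (b * c^2)\<bar> * ?f (a / (b * c))) \<partial>lborel)"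
      unfolding I2 using a b I0 by (simp add: ennreal_mult[symmetric])
    also have "\<dots> = (\<integral>\<^sup>+c. ennreal (b/a) * (ennreal (\<bar>- a / (b * c^2)\<bar> * ?f (a / (b * c))) * indicator {0<..} c) \<partial>lborel)"
      by (rule nn_integral_cmult[symmetric]) measurable
    also have "\<dots> = (\<integral>\<^sup>+c\<in>{0<..}. ennreal (?f c / c^2) \<partial>lborel)"
    proof (rule nn_integral_cong)
      fix c :: real
      show "ennreal (b/a) * (ennreal (\<bar>- a / (b * c^2)\<bar> * ?f (a / (b * c))) * indicator {0<..} c) = ennreal (?f c / c^2) * indicator {0<..} c"
        using a b sym by (auto simp: indicator_def ennreal_mult[symmetric] simp del: divide_divide_eq_right)
    qed
    finally show ?thesis by simp
  qed
  \<comment> \<open>The weight b + a / c^2 of the first substitution is split into its two parts,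
    which contribute b I each. Their known sum determines I.\<close>
  have "ennreal (b * I + a * (b / a * I)) = ennreal b * ennreal I + ennreal a * ennreal (b / a * I)"
    using a b I0 by (metis ennreal_mult ennreal_plus less_imp_le mult_nonneg_nonneg zero_le_divide_iff)
  also have "\<dots> = (\<integral>\<^sup>+c. ennreal b * (ennreal (?f c) * indicator {0<..} c) \<partial>lborel)
       + (\<integral>\<^sup>+c. ennreal a * (ennreal (?f c / c^2) * indicator {0<..} c) \<partial>lborel)"
    unfolding I1[symmetric] I2'[symmetric]
    by (simp add: nn_integral_cmult)
  also have "\<dots> = (\<integral>\<^sup>+c. ennreal b * (ennreal (?f c) * indicator {0<..} c) +
        ennreal a * (ennreal (?f c / c^2) * indicator {0<..} c) \<partial>lborel)"
    by (rule nn_integral_add[symmetric]) measurable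
  also have "\<dots> = (\<integral>\<^sup>+c\<in>{0<..}. ennreal (\<bar>b + a / c^2\<bar> * ?f c) \<partial>lborel)"
  proof (rule nn_integral_cong)
    fix c :: real
    have *: "\<bar>b + a / c^2\<bar> * ?f c = b * ?f c + a * (?f c / c^2)" if "c > 0"
      using a b that by (simp add: distrib_right add_nonneg_nonneg)
    show "ennreal b * (ennreal (?f c) * indicator {0<..} c) + ennreal a * (ennreal (?f c / c^2) * indicator {0<..} c)
        = ennreal (\<bar>b + a / c^2\<bar> * ?f c) * indicator {0<..} c"
    proof (cases "c > 0")
      case True
      have "ennreal (b * ?f c) = ennreal b * ennreal (?f c)" "ennreal (a * (?f c / c^2)) = ennreal a * ennreal (?f c / c^2)"
        using a b by (intro ennreal_mult; simp)+
      moreover have "ennreal (b * ?f c + a * (?f c / c^2)) = ennreal (b * ?f c) + ennreal (a * (?f c / c^2))"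
        using a b by (intro ennreal_plus; simp)
      ultimately show ?thesis using True * by simp
    qed simp
  qed
  finally have "ennreal (b * I + a * (b / a * I)) = ennreal (sqrt pi / q)" using 1 by simp
  then have "b * I + a * (b / a * I) = sqrt pi / q" using a b I0 q by (subst (asm) ennreal_inj) auto
  then have Iv: "I = sqrt pi / (2 * q * b)" using a b q by (simp add: field_simps)
  have "(\<integral>\<^sup>+c\<in>{0<..}. ennreal ((1 + 1 / c^2) * ?f c) \<partial>lborel)
     = (\<integral>\<^sup>+c. ennreal (?f c) * indicator {0<..} c + ennreal (?f c / c^2) * indicator {0<..} c \<partial>lborel)"
    by (intro nn_integral_cong) (auto simp: indicator_def distrib_right)
  also have "\<dots> = ennreal I + ennreal (b / a * I)"
    unfolding I1[symmetric] I2'[symmetric] by (rule nn_integral_add) measurable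
  also have "\<dots> = ennreal ((1 / a + 1 / b) * (sqrt pi / (2 * q)))"
  proof -
    have "I + b / a * I = (1 / a + 1 / b) * (sqrt pi / (2 * q))"
      using a b q unfolding Iv by (simp add: field_simps)
    then show ?thesis using a b I0 by (simp flip: ennreal_plus)
  qed
  finally show ?thesis .
qed

text \<open>The substitution u = b y^2 in Euler's integral. It is the source of the Gamma factor in
  the normalizing constant of the Poisson kernel.\<close>

lemma nn_integral_power_exp_square:
  fixes b :: real
  assumes b: "b > 0"
  shows "(\<integral>\<^sup>+y\<in>{0<..}. ennreal (y ^ k * exp (- (b * y^2))) \<partial>lborel)
    = ennreal (Gamma ((real k + 1) / 2) / (2 * b powr ((real k + 1) / 2)))"
proof -
  let ?a = "(real k + 1) / 2"
  let ?f = "\<lambda>u::real. u powr (?a - 1) / exp u"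
  have ga: "(?f has_integral Gamma ?a) {0..}" by (rule Gamma_integral_real) auto
  have ga': "(?f has_integral Gamma ?a) {0<..}"
    proof (rule has_integral_spike_set_eq[THEN iffD1, OF _ _ ga])
    have "{x \<in> {0..} - {0<..}. ?f x \<noteq> 0} \<subseteq> {0}" "{x \<in> {0<..} - {0..}. ?f x \<noteq> 0} \<subseteq> {0}" by auto
    then show "negligible {x \<in> {0..} - {0<..}. ?f x \<noteq> 0}" "negligible {x \<in> {0<..} - {0..}. ?f x \<noteq> 0}"
      using negligible_subset negligible_sing by blast+
  qed
  then have f: "?f absolutely_integrable_on {0<..}"
    by (intro nonnegative_absolutely_integrable_1) auto
  have img: "(\<lambda>y. b * y^2) ` {0<..} = {0<..}"
  proof -
    have "u \<in> (\<lambda>y. b * y^2) ` {0<..}" if "u > 0" for u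
      using that b by (intro image_eqI[of _ _ "sqrt (u / b)"]) auto
    then show ?thesis using b by auto
  qed
  have inj: "inj_on (\<lambda>y. b * y^2) {0<..}"
  proof (rule inj_onI)
    fix x y :: real assume "x \<in> {0<..}" "y \<in> {0<..}" "b * x\<^sup>2 = b * y\<^sup>2"
    then show "x = y" using b by (intro power2_eq_imp_eq[of x y]) auto
  qed
  have d: "((\<lambda>y. b * y^2) has_field_derivative 2 * b * y) (at y within {0<..})" for y
    by (auto intro!: derivative_eq_intros)
  have "(\<integral>\<^sup>+y\<in>{0<..}. ennreal (\<bar>2 * b * y\<bar> * ?f (b * y^2)) \<partial>lborel) = ennreal (Gamma ?a)"
    using nn_integral_change_of_variables(1)[of "{0<..}" "\<lambda>y. b * y^2", OF _ d inj, of ?f] f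
    unfolding img integral_unique[OF ga'] by simp
  also have "(\<integral>\<^sup>+y\<in>{0<..}. ennreal (\<bar>2 * b * y\<bar> * ?f (b * y^2)) \<partial>lborel)
     = (\<integral>\<^sup>+y. ennreal (2 * b powr ?a) * (ennreal (y ^ k * exp (- (b * y^2))) * indicator {0<..} y) \<partial>lborel)"
  proof (rule nn_integral_cong)
    fix y :: real
    have *: "\<bar>2 * b * y\<bar> * ?f (b * y^2) = 2 * b powr ?a * (y ^ k * exp (- (b * y^2)))" if y: "y > 0"
    proof -
      have "(y^2) powr (?a - 1) = (y powr 2) powr (?a - 1)" using y by (subst powr_numeral) auto
      then have e: "(b * y^2) powr (?a - 1) = b powr (?a - 1) * y powr (2 * (?a - 1))"
        using b y by (simp only: powr_mult powr_powr)
      have "b * b powr (?a - 1) = b powr (1 + (?a - 1))" using b by (intro powr_mult_base) simp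
      also have "1 + (?a - 1) = ?a" by linarith
      finally have "b * b powr (?a - 1) = b powr ?a" .
      moreover have "y * y powr (2 * (?a - 1)) = y ^ k"
      proof -
        have "y * y powr (2 * (?a - 1)) = y powr (1 + 2 * (?a - 1))" using y by (intro powr_mult_base) simp
        also have "1 + 2 * (?a - 1) = real k" by (simp add: diff_divide_distrib add_divide_distrib right_diff_distrib)
        finally show ?thesis using y by (simp only: powr_realpow)
      qed
      moreover have "\<bar>2 * b * y\<bar> * ?f (b * y^2) = 2 * (b * b powr (?a - 1)) * (y * y powr (2 * (?a - 1))) * exp (- (b * y^2))"
      proof -
        have "\<bar>2 * b * y\<bar> = 2 * b * y" using b y by simp
        then show ?thesis unfolding e unfolding exp_minus divide_inverse by (simp only: mult_ac)
      qed
      ultimately show ?thesis by (simp only: mult.assoc)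
    qed
    show "ennreal (\<bar>2 * b * y\<bar> * ?f (b * y^2)) * indicator {0<..} y =
        ennreal (2 * b powr ?a) * (ennreal (y ^ k * exp (- (b * y^2))) * indicator {0<..} y)"
    proof (cases "y > 0")
      case True
      have "ennreal (2 * b powr ?a * (y ^ k * exp (- (b * y\<^sup>2)))) = ennreal (2 * b powr ?a) * ennreal (y ^ k * exp (- (b * y\<^sup>2)))"
        using True by (intro ennreal_mult) auto
      then show ?thesis using True * by (simp only: indicator_simps greaterThan_iff mult_1_right)
    qed simp
  qed
  also have "\<dots> = ennreal (2 * b powr ?a) * (\<integral>\<^sup>+y\<in>{0<..}. ennreal (y ^ k * exp (- (b * y^2))) \<partial>lborel)"
    by (rule nn_integral_cmult) measurable
  finally have *: "ennreal (2 * b powr ?a) * (\<integral>\<^sup>+y\<in>{0<..}. ennreal (y ^ k * exp (- (b * y^2))) \<partial>lborel) = ennreal (Gamma ?a)" .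
  have "ennreal (1 / (2 * b powr ?a)) * ennreal (2 * b powr ?a) = 1"
    using b by (subst ennreal_mult[symmetric]) auto
  then have "(\<integral>\<^sup>+y\<in>{0<..}. ennreal (y ^ k * exp (- (b * y^2))) \<partial>lborel)
     = ennreal (1 / (2 * b powr ?a)) * (ennreal (2 * b powr ?a) * (\<integral>\<^sup>+y\<in>{0<..}. ennreal (y ^ k * exp (- (b * y^2))) \<partial>lborel))"
    by (simp only: mult.assoc[symmetric] mult_1_left)
  also have "\<dots> = ennreal (1 / (2 * b powr ?a) * Gamma ?a)"
    unfolding * using b by (intro ennreal_mult[symmetric]) (auto intro: less_imp_le[OF Gamma_real_pos])
  finally show ?thesis by simp
qed

section \<open>Product measurability over the completed Lebesgue measure\<close>

text \<open>A countable exhaustion for \<open>lborel\<close> remains one in the completion. Members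
  of the spaces are only Lebesgue measurable, so Fubini is needed for products of
  \<open>lebesgue\<close> itself.\<close>

lemma sigma_finite_lebesgue: "sigma_finite_measure (lebesgue :: 'a::euclidean_space measure)"
proof
  obtain A :: "'a set set" where A: "countable A" "A \<subseteq> sets lborel" "\<Union>A = space lborel"
      "\<forall>a\<in>A. emeasure lborel a \<noteq> \<infinity>"
    using lborel.sigma_finite_countable by auto
  then show "\<exists>A::'a set set. countable A \<and> A \<subseteq> sets lebesgue \<and> \<Union>A = space lebesgue \<and>
      (\<forall>a\<in>A. emeasure lebesgue a \<noteq> \<infinity>)"
    by (intro exI[of _ A]) (auto simp: subset_eq sets_completionI_sets)
qed

interpretation lebesgue: sigma_finite_measure lebesgue
  by (rule sigma_finite_lebesgue)

interpretation lebesgue_pair: pair_sigma_finite lebesgue lebesgue ..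

interpretation lborel_lebesgue_pair: pair_sigma_finite lborel lebesgue ..

lemma measurable_ident_lebesgue: "(\<lambda>x. x) \<in> lebesgue \<rightarrow>\<^sub>M borel"
  by (rule measurable_completion) simp

lemma measurable_lebesgue_compose: "f \<in> borel_measurable borel \<Longrightarrow> f \<in> borel_measurable lebesgue"
  using measurable_compose[OF measurable_ident_lebesgue] by auto

text \<open>The kernels are Borel functions, so Borel measurability of the projections suffices for
  them. Functions that are merely Lebesgue measurable enter as compositions with a projection into
  \<open>lebesgue\<close>.\<close>

lemma measurable_fst_lebesgue_borel:
  "fst \<in> (lebesgue :: 'a::euclidean_space measure) \<Otimes>\<^sub>M M \<rightarrow>\<^sub>M borel"
  using measurable_compose[OF measurable_fst[of lebesgue M] measurable_ident_lebesgue] by simp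

lemma measurable_snd_lebesgue_borel:
  "snd \<in> M \<Otimes>\<^sub>M (lebesgue :: 'a::euclidean_space measure) \<rightarrow>\<^sub>M borel"
  using measurable_compose[OF measurable_snd[of M lebesgue] measurable_ident_lebesgue] by simp

section \<open>The heat and Poisson semigroups\<close>

abbreviation heat :: "real \<Rightarrow> real^'n \<Rightarrow> real^'n \<Rightarrow> real" where "heat \<equiv> kernel Laplacian"
abbreviation poisson :: "real \<Rightarrow> real^'n \<Rightarrow> real^'n \<Rightarrow> real" where "poisson \<equiv> kernel Sqrt_Laplacian"

lemma borel_measurable_kernel [measurable]:
  assumes [measurable]: "t \<in> borel_measurable M" "x \<in> borel_measurable M" "y \<in> borel_measurable M"
  shows "(\<lambda>w. kernel A (t w) (x w) (y w)) \<in> borel_measurable M"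
  by (cases A) simp_all

lemma kernel_pos: "t > 0 \<Longrightarrow> 0 < kernel A t x y"
  by (cases A) (auto intro!: mult_pos_pos divide_pos_pos Gamma_real_pos add_pos_nonneg)

lemma kernel_nonneg: "t > 0 \<Longrightarrow> 0 \<le> kernel A t x y"
  using kernel_pos[of t A x y] by simp

text \<open>In each coordinate exp(- u^2 / (4 t)) belongs to the centred normal density of variance
  2 t. This reduces total mass and the semigroup law to one-dimensional facts about normal
  densities.\<close>

lemma heat_eq_prod:
  fixes x y :: "real^'n"
  assumes "t > 0"
  shows "heat t x y = (\<Prod>b\<in>Basis. normal_density 0 (sqrt (2 * t)) ((x - y) \<bullet> b))"
proof -
  have "(\<Prod>b\<in>Basis. normal_density 0 (sqrt (2 * t)) ((x - y) \<bullet> b))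
     = (\<Prod>b\<in>(Basis::(real^'n) set). 1 / sqrt (4 * pi * t)) * (\<Prod>b\<in>Basis. exp (- ((x - y) \<bullet> b)\<^sup>2 / (4 * t)))"
    using assms unfolding normal_density_def prod.distrib[symmetric] by (simp add: mult_ac)
  also have "(\<Prod>b\<in>Basis. exp (- ((x - y) \<bullet> b)\<^sup>2 / (4 * t))) = exp (- (norm (x - y))\<^sup>2 / (4 * t))"
  proof -
    have "(norm (x - y))\<^sup>2 = (\<Sum>b\<in>Basis. ((x - y) \<bullet> b)\<^sup>2)"
      by (subst power2_norm_eq_inner, subst euclidean_inner) (simp add: power2_eq_square)
    then show ?thesis
      unfolding exp_sum[OF finite_Basis, symmetric] by (simp add: sum_negf sum_divide_distrib)
  qed
  also have "(\<Prod>b\<in>(Basis::(real^'n) set). 1 / sqrt (4 * pi * t)) = (4 * pi * t) powr (- real CARD('n) / 2)"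
  proof -
    have c: "1 / sqrt (4 * pi * t) = (4 * pi * t) powr (- (1/2))"
      using assms unfolding powr_minus_divide by (simp add: powr_half_sqrt)
    have "(\<Prod>b\<in>(Basis::(real^'n) set). 1 / sqrt (4 * pi * t)) = ((4 * pi * t) powr (- (1/2))) ^ CARD('n)"
      unfolding c by simp
    also have "\<dots> = ((4 * pi * t) powr (- (1/2))) powr real CARD('n)"
      using assms by (intro powr_realpow[symmetric]) simp
    also have "\<dots> = (4 * pi * t) powr (- real CARD('n) / 2)"
      unfolding powr_powr by simp
    finally show ?thesis .
  qed
  finally show ?thesis by simp
qed

lemma nn_integral_heat:
  fixes x :: "real^'n"
  assumes "t > 0"
  shows "(\<integral>\<^sup>+y. ennreal (heat t x y) \<partial>lborel) = 1"
proof -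
  have "(\<integral>\<^sup>+y. ennreal (heat t x y) \<partial>lborel)
     = (\<integral>\<^sup>+y. (\<Prod>b\<in>Basis. ennreal (normal_density 0 (sqrt (2 * t)) (x \<bullet> b - y \<bullet> b))) \<partial>lborel)"
    unfolding heat_eq_prod[OF assms] using assms
    by (simp add: prod_ennreal inner_diff_left)
  also have "\<dots> = (\<Prod>b\<in>Basis. \<integral>\<^sup>+v. ennreal (normal_density 0 (sqrt (2 * t)) (x \<bullet> b - v)) \<partial>lborel)"
    by (rule nn_integral_lborel_prod) simp_all
  also have "\<dots> = (\<Prod>b\<in>(Basis::(real^'n) set). 1)"
  proof (rule prod.cong[OF refl])
    fix b
    have "(\<integral>\<^sup>+v. ennreal (normal_density 0 (sqrt (2 * t)) (x \<bullet> b - v)) \<partial>lborel)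
       = (\<integral>\<^sup>+v. ennreal (normal_density (x \<bullet> b) (sqrt (2 * t)) v) \<partial>lborel)"
      by (intro nn_integral_cong) (simp add: normal_density_def power2_commute)
    then show "(\<integral>\<^sup>+v. ennreal (normal_density 0 (sqrt (2 * t)) (x \<bullet> b - v)) \<partial>lborel) = 1"
      using assms by (subst (asm) nn_integral_eq_integral) auto
  qed
  finally show ?thesis by simp
qed

text \<open>In each coordinate the integral is a convolution of centred normal densities after a
  shift by the coordinate of z, and variances add under convolution: 2 s + 2 t.\<close>

lemma nn_integral_heat_mult_heat:
  fixes x z :: "real^'n"
  assumes s: "s > 0" and t: "t > 0"
  shows "(\<integral>\<^sup>+y. ennreal (heat s x y) * ennreal (heat t y z) \<partial>lborel) = ennreal (heat (s + t) x z)"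
proof -
  let ?N = "\<lambda>s. normal_density 0 (sqrt (2 * s))"
  have "(\<integral>\<^sup>+y. ennreal (heat s x y) * ennreal (heat t y z) \<partial>lborel)
     = (\<integral>\<^sup>+y. (\<Prod>b\<in>Basis. ennreal (?N s (x \<bullet> b - y \<bullet> b) * ?N t (y \<bullet> b - z \<bullet> b))) \<partial>lborel)"
    unfolding heat_eq_prod[OF s] heat_eq_prod[OF t]
    by (simp add: prod_ennreal inner_diff_left prod.distrib ennreal_mult' prod_nonneg)
  also have "\<dots> = (\<Prod>b\<in>Basis. \<integral>\<^sup>+v. ennreal (?N s (x \<bullet> b - v) * ?N t (v - z \<bullet> b)) \<partial>lborel)"
    by (rule nn_integral_lborel_prod) simp_all
  also have "\<dots> = (\<Prod>b\<in>Basis. ennreal (?N (s + t) ((x - z) \<bullet> b)))"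
  proof (rule prod.cong[OF refl])
    fix b :: "real^'n"
    have "(\<integral>\<^sup>+v. ennreal (?N s (x \<bullet> b - v) * ?N t (v - z \<bullet> b)) \<partial>lborel)
       = (\<integral>\<^sup>+v. ennreal (?N s (x \<bullet> b - (z \<bullet> b + 1 * v)) * ?N t ((z \<bullet> b + 1 * v) - z \<bullet> b)) \<partial>lborel)"
      by (subst nn_integral_real_affine[where c = 1 and t = "z \<bullet> b"]) simp_all
    also have "\<dots> = (\<integral>\<^sup>+v. ennreal (?N s ((x - z) \<bullet> b - v) * ?N t v) \<partial>lborel)"
      by (simp add: inner_diff_left algebra_simps)
    also have "\<dots> = ennreal (?N (s + t) ((x - z) \<bullet> b))"
      using fun_cong[OF conv_normal_density_zero_mean[of "sqrt (2 * s)" "sqrt (2 * t)"], of "(x - z) \<bullet> b"] s t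
      by (simp add: algebra_simps)
    finally show "(\<integral>\<^sup>+v. ennreal (?N s (x \<bullet> b - v) * ?N t (v - z \<bullet> b)) \<partial>lborel) = ennreal (?N (s + t) ((x - z) \<bullet> b))" .
  qed
  also have "\<dots> = ennreal (heat (s + t) x z)"
    using s t by (subst heat_eq_prod) (auto simp: prod_ennreal)
  finally show ?thesis .
qed

text \<open>Subordination, in the variable \<open>w = s\<^sup>-\<^sup>1\<^sup>/\<^sup>2\<close>, where \<open>s\<close> is the heat time.\<close>

definition subordinator :: "real \<Rightarrow> real \<Rightarrow> real" where
  "subordinator a w = a / sqrt pi * exp (- (a\<^sup>2 * w\<^sup>2 / 4))"

lemma subordinator_nonneg: "a > 0 \<Longrightarrow> 0 \<le> subordinator a w"
  by (simp add: subordinator_def)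

lemma borel_measurable_subordinator [measurable]:
  assumes [measurable]: "f \<in> borel_measurable M"
  shows "(\<lambda>w. subordinator a (f w)) \<in> borel_measurable M"
  unfolding subordinator_def by measurable

text \<open>At heat time 1 / w^2 the prefactor is a multiple of w^n, and the two exponents combine
  to - b w^2 with b = (a^2 + |x - y|^2) / 4. The Gamma integral then produces the power b^(- (n + 1)
  / 2), which is the Poisson kernel.\<close>

lemma poisson_eq_nn_integral_heat:
  fixes x y :: "real^'n"
  assumes a: "a > 0"
  shows "ennreal (poisson a x y) = (\<integral>\<^sup>+w\<in>{0<..}. ennreal (subordinator a w * heat (1 / w\<^sup>2) x y) \<partial>lborel)"
proof -
  let ?n = "CARD('n)"
  let ?N = "real CARD('n)"
  define b where "b = (a\<^sup>2 + (norm (x - y))\<^sup>2) / 4"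
  have b: "b > 0" using a by (auto simp: b_def intro: add_pos_nonneg)
  have "(\<integral>\<^sup>+w\<in>{0<..}. ennreal (subordinator a w * heat (1 / w\<^sup>2) x y) \<partial>lborel)
     = (\<integral>\<^sup>+w. ennreal (a / sqrt pi * (4 * pi) powr (- ?N / 2)) * (ennreal (w ^ ?n * exp (- (b * w\<^sup>2))) * indicator {0<..} w) \<partial>lborel)"
  proof (rule nn_integral_cong)
    fix w :: real
    have "subordinator a w * heat (1 / w\<^sup>2) x y
        = a / sqrt pi * (4 * pi) powr (- ?N / 2) * (w ^ ?n * exp (- (b * w\<^sup>2)))" if w: "w > 0"
    proof -
      have "1 / w\<^sup>2 = w powr (- 2)"
        using w by (simp add: powr_minus_divide)
      then have "(1 / w\<^sup>2) powr (- ?N / 2) = w powr ?N"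
        by (simp only: powr_powr) simp
      also have "\<dots> = w ^ ?n" using w by (rule powr_realpow)
      finally have "(4 * pi * (1 / w\<^sup>2)) powr (- ?N / 2) = (4 * pi) powr (- ?N / 2) * w ^ ?n"
        by (simp only: powr_mult)
      then have 1: "(4 * pi * (1 / w\<^sup>2)) powr (- ?N / 2) = (4 * pi) powr (- ?N / 2) * w ^ ?n" by simp
      have 2: "exp (- (a\<^sup>2 * w\<^sup>2 / 4)) * exp (- (norm (x - y))\<^sup>2 / (4 * (1 / w\<^sup>2))) = exp (- (b * w\<^sup>2))"
        using w by (simp add: exp_add[symmetric] b_def field_simps)
      show ?thesis unfolding subordinator_def kernel.simps 1 2[symmetric] by simp
    qed
    then show "ennreal (subordinator a w * heat (1 / w\<^sup>2) x y) * indicator {0<..} w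
      = ennreal (a / sqrt pi * (4 * pi) powr (- ?N / 2)) * (ennreal (w ^ ?n * exp (- (b * w\<^sup>2))) * indicator {0<..} w)"
      using a by (auto simp: indicator_def ennreal_mult'[symmetric])
  qed
  also have "\<dots> = ennreal (a / sqrt pi * (4 * pi) powr (- ?N / 2)) * (\<integral>\<^sup>+w\<in>{0<..}. ennreal (w ^ ?n * exp (- (b * w\<^sup>2))) \<partial>lborel)"
    by (rule nn_integral_cmult) measurable
  also have "\<dots> = ennreal (a / sqrt pi * (4 * pi) powr (- ?N / 2) * (Gamma ((?N + 1) / 2) / (2 * b powr ((?N + 1) / 2))))"
    unfolding nn_integral_power_exp_square[OF b] using a b by (intro ennreal_mult[symmetric]) (auto intro!: divide_nonneg_nonneg less_imp_le[OF Gamma_real_pos])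
  also have "a / sqrt pi * (4 * pi) powr (- ?N / 2) * (Gamma ((?N + 1) / 2) / (2 * b powr ((?N + 1) / 2))) = poisson a x y"
  proof -
    have "(4::real) powr ((?N + 1) / 2) = 4 powr (?N/2) * 4 powr (1/2)"
      unfolding add_divide_distrib by (rule powr_add)
    moreover have "(4::real) powr (1/2) = 2" by (simp add: powr_half_sqrt)
    ultimately have 4: "(4::real) powr ((?N + 1) / 2) = 2 * 4 powr (?N/2)" by (simp only: mult.commute)
    have p: "pi powr ((?N + 1) / 2) = pi powr (?N/2) * sqrt pi" by (simp add: powr_add powr_half_sqrt add_divide_distrib)
    have S: "b powr ((?N + 1) / 2) = (a\<^sup>2 + (norm (x - y))\<^sup>2) powr ((?N + 1) / 2) / (2 * 4 powr (?N/2))"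
      unfolding b_def unfolding powr_divide 4 ..
    have R: "(4 * pi) powr (- ?N / 2) = 1 / (4 powr (?N/2) * pi powr (?N/2))"
      unfolding minus_divide_left[symmetric] powr_minus_divide powr_mult ..
    have alg: "a / sp * (1 / (Q * P)) * (G / (2 * (S / (2 * Q)))) = G / (P * sp) * a / S"
      if "Q \<noteq> 0" for sp Q P G S :: real
      using that by (simp add: field_simps)
    show ?thesis unfolding kernel.simps p S R by (rule alg) simp
  qed
  finally show ?thesis by simp
qed

lemma nn_integral_subordinator:
  assumes "a > 0"
  shows "(\<integral>\<^sup>+w\<in>{0<..}. ennreal (subordinator a w) \<partial>lborel) = 1"
proof -
  have "(\<integral>\<^sup>+w\<in>{0<..}. ennreal (subordinator a w) \<partial>lborel)
     = (\<integral>\<^sup>+w. ennreal (a / sqrt pi) * (ennreal (w ^ 0 * exp (- (a\<^sup>2 / 4 * w\<^sup>2))) * indicator {0<..} w) \<partial>lborel)"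
  proof (rule nn_integral_cong)
    fix w :: real
    have "ennreal (a / sqrt pi * exp (- (a\<^sup>2 / 4 * w\<^sup>2))) = ennreal (a / sqrt pi) * ennreal (exp (- (a\<^sup>2 / 4 * w\<^sup>2)))"
      using assms by (intro ennreal_mult) auto
    then show "ennreal (subordinator a w) * indicator {0<..} w
        = ennreal (a / sqrt pi) * (ennreal (w ^ 0 * exp (- (a\<^sup>2 / 4 * w\<^sup>2))) * indicator {0<..} w)"
      unfolding subordinator_def by (simp add: mult.assoc)
  qed
  also have "\<dots> = ennreal (a / sqrt pi) * (\<integral>\<^sup>+w\<in>{0<..}. ennreal (w ^ 0 * exp (- (a\<^sup>2 / 4 * w\<^sup>2))) \<partial>lborel)"
    by (rule nn_integral_cmult) measurable
  also have "\<dots> = 1"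
  proof -
    have "(a\<^sup>2 / 4) powr (1 / 2) = a / 2"
      using assms by (subst powr_half_sqrt) (auto simp: real_sqrt_divide)
    then have "Gamma ((real 0 + 1) / 2) / (2 * (a\<^sup>2 / 4) powr ((real 0 + 1) / 2)) = sqrt pi / a"
      using assms by (simp add: Gamma_one_half_real)
    moreover have "ennreal (a / sqrt pi) * ennreal (sqrt pi / a) = 1"
      using assms by (subst ennreal_mult[symmetric]) auto
    ultimately show ?thesis using assms by (subst nn_integral_power_exp_square) auto
  qed
  finally show ?thesis .
qed

lemma nn_integral_poisson:
  fixes x :: "real^'n"
  assumes "a > 0"
  shows "(\<integral>\<^sup>+y. ennreal (poisson a x y) \<partial>lborel) = 1"
proof -
  have "(\<integral>\<^sup>+y. ennreal (poisson a x y) \<partial>lborel)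
     = (\<integral>\<^sup>+y. (\<integral>\<^sup>+w\<in>{0<..}. ennreal (subordinator a w * heat (1 / w\<^sup>2) x y) \<partial>lborel) \<partial>lborel)"
    by (simp only: poisson_eq_nn_integral_heat[OF assms])
  also have "\<dots> = (\<integral>\<^sup>+w. (\<integral>\<^sup>+y. ennreal (subordinator a w * heat (1 / w\<^sup>2) x y) * indicator {0<..} w \<partial>lborel) \<partial>lborel)"
    by (rule lborel_pair.Fubini') (measurable)
  also have "\<dots> = (\<integral>\<^sup>+w\<in>{0<..}. ennreal (subordinator a w) \<partial>lborel)"
  proof (rule nn_integral_cong)
    fix w :: real
    have "(\<integral>\<^sup>+y. ennreal (subordinator a w * heat (1 / w\<^sup>2) x y) \<partial>lborel) = ennreal (subordinator a w)" if "w > 0"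
      using that assms nn_integral_heat[of "1 / w\<^sup>2" x]
      by (simp add: ennreal_mult' subordinator_nonneg nn_integral_cmult del: kernel.simps)
    then show "(\<integral>\<^sup>+y. ennreal (subordinator a w * heat (1 / w\<^sup>2) x y) * indicator {0<..} w \<partial>lborel) = ennreal (subordinator a w) * indicator {0<..} w"
      by (cases "w > 0") (auto simp: indicator_def simp del: kernel.simps)
  qed
  also have "\<dots> = 1" by (rule nn_integral_subordinator[OF assms])
  finally show ?thesis .
qed


text \<open>Both kernels are subordinated and the heat kernels convolved, which leaves a double
  integral over u, v with heat time 1 / u^2 + 1 / v^2. New variables c = v / u and w are chosen so
  that the heat time is 1 / w^2. The integral over c is then of Cauchy-Schloemilch type, and what
  remains is the subordination formula for a + b.\<close>

lemma nn_integral_poisson_mult_poisson: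
  fixes x z :: "real^'n"
  assumes a: "a > 0" and b: "b > 0"
  shows "(\<integral>\<^sup>+y. ennreal (poisson a x y) * ennreal (poisson b y z) \<partial>lborel) = ennreal (poisson (a + b) x z)"
proof -
  define A where "A u = ennreal (subordinator a u) * indicator {0<..} u" for u :: real
  define B where "B u = ennreal (subordinator b u) * indicator {0<..} u" for u :: real
  define H where "H u = ennreal (heat (1 / u\<^sup>2) x z)" for u :: real
  have [measurable]: "A \<in> borel_measurable borel" "B \<in> borel_measurable borel" "H \<in> borel_measurable borel"
    unfolding A_def B_def H_def by measurable
  have pA: "ennreal (poisson a x y) = (\<integral>\<^sup>+u. A u * ennreal (heat (1 / u\<^sup>2) x y) \<partial>lborel)" for y
    unfolding poisson_eq_nn_integral_heat[OF a] A_def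
    by (intro nn_integral_cong) (auto simp: indicator_def ennreal_mult' subordinator_nonneg[OF a] simp del: kernel.simps)
  have pB: "ennreal (poisson b y z) = (\<integral>\<^sup>+u. B u * ennreal (heat (1 / u\<^sup>2) y z) \<partial>lborel)" for y
    unfolding poisson_eq_nn_integral_heat[OF b] B_def
    by (intro nn_integral_cong) (auto simp: indicator_def ennreal_mult' subordinator_nonneg[OF b] simp del: kernel.simps)
  have "(\<integral>\<^sup>+y. ennreal (poisson a x y) * ennreal (poisson b y z) \<partial>lborel)
     = (\<integral>\<^sup>+y. (\<integral>\<^sup>+u. (\<integral>\<^sup>+v. (A u * ennreal (heat (1 / u\<^sup>2) x y)) * (B v * ennreal (heat (1 / v\<^sup>2) y z)) \<partial>lborel) \<partial>lborel) \<partial>lborel)"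
  proof (rule nn_integral_cong)
    fix y :: "real^'n"
    have "ennreal (poisson a x y) * ennreal (poisson b y z)
        = (\<integral>\<^sup>+u. (A u * ennreal (heat (1 / u\<^sup>2) x y)) * ennreal (poisson b y z) \<partial>lborel)"
      unfolding pA by (rule nn_integral_multc[symmetric]) measurable
    also have "\<dots> = (\<integral>\<^sup>+u. (\<integral>\<^sup>+v. (A u * ennreal (heat (1 / u\<^sup>2) x y)) * (B v * ennreal (heat (1 / v\<^sup>2) y z)) \<partial>lborel) \<partial>lborel)"
      unfolding pB by (intro nn_integral_cong nn_integral_cmult[symmetric]) measurable
    finally show "ennreal (poisson a x y) * ennreal (poisson b y z) = \<dots>" .
  qed
  also have "\<dots> = (\<integral>\<^sup>+u. (\<integral>\<^sup>+y. (\<integral>\<^sup>+v. (A u * ennreal (heat (1 / u\<^sup>2) x y)) * (B v * ennreal (heat (1 / v\<^sup>2) y z)) \<partial>lborel) \<partial>lborel) \<partial>lborel)"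
    by (rule lborel_pair.Fubini') measurable
  also have "\<dots> = (\<integral>\<^sup>+u. (\<integral>\<^sup>+v. (\<integral>\<^sup>+y. (A u * ennreal (heat (1 / u\<^sup>2) x y)) * (B v * ennreal (heat (1 / v\<^sup>2) y z)) \<partial>lborel) \<partial>lborel) \<partial>lborel)"
    by (intro nn_integral_cong lborel_pair.Fubini') measurable
  also have "\<dots> = (\<integral>\<^sup>+u. (\<integral>\<^sup>+v\<in>{0<..}. A u * B v * ennreal (heat (1 / u\<^sup>2 + 1 / v\<^sup>2) x z) \<partial>lborel) \<partial>lborel)"
  proof (intro nn_integral_cong)
    fix u v :: real
    have "(\<integral>\<^sup>+y. (A u * ennreal (heat (1 / u\<^sup>2) x y)) * (B v * ennreal (heat (1 / v\<^sup>2) y z)) \<partial>lborel)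
       = (\<integral>\<^sup>+y. (A u * B v) * (ennreal (heat (1 / u\<^sup>2) x y) * ennreal (heat (1 / v\<^sup>2) y z)) \<partial>lborel)"
      by (intro nn_integral_cong) (simp only: mult_ac)
    also have "\<dots> = (A u * B v) * (\<integral>\<^sup>+y. ennreal (heat (1 / u\<^sup>2) x y) * ennreal (heat (1 / v\<^sup>2) y z) \<partial>lborel)"
      by (rule nn_integral_cmult) measurable
    finally have *: "(\<integral>\<^sup>+y. (A u * ennreal (heat (1 / u\<^sup>2) x y)) * (B v * ennreal (heat (1 / v\<^sup>2) y z)) \<partial>lborel)
       = (A u * B v) * (\<integral>\<^sup>+y. ennreal (heat (1 / u\<^sup>2) x y) * ennreal (heat (1 / v\<^sup>2) y z) \<partial>lborel)" .
    show "(\<integral>\<^sup>+y. (A u * ennreal (heat (1 / u\<^sup>2) x y)) * (B v * ennreal (heat (1 / v\<^sup>2) y z)) \<partial>lborel)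
       = A u * B v * ennreal (heat (1 / u\<^sup>2 + 1 / v\<^sup>2) x z) * indicator {0<..} v"
    proof (cases "u > 0 \<and> v > 0")
      case True
      then show ?thesis unfolding * by (subst nn_integral_heat_mult_heat) (auto simp del: kernel.simps)
    next
      case False
      then show ?thesis unfolding * A_def B_def by (auto simp: indicator_def simp del: kernel.simps)
    qed
  qed
  \<comment> \<open>The ratio c = v / u becomes the inner variable, with Jacobian u.\<close>
  also have "\<dots> = (\<integral>\<^sup>+u. (\<integral>\<^sup>+c\<in>{0<..}. ennreal u * (A u * B (u * c) * ennreal (heat (1 / u\<^sup>2 + 1 / (u * c)\<^sup>2) x z)) \<partial>lborel) \<partial>lborel)"
  proof (rule nn_integral_cong)
    fix u :: real
    show "(\<integral>\<^sup>+v\<in>{0<..}. A u * B v * ennreal (heat (1 / u\<^sup>2 + 1 / v\<^sup>2) x z) \<partial>lborel)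
      = (\<integral>\<^sup>+c\<in>{0<..}. ennreal u * (A u * B (u * c) * ennreal (heat (1 / u\<^sup>2 + 1 / (u * c)\<^sup>2) x z)) \<partial>lborel)"
    proof (cases "u > 0")
      case True
      then show ?thesis by (intro nn_integral_half_line_scale) measurable
    next
      case False
      then have "A u = 0" by (simp add: A_def)
      then show ?thesis by simp
    qed
  qed
  also have "\<dots> = (\<integral>\<^sup>+c. (\<integral>\<^sup>+u. ennreal u * (A u * B (u * c) * ennreal (heat (1 / u\<^sup>2 + 1 / (u * c)\<^sup>2) x z)) * indicator {0<..} c \<partial>lborel) \<partial>lborel)"
    by (rule lborel_pair.Fubini') measurable
  also have "\<dots> = (\<integral>\<^sup>+c. (\<integral>\<^sup>+w. ennreal (a * b / pi * (w * (1 + 1 / c\<^sup>2)) * exp (- ((a + b)\<^sup>2 * w\<^sup>2 / 4)) * exp (- ((w / 2)\<^sup>2 * (b * c - a / c)\<^sup>2)))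
       * H w * indicator {0<..} w * indicator {0<..} c \<partial>lborel) \<partial>lborel)"
  proof (rule nn_integral_cong)
    fix c :: real
    let ?F = "\<lambda>u. ennreal u * (A u * B (u * c) * ennreal (heat (1 / u\<^sup>2 + 1 / (u * c)\<^sup>2) x z))"
    show "(\<integral>\<^sup>+u. ?F u * indicator {0<..} c \<partial>lborel)
      = (\<integral>\<^sup>+w. ennreal (a * b / pi * (w * (1 + 1 / c\<^sup>2)) * exp (- ((a + b)\<^sup>2 * w\<^sup>2 / 4)) * exp (- ((w / 2)\<^sup>2 * (b * c - a / c)\<^sup>2)))
       * H w * indicator {0<..} w * indicator {0<..} c \<partial>lborel)"
    proof (cases "c > 0")
      case c: True
      \<comment> \<open>With u = \<kappa> w and \<kappa>^2 = 1 + 1 / c^2 the two heat times 1 / u^2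
        and 1 / (u c)^2 add up to 1 / w^2.\<close>
      define \<kappa> where "\<kappa> = sqrt (1 + c\<^sup>2) / c"
      have k: "\<kappa> > 0" using c by (simp add: \<kappa>_def add_pos_nonneg)
      have k2: "\<kappa>\<^sup>2 = 1 + 1 / c\<^sup>2" using c by (simp add: \<kappa>_def power_divide add_nonneg_nonneg add_divide_distrib)
      have kc2: "(\<kappa> * c)\<^sup>2 = 1 + c\<^sup>2" using c by (simp add: \<kappa>_def add_nonneg_nonneg)
      have "(\<integral>\<^sup>+u. ?F u * indicator {0<..} c \<partial>lborel) = (\<integral>\<^sup>+u\<in>{0<..}. ?F u \<partial>lborel)"
        using c by (intro nn_integral_cong) (auto simp: indicator_def A_def)
      also have "\<dots> = (\<integral>\<^sup>+w\<in>{0<..}. ennreal \<kappa> * ?F (\<kappa> * w) \<partial>lborel)"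
        using k by (intro nn_integral_half_line_scale) measurable
      also have "\<dots> = (\<integral>\<^sup>+w. ennreal (a * b / pi * (w * (1 + 1 / c\<^sup>2)) * exp (- ((a + b)\<^sup>2 * w\<^sup>2 / 4)) * exp (- ((w / 2)\<^sup>2 * (b * c - a / c)\<^sup>2)))
         * H w * indicator {0<..} w * indicator {0<..} c \<partial>lborel)"
      proof (rule nn_integral_cong)
        fix w :: real
        show "ennreal \<kappa> * ?F (\<kappa> * w) * indicator {0<..} w
         = ennreal (a * b / pi * (w * (1 + 1 / c\<^sup>2)) * exp (- ((a + b)\<^sup>2 * w\<^sup>2 / 4)) * exp (- ((w / 2)\<^sup>2 * (b * c - a / c)\<^sup>2)))
         * H w * indicator {0<..} w * indicator {0<..} c"
        proof (cases "w > 0")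
          case w: True
          have h: "1 / (\<kappa> * w)\<^sup>2 + 1 / (\<kappa> * w * c)\<^sup>2 = 1 / w\<^sup>2"
          proof -
            have "1 / (\<kappa> * w)\<^sup>2 + 1 / (\<kappa> * w * c)\<^sup>2 = (1 + 1 / c\<^sup>2) / (\<kappa>\<^sup>2 * w\<^sup>2)"
              using c w k by (simp add: power_mult_distrib field_simps)
            also have "\<dots> = 1 / w\<^sup>2" unfolding k2[symmetric] using k by simp
            finally show ?thesis .
          qed
          \<comment> \<open>Completing the square: a^2 (1 + 1 / c^2) + b^2 (1 + c^2) = (a + b)^2 +
            (b c - a / c)^2. The first square belongs to the subordinator of a + b, the second to
            the Cauchy-Schloemilch integral with parameter w / 2.\<close>
          have e: "exp (- (a\<^sup>2 * (\<kappa> * w)\<^sup>2 / 4)) * exp (- (b\<^sup>2 * (\<kappa> * w * c)\<^sup>2 / 4))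
             = exp (- ((a + b)\<^sup>2 * w\<^sup>2 / 4)) * exp (- ((w / 2)\<^sup>2 * (b * c - a / c)\<^sup>2))"
          proof -
            have "(b * c - a / c)\<^sup>2 = b\<^sup>2 * c\<^sup>2 + a\<^sup>2 / c\<^sup>2 - 2 * a * b"
              using c by (simp add: power2_diff power_mult_distrib power_divide)
            then have "a\<^sup>2 * (1 + 1 / c\<^sup>2) + b\<^sup>2 * (1 + c\<^sup>2) = (a + b)\<^sup>2 + (b * c - a / c)\<^sup>2"
              by (simp add: power2_sum distrib_left)
            then have "a\<^sup>2 * \<kappa>\<^sup>2 + b\<^sup>2 * (\<kappa> * c)\<^sup>2 = (a + b)\<^sup>2 + (b * c - a / c)\<^sup>2"
              unfolding k2 kc2 .
            then have K: "a\<^sup>2 * \<kappa>\<^sup>2 + b\<^sup>2 * (\<kappa> * c)\<^sup>2 = (a + b)\<^sup>2 + (b * c - a / c)\<^sup>2" .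
            have alg: "- (A * (K * W) / 4) + - (B * (L * W) / 4) = - (S * W / 4) + - (W / 4 * D)"
              if "A * K + B * L = S + D" for A B K L S D W :: real
            proof -
              have "(A * K + B * L) * W = (S + D) * W" using that by simp
              then show ?thesis by (simp add: algebra_simps)
            qed
            have "- (a\<^sup>2 * (\<kappa> * w)\<^sup>2 / 4) + - (b\<^sup>2 * (\<kappa> * w * c)\<^sup>2 / 4)
               = - ((a + b)\<^sup>2 * w\<^sup>2 / 4) + - ((w / 2)\<^sup>2 * (b * c - a / c)\<^sup>2)"
              using alg[OF K, of "w\<^sup>2"] by (simp add: power_mult_distrib power_divide mult_ac)
            then show ?thesis by (simp only: exp_add[symmetric])
          qed
          have p: "\<kappa> * (\<kappa> * w * (subordinator a (\<kappa> * w) * subordinator b (\<kappa> * w * c)))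
            = a * b / pi * (w * (1 + 1 / c\<^sup>2)) * exp (- ((a + b)\<^sup>2 * w\<^sup>2 / 4)) * exp (- ((w / 2)\<^sup>2 * (b * c - a / c)\<^sup>2))"
          proof -
            have "\<kappa> * (\<kappa> * w * (subordinator a (\<kappa> * w) * subordinator b (\<kappa> * w * c)))
              = \<kappa>\<^sup>2 * w * (a * b / (sqrt pi * sqrt pi)) * (exp (- (a\<^sup>2 * (\<kappa> * w)\<^sup>2 / 4)) * exp (- (b\<^sup>2 * (\<kappa> * w * c)\<^sup>2 / 4)))"
              unfolding subordinator_def power2_eq_square[of \<kappa>] by simp
            also have "\<dots> = (1 + 1 / c\<^sup>2) * w * (a * b / pi) * (exp (- ((a + b)\<^sup>2 * w\<^sup>2 / 4)) * exp (- ((w / 2)\<^sup>2 * (b * c - a / c)\<^sup>2)))"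
              unfolding e k2 by simp
            finally show ?thesis by (simp only: mult_ac)
          qed
          have "ennreal \<kappa> * ?F (\<kappa> * w) = ennreal (\<kappa> * (\<kappa> * w * (subordinator a (\<kappa> * w) * subordinator b (\<kappa> * w * c)))) * H w"
            unfolding h H_def A_def B_def using k w c a b
            by (simp add: ennreal_mult subordinator_nonneg mult.assoc del: kernel.simps)
          then show ?thesis unfolding p using w c by simp
        qed simp
      qed
      finally show ?thesis .
    qed simp
  qed
  also have "\<dots> = (\<integral>\<^sup>+w. (\<integral>\<^sup>+c. ennreal (a * b / pi * (w * (1 + 1 / c\<^sup>2)) * exp (- ((a + b)\<^sup>2 * w\<^sup>2 / 4)) * exp (- ((w / 2)\<^sup>2 * (b * c - a / c)\<^sup>2)))
       * H w * indicator {0<..} w * indicator {0<..} c \<partial>lborel) \<partial>lborel)"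
    by (rule lborel_pair.Fubini') measurable
  also have "\<dots> = (\<integral>\<^sup>+w\<in>{0<..}. ennreal (subordinator (a + b) w * heat (1 / w\<^sup>2) x z) \<partial>lborel)"
  proof (rule nn_integral_cong)
    fix w :: real
    show "(\<integral>\<^sup>+c. ennreal (a * b / pi * (w * (1 + 1 / c\<^sup>2)) * exp (- ((a + b)\<^sup>2 * w\<^sup>2 / 4)) * exp (- ((w / 2)\<^sup>2 * (b * c - a / c)\<^sup>2)))
       * H w * indicator {0<..} w * indicator {0<..} c \<partial>lborel)
       = ennreal (subordinator (a + b) w * heat (1 / w\<^sup>2) x z) * indicator {0<..} w"
    proof (cases "w > 0")
      case w: True
      define q where "q = a * b / pi * w * exp (- ((a + b)\<^sup>2 * w\<^sup>2 / 4))"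
      have q: "q \<ge> 0" using a b w by (simp add: q_def)
      have "(\<integral>\<^sup>+c. ennreal (a * b / pi * (w * (1 + 1 / c\<^sup>2)) * exp (- ((a + b)\<^sup>2 * w\<^sup>2 / 4)) * exp (- ((w / 2)\<^sup>2 * (b * c - a / c)\<^sup>2)))
       * H w * indicator {0<..} w * indicator {0<..} c \<partial>lborel)
       = (\<integral>\<^sup>+c. (ennreal q * H w) * (ennreal ((1 + 1 / c\<^sup>2) * exp (- ((w / 2)\<^sup>2 * (b * c - a / c)\<^sup>2))) * indicator {0<..} c) \<partial>lborel)"
      proof (rule nn_integral_cong)
        fix c :: real
        have "a * b / pi * (w * (1 + 1 / c\<^sup>2)) * exp (- ((a + b)\<^sup>2 * w\<^sup>2 / 4)) * exp (- ((w / 2)\<^sup>2 * (b * c - a / c)\<^sup>2))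
          = q * ((1 + 1 / c\<^sup>2) * exp (- ((w / 2)\<^sup>2 * (b * c - a / c)\<^sup>2)))"
          unfolding q_def by (simp only: mult_ac)
        then show "ennreal (a * b / pi * (w * (1 + 1 / c\<^sup>2)) * exp (- ((a + b)\<^sup>2 * w\<^sup>2 / 4)) * exp (- ((w / 2)\<^sup>2 * (b * c - a / c)\<^sup>2)))
          * H w * indicator {0<..} w * indicator {0<..} c
          = (ennreal q * H w) * (ennreal ((1 + 1 / c\<^sup>2) * exp (- ((w / 2)\<^sup>2 * (b * c - a / c)\<^sup>2))) * indicator {0<..} c)"
          using q w by (simp add: ennreal_mult' mult_ac)
      qed
      also have "\<dots> = (ennreal q * H w) * (\<integral>\<^sup>+c\<in>{0<..}. ennreal ((1 + 1 / c\<^sup>2) * exp (- ((w / 2)\<^sup>2 * (b * c - a / c)\<^sup>2))) \<partial>lborel)"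
        by (rule nn_integral_cmult) measurable
      also have "\<dots> = (ennreal q * H w) * ennreal ((1 / a + 1 / b) * (sqrt pi / (2 * (w / 2))))"
        using w by (subst nn_integral_Cauchy_Schloemilch[OF a b]) auto
      also have "\<dots> = ennreal (q * ((1 / a + 1 / b) * (sqrt pi / (2 * (w / 2))))) * H w"
      proof -
        have "ennreal (q * ((1 / a + 1 / b) * (sqrt pi / (2 * (w / 2))))) = ennreal q * ennreal ((1 / a + 1 / b) * (sqrt pi / (2 * (w / 2))))"
          using q a b w by (intro ennreal_mult) auto
        then show ?thesis by (simp only: mult_ac)
      qed
      also have "q * ((1 / a + 1 / b) * (sqrt pi / (2 * (w / 2)))) = subordinator (a + b) w"
      proof -
        have "sqrt pi / pi = 1 / sqrt pi" by (simp add: divide_simps)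
        moreover have "q * ((1 / a + 1 / b) * (sqrt pi / (2 * (w / 2)))) = (a + b) * (sqrt pi / pi) * exp (- ((a + b)\<^sup>2 * w\<^sup>2 / 4))"
          using a b w by (simp add: q_def field_simps)
        ultimately show ?thesis by (simp add: subordinator_def)
      qed
      finally show ?thesis using w a b by (simp add: H_def ennreal_mult' subordinator_nonneg del: kernel.simps)
    qed simp
  qed
  also have "\<dots> = ennreal (poisson (a + b) x z)"
    using a b by (intro poisson_eq_nn_integral_heat[symmetric]) simp
  finally show ?thesis .
qed

lemma nn_integral_kernel:
  assumes "t > 0"
  shows "(\<integral>\<^sup>+y. ennreal (kernel A t x y) \<partial>lebesgue) = 1"
  using assms by (cases A) (simp_all only: nn_integral_completion nn_integral_heat nn_integral_poisson)

lemma nn_integral_kernel_mult_kernel: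
  assumes "s > 0" "t > 0"
  shows "(\<integral>\<^sup>+y. ennreal (kernel A s x y) * ennreal (kernel A t y z) \<partial>lebesgue) = ennreal (kernel A (s + t) x z)"
  using assms by (cases A) (simp_all only: nn_integral_completion nn_integral_heat_mult_heat nn_integral_poisson_mult_poisson)

section \<open>The common majorant and its integrals\<close>

definition maj :: "real \<Rightarrow> real^'n \<Rightarrow> real" where
  "maj r z = r / (r + norm z) ^ (CARD('n) + 1)"

lemma add_norm_power_pos: "r > 0 \<Longrightarrow> 0 < (r + norm z) ^ k"
  by (intro zero_less_power add_pos_nonneg) auto

lemma ennreal_le_suminf:
  fixes f :: "nat \<Rightarrow> ennreal"
  shows "f k \<le> suminf f"
  using sum_le_suminf[OF summableI, of "{k}" f] by simp

lemma ball_in_sets_lebesgue [measurable, simp]: "ball x r \<in> sets lebesgue"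
  by (intro sets_completionI_sets) simp

lemma maj_pos: "r > 0 \<Longrightarrow> 0 < maj r z"
  unfolding maj_def by (intro divide_pos_pos add_norm_power_pos)

lemma borel_measurable_maj [measurable]:
  "f \<in> borel_measurable M \<Longrightarrow> (\<lambda>w. maj r (f w)) \<in> borel_measurable M"
  unfolding maj_def by simp

text \<open>By the triangle inequality r + |x - y| is at most 2 (r + |x' - y|). Thus one estimate at
  the centre of a ball of radius r serves all its points.\<close>

lemma maj_shift:
  fixes x x' y :: "real^'n"
  assumes "r > 0" "norm (x - x') \<le> r"
  shows "maj r (x' - y) \<le> 2 ^ (CARD('n) + 1) * maj r (x - y)"
proof -
  have "norm (x - y) \<le> norm (x - x') + norm (x' - y)"
    using norm_triangle_ineq[of "x - x'" "x' - y"] by simp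
  then have "r + norm (x - y) \<le> 2 * (r + norm (x' - y))"
    using assms norm_ge_zero[of "x' - y"] unfolding mult_2 by linarith
  then have "(r + norm (x - y)) ^ (CARD('n) + 1) \<le> (2 * (r + norm (x' - y))) ^ (CARD('n) + 1)"
    using assms by (intro power_mono) auto
  then have "(r + norm (x - y)) ^ (CARD('n) + 1) \<le> 2 ^ (CARD('n) + 1) * (r + norm (x' - y)) ^ (CARD('n) + 1)"
    by (simp only: power_mult_distrib)
  moreover have "r / B \<le> c * (r / A)" if "A \<le> c * B" "A > 0" "B > 0" for A B c :: real
    using that assms(1) by (simp add: field_simps)
  moreover have "0 < (r + norm (x - y)) ^ (CARD('n) + 1)" "0 < (r + norm (x' - y)) ^ (CARD('n) + 1)"
    using assms by (intro add_norm_power_pos; simp)+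
  ultimately show ?thesis unfolding maj_def by blast
qed

text \<open>The constant depends on both points and both scales, so this comparison is only good for
  qualitative statements: membership in a domain and finiteness of an integral.\<close>

lemma maj_comparable:
  fixes x x' :: "real^'n"
  assumes "r > 0" "s > 0"
  shows "\<exists>C>0. \<forall>y. maj r (x - y) \<le> C * maj s (x' - y)"
proof -
  define c where "c = max 1 (s / r) + norm (x - x') / r"
  have c: "c \<ge> 1" using assms by (simp add: c_def add_increasing2)
  have "maj r (x - y) \<le> (r / s * c ^ (CARD('n) + 1)) * maj s (x' - y)" for y
  proof -
    have "norm (x' - y) \<le> norm (x - x') + norm (x - y)"
      using norm_triangle_ineq4[of "x - y" "x - x'"] by simp
    moreover have "s \<le> max 1 (s / r) * r" using assms by (simp add: max_def field_simps)
    moreover have "norm (x - y) \<le> c * norm (x - y)" using c mult_right_mono[of 1 c "norm (x - y)"] by simp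
    moreover have "norm (x - x') = norm (x - x') / r * r" using assms by simp
    ultimately have "s + norm (x' - y) \<le> c * (r + norm (x - y))"
      unfolding c_def by (simp add: distrib_right distrib_left)
    then have "(s + norm (x' - y)) ^ (CARD('n) + 1) \<le> (c * (r + norm (x - y))) ^ (CARD('n) + 1)"
      using assms by (intro power_mono) auto
    then have "(s + norm (x' - y)) ^ (CARD('n) + 1) \<le> c ^ (CARD('n) + 1) * (r + norm (x - y)) ^ (CARD('n) + 1)"
      by (simp only: power_mult_distrib)
    moreover have "r / A \<le> r / s * d * (s / B)" if "B \<le> d * A" "A > 0" "B > 0" for A B d :: real
      using that assms by (simp add: field_simps)
    moreover have "0 < (s + norm (x' - y)) ^ (CARD('n) + 1)" "0 < (r + norm (x - y)) ^ (CARD('n) + 1)"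
      using assms by (intro add_norm_power_pos; simp)+
    ultimately show ?thesis unfolding maj_def by blast
  qed
  moreover have "r / s * c ^ (CARD('n) + 1) > 0"
    using assms c by (intro mult_pos_pos divide_pos_pos zero_less_power) auto
  ultimately show ?thesis by blast
qed

text \<open>A single summand suffices: that of the least k with |z| < 2^k r. Minimality gives |z| at
  least 2^(k - 1) r when k > 0, and the factor 2^(n + 1) absorbs the shift from k - 1 to k.\<close>

lemma maj_le_layers:
  fixes z :: "real^'n"
  assumes r: "r > 0"
  shows "ennreal (maj r z) \<le>
    (\<Sum>k. ennreal (2 ^ (CARD('n) + 1) / (2 ^ k) ^ (CARD('n) + 1) / r ^ CARD('n)) * indicator (ball 0 (2 ^ k * r)) z)"
    (is "_ \<le> (\<Sum>k. ?f k)")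
proof -
  let ?d = "CARD('n) + 1"
  obtain k0 :: nat where "norm z / r < 2 ^ k0"
    using real_arch_pow[of 2 "norm z / r"] by auto
  then have "\<exists>k. norm z < 2 ^ k * r" using r by (auto simp: field_simps)
  define k where "k = (LEAST k. norm z < 2 ^ k * r)"
  have k: "norm z < 2 ^ k * r"
    unfolding k_def by (rule LeastI_ex) fact
  have "maj r z \<le> 2 ^ ?d / (2 ^ k) ^ ?d / r ^ CARD('n)"
  proof (cases k)
    case 0
    have "maj r z \<le> r / r ^ ?d"
      unfolding maj_def using r by (intro divide_left_mono power_mono mult_pos_pos zero_less_power add_pos_nonneg) auto
    also have "\<dots> = 1 / r ^ CARD('n)" using r by simp
    also have "\<dots> \<le> 2 ^ ?d / r ^ CARD('n)" using r by (intro divide_right_mono one_le_power) auto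
    finally show ?thesis using 0 by simp
  next
    case (Suc j)
    have "\<not> norm z < 2 ^ j * r" using not_less_Least[of j "\<lambda>k. norm z < 2 ^ k * r"] Suc by (simp add: k_def)
    then have z: "2 ^ j * r \<le> r + norm z" using r by linarith
    have "maj r z \<le> r / (2 ^ j * r) ^ ?d"
      unfolding maj_def using r z by (intro divide_left_mono power_mono mult_pos_pos zero_less_power add_pos_nonneg) auto
    also have "\<dots> = 1 / (2 ^ j) ^ ?d / r ^ CARD('n)" using r by (simp add: power_mult_distrib)
    also have "1 / (2 ^ j :: real) ^ ?d = 2 ^ ?d / (2 ^ k) ^ ?d"
    proof -
      have eq: "(2 ^ k) ^ ?d = 2 ^ ?d * (2 ^ j :: real) ^ ?d"
        unfolding Suc power_Suc by (rule power_mult_distrib)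
      have alg: "1 / b = a / (a * b)" if "a \<noteq> 0" for a b :: real using that by simp
      have "1 / (2 ^ j) ^ ?d = 2 ^ ?d / (2 ^ ?d * (2 ^ j :: real) ^ ?d)" by (rule alg) simp
      then show ?thesis by (simp only: eq)
    qed
    finally show ?thesis by simp
  qed
  then have "ennreal (maj r z) \<le> ?f k"
    using k by (auto intro: ennreal_leI)
  also have "\<dots> \<le> (\<Sum>k. ?f k)"
    by (rule ennreal_le_suminf)
  finally show ?thesis .
qed

text \<open>Layer k has weight 2^(- k (n + 1)) r^(- n) and carries at most a (2^k r)^n 2^(k
  \<gamma>), up to a constant a 2^(k (\<gamma> - 1)). The geometric series converges because
  \<gamma> < 1.\<close>

lemma nn_integral_maj_le:
  assumes \<gamma>: "\<gamma> < 1"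
  shows "\<exists>C>0. \<forall>(u :: real^'n \<Rightarrow> ennreal) r x a.
    u \<in> borel_measurable lebesgue \<longrightarrow> 0 < r \<longrightarrow> 0 \<le> a \<longrightarrow>
    (\<forall>R\<ge>r. (\<integral>\<^sup>+y\<in>ball x R. u y \<partial>lebesgue) \<le> ennreal (a * R ^ CARD('n) * (R / r) powr \<gamma>)) \<longrightarrow>
    (\<integral>\<^sup>+y. ennreal (maj r (x - y)) * u y \<partial>lebesgue) \<le> ennreal (C * a)"
proof -
  let ?n = "CARD('n)"
  define \<theta> where "\<theta> = 2 powr (\<gamma> - 1)"
  have \<theta>: "0 < \<theta>" "\<theta> < 1" using \<gamma> by (auto simp: \<theta>_def powr_less_one)
  define C where "C = 2 ^ (?n + 1) / (1 - \<theta>)"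
  have C: "C > 0" using \<theta> by (simp add: C_def)
  have "(\<integral>\<^sup>+y. ennreal (maj r (x - y)) * u y \<partial>lebesgue) \<le> ennreal (C * a)"
    if u: "u \<in> borel_measurable lebesgue" and r: "0 < r" and a: "0 \<le> a"
      and bnd: "\<forall>R\<ge>r. (\<integral>\<^sup>+y\<in>ball x R. u y \<partial>lebesgue) \<le> ennreal (a * R ^ ?n * (R / r) powr \<gamma>)"
    for u :: "real^'n \<Rightarrow> ennreal" and r a :: real and x :: "real^'n"
  proof -
    note u [measurable]
    define b where "b k = 2 ^ (?n + 1) / (2 ^ k) ^ (?n + 1) / r ^ ?n" for k :: nat
    have b: "b k \<ge> 0" for k using r by (simp add: b_def)
    have "(\<integral>\<^sup>+y. ennreal (maj r (x - y)) * u y \<partial>lebesgue)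
      \<le> (\<integral>\<^sup>+y. (\<Sum>k. ennreal (b k) * (u y * indicator (ball x (2 ^ k * r)) y)) \<partial>lebesgue)"
    proof (rule nn_integral_mono)
      fix y :: "real^'n"
      have "ennreal (maj r (x - y)) * u y \<le> (\<Sum>k. ennreal (b k) * indicator (ball 0 (2 ^ k * r)) (x - y)) * u y"
        unfolding b_def by (intro mult_right_mono maj_le_layers r) simp
      also have "\<dots> = (\<Sum>k. ennreal (b k) * indicator (ball 0 (2 ^ k * r)) (x - y) * u y)"
        by (rule ennreal_suminf_multc[symmetric])
      also have "\<dots> = (\<Sum>k. ennreal (b k) * (u y * indicator (ball x (2 ^ k * r)) y))"
        by (intro arg_cong[of _ _ suminf] ext) (auto simp: indicator_def dist_norm norm_minus_commute)
      finally show "ennreal (maj r (x - y)) * u y \<le> \<dots>" .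
    qed
    also have "\<dots> = (\<Sum>k. \<integral>\<^sup>+y. ennreal (b k) * (u y * indicator (ball x (2 ^ k * r)) y) \<partial>lebesgue)"
      by (intro nn_integral_suminf) measurable
    also have "\<dots> = (\<Sum>k. ennreal (b k) * (\<integral>\<^sup>+y\<in>ball x (2 ^ k * r). u y \<partial>lebesgue))"
      by (intro arg_cong[of _ _ suminf] ext nn_integral_cmult) measurable
    also have "\<dots> \<le> (\<Sum>k. ennreal (2 ^ (?n + 1) * a * \<theta> ^ k))"
    proof (intro suminf_le summableI)
      fix k :: nat
      have "ennreal (b k) * (\<integral>\<^sup>+y\<in>ball x (2 ^ k * r). u y \<partial>lebesgue)
        \<le> ennreal (b k) * ennreal (a * (2 ^ k * r) ^ ?n * (2 ^ k * r / r) powr \<gamma>)"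
        using r mult_right_mono[of 1 "2 ^ k" r] by (intro mult_left_mono bnd[rule_format]) auto
      also have "\<dots> = ennreal (b k * (a * (2 ^ k * r) ^ ?n * (2 ^ k * r / r) powr \<gamma>))"
        using b a r by (intro ennreal_mult[symmetric]) auto
      also have "b k * (a * (2 ^ k * r) ^ ?n * (2 ^ k * r / r) powr \<gamma>) = 2 ^ (?n + 1) * a * ((2 ^ k) powr \<gamma> / 2 ^ k)"
        using r by (simp add: b_def power_mult_distrib field_simps)
      also have "(2 ^ k) powr \<gamma> / 2 ^ k = \<theta> ^ k"
      proof -
        have "\<theta> ^ k = 2 powr ((\<gamma> - 1) * real k)"
          unfolding \<theta>_def by (simp add: powr_power mult.commute)
        also have "\<dots> = (2 powr real k) powr \<gamma> / 2 powr real k"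
          by (simp only: powr_powr powr_diff[symmetric]) (simp add: algebra_simps)
        finally show ?thesis by (simp add: powr_realpow)
      qed
      finally show "ennreal (b k) * (\<integral>\<^sup>+y\<in>ball x (2 ^ k * r). u y \<partial>lebesgue) \<le> ennreal (2 ^ (?n + 1) * a * \<theta> ^ k)" .
    qed
    also have "\<dots> = ennreal (2 ^ (?n + 1) * a * (1 / (1 - \<theta>)))"
      using a \<theta> by (intro suminf_ennreal_eq sums_mult geometric_sums) auto
    also have "2 ^ (?n + 1) * a * (1 / (1 - \<theta>)) = C * a" by (simp add: C_def)
    finally show ?thesis .
  qed
  then show ?thesis using C by blast
qed

lemma emeasure_lebesgue_ball:
  fixes x :: "real^'n"
  shows "r \<ge> 0 \<Longrightarrow> emeasure lebesgue (ball x r) = ennreal (unit_ball_vol (real CARD('n)) * r ^ CARD('n))"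
  using emeasure_ball[of r x] by simp

lemma measure_lebesgue_ball:
  fixes x :: "real^'n"
  shows "r \<ge> 0 \<Longrightarrow> measure lebesgue (ball x r) = unit_ball_vol (real CARD('n)) * r ^ CARD('n)"
  by (simp add: content_ball)

lemma nn_integral_maj_bounded:
  "\<exists>C>0. \<forall>r>0. \<forall>x::real^'n. (\<integral>\<^sup>+y. ennreal (maj r (x - y)) \<partial>lebesgue) \<le> ennreal C"
proof -
  obtain C where C: "C > 0" "\<And>(u :: real^'n \<Rightarrow> ennreal) r x a.
    \<lbrakk>u \<in> borel_measurable lebesgue; 0 < r; 0 \<le> a;
    \<forall>R\<ge>r. (\<integral>\<^sup>+y\<in>ball x R. u y \<partial>lebesgue) \<le> ennreal (a * R ^ CARD('n) * (R / r) powr 0)\<rbrakk> \<Longrightarrow>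
    (\<integral>\<^sup>+y. ennreal (maj r (x - y)) * u y \<partial>lebesgue) \<le> ennreal (C * a)"
    using nn_integral_maj_le[of 0, where 'n = 'n] by auto
  let ?v = "unit_ball_vol (real CARD('n))"
  have "(\<integral>\<^sup>+y. ennreal (maj r (x - y)) * 1 \<partial>lebesgue) \<le> ennreal (C * ?v)" if "r > 0" for r and x :: "real^'n"
    using that by (intro C(2)) (auto simp: emeasure_ball)
  then show ?thesis using C(1) by (intro exI[of _ "C * ?v"]) auto
qed

section \<open>Size and smoothness of the kernels\<close>

text \<open>With X = 1 + q u^2 the square of 1 + u is at most c X, and X / K is below exp(X / K);
  raising this to the power K gives a bound of X^K by a multiple of exp X.\<close>

lemma power_mult_exp_neg_square_bounded:
  fixes q :: real
  assumes q: "q > 0"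
  shows "\<exists>C>0. \<forall>u\<ge>0. (1 + u) ^ k * exp (- (q * u\<^sup>2)) \<le> C"
proof -
  \<comment> \<open>The successor keeps K positive, so that division by K is meaningful also for k =
    0.\<close>
  define K where "K = Suc k"
  define c where "c = 2 + 2 / q"
  have c: "c > 0" using q by (simp add: c_def add_pos_pos)
  define C where "C = c ^ K * real K ^ K * exp 1"
  have "(1 + u) ^ k * exp (- (q * u\<^sup>2)) \<le> C" if u: "u \<ge> 0" for u
  proof -
    define X where "X = 1 + q * u\<^sup>2"
    have X: "X \<ge> 0" using q by (simp add: X_def)
    have "(1 + u)\<^sup>2 \<le> 2 + 2 * u\<^sup>2"
      using zero_le_power2[of "1 - u"] by (simp add: power2_eq_square algebra_simps)
    also have "\<dots> \<le> c * X" using q by (simp add: c_def X_def algebra_simps)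
    finally have 1: "(1 + u)\<^sup>2 \<le> c * X" .
    have "X / real K \<le> exp (X / real K)"
      using exp_ge_add_one_self[of "X / real K"] by linarith
    then have "(X / real K) ^ K \<le> exp (X / real K) ^ K" using X by (intro power_mono) (auto simp: K_def)
    also have "\<dots> = exp X" by (subst exp_of_nat_mult[symmetric]) (simp add: K_def)
    finally have "X ^ K / real K ^ K \<le> exp X" unfolding power_divide .
    moreover have "real K ^ K > 0" by (simp add: K_def)
    ultimately have 2: "X ^ K \<le> real K ^ K * exp X"
      using pos_divide_le_eq by (metis mult.commute)
    have "(1 + u) ^ k \<le> (1 + u) ^ (2 * K)" using u by (intro power_increasing) (auto simp: K_def)
    also have "\<dots> = ((1 + u)\<^sup>2) ^ K" by (rule power_mult)
    also have "\<dots> \<le> (c * X) ^ K" using 1 by (intro power_mono) auto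
    also have "\<dots> = c ^ K * X ^ K" by (rule power_mult_distrib)
    also have "\<dots> \<le> c ^ K * (real K ^ K * exp X)" using 2 c by (intro mult_left_mono) auto
    also have "\<dots> = C * exp (q * u\<^sup>2)" by (simp add: C_def X_def exp_add)
    finally have "(1 + u) ^ k * exp (- (q * u\<^sup>2)) \<le> C * exp (q * u\<^sup>2) * exp (- (q * u\<^sup>2))"
      by (intro mult_right_mono) auto
    also have "\<dots> = C" by (simp add: exp_minus)
    finally show ?thesis .
  qed
  moreover have "C > 0" using c by (simp add: C_def K_def)
  ultimately show ?thesis by blast
qed

text \<open>The radial profile of the kernel at unit scale. At time r^m both kernels are the dilates
  of their profile by r, so that every kernel bound becomes a statement on one real
  variable.\<close>

fun profile :: "generator \<Rightarrow> nat \<Rightarrow> real \<Rightarrow> real" where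
  "profile Sqrt_Laplacian n u =
     Gamma ((real n + 1) / 2) / pi powr ((real n + 1) / 2) * (1 + u\<^sup>2) powr (- ((real n + 1) / 2))"
| "profile Laplacian n u = (4 * pi) powr (- real n / 2) * exp (- (1 / 4 * u\<^sup>2))"

lemma kernel_eq_profile:
  fixes x y :: "real^'n"
  assumes r: "r > 0"
  shows "kernel A (r ^ gen_order A) x y = profile A CARD('n) (norm (x - y) / r) / r ^ CARD('n)"
proof (cases A)
  case Sqrt_Laplacian
  let ?n = "CARD('n)" and ?e = "(real CARD('n) + 1) / 2"
  have "r\<^sup>2 + (norm (x - y))\<^sup>2 = r\<^sup>2 * (1 + (norm (x - y) / r)\<^sup>2)"
    using r by (simp add: field_simps power_divide)
  then have "(r\<^sup>2 + (norm (x - y))\<^sup>2) powr ?e = (r\<^sup>2) powr ?e * (1 + (norm (x - y) / r)\<^sup>2) powr ?e"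
    by (simp only: powr_mult)
  moreover have "(r\<^sup>2) powr ?e = r * r ^ ?n"
  proof -
    have "r\<^sup>2 = r powr 2" using r by simp
    then have "(r\<^sup>2) powr ?e = r powr real (?n + 1)" by (simp only: powr_powr) (simp add: add_divide_distrib add.commute)
    also have "\<dots> = r ^ (?n + 1)" using r by (rule powr_realpow)
    finally show ?thesis by simp
  qed
  moreover have "G / P * r / (r * R * S) = G / P * (1 / S) / R" if "S \<noteq> 0" for G P R S :: real
    using r that by (simp add: field_simps)
  moreover have "(1 + (norm (x - y) / r)\<^sup>2) powr ?e \<noteq> 0"
    by (simp add: add_nonneg_eq_0_iff)
  ultimately show ?thesis
    unfolding Sqrt_Laplacian by (simp only: kernel.simps profile.simps gen_order.simps power_one_right powr_minus_divide)
next
  case Laplacian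
  have "r\<^sup>2 = r powr 2" using r by simp
  then have "(r\<^sup>2) powr (- real CARD('n) / 2) = r powr (- real CARD('n))" by (simp only: powr_powr) simp
  also have "\<dots> = 1 / r ^ CARD('n)" using r unfolding powr_minus_divide by (simp add: powr_realpow)
  finally have "(4 * pi * r\<^sup>2) powr (- real CARD('n) / 2) = (4 * pi) powr (- real CARD('n) / 2) * (1 / r ^ CARD('n))"
    unfolding powr_mult by simp
  moreover have "- (norm (x - y))\<^sup>2 / (4 * r\<^sup>2) = - (1 / 4 * (norm (x - y) / r)\<^sup>2)"
    by (simp add: power_divide)
  ultimately show ?thesis unfolding Laplacian by simp
qed

lemma one_plus_square_powr_le:
  fixes u :: real
  assumes "u \<ge> 0"
  shows "(1 + u\<^sup>2) powr (- ((real n + 1) / 2)) \<le> 2 ^ (n + 1) / (1 + u) ^ (n + 1)"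
proof -
  let ?e = "(real n + 1) / 2"
  have "((1 + u) / 2)\<^sup>2 \<le> 1 + u\<^sup>2"
    using zero_le_power2[of "1 - u"] assms by (simp add: power2_eq_square field_simps)
  then have "(1 + u\<^sup>2) powr (- ?e) \<le> (((1 + u) / 2)\<^sup>2) powr (- ?e)"
    using assms by (intro powr_mono2') auto
  also have "((1 + u) / 2)\<^sup>2 = ((1 + u) / 2) powr 2" using assms by simp
  also have "(((1 + u) / 2) powr 2) powr (- ?e) = ((1 + u) / 2) powr (- real (n + 1))"
  proof -
    have "2 * (- ?e) = - real (n + 1)" by (simp add: add_divide_distrib)
    then show ?thesis unfolding powr_powr by (simp only:)
  qed
  also have "\<dots> = 1 / ((1 + u) / 2) ^ (n + 1)"
    unfolding powr_minus_divide using assms by (subst powr_realpow) auto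
  also have "\<dots> = 2 ^ (n + 1) / (1 + u) ^ (n + 1)" by (simp only: power_divide) simp
  finally show ?thesis .
qed

lemma profile_pos: "0 < profile A n u"
proof -
  have "1 + u\<^sup>2 > 0" by (simp add: add_pos_nonneg)
  then show ?thesis
    by (cases A) (auto intro!: mult_pos_pos divide_pos_pos Gamma_real_pos)
qed

lemma profile_antimono:
  assumes "0 \<le> u" "u \<le> v"
  shows "profile A n v \<le> profile A n u"
proof -
  have uv: "u\<^sup>2 \<le> v\<^sup>2" using assms by (intro power_mono)
  have "(1 + v\<^sup>2) powr (- ((real n + 1) / 2)) \<le> (1 + u\<^sup>2) powr (- ((real n + 1) / 2))"
    using uv by (intro powr_mono2') (auto intro: add_pos_nonneg)
  moreover have "0 \<le> Gamma ((real n + 1) / 2) / pi powr ((real n + 1) / 2)"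
    by (intro divide_nonneg_nonneg less_imp_le[OF Gamma_real_pos]) auto
  ultimately have "profile Sqrt_Laplacian n v \<le> profile Sqrt_Laplacian n u"
    unfolding profile.simps by (rule mult_left_mono)
  then show ?thesis using uv by (cases A) auto
qed

text \<open>The derivative has the same decay as the profile. In the Poisson case differentiation
  produces the bounded factor u / (1 + u^2); in the heat case it produces a factor u, paid for by
  the Gaussian.\<close>

lemma profile_bounds:
  "\<exists>C>0. \<forall>u\<ge>0. profile A n u \<le> C / (1 + u) ^ (n + 1) \<and>
     (\<exists>D. (profile A n has_field_derivative D) (at u) \<and> \<bar>D\<bar> \<le> C / (1 + u) ^ (n + 1))"
proof (cases A)
  case Sqrt_Laplacian
  let ?e = "(real n + 1) / 2"
  define c where "c = Gamma ?e / pi powr ?e"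
  have c: "c > 0" unfolding c_def by (intro divide_pos_pos Gamma_real_pos) auto
  define C where "C = c * (2 * ?e) * 2 ^ (n + 1) + c * 2 ^ (n + 1)"
  have C: "C > 0" using c by (simp add: C_def add_nonneg_pos)
  have "profile A n u \<le> C / (1 + u) ^ (n + 1) \<and>
     (\<exists>D. (profile A n has_field_derivative D) (at u) \<and> \<bar>D\<bar> \<le> C / (1 + u) ^ (n + 1))" if u: "u \<ge> 0" for u
  proof
    let ?q = "2 ^ (n + 1) / (1 + u) ^ (n + 1)"
    have q0: "?q \<ge> 0" using u by simp
    have p: "1 + u\<^sup>2 > 0" by (simp add: add_pos_nonneg)
    have q: "(1 + u\<^sup>2) powr (- ?e) \<le> ?q" using u by (rule one_plus_square_powr_le)
    have Cq: "C / (1 + u) ^ (n + 1) = c * (2 * ?e) * ?q + c * ?q"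
      unfolding C_def by (simp add: add_divide_distrib)
    have "profile A n u = c * (1 + u\<^sup>2) powr (- ?e)" unfolding Sqrt_Laplacian c_def by simp
    also have "\<dots> \<le> c * ?q" using q c by (intro mult_left_mono) auto
    also have "\<dots> \<le> C / (1 + u) ^ (n + 1)" unfolding Cq using c q0 by (intro add_increasing mult_nonneg_nonneg) auto
    finally show "profile A n u \<le> C / (1 + u) ^ (n + 1)" .
    define D where "D = c * (- ?e * (1 + u\<^sup>2) powr (- ?e - 1) * (2 * u))"
    have eq: "profile A n = (\<lambda>u. c * (1 + u\<^sup>2) powr (- ?e))"
      unfolding Sqrt_Laplacian c_def by (intro ext) simp
    have "((\<lambda>u. 1 + u\<^sup>2) has_field_derivative 2 * u) (at u)"
      by (auto intro!: derivative_eq_intros)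
    then have "((\<lambda>u. (1 + u\<^sup>2) powr (- ?e)) has_field_derivative - ?e * (1 + u\<^sup>2) powr (- ?e - 1) * (2 * u)) (at u)"
      using DERIV_fun_powr[of "\<lambda>u. 1 + u\<^sup>2" "2 * u" u "- ?e"] p by (simp only: of_nat_1)
    then have "(profile A n has_field_derivative D) (at u)"
      unfolding eq D_def by (rule DERIV_cmult)
    moreover have "\<bar>D\<bar> \<le> C / (1 + u) ^ (n + 1)"
    proof -
      have "\<bar>D\<bar> = c * (2 * ?e) * ((1 + u\<^sup>2) powr (- ?e - 1) * u)"
        unfolding D_def using c u by (simp add: abs_mult)
      also have "(1 + u\<^sup>2) powr (- ?e - 1) * u = (1 + u\<^sup>2) powr (- ?e) * (u / (1 + u\<^sup>2))"
        using p unfolding powr_diff by simp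
      also have "\<dots> \<le> (1 + u\<^sup>2) powr (- ?e) * 1"
      proof (rule mult_left_mono)
        have "u \<le> 1 + u\<^sup>2" using zero_le_power2[of "u - 1"] u unfolding power2_diff by simp
        then show "u / (1 + u\<^sup>2) \<le> 1" using p by simp
      qed simp
      also have "\<dots> \<le> ?q" using q by simp
      finally have "\<bar>D\<bar> \<le> c * (2 * ?e) * ?q" using c by (simp add: mult_left_mono)
      also have "\<dots> \<le> C / (1 + u) ^ (n + 1)" unfolding Cq using mult_nonneg_nonneg[of c ?q] c q0 by linarith
      finally show ?thesis .
    qed
    ultimately show "\<exists>D. (profile A n has_field_derivative D) (at u) \<and> \<bar>D\<bar> \<le> C / (1 + u) ^ (n + 1)" by blast
  qed
  then show ?thesis using C by blast
next
  case Laplacian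
  \<comment> \<open>One power beyond n + 1: it pays for the factor u / 2 that differentiation
    brings.\<close>
  obtain B where B: "B > 0" "\<And>u::real. u \<ge> 0 \<Longrightarrow> (1 + u) ^ (n + 2) * exp (- (1 / 4 * u\<^sup>2)) \<le> B"
    using power_mult_exp_neg_square_bounded[of "1 / 4" "n + 2"] by auto
  define c where "c = (4 * pi) powr (- real n / 2)"
  have c: "c > 0" by (simp add: c_def)
  have "profile A n u \<le> c * B / (1 + u) ^ (n + 1) \<and>
     (\<exists>D. (profile A n has_field_derivative D) (at u) \<and> \<bar>D\<bar> \<le> c * B / (1 + u) ^ (n + 1))" if u: "u \<ge> 0" for u
  proof
    let ?E = "exp (- (1 / 4 * u\<^sup>2))"
    have "(1 + u) ^ (n + 2) = (1 + u) ^ (n + 1) * (1 + u)" by simp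
    then have "(1 + u) ^ (n + 1) * ((1 + u) * ?E) \<le> B" using B(2)[OF u] by (simp only: mult.assoc)
    then have q: "(1 + u) * ?E \<le> B / (1 + u) ^ (n + 1)"
      using u by (subst pos_le_divide_eq) (auto simp: mult.commute)
    have "?E \<le> (1 + u) * ?E" "u / 2 * ?E \<le> (1 + u) * ?E" using u by (simp_all add: mult_right_mono)
    then have q1: "?E \<le> B / (1 + u) ^ (n + 1)" and q2: "u / 2 * ?E \<le> B / (1 + u) ^ (n + 1)"
      using q by linarith+
    have eq: "profile A n = (\<lambda>u. c * exp (- (1 / 4 * u\<^sup>2)))"
      unfolding Laplacian c_def by (intro ext) simp
    show "profile A n u \<le> c * B / (1 + u) ^ (n + 1)"
      unfolding eq using mult_left_mono[OF q1, of c] c by simp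
    have "(profile A n has_field_derivative (- (c * (u / 2 * ?E)))) (at u)"
      unfolding eq by (auto intro!: derivative_eq_intros)
    moreover have "\<bar>- (c * (u / 2 * ?E))\<bar> \<le> c * B / (1 + u) ^ (n + 1)"
      using mult_left_mono[OF q2, of c] c u by (simp add: abs_mult)
    ultimately show "\<exists>D. (profile A n has_field_derivative D) (at u) \<and> \<bar>D\<bar> \<le> c * B / (1 + u) ^ (n + 1)" by blast
  qed
  then show ?thesis using B c by (intro exI[of _ "c * B"]) auto
qed

lemma maj_eq_scaled:
  fixes z :: "real^'n"
  assumes "r > 0"
  shows "maj r z = 1 / (1 + norm z / r) ^ (CARD('n) + 1) / r ^ CARD('n)"
proof -
  have "r + norm z = r * (1 + norm z / r)" using assms by (simp add: field_simps)
  then have "(r + norm z) ^ (CARD('n) + 1) = r * r ^ CARD('n) * (1 + norm z / r) ^ (CARD('n) + 1)"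
    by (simp only: power_mult_distrib) simp
  moreover have "r / (r * a * b) = 1 / b / a" for a b using assms by (simp add: mult.commute)
  ultimately show ?thesis unfolding maj_def by simp
qed

lemma kernel_le_maj:
  "\<exists>C>0. \<forall>r>0. \<forall>x y::real^'n. kernel A (r ^ gen_order A) x y \<le> C * maj r (x - y)"
proof -
  obtain C where C: "C > 0" "\<And>u. u \<ge> 0 \<Longrightarrow> profile A CARD('n) u \<le> C / (1 + u) ^ (CARD('n) + 1)"
    using profile_bounds[of A "CARD('n)"] by blast
  have "kernel A (r ^ gen_order A) x y \<le> C * maj r (x - y)" if "r > 0" for r and x y :: "real^'n"
  proof -
    have "profile A CARD('n) (norm (x - y) / r) / r ^ CARD('n) \<le> C / (1 + norm (x - y) / r) ^ (CARD('n) + 1) / r ^ CARD('n)"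
      using that by (intro divide_right_mono C(2)) auto
    moreover have "C * (1 / a / b) = C / a / b" for a b by simp
    ultimately show ?thesis unfolding kernel_eq_profile[OF that] maj_eq_scaled[OF that] by presburger
  qed
  then show ?thesis using C(1) by blast
qed

text \<open>The profile decreases, so its least value for |x - y| at most r is taken at 1. This
  recovers integrals over a ball from values of the semigroup at its centre.\<close>

lemma kernel_ge:
  "\<exists>c>0. \<forall>r>0. \<forall>x y::real^'n. norm (x - y) \<le> r \<longrightarrow> c / r ^ CARD('n) \<le> kernel A (r ^ gen_order A) x y"
proof (intro exI[of _ "profile A CARD('n) 1"] conjI allI impI)
  fix r :: real and x y :: "real^'n" assume "r > 0" "norm (x - y) \<le> r"
  then show "profile A CARD('n) 1 / r ^ CARD('n) \<le> kernel A (r ^ gen_order A) x y"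
    by (subst kernel_eq_profile) (auto intro!: divide_right_mono profile_antimono)
qed (rule profile_pos)

text \<open>The mean value theorem for the profile. Since |x - x'| is at most r, the intermediate
  point is within distance 1 of u = |x - y| / r, and the derivative bound there can be replaced by
  the one at u.\<close>

lemma kernel_Lipschitz:
  "\<exists>C>0. \<forall>r>0. \<forall>x x' y::real^'n. norm (x - x') \<le> r \<longrightarrow>
     \<bar>kernel A (r ^ gen_order A) x y - kernel A (r ^ gen_order A) x' y\<bar> \<le> C * (norm (x - x') / r) * maj r (x - y)"
proof -
  let ?d = "CARD('n) + 1"
  let ?p = "profile A CARD('n)"
  obtain C where C: "C > 0" "\<And>u. u \<ge> 0 \<Longrightarrow>
      \<exists>D. (?p has_field_derivative D) (at u) \<and> \<bar>D\<bar> \<le> C / (1 + u) ^ ?d"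
    using profile_bounds[of A "CARD('n)"] by blast
  have lip: "\<bar>?p v - ?p w\<bar> \<le> C * 2 ^ ?d / (1 + u) ^ ?d * (w - v)"
    if "0 \<le> v" "v \<le> w" "u \<ge> 0" "u \<le> v + 1" for u v w
  proof (cases "v = w")
    case False
    then have vw: "v < w" using that by simp
    define D where "D \<xi> = (SOME D. (?p has_field_derivative D) (at \<xi>) \<and> \<bar>D\<bar> \<le> C / (1 + \<xi>) ^ ?d)" for \<xi>
    have D: "(?p has_field_derivative D \<xi>) (at \<xi>) \<and> \<bar>D \<xi>\<bar> \<le> C / (1 + \<xi>) ^ ?d" if "\<xi> \<ge> 0" for \<xi>
      unfolding D_def by (rule someI_ex) (rule C(2)[OF that])
    have "\<exists>\<xi>. v < \<xi> \<and> \<xi> < w \<and> ?p w - ?p v = (w - v) * D \<xi>"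
      by (rule MVT2[OF vw]) (use D that in auto)
    then obtain \<xi> where \<xi>: "v < \<xi>" "\<xi> < w" "?p w - ?p v = (w - v) * D \<xi>"
      by blast
    \<comment> \<open>The hypothesis u \<le> v + 1 gives 1 + u \<le> 2 (1 + \<xi>). It is stated in
      this form because u is the smaller or the larger end of the interval, depending on the
      case.\<close>
    have "(1 + u) ^ ?d \<le> (2 * (1 + \<xi>)) ^ ?d" using \<xi> that by (intro power_mono) auto
    then have "(1 + u) ^ ?d \<le> 2 ^ ?d * (1 + \<xi>) ^ ?d" by (simp only: power_mult_distrib)
    moreover have "C / Y \<le> C * q / X" if "X \<le> q * Y" "X > 0" "Y > 0" for X Y q :: real
      using that C(1) by (simp add: field_simps)
    moreover have "(1 + u) ^ ?d > 0" "(1 + \<xi>) ^ ?d > 0" using \<xi> that by (auto intro!: zero_less_power)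
    ultimately have "C / (1 + \<xi>) ^ ?d \<le> C * 2 ^ ?d / (1 + u) ^ ?d" by blast
    then have "\<bar>D \<xi>\<bar> \<le> C * 2 ^ ?d / (1 + u) ^ ?d" using D[of \<xi>] \<xi> that by linarith
    moreover have "\<bar>?p v - ?p w\<bar> = \<bar>D \<xi>\<bar> * (w - v)"
      using \<xi>(3) vw by (subst abs_minus_commute) (simp add: abs_mult)
    ultimately show ?thesis using vw by (metis diff_ge_0_iff_ge less_imp_le mult_right_mono)
  qed simp
  have "\<bar>kernel A (r ^ gen_order A) x y - kernel A (r ^ gen_order A) x' y\<bar>
      \<le> C * 2 ^ ?d * (norm (x - x') / r) * maj r (x - y)"
    if r: "r > 0" and xx: "norm (x - x') \<le> r" for r and x x' y :: "real^'n"
  proof -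
    define u where "u = norm (x - y) / r"
    define v where "v = norm (x' - y) / r"
    have uv: "u \<ge> 0" "v \<ge> 0" using r by (auto simp: u_def v_def)
    have "\<bar>norm (x - y) - norm (x' - y)\<bar> \<le> norm (x - x')"
      using norm_triangle_ineq3[of "x - y" "x' - y"] by simp
    then have d: "\<bar>u - v\<bar> \<le> norm (x - x') / r"
      unfolding u_def v_def using r by (simp add: diff_divide_distrib[symmetric] divide_right_mono)
    then have d1: "\<bar>u - v\<bar> \<le> 1" using xx r by (smt (verit) divide_le_eq_1_pos)
    have "\<bar>?p u - ?p v\<bar> \<le> C * 2 ^ ?d / (1 + u) ^ ?d * \<bar>u - v\<bar>"
    proof (cases "u \<le> v")
      case True
      then show ?thesis using lip[of u v u] uv by simp
    next
      case False
      then show ?thesis using lip[of v u u] uv d1 by (simp add: abs_minus_commute)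
    qed
    also have "\<dots> \<le> C * 2 ^ ?d / (1 + u) ^ ?d * (norm (x - x') / r)"
      using d C(1) uv by (intro mult_left_mono) auto
    finally have "\<bar>?p u - ?p v\<bar> / r ^ CARD('n) \<le> C * 2 ^ ?d / (1 + u) ^ ?d * (norm (x - x') / r) / r ^ CARD('n)"
      using r by (intro divide_right_mono) auto
    moreover have "\<bar>kernel A (r ^ gen_order A) x y - kernel A (r ^ gen_order A) x' y\<bar> = \<bar>?p u - ?p v\<bar> / r ^ CARD('n)"
      unfolding kernel_eq_profile[OF r] u_def v_def diff_divide_distrib[symmetric] using r by (simp add: abs_divide)
    ultimately show ?thesis
      unfolding maj_eq_scaled[OF r] u_def[symmetric] by (simp add: mult_ac)
  qed
  then show ?thesis using C(1) by (intro exI[of _ "C * 2 ^ ?d"]) auto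
qed

section \<open>The semigroups on their domains\<close>

fun dom_weight :: "generator \<Rightarrow> real^'n \<Rightarrow> real" where
  "dom_weight Sqrt_Laplacian x = inverse (1 + norm x ^ (CARD('n) + 1))"
| "dom_weight Laplacian x = exp (- norm x)"

lemma dom_weight_pos: "0 < dom_weight A x"
  by (cases A) (auto intro!: positive_imp_inverse_positive add_pos_nonneg simp del: power_Suc)

lemma borel_measurable_dom_weight [measurable]: "dom_weight A \<in> borel_measurable (borel :: (real^'n) measure)"
proof -
  have "dom_weight Sqrt_Laplacian = (\<lambda>x::real^'n. inverse (1 + norm x ^ (CARD('n) + 1)))"
       "dom_weight Laplacian = (\<lambda>x::real^'n. exp (- norm x))" by auto
  then show ?thesis by (cases A) simp_all
qed

lemma one_plus_power_le:
  fixes u :: real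
  assumes "u \<ge> 0"
  shows "(1 + u) ^ k \<le> 2 ^ k * (1 + u ^ k)"
proof (cases "u \<le> 1")
  case True
  have "(1 + u) ^ k \<le> 2 ^ k" using assms True by (intro power_mono) auto
  also have "\<dots> \<le> 2 ^ k * (1 + u ^ k)" using assms by simp
  finally show ?thesis .
next
  case False
  have "(1 + u) ^ k \<le> (2 * u) ^ k" using assms False by (intro power_mono) auto
  also have "\<dots> = 2 ^ k * u ^ k" by (rule power_mult_distrib)
  also have "\<dots> \<le> 2 ^ k * (1 + u ^ k)" by (intro mult_left_mono) auto
  finally show ?thesis .
qed

lemma one_plus_power_ge:
  fixes u :: real
  assumes "u \<ge> 0"
  shows "1 + u ^ Suc k \<le> (1 + u) ^ Suc k"
proof (induction k)
  case (Suc k)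
  have "1 + u ^ Suc (Suc k) \<le> (1 + u) * (1 + u ^ Suc k)" using assms by (simp add: algebra_simps)
  also have "\<dots> \<le> (1 + u) * (1 + u) ^ Suc k" using Suc assms by (intro mult_left_mono) auto
  finally show ?case by simp
qed simp

lemma borel_measurable_maj_mult_norm:
  fixes f :: "real^'n \<Rightarrow> complex"
  assumes "f \<in> borel_measurable lebesgue"
  shows "(\<lambda>y. ennreal (maj r (x - y)) * ennreal (norm (f y))) \<in> borel_measurable lebesgue"
proof -
  have "(\<lambda>y. norm (f y)) \<in> borel_measurable lebesgue" using assms by measurable
  then show ?thesis
    by (intro borel_measurable_times_ennreal measurable_compose[OF _ measurable_ennreal]
      borel_measurable_maj borel_measurable_diff borel_measurable_const measurable_ident_lebesgue)
qed

lemma borel_measurable_of_dom_weight: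
  fixes f :: "real^'n \<Rightarrow> complex"
  assumes "integrable lebesgue (\<lambda>x. dom_weight A x *\<^sub>R f x)"
  shows "f \<in> borel_measurable lebesgue"
proof -
  have "(\<lambda>x. inverse (dom_weight A x) *\<^sub>R (dom_weight A x *\<^sub>R f x)) \<in> borel_measurable lebesgue"
    by (rule borel_measurable_scaleR[OF borel_measurable_inverse
          [OF measurable_lebesgue_compose[OF borel_measurable_dom_weight]] borel_measurable_integrable[OF assms]])
  moreover have "inverse (dom_weight A x) *\<^sub>R (dom_weight A x *\<^sub>R f x) = f x" for x
    using dom_weight_pos[of A x] by simp
  ultimately show ?thesis by simp
qed

text \<open>Makes the majorant a common test for both domains: a measurable function with a finite
  integral against one majorant lies in each of them. The heat weight is treated by comparing the
  exponential with a power.\<close>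

lemma dom_weight_le_maj:
  fixes x :: "real^'n"
  assumes "r > 0"
  shows "\<exists>C>0. \<forall>y. dom_weight A y \<le> C * maj r (x - y)"
proof -
  let ?d = "CARD('n) + 1"
  obtain C1 where C1: "C1 > 0" "\<And>y. maj 1 (0 - y) \<le> C1 * maj r (x - y)"
    using maj_comparable[of 1 r 0 x] assms by auto
  have "\<exists>C>0. \<forall>y::real^'n. dom_weight A y \<le> C * maj 1 (0 - y)"
  proof (cases A)
    case Sqrt_Laplacian
    have "dom_weight A y \<le> 2 ^ ?d * maj 1 (0 - y)" for y :: "real^'n"
    proof -
      have "(1 + norm y) ^ ?d \<le> 2 ^ ?d * (1 + norm y ^ ?d)" by (rule one_plus_power_le) simp
      moreover have "inverse B \<le> c * (1 / A)" if "A \<le> c * B" "A > 0" "B > 0" for A B c :: real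
        using that by (simp add: field_simps)
      moreover have "0 < (1 + norm y) ^ ?d" by (intro add_norm_power_pos) simp
      moreover have "0 < 1 + norm y ^ ?d" by (intro add_pos_nonneg zero_le_power) auto
      ultimately have "inverse (1 + norm y ^ ?d) \<le> 2 ^ ?d * (1 / (1 + norm y) ^ ?d)" by blast
      then show ?thesis unfolding Sqrt_Laplacian by (simp only: dom_weight.simps maj_def diff_0 norm_minus_cancel)
    qed
    then show ?thesis by (intro exI[of _ "2 ^ ?d"]) auto
  next
    case Laplacian
    have e: "exp (- u) \<le> (real ?d) ^ ?d * exp 1 * (1 / (1 + u) ^ ?d)" if "u \<ge> 0" for u :: real
    proof -
      have "(1 + u) / real ?d \<le> exp ((1 + u) / real ?d)"
        using exp_ge_add_one_self[of "(1 + u) / real ?d"] by linarith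
      then have "((1 + u) / real ?d) ^ ?d \<le> exp ((1 + u) / real ?d) ^ ?d" using that by (intro power_mono) auto
      also have "\<dots> = exp (1 + u)" by (subst exp_of_nat_mult[symmetric]) simp
      finally have "(1 + u) ^ ?d / real ?d ^ ?d \<le> exp (1 + u)" unfolding power_divide .
      moreover have "inverse E \<le> D * e1 * (1 / P)" if "P / D \<le> e1 * E" "D > 0" "P > 0" "E > 0" for P D e1 E :: real
        using that by (simp add: field_simps)
      moreover have "real ?d ^ ?d > 0" "(1 + u) ^ ?d > 0" using that by (intro zero_less_power; simp)+
      ultimately show ?thesis unfolding exp_minus exp_add by (metis exp_gt_zero)
    qed
    have "dom_weight A y \<le> ((real ?d) ^ ?d * exp 1) * maj 1 (0 - y)" for y :: "real^'n"
      using e[of "norm y"] unfolding Laplacian by (simp only: dom_weight.simps maj_def diff_0 norm_minus_cancel norm_ge_zero)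
    moreover have "(real ?d) ^ ?d * exp 1 > 0" by (intro mult_pos_pos zero_less_power) auto
    ultimately show ?thesis by blast
  qed
  then obtain C2 where C2: "C2 > 0" "\<And>y::real^'n. dom_weight A y \<le> C2 * maj 1 (0 - y)" by blast
  have "dom_weight A y \<le> C2 * C1 * maj r (x - y)" for y
  proof -
    have "dom_weight A y \<le> C2 * maj 1 (0 - y)" by (rule C2)
    also have "\<dots> \<le> C2 * (C1 * maj r (x - y))" using C2(1) by (intro mult_left_mono C1) auto
    finally show ?thesis by (simp only: mult.assoc)
  qed
  then show ?thesis using C1(1) C2(1) by (intro exI[of _ "C2 * C1"]) auto
qed

text \<open>Ensures that the integral defining A_t f converges at every point for f in the domain.
  The constant may depend on t and x.\<close>

lemma kernel_le_dom_weight: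
  fixes x :: "real^'n"
  assumes t: "t > 0"
  shows "\<exists>C>0. \<forall>y. kernel A t x y \<le> C * dom_weight A y"
proof (cases A)
  case Sqrt_Laplacian
  let ?d = "CARD('n) + 1"
  obtain C1 where C1: "C1 > 0" "\<And>y. poisson t x y \<le> C1 * maj t (x - y)"
    using kernel_le_maj[of Sqrt_Laplacian, where 'n = 'n] t by fastforce
  obtain C2 where C2: "C2 > 0" "\<And>y. maj t (x - y) \<le> C2 * maj 1 (0 - y)"
    using maj_comparable[of t 1 x 0] t by auto
  have C3: "maj 1 (0 - y) \<le> dom_weight A y" for y :: "real^'n"
  proof -
    have "1 + norm y ^ ?d \<le> (1 + norm y) ^ ?d"
      using one_plus_power_ge[of "norm y" "CARD('n)"] by simp
    then have "1 / (1 + norm y) ^ ?d \<le> inverse (1 + norm y ^ ?d)"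
      unfolding inverse_eq_divide by (intro divide_left_mono mult_pos_pos add_norm_power_pos add_pos_nonneg zero_le_power) auto
    then show ?thesis unfolding Sqrt_Laplacian by (simp only: dom_weight.simps maj_def diff_0 norm_minus_cancel)
  qed
  have "kernel A t x y \<le> C1 * C2 * dom_weight A y" for y
  proof -
    have "kernel A t x y \<le> C1 * maj t (x - y)" unfolding Sqrt_Laplacian by (rule C1)
    also have "\<dots> \<le> C1 * (C2 * maj 1 (0 - y))" using C1 C2 by (intro mult_left_mono) auto
    also have "\<dots> \<le> C1 * (C2 * dom_weight A y)" using C1 C2 C3 by (intro mult_left_mono) auto
    finally show ?thesis by simp
  qed
  then show ?thesis using C1 C2 by (intro exI[of _ "C1 * C2"]) auto
next
  case Laplacian
  define c where "c = (4 * pi * t) powr (- real CARD('n) / 2)"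
  have c: "c > 0" using t by (simp add: c_def)
  have "kernel A t x y \<le> c * exp (norm x + t) * dom_weight A y" for y
  proof -
    let ?u = "norm (x - y)"
    \<comment> \<open>Expanding the square bounds the Gaussian exponent by t - |x - y|, a linear
      expression that can be compared with the weight exp(- |y|).\<close>
    have "0 \<le> (?u - 2 * t)\<^sup>2" by simp
    then have "?u * (4 * t) \<le> ?u\<^sup>2 + t * (4 * t)" by (simp add: power2_eq_square algebra_simps)
    then have "?u \<le> (?u\<^sup>2 + t * (4 * t)) / (4 * t)" using t by (subst pos_le_divide_eq) auto
    then have "- ?u\<^sup>2 / (4 * t) \<le> t - ?u" using t by (simp add: add_divide_distrib)
    moreover have "norm y \<le> norm x + ?u" using norm_triangle_ineq4[of x "x - y"] by simp
    ultimately have "- ?u\<^sup>2 / (4 * t) \<le> (norm x + t) + - norm y" by linarith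
    then have "exp (- ?u\<^sup>2 / (4 * t)) \<le> exp (norm x + t) * exp (- norm y)" unfolding exp_add[symmetric] by simp
    then have "c * exp (- ?u\<^sup>2 / (4 * t)) \<le> c * (exp (norm x + t) * exp (- norm y))" using c by simp
    then show ?thesis unfolding Laplacian kernel.simps c_def dom_weight.simps by (simp only: mult.assoc)
  qed
  then show ?thesis using c by (intro exI[of _ "c * exp (norm x + t)"]) auto
qed

text \<open>Local integrability, which the Poisson domain demands explicitly, follows from weighted
  integrability, because the weight is bounded away from 0 on compact sets. Both domains thereby get
  the same description.\<close>

lemma dom_class_iff:
  "f \<in> dom_class A \<longleftrightarrow> integrable lebesgue (\<lambda>x. dom_weight A x *\<^sub>R f x)"
proof -
  have "locally_integrable f" if int: "integrable lebesgue (\<lambda>x. dom_weight A x *\<^sub>R f x)"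
  proof -
    have fm: "f \<in> borel_measurable lebesgue" using int by (rule borel_measurable_of_dom_weight)
    have "set_integrable lebesgue S f" if S: "compact S" for S
    proof -
      obtain B where B: "\<And>x. x \<in> S \<Longrightarrow> norm x \<le> B" "B > 0"
        using compact_imp_bounded[OF S] bounded_pos by metis
      have "\<exists>c>0. \<forall>x\<in>S. c \<le> dom_weight A x"
      proof (cases A)
        case Sqrt_Laplacian
        have "inverse (1 + B ^ (CARD('a) + 1)) \<le> dom_weight A x" if "x \<in> S" for x
          unfolding Sqrt_Laplacian dom_weight.simps using B that
          by (intro le_imp_inverse_le add_left_mono power_mono add_pos_nonneg zero_le_power) auto
        moreover have "inverse (1 + B ^ (CARD('a) + 1)) > 0"
          using B by (intro positive_imp_inverse_positive add_pos_nonneg zero_le_power) auto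
        ultimately show ?thesis by blast
      next
        case Laplacian
        have "exp (- B) \<le> dom_weight A x" if "x \<in> S" for x
          unfolding Laplacian using B that by simp
        then show ?thesis by (intro exI[of _ "exp (- B)"]) auto
      qed
      then obtain c where c: "c > 0" "\<And>x. x \<in> S \<Longrightarrow> c \<le> dom_weight A x" by blast
      have Sm: "S \<in> sets lebesgue" using S by (intro sets_completionI_sets) (auto dest: compact_imp_closed)
      show ?thesis unfolding set_integrable_def
      proof (rule Bochner_Integration.integrable_bound)
        show "integrable lebesgue (\<lambda>x. (1 / c) *\<^sub>R (dom_weight A x *\<^sub>R f x))"
          using int by (rule integrable_scaleR_right)
        show "(\<lambda>x. indicat_real S x *\<^sub>R f x) \<in> borel_measurable lebesgue"
          using fm Sm by (intro borel_measurable_scaleR borel_measurable_indicator) auto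
        show "AE x in lebesgue. norm (indicat_real S x *\<^sub>R f x) \<le> norm ((1 / c) *\<^sub>R (dom_weight A x *\<^sub>R f x))"
        proof (rule AE_I2)
          fix x
          show "norm (indicat_real S x *\<^sub>R f x) \<le> norm ((1 / c) *\<^sub>R (dom_weight A x *\<^sub>R f x))"
          proof (cases "x \<in> S")
            case True
            have "norm (f x) * c \<le> norm (f x) * dom_weight A x" using c(2)[OF True] by (intro mult_left_mono) auto
            then show ?thesis using True c(1) dom_weight_pos[of A x] by (simp add: field_simps)
          qed simp
        qed
      qed
    qed
    then show ?thesis by (simp add: locally_integrable_def)
  qed
  then show ?thesis by (cases A) auto
qed

lemma dom_class_measurable: "f \<in> dom_class A \<Longrightarrow> f \<in> borel_measurable lebesgue"
  unfolding dom_class_iff by (rule borel_measurable_of_dom_weight)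

lemma dom_class_add: "f \<in> dom_class A \<Longrightarrow> g \<in> dom_class A \<Longrightarrow> (\<lambda>x. f x + g x) \<in> dom_class A"
  unfolding dom_class_iff scaleR_add_right by (rule Bochner_Integration.integrable_add)

lemma dom_class_diff: "f \<in> dom_class A \<Longrightarrow> g \<in> dom_class A \<Longrightarrow> (\<lambda>x. f x - g x) \<in> dom_class A"
  unfolding dom_class_iff scaleR_diff_right by (rule Bochner_Integration.integrable_diff)

lemma dom_class_minus: "f \<in> dom_class A \<Longrightarrow> (\<lambda>x. - f x) \<in> dom_class A"
  unfolding dom_class_iff scaleR_minus_right by (rule integrable_minus)

lemma dom_classI_maj:
  fixes f :: "real^'n \<Rightarrow> complex"
  assumes f: "f \<in> borel_measurable lebesgue" and r: "r > 0"
    and fin: "(\<integral>\<^sup>+y. ennreal (maj r (x - y)) * ennreal (norm (f y)) \<partial>lebesgue) < \<infinity>"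
  shows "f \<in> dom_class A"
  unfolding dom_class_iff
proof (rule integrableI_bounded)
  show "(\<lambda>x. dom_weight A x *\<^sub>R f x) \<in> borel_measurable lebesgue"
    using f measurable_lebesgue_compose[OF borel_measurable_dom_weight, of A] by (intro borel_measurable_scaleR) auto
  obtain C where C: "C > 0" "\<And>y. dom_weight A y \<le> C * maj r (x - y)"
    using dom_weight_le_maj[OF r, of A x] by blast
  have "(\<integral>\<^sup>+y. ennreal (norm (dom_weight A y *\<^sub>R f y)) \<partial>lebesgue)
    \<le> (\<integral>\<^sup>+y. ennreal C * (ennreal (maj r (x - y)) * ennreal (norm (f y))) \<partial>lebesgue)"
  proof (rule nn_integral_mono)
    fix y
    have m: "0 \<le> maj r (x - y)" using maj_pos[OF r, of "x - y"] by simp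
    have "norm (dom_weight A y *\<^sub>R f y) = dom_weight A y * norm (f y)"
      using dom_weight_pos[of A y] by simp
    also have "\<dots> \<le> C * maj r (x - y) * norm (f y)" using C by (intro mult_right_mono) auto
    finally have "ennreal (norm (dom_weight A y *\<^sub>R f y)) \<le> ennreal (C * (maj r (x - y) * norm (f y)))"
      by (intro ennreal_leI) (simp add: mult.assoc)
    also have "\<dots> = ennreal C * (ennreal (maj r (x - y)) * ennreal (norm (f y)))"
      using C m by (simp add: ennreal_mult)
    finally show "ennreal (norm (dom_weight A y *\<^sub>R f y)) \<le> \<dots>" .
  qed
  also have "\<dots> = ennreal C * (\<integral>\<^sup>+y. ennreal (maj r (x - y)) * ennreal (norm (f y)) \<partial>lebesgue)"
    by (intro nn_integral_cmult borel_measurable_maj_mult_norm f)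
  also have "\<dots> < \<infinity>" using fin by (simp add: ennreal_mult_less_top)
  finally show "(\<integral>\<^sup>+y. ennreal (norm (dom_weight A y *\<^sub>R f y)) \<partial>lebesgue) < \<infinity>" .
qed

lemma dom_class_const: "(\<lambda>_. c) \<in> dom_class A"
proof (rule dom_classI_maj[where r = 1 and x = 0])
  obtain C where C: "C > 0" "\<And>r x. r > 0 \<Longrightarrow> (\<integral>\<^sup>+y. ennreal (maj r (x - y :: real^'a)) \<partial>lebesgue) \<le> ennreal C"
    using nn_integral_maj_bounded by blast
  have "(\<integral>\<^sup>+y. ennreal (maj 1 (0 - y :: real^'a)) * ennreal (norm c) \<partial>lebesgue)
     = (\<integral>\<^sup>+y. ennreal (maj 1 (0 - y :: real^'a)) \<partial>lebesgue) * ennreal (norm c)"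
    by (intro nn_integral_multc measurable_compose[OF _ measurable_ennreal]
        measurable_lebesgue_compose borel_measurable_maj) auto
  also have "\<dots> < \<infinity>" using C(2)[of 1 0] by (auto simp: ennreal_mult_less_top intro: le_less_trans)
  finally show "(\<integral>\<^sup>+y. ennreal (maj 1 (0 - y :: real^'a)) * ennreal (norm c) \<partial>lebesgue) < \<infinity>" .
qed auto

lemma borel_measurable_kernel_lebesgue:
  "(\<lambda>y. kernel A t x y) \<in> borel_measurable lebesgue" "(\<lambda>y. kernel A t y x) \<in> borel_measurable lebesgue"
  by (rule measurable_lebesgue_compose, measurable)+

lemma integrable_kernel:
  assumes f: "f \<in> dom_class A" and t: "t > 0"
  shows "integrable lebesgue (\<lambda>y. kernel A t x y *\<^sub>R f y)"
proof -
  obtain C where C: "C > 0" "\<And>y. kernel A t x y \<le> C * dom_weight A y"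
    using kernel_le_dom_weight[OF t, of A x] by blast
  have int: "integrable lebesgue (\<lambda>y. C *\<^sub>R (dom_weight A y *\<^sub>R f y))"
    using f unfolding dom_class_iff by (rule integrable_scaleR_right)
  show ?thesis
  proof (rule Bochner_Integration.integrable_bound[OF int])
    show "(\<lambda>y. kernel A t x y *\<^sub>R f y) \<in> borel_measurable lebesgue"
      using dom_class_measurable[OF f] by (intro borel_measurable_scaleR borel_measurable_kernel_lebesgue)
    show "AE y in lebesgue. norm (kernel A t x y *\<^sub>R f y) \<le> norm (C *\<^sub>R (dom_weight A y *\<^sub>R f y))"
    proof (rule AE_I2)
      fix y
      have "kernel A t x y * norm (f y) \<le> C * dom_weight A y * norm (f y)" using C by (intro mult_right_mono) auto
      then show "norm (kernel A t x y *\<^sub>R f y) \<le> norm (C *\<^sub>R (dom_weight A y *\<^sub>R f y))"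
        using C(1) dom_weight_pos[of A y] kernel_nonneg[OF t, of A x y] by (simp add: mult.assoc)
    qed
  qed
qed

lemma has_bochner_integral_kernel:
  assumes "t > 0"
  shows "has_bochner_integral lebesgue (\<lambda>y. kernel A t x y) 1"
  using nn_integral_kernel[OF assms, of A x] kernel_nonneg[OF assms]
  by (intro has_bochner_integral_nn_integral borel_measurable_kernel_lebesgue) auto

lemma semigroup_op_const:
  assumes "t > 0"
  shows "semigroup_op A t (\<lambda>_. c) x = c"
  using has_bochner_integral_kernel[OF assms, of A x]
  unfolding semigroup_op_def has_bochner_integral_iff by simp

lemma semigroup_op_add:
  "f \<in> dom_class A \<Longrightarrow> g \<in> dom_class A \<Longrightarrow> t > 0 \<Longrightarrow>
    semigroup_op A t (\<lambda>x. f x + g x) x = semigroup_op A t f x + semigroup_op A t g x"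
  unfolding semigroup_op_def scaleR_add_right
  by (intro Bochner_Integration.integral_add integrable_kernel)

lemma semigroup_op_diff:
  "f \<in> dom_class A \<Longrightarrow> g \<in> dom_class A \<Longrightarrow> t > 0 \<Longrightarrow>
    semigroup_op A t (\<lambda>x. f x - g x) x = semigroup_op A t f x - semigroup_op A t g x"
  unfolding semigroup_op_def scaleR_diff_right
  by (intro Bochner_Integration.integral_diff integrable_kernel)

lemma semigroup_op_minus: "semigroup_op A t (\<lambda>x. - f x) x = - semigroup_op A t f x"
  unfolding semigroup_op_def by simp

text \<open>Holds for every measurable f: if the Bochner integral diverges, the left side is 0 by
  the default value.\<close>

lemma norm_semigroup_op_le:
  assumes "t > 0" and f: "f \<in> borel_measurable lebesgue"
  shows "ennreal (norm (semigroup_op A t f x)) \<le> (\<integral>\<^sup>+y. ennreal (kernel A t x y) * ennreal (norm (f y)) \<partial>lebesgue)"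
proof (cases "integrable lebesgue (\<lambda>y. kernel A t x y *\<^sub>R f y)")
  case True
  have "ennreal (norm (semigroup_op A t f x)) \<le> (\<integral>\<^sup>+y. ennreal (norm (kernel A t x y *\<^sub>R f y)) \<partial>lebesgue)"
    unfolding semigroup_op_def using True by (rule integral_norm_bound_ennreal)
  also have "\<dots> = (\<integral>\<^sup>+y. ennreal (kernel A t x y) * ennreal (norm (f y)) \<partial>lebesgue)"
    by (intro nn_integral_cong) (simp add: ennreal_mult kernel_nonneg[OF assms(1)] del: kernel.simps)
  finally show ?thesis .
next
  case False
  then show ?thesis unfolding semigroup_op_def by (simp add: not_integrable_integral_eq)
qed

lemma borel_measurable_semigroup_op:
  assumes f: "f \<in> borel_measurable lebesgue"
  shows "semigroup_op A t f \<in> borel_measurable borel"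
proof -
  have "(\<lambda>p. kernel A t (fst p) (snd p) *\<^sub>R f (snd p)) \<in> borel_measurable (lborel \<Otimes>\<^sub>M lebesgue)"
    by (intro borel_measurable_scaleR borel_measurable_kernel borel_measurable_const measurable_snd_lebesgue_borel
        measurable_compose[OF measurable_snd f] measurable_compose[OF measurable_fst]) auto
  then have "(\<lambda>x. LINT y|lebesgue. kernel A t x y *\<^sub>R f y) \<in> borel_measurable lborel"
    by (intro lebesgue.borel_measurable_lebesgue_integral) (simp add: case_prod_unfold)
  then show ?thesis unfolding semigroup_op_def by simp
qed

text \<open>Fubini. Joint integrability is checked by integrating the norm in y, which yields the
  kernel at time s + t, whose product with f is integrable by the domain condition. The first claim
  gives the convergence of the outer integral without asking whether A_t f lies in the
  domain.\<close>

lemma semigroup_op_semigroup_op: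
  fixes f :: "real^'n \<Rightarrow> complex"
  assumes f: "f \<in> dom_class A" and s: "s > 0" and t: "t > 0"
  shows "integrable lebesgue (\<lambda>y. kernel A s x y *\<^sub>R semigroup_op A t f y)"
    and "semigroup_op A s (semigroup_op A t f) x = semigroup_op A (s + t) f x"
proof -
  let ?F = "\<lambda>y z. (kernel A s x y * kernel A t y z) *\<^sub>R f z"
  have fm: "f \<in> borel_measurable lebesgue" by (rule dom_class_measurable[OF f])
  have meas: "case_prod ?F \<in> borel_measurable (lebesgue \<Otimes>\<^sub>M lebesgue)"
    unfolding case_prod_unfold
    by (intro borel_measurable_scaleR borel_measurable_times borel_measurable_kernel borel_measurable_const
        measurable_snd_lebesgue_borel measurable_fst_lebesgue_borel measurable_compose[OF measurable_snd fm])
  have kk: "(\<integral>\<^sup>+y. ennreal (kernel A s x y * kernel A t y z) \<partial>lebesgue) = ennreal (kernel A (s + t) x z)" for z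
    unfolding nn_integral_kernel_mult_kernel[OF s t, of A x z, symmetric]
    by (intro nn_integral_cong ennreal_mult kernel_nonneg s t)
  have "(\<integral>\<^sup>+p. ennreal (norm (case_prod ?F p)) \<partial>(lebesgue \<Otimes>\<^sub>M lebesgue))
    = (\<integral>\<^sup>+z. (\<integral>\<^sup>+y. ennreal (norm (?F y z)) \<partial>lebesgue) \<partial>lebesgue)"
    using lebesgue_pair.nn_integral_snd[of "\<lambda>p. ennreal (norm (case_prod ?F p))"] meas by simp
  also have "\<dots> = (\<integral>\<^sup>+z. ennreal (norm (kernel A (s + t) x z *\<^sub>R f z)) \<partial>lebesgue)"
  proof (rule nn_integral_cong)
    fix z
    have "(\<integral>\<^sup>+y. ennreal (norm (?F y z)) \<partial>lebesgue)
      = (\<integral>\<^sup>+y. ennreal (kernel A s x y * kernel A t y z) * ennreal (norm (f z)) \<partial>lebesgue)"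
      by (intro nn_integral_cong) (simp add: ennreal_mult' kernel_nonneg[OF s] kernel_nonneg[OF t] del: kernel.simps)
    also have "\<dots> = (\<integral>\<^sup>+y. ennreal (kernel A s x y * kernel A t y z) \<partial>lebesgue) * ennreal (norm (f z))"
      by (intro nn_integral_multc measurable_compose[OF _ measurable_ennreal] borel_measurable_times borel_measurable_kernel_lebesgue)
    also have "\<dots> = ennreal (norm (kernel A (s + t) x z *\<^sub>R f z))"
      unfolding kk using s t by (simp add: ennreal_mult kernel_nonneg del: kernel.simps)
    finally show "(\<integral>\<^sup>+y. ennreal (norm (?F y z)) \<partial>lebesgue) = \<dots>" .
  qed
  also have "\<dots> < \<infinity>"
    using integrable_kernel[OF f, of "s + t" x] s t by (simp add: integrable_iff_bounded)
  finally have int: "integrable (lebesgue \<Otimes>\<^sub>M lebesgue) (case_prod ?F)"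
    by (intro integrableI_bounded meas)
  have inner1: "(LINT z|lebesgue. ?F y z) = kernel A s x y *\<^sub>R semigroup_op A t f y" for y
    unfolding semigroup_op_def scaleR_scaleR[symmetric] by (rule integral_scaleR_right)
  have inner2: "(LINT y|lebesgue. ?F y z) = kernel A (s + t) x z *\<^sub>R f z" for z
  proof -
    have "has_bochner_integral lebesgue (\<lambda>y. kernel A s x y * kernel A t y z) (kernel A (s + t) x z)"
      using s t kk[of z] by (intro has_bochner_integral_nn_integral borel_measurable_times borel_measurable_kernel_lebesgue
          AE_I2 mult_nonneg_nonneg kernel_nonneg add_pos_pos)
    then show ?thesis by (simp add: has_bochner_integral_iff)
  qed
  show "integrable lebesgue (\<lambda>y. kernel A s x y *\<^sub>R semigroup_op A t f y)"
    using lebesgue_pair.integrable_fst'[OF int] by (simp add: inner1)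
  show "semigroup_op A s (semigroup_op A t f) x = semigroup_op A (s + t) f x"
    using lebesgue_pair.Fubini_integral[OF int] unfolding inner1 inner2 by (simp add: semigroup_op_def)
qed

lemma semigroup_op_diff_semigroup_op:
  fixes f :: "real^'n \<Rightarrow> complex"
  assumes f: "f \<in> dom_class A" and s: "s > 0" and t: "t > 0"
  shows "semigroup_op A s (\<lambda>y. f y - semigroup_op A t f y) x = semigroup_op A s f x - semigroup_op A (s + t) f x"
proof -
  have "semigroup_op A s (\<lambda>y. f y - semigroup_op A t f y) x = semigroup_op A s f x - semigroup_op A s (semigroup_op A t f) x"
    unfolding semigroup_op_def[of A s] scaleR_diff_right
    by (intro Bochner_Integration.integral_diff integrable_kernel[OF f s] semigroup_op_semigroup_op(1)[OF assms])
  then show ?thesis by (simp only: semigroup_op_semigroup_op(2)[OF assms])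
qed

lemma norm_semigroup_op_le_maj:
  "\<exists>C>0. \<forall>r>0. \<forall>(f :: real^'n \<Rightarrow> complex) \<in> borel_measurable lebesgue. \<forall>x.
     ennreal (norm (semigroup_op A (r ^ gen_order A) f x))
     \<le> ennreal C * (\<integral>\<^sup>+y. ennreal (maj r (x - y)) * ennreal (norm (f y)) \<partial>lebesgue)"
proof -
  obtain C where C: "C > 0" "\<And>r x y::real^'n. r > 0 \<Longrightarrow> kernel A (r ^ gen_order A) x y \<le> C * maj r (x - y)"
    using kernel_le_maj[of A, where 'n = 'n] by blast
  have "ennreal (norm (semigroup_op A (r ^ gen_order A) f x))
     \<le> ennreal C * (\<integral>\<^sup>+y. ennreal (maj r (x - y)) * ennreal (norm (f y)) \<partial>lebesgue)"
    if r: "r > 0" and f: "f \<in> borel_measurable lebesgue" for r x and f :: "real^'n \<Rightarrow> complex"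
  proof -
    have "ennreal (norm (semigroup_op A (r ^ gen_order A) f x))
      \<le> (\<integral>\<^sup>+y. ennreal (kernel A (r ^ gen_order A) x y) * ennreal (norm (f y)) \<partial>lebesgue)"
      using r f by (intro norm_semigroup_op_le) auto
    also have "\<dots> \<le> (\<integral>\<^sup>+y. ennreal C * (ennreal (maj r (x - y)) * ennreal (norm (f y))) \<partial>lebesgue)"
    proof (rule nn_integral_mono)
      fix y
      have "ennreal (kernel A (r ^ gen_order A) x y) \<le> ennreal C * ennreal (maj r (x - y))"
        using C r maj_pos[OF r, of "x - y"] by (subst ennreal_mult[symmetric]) (auto intro!: ennreal_leI)
      then have "ennreal (kernel A (r ^ gen_order A) x y) * ennreal (norm (f y)) \<le> ennreal C * ennreal (maj r (x - y)) * ennreal (norm (f y))"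
        by (rule mult_right_mono) simp
      then show "ennreal (kernel A (r ^ gen_order A) x y) * ennreal (norm (f y)) \<le> ennreal C * (ennreal (maj r (x - y)) * ennreal (norm (f y)))"
        by (simp only: mult.assoc)
    qed
    also have "\<dots> = ennreal C * (\<integral>\<^sup>+y. ennreal (maj r (x - y)) * ennreal (norm (f y)) \<partial>lebesgue)"
      by (intro nn_integral_cmult borel_measurable_maj_mult_norm f)
    finally show ?thesis .
  qed
  then show ?thesis using C(1) by blast
qed

lemma semigroup_op_Lipschitz:
  "\<exists>C>0. \<forall>r>0. \<forall>(f :: real^'n \<Rightarrow> complex) \<in> dom_class A. \<forall>x x'. norm (x - x') \<le> r \<longrightarrow>
     ennreal (norm (semigroup_op A (r ^ gen_order A) f x - semigroup_op A (r ^ gen_order A) f x'))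
     \<le> ennreal (C * (norm (x - x') / r)) * (\<integral>\<^sup>+y. ennreal (maj r (x - y)) * ennreal (norm (f y)) \<partial>lebesgue)"
proof -
  obtain C where C: "C > 0" "\<And>r x x' y::real^'n. r > 0 \<Longrightarrow> norm (x - x') \<le> r \<Longrightarrow>
     \<bar>kernel A (r ^ gen_order A) x y - kernel A (r ^ gen_order A) x' y\<bar> \<le> C * (norm (x - x') / r) * maj r (x - y)"
    using kernel_Lipschitz[of A, where 'n = 'n] by blast
  have "ennreal (norm (semigroup_op A (r ^ gen_order A) f x - semigroup_op A (r ^ gen_order A) f x'))
     \<le> ennreal (C * (norm (x - x') / r)) * (\<integral>\<^sup>+y. ennreal (maj r (x - y)) * ennreal (norm (f y)) \<partial>lebesgue)"
    if r: "r > 0" and f: "f \<in> dom_class A" and xx: "norm (x - x') \<le> r" for r x x' and f :: "real^'n \<Rightarrow> complex"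
  proof -
    let ?k = "kernel A (r ^ gen_order A)" and ?L = "C * (norm (x - x') / r)"
    have L: "?L \<ge> 0" using C r by simp
    have r': "r ^ gen_order A > 0" using r by simp
    have fm: "f \<in> borel_measurable lebesgue" by (rule dom_class_measurable[OF f])
    have i: "integrable lebesgue (\<lambda>y. ?k x y *\<^sub>R f y - ?k x' y *\<^sub>R f y)"
      by (intro Bochner_Integration.integrable_diff integrable_kernel[OF f r'])
    have "semigroup_op A (r ^ gen_order A) f x - semigroup_op A (r ^ gen_order A) f x'
      = (LINT y|lebesgue. ?k x y *\<^sub>R f y - ?k x' y *\<^sub>R f y)"
      unfolding semigroup_op_def by (intro Bochner_Integration.integral_diff[symmetric] integrable_kernel[OF f r'])
    then have "ennreal (norm (semigroup_op A (r ^ gen_order A) f x - semigroup_op A (r ^ gen_order A) f x'))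
      \<le> (\<integral>\<^sup>+y. ennreal (norm (?k x y *\<^sub>R f y - ?k x' y *\<^sub>R f y)) \<partial>lebesgue)"
      using integral_norm_bound_ennreal[OF i] by simp
    also have "\<dots> \<le> (\<integral>\<^sup>+y. ennreal ?L * (ennreal (maj r (x - y)) * ennreal (norm (f y))) \<partial>lebesgue)"
    proof (rule nn_integral_mono)
      fix y
      have "norm (?k x y *\<^sub>R f y - ?k x' y *\<^sub>R f y) = \<bar>?k x y - ?k x' y\<bar> * norm (f y)"
        unfolding scaleR_diff_left[symmetric] by (rule norm_scaleR)
      also have "\<dots> \<le> ?L * maj r (x - y) * norm (f y)" using C(2)[OF r xx, of y] by (rule mult_right_mono) simp
      finally have "ennreal (norm (?k x y *\<^sub>R f y - ?k x' y *\<^sub>R f y)) \<le> ennreal (?L * (maj r (x - y) * norm (f y)))"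
        by (intro ennreal_leI) (simp only: mult.assoc)
      also have "\<dots> = ennreal ?L * (ennreal (maj r (x - y)) * ennreal (norm (f y)))"
        using L maj_pos[OF r, of "x - y"] by (simp only: ennreal_mult mult_nonneg_nonneg norm_ge_zero less_imp_le)
      finally show "ennreal (norm (?k x y *\<^sub>R f y - ?k x' y *\<^sub>R f y)) \<le> \<dots>" .
    qed
    also have "\<dots> = ennreal ?L * (\<integral>\<^sup>+y. ennreal (maj r (x - y)) * ennreal (norm (f y)) \<partial>lebesgue)"
      by (intro nn_integral_cmult borel_measurable_maj_mult_norm fm)
    finally show ?thesis .
  qed
  then show ?thesis using C(1) by blast
qed

section \<open>Oscillation with respect to a gauge of balls\<close>

abbreviation nint :: "(real^'n) set \<Rightarrow> (real^'n \<Rightarrow> complex) \<Rightarrow> ennreal" where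
  "nint S p \<equiv> (\<integral>\<^sup>+x\<in>S. ennreal (norm (p x)) \<partial>lebesgue)"

abbreviation mint :: "real \<Rightarrow> real^'n \<Rightarrow> (real^'n \<Rightarrow> complex) \<Rightarrow> ennreal" where
  "mint r x p \<equiv> (\<integral>\<^sup>+y. ennreal (maj r (x - y)) * ennreal (norm (p y)) \<partial>lebesgue)"

lemma nint_triangle:
  fixes p q s :: "real^'n \<Rightarrow> complex"
  assumes [measurable]: "S \<in> sets lebesgue" "p \<in> borel_measurable lebesgue" "q \<in> borel_measurable lebesgue"
    "s \<in> borel_measurable lebesgue"
  shows "nint S (\<lambda>x. p x - s x) \<le> nint S (\<lambda>x. p x - q x) + nint S (\<lambda>x. q x - s x)"
proof -
  have "nint S (\<lambda>x. p x - s x) \<le> (\<integral>\<^sup>+x. ennreal (norm (p x - q x)) * indicator S x + ennreal (norm (q x - s x)) * indicator S x \<partial>lebesgue)"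
  proof (rule nn_integral_mono)
    fix x
    have "norm (p x - s x) \<le> norm (p x - q x) + norm (q x - s x)"
      using norm_triangle_ineq[of "p x - q x" "q x - s x"] by simp
    then have "ennreal (norm (p x - s x)) \<le> ennreal (norm (p x - q x)) + ennreal (norm (q x - s x))"
      by (simp flip: ennreal_plus)
    then show "ennreal (norm (p x - s x)) * indicator S x
      \<le> ennreal (norm (p x - q x)) * indicator S x + ennreal (norm (q x - s x)) * indicator S x"
      by (simp add: indicator_def)
  qed
  also have "\<dots> = nint S (\<lambda>x. p x - q x) + nint S (\<lambda>x. q x - s x)"
    by (rule nn_integral_add) measurable
  finally show ?thesis .
qed

lemma nint_ball_le:
  fixes p :: "real^'n \<Rightarrow> complex"
  assumes "r > 0" "0 \<le> b" "\<And>x. x \<in> ball c r \<Longrightarrow> norm (p x) \<le> b"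
  shows "nint (ball c r) p \<le> ennreal (b * (unit_ball_vol (real CARD('n)) * r ^ CARD('n)))"
proof -
  have "nint (ball c r) p \<le> (\<integral>\<^sup>+x. ennreal b * indicator (ball c r) x \<partial>lebesgue)"
    using assms by (intro nn_integral_mono) (auto simp: indicator_def intro!: ennreal_leI)
  also have "\<dots> = ennreal b * emeasure lebesgue (ball c r)"
    by (rule nn_integral_cmult_indicator) simp
  also have "\<dots> = ennreal (b * (unit_ball_vol (real CARD('n)) * r ^ CARD('n)))"
    using assms by (subst emeasure_lebesgue_ball) (auto simp: ennreal_mult)
  finally show ?thesis .
qed

lemma nint_mono_set: "S \<subseteq> T \<Longrightarrow> nint S p \<le> nint T p"
  by (intro nn_integral_mono) (auto simp: indicator_def)

lemma set_integrable_ball_iff: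
  fixes p :: "real^'n \<Rightarrow> complex"
  assumes p: "p \<in> borel_measurable lebesgue"
  shows "set_integrable lebesgue (ball c r) p \<longleftrightarrow> nint (ball c r) p < \<infinity>"
proof -
  have "(\<lambda>x. indicat_real (ball c r) x *\<^sub>R p x) \<in> borel_measurable lebesgue"
    using p by (intro borel_measurable_scaleR borel_measurable_indicator) auto
  moreover have "(\<integral>\<^sup>+x. ennreal (norm (indicat_real (ball c r) x *\<^sub>R p x)) \<partial>lebesgue) = nint (ball c r) p"
    by (intro nn_integral_cong) (auto simp: indicator_def)
  ultimately show ?thesis unfolding set_integrable_def integrable_iff_bounded by simp
qed

lemma locally_integrable_measurable:
  fixes f :: "real^'n \<Rightarrow> complex"
  assumes "locally_integrable f"
  shows "f \<in> borel_measurable lebesgue"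
proof (rule borel_measurable_LIMSEQ_metric)
  fix i :: nat
  have "set_integrable lebesgue (cball 0 (real i)) f"
    using assms by (simp add: locally_integrable_def)
  then show "(\<lambda>x. indicat_real (cball 0 (real i)) x *\<^sub>R f x) \<in> borel_measurable lebesgue"
    unfolding set_integrable_def by (rule borel_measurable_integrable)
next
  fix x :: "real^'n"
  obtain k :: nat where k: "norm x \<le> real k" using real_arch_simple by blast
  show "(\<lambda>i. indicat_real (cball 0 (real i)) x *\<^sub>R f x) \<longlonglongrightarrow> f x"
  proof (rule tendsto_eventually, rule eventually_sequentiallyI[of k])
    fix i assume "k \<le> i"
    then have "x \<in> cball 0 (real i)" using k by simp
    then show "indicat_real (cball 0 (real i)) x *\<^sub>R f x = f x" by simp
  qed
qed

lemma locally_integrable_iff: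
  fixes f :: "real^'n \<Rightarrow> complex"
  shows "locally_integrable f \<longleftrightarrow> f \<in> borel_measurable lebesgue \<and> (\<forall>c. \<forall>r>0. nint (ball c r) f < \<infinity>)"
proof
  assume f: "locally_integrable f"
  then have fm: "f \<in> borel_measurable lebesgue" by (rule locally_integrable_measurable)
  have "set_integrable lebesgue (ball c r) f" for c r
  proof (rule set_integrable_subset)
    show "set_integrable lebesgue (cball c r) f" using f by (simp add: locally_integrable_def)
  qed auto
  then show "f \<in> borel_measurable lebesgue \<and> (\<forall>c. \<forall>r>0. nint (ball c r) f < \<infinity>)"
    using fm set_integrable_ball_iff[OF fm] by blast
next
  assume f: "f \<in> borel_measurable lebesgue \<and> (\<forall>c. \<forall>r>0. nint (ball c r) f < \<infinity>)"
  have "set_integrable lebesgue S f" if S: "compact S" for S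
  proof -
    obtain R where R: "R > 0" "\<And>x. x \<in> S \<Longrightarrow> norm x \<le> R"
      using compact_imp_bounded[OF S] bounded_pos by metis
    then have "S \<subseteq> ball 0 (R + 1)" by force
    moreover have "set_integrable lebesgue (ball 0 (R + 1)) f"
      using f R by (subst set_integrable_ball_iff) auto
    moreover have "S \<in> sets lebesgue" using S by (intro sets_completionI_sets) (auto dest: compact_imp_closed)
    ultimately show ?thesis by (rule set_integrable_subset[rotated 2])
  qed
  then show "locally_integrable f" by (simp add: locally_integrable_def)
qed

text \<open>The measure of the ball times (mean of f - a) is the integral of f - a. This compares
  the mean with any other candidate constant, in particular with the mean over a larger
  ball.\<close>

lemma norm_ball_mean_diff_le:
  fixes f :: "real^'n \<Rightarrow> complex"
  assumes f: "locally_integrable f" and r: "r > 0"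
  shows "ennreal (norm (ball_mean f c r - a) * (unit_ball_vol (real CARD('n)) * r ^ CARD('n)))
    \<le> nint (ball c r) (\<lambda>x. f x - a)"
proof -
  let ?V = "unit_ball_vol (real CARD('n)) * r ^ CARD('n)"
  have V: "?V > 0" using r by simp
  have m: "measure lebesgue (ball c r) = ?V" using r by (intro measure_lebesgue_ball) simp
  have fi: "set_integrable lebesgue (ball c r) f"
    using f r set_integrable_ball_iff[OF locally_integrable_measurable[OF f]] by (auto simp: locally_integrable_iff)
  have ai: "set_integrable lebesgue (ball c r) (\<lambda>_. a)"
  proof -
    have "nint (ball c r) (\<lambda>_. a) \<le> ennreal (norm a * ?V)" using r by (intro nint_ball_le) auto
    also have "\<dots> < \<infinity>" by simp
    finally show ?thesis by (subst set_integrable_ball_iff) auto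
  qed
  have "(LINT x:ball c r|lebesgue. a) = ?V *\<^sub>R a"
  proof -
    have i: "integrable lebesgue (indicat_real (ball c r))"
      using r by (intro integrable_real_indicator) (auto simp: emeasure_ball)
    have "(LINT x|lebesgue. indicat_real (ball c r) x *\<^sub>R a) = (LINT x|lebesgue. indicat_real (ball c r) x) *\<^sub>R a"
      using i by (intro integral_scaleR_left)
    also have "(LINT x|lebesgue. indicat_real (ball c r) x) = measure lebesgue (ball c r)"
      by simp
    finally show ?thesis unfolding set_lebesgue_integral_def m .
  qed
  then have "(LINT x:ball c r|lebesgue. f x - a) = (LINT x:ball c r|lebesgue. f x) - ?V *\<^sub>R a"
    using set_integral_diff(2)[OF fi ai] by simp
  moreover have "?V *\<^sub>R (ball_mean f c r - a) = (LINT x:ball c r|lebesgue. f x) - ?V *\<^sub>R a"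
  proof -
    have "v *\<^sub>R ((1 / v) *\<^sub>R I - a) = I - v *\<^sub>R a" if "v > 0" for v :: real and I :: complex
      using that by (simp add: scaleR_diff_right)
    from this[OF V] show ?thesis unfolding ball_mean_def m .
  qed
  ultimately have "?V *\<^sub>R (ball_mean f c r - a) = (LINT x:ball c r|lebesgue. f x - a)" by simp
  then have "norm (ball_mean f c r - a) * ?V = norm (LINT x:ball c r|lebesgue. f x - a)"
    using V by (metis abs_of_pos mult.commute norm_scaleR)
  also have "ennreal \<dots> \<le> (\<integral>\<^sup>+x. ennreal (norm (indicat_real (ball c r) x *\<^sub>R (f x - a))) \<partial>lebesgue)"
    unfolding set_lebesgue_integral_def
    using set_integral_diff(1)[OF fi ai] by (intro integral_norm_bound_ennreal) (simp add: set_integrable_def)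
  also have "\<dots> = nint (ball c r) (\<lambda>x. f x - a)"
    by (intro nn_integral_cong) (auto simp: indicator_def)
  finally show ?thesis .
qed

lemma mint_shift:
  fixes x c :: "real^'n"
  assumes r: "r > 0" and xc: "norm (c - x) \<le> r" and p: "p \<in> borel_measurable lebesgue"
  shows "mint r x p \<le> ennreal (2 ^ (CARD('n) + 1)) * mint r c p"
proof -
  have "mint r x p \<le> (\<integral>\<^sup>+y. ennreal (2 ^ (CARD('n) + 1)) * (ennreal (maj r (c - y)) * ennreal (norm (p y))) \<partial>lebesgue)"
  proof (rule nn_integral_mono)
    fix y
    have "ennreal (maj r (x - y)) \<le> ennreal (2 ^ (CARD('n) + 1)) * ennreal (maj r (c - y))"
      using maj_shift[OF r xc, of y] maj_pos[OF r, of "c - y"]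
      by (subst ennreal_mult[symmetric]) (auto intro!: ennreal_leI simp del: power_Suc)
    then show "ennreal (maj r (x - y)) * ennreal (norm (p y))
      \<le> ennreal (2 ^ (CARD('n) + 1)) * (ennreal (maj r (c - y)) * ennreal (norm (p y)))"
      unfolding mult.assoc[symmetric] by (rule mult_right_mono) simp
  qed
  also have "\<dots> = ennreal (2 ^ (CARD('n) + 1)) * mint r c p"
    by (intro nn_integral_cmult borel_measurable_maj_mult_norm p)
  finally show ?thesis .
qed

section \<open>Summation of dyadic increments\<close>

text \<open>The increments over dyadic intervals form a growing geometric sequence, so the total is
  comparable to the last one. The induction halves T until it reaches [r, 2 r].\<close>

lemma dyadic_growth:
  fixes d :: "real \<Rightarrow> 'a::real_normed_vector"
  assumes \<beta>: "\<beta> > 0" and r: "r > 0" and a: "a \<ge> 0" and T: "T \<ge> r"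
    and st: "\<And>T T'. \<lbrakk>r \<le> T; T \<le> T'; T' \<le> 2 * T\<rbrakk> \<Longrightarrow> norm (d T' - d T) \<le> a * T powr \<beta>"
  shows "norm (d T - d r) \<le> (1 + 1 / (2 powr \<beta> - 1)) * a * T powr \<beta>"
proof -
  define q where "q = (2::real) powr \<beta>"
  have q: "q > 1" using \<beta> by (simp add: q_def)
  \<comment> \<open>Chosen such that (C + 1) / q is at most C, which closes the induction, and at
    least 1 for its start.\<close>
  define C where "C = 1 + 1 / (q - 1)"
  have C: "C \<ge> 1" using q by (simp add: C_def)
  have Cq: "(C + 1) / q \<le> C"
  proof -
    have "C * (q - 1) = q" using q by (simp add: C_def field_simps)
    then have "C + 1 \<le> C * q" using q by (simp add: algebra_simps)
    then show ?thesis using q by (simp add: divide_le_eq)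
  qed
  have "norm (d T - d r) \<le> C * a * T powr \<beta>"
  proof -
    have "\<forall>T. r \<le> T \<and> T \<le> 2 ^ k * r \<longrightarrow> norm (d T - d r) \<le> C * a * T powr \<beta>" for k :: nat
    proof (induction k)
      case 0
      then show ?case using a C r by (auto intro!: mult_nonneg_nonneg)
    next
      case (Suc k)
      show ?case
      proof (intro allI impI)
        fix T assume T: "r \<le> T \<and> T \<le> 2 ^ Suc k * r"
        show "norm (d T - d r) \<le> C * a * T powr \<beta>"
        proof (cases "T \<le> 2 * r")
          case True
          then have "norm (d T - d r) \<le> a * r powr \<beta>" using st T by auto
          also have "\<dots> \<le> a * T powr \<beta>" using a r T \<beta> by (intro mult_left_mono powr_mono2) auto
          also have "\<dots> \<le> C * (a * T powr \<beta>)" using mult_right_mono[OF C, of "a * T powr \<beta>"] a by simp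
          finally show ?thesis by (simp only: mult.assoc)
        next
          case False
          have "norm (d T - d (T / 2)) \<le> a * (T / 2) powr \<beta>"
            using st[of "T / 2" T] False r by auto
          moreover have "norm (d (T / 2) - d r) \<le> C * a * (T / 2) powr \<beta>"
            using Suc False T r by auto
          moreover have "norm (d T - d r) \<le> norm (d T - d (T / 2)) + norm (d (T / 2) - d r)"
            using norm_triangle_ineq[of "d T - d (T / 2)" "d (T / 2) - d r"] by simp
          ultimately have "norm (d T - d r) \<le> a * (T / 2) powr \<beta> + C * a * (T / 2) powr \<beta>" by linarith
          also have "(T / 2) powr \<beta> = T powr \<beta> / q" using r T by (simp add: powr_divide q_def)
          also have "a * (T powr \<beta> / q) + C * a * (T powr \<beta> / q) = (C + 1) / q * (a * T powr \<beta>)"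
            by (simp add: algebra_simps add_divide_distrib)
          also have "\<dots> \<le> C * (a * T powr \<beta>)" using Cq a by (intro mult_right_mono) auto
          finally show ?thesis by (simp only: mult.assoc)
        qed
      qed
    qed
    moreover obtain k :: nat where "T / r < 2 ^ k" using real_arch_pow[of 2 "T / r"] by auto
    then have "T \<le> 2 ^ k * r" using r by (simp add: field_simps)
    ultimately show ?thesis using T by blast
  qed
  then show ?thesis by (simp only: C_def q_def)
qed

text \<open>Counterpart for shrinking increments, where the total is comparable to the first one.
  The induction doubles the left endpoint; its constant solves C q + 1 = C.\<close>

lemma dyadic_decay:
  fixes d :: "real \<Rightarrow> 'a::real_normed_vector"
  assumes \<gamma>: "\<gamma> > 0" and r: "r > 0" and a: "a \<ge> 0" and T: "T \<ge> r" and T': "T' \<ge> T"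
    and st: "\<And>T T'. \<lbrakk>r \<le> T; T \<le> T'; T' \<le> 2 * T\<rbrakk> \<Longrightarrow> norm (d T' - d T) \<le> a * T powr (- \<gamma>)"
  shows "norm (d T' - d T) \<le> 1 / (1 - 2 powr (- \<gamma>)) * a * T powr (- \<gamma>)"
proof -
  define q where "q = (2::real) powr (- \<gamma>)"
  have q: "q > 0" "q < 1" using \<gamma> by (auto simp: q_def intro: powr_less_one)
  define C where "C = 1 / (1 - q)"
  have C: "C \<ge> 1" using q by (simp add: C_def)
  have Cq: "C * q + 1 = C"
  proof -
    have "C * (1 - q) = 1" using q by (simp add: C_def)
    then show ?thesis by (simp add: algebra_simps)
  qed
  have "norm (d T' - d T) \<le> C * a * T powr (- \<gamma>)"
  proof -
    have "\<forall>T\<ge>r. \<forall>T'. T \<le> T' \<and> T' \<le> 2 ^ k * T \<longrightarrow> norm (d T' - d T) \<le> C * a * T powr (- \<gamma>)" for k :: nat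
    proof (induction k)
      case 0
      then show ?case using a C r by (auto intro!: mult_nonneg_nonneg)
    next
      case (Suc k)
      show ?case
      proof (intro allI impI)
        fix T T' assume T: "r \<le> T" "T \<le> T' \<and> T' \<le> 2 ^ Suc k * T"
        show "norm (d T' - d T) \<le> C * a * T powr (- \<gamma>)"
        proof (cases "T' \<le> 2 * T")
          case True
          then have "norm (d T' - d T) \<le> a * T powr (- \<gamma>)" using st T by auto
          also have "\<dots> \<le> C * (a * T powr (- \<gamma>))" using mult_right_mono[OF C, of "a * T powr (- \<gamma>)"] a by simp
          finally show ?thesis by (simp only: mult.assoc)
        next
          case False
          have "norm (d (2 * T) - d T) \<le> a * T powr (- \<gamma>)"
            using st[of T "2 * T"] T r by auto
          moreover have "norm (d T' - d (2 * T)) \<le> C * a * (2 * T) powr (- \<gamma>)"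
          proof (rule Suc[rule_format])
            show "r \<le> 2 * T" using T r by linarith
            have "2 ^ Suc k * T = 2 ^ k * (2 * T)" by simp
            then show "2 * T \<le> T' \<and> T' \<le> 2 ^ k * (2 * T)" using False T by linarith
          qed
          moreover have "norm (d T' - d T) \<le> norm (d T' - d (2 * T)) + norm (d (2 * T) - d T)"
            using norm_triangle_ineq[of "d T' - d (2 * T)" "d (2 * T) - d T"] by simp
          ultimately have "norm (d T' - d T) \<le> C * a * (2 * T) powr (- \<gamma>) + a * T powr (- \<gamma>)" by linarith
          also have "(2 * T) powr (- \<gamma>) = q * T powr (- \<gamma>)" using r T by (simp add: powr_mult q_def)
          also have "C * a * (q * T powr (- \<gamma>)) + a * T powr (- \<gamma>) = (C * q + 1) * (a * T powr (- \<gamma>))"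
            by (simp add: algebra_simps)
          finally show ?thesis unfolding Cq by (simp only: mult.assoc)
        qed
      qed
    qed
    moreover obtain k :: nat where "T' / T < 2 ^ k" using real_arch_pow[of 2 "T' / T"] by auto
    then have "T' \<le> 2 ^ k * T" using r T by (simp add: field_simps)
    ultimately show ?thesis using T T' by blast
  qed
  then show ?thesis by (simp only: C_def q_def)
qed

section \<open>Gauges of balls and averaging over centres\<close>

text \<open>The comparison estimates are proved for an abstract gauge X, so that \<phi> enters
  through these inequalities alone. Measurability of \<open>y \<mapsto> X y r\<close> is not part of
  the interface; its integral is only ever used through monotonicity and
  \<open>X_int\<close>.\<close>

locale ball_gauge =
  fixes X :: "real^'n \<Rightarrow> real \<Rightarrow> real" and D \<beta> :: real
  assumes D_ge: "1 \<le> D" and beta: "0 < \<beta>" "2 * \<beta> < 1"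
    and X_pos: "\<And>c r. r > 0 \<Longrightarrow> 0 < X c r"
    and X_mono: "\<And>c\<^sub>1 c\<^sub>2 r\<^sub>1 r\<^sub>2. \<lbrakk>0 < r\<^sub>1; 0 < r\<^sub>2; ball c\<^sub>1 r\<^sub>1 \<subseteq> ball c\<^sub>2 r\<^sub>2\<rbrakk> \<Longrightarrow> X c\<^sub>1 r\<^sub>1 \<le> X c\<^sub>2 r\<^sub>2"
    and X_grow: "\<And>c\<^sub>1 c\<^sub>2 r\<^sub>1 r\<^sub>2. \<lbrakk>0 < r\<^sub>1; 0 < r\<^sub>2; ball c\<^sub>1 r\<^sub>1 \<subseteq> ball c\<^sub>2 r\<^sub>2\<rbrakk> \<Longrightarrow>
      X c\<^sub>2 r\<^sub>2 \<le> D * (r\<^sub>2 / r\<^sub>1) powr (real CARD('n) + \<beta>) * X c\<^sub>1 r\<^sub>1"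
    and X_int: "\<And>x r R. \<lbrakk>0 < r; 0 < R\<rbrakk> \<Longrightarrow>
      (\<integral>\<^sup>+y\<in>ball x R. ennreal (X y r) \<partial>lebesgue) \<le> ennreal (D * r ^ CARD('n) * X x (R + r))"
begin

text \<open>Up to the factor V this is X divided by the measure of the ball, the natural size of
  pointwise oscillation at x and scale r. It grows in r with exponent \<beta> only.\<close>

definition Y :: "real^'n \<Rightarrow> real \<Rightarrow> real" where "Y x r = X x r / r ^ CARD('n)"

definition V :: real where "V = unit_ball_vol (real CARD('n))"

lemma V_pos: "V > 0" by (simp add: V_def)

lemma D_pos: "D > 0" using D_ge by simp

lemma Y_pos: "r > 0 \<Longrightarrow> 0 < Y x r"
  using X_pos by (simp add: Y_def)

lemma X_eq_Y: "r > 0 \<Longrightarrow> X x r = Y x r * r ^ CARD('n)"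
  by (simp add: Y_def)

lemma X_grow_concentric:
  assumes "0 < r" "r \<le> R"
  shows "X x R \<le> D * Y x r * R ^ CARD('n) * (R / r) powr \<beta>"
proof -
  have "X x R \<le> D * (R / r) powr (real CARD('n) + \<beta>) * X x r"
    using assms by (intro X_grow subset_ball) auto
  also have "(R / r) powr (real CARD('n) + \<beta>) = R ^ CARD('n) / r ^ CARD('n) * (R / r) powr \<beta>"
    using assms by (simp add: powr_add powr_realpow power_divide)
  finally show ?thesis unfolding Y_def by (simp add: mult_ac)
qed

lemma Y_grow:
  assumes "0 < r" "r \<le> R"
  shows "Y x R \<le> D * Y x r * (R / r) powr \<beta>"
proof -
  have "Y x R * R ^ CARD('n) \<le> (D * Y x r * (R / r) powr \<beta>) * R ^ CARD('n)"
    using X_grow_concentric[OF assms, of x] X_eq_Y[of R x] assms by (simp only: mult_ac)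
  moreover have "R ^ CARD('n) > 0" using assms by simp
  ultimately show ?thesis using mult_le_cancel_right_pos by blast
qed

text \<open>The ball around y lies in the ball around x of radius r + |x - y|. The exponent n +
  \<beta> is rounded up to n + 1, so that the dependence on y is a polynomial weight whose heat
  moments are bounded.\<close>

lemma Y_shift:
  assumes "0 < r"
  shows "Y y r \<le> D * Y x r * (1 + norm (x - y) / r) ^ (CARD('n) + 1)"
proof -
  let ?R = "r + norm (x - y)"
  have R: "?R > 0" using assms by (simp add: add_pos_nonneg)
  have "ball y r \<subseteq> ball x ?R"
  proof
    fix z assume "z \<in> ball y r"
    then show "z \<in> ball x ?R" using dist_triangle[of x z y] by (simp add: dist_norm[of x y])
  qed
  then have "X y r \<le> X x ?R" using assms R by (intro X_mono) auto
  also have "\<dots> \<le> D * (?R / r) powr (real CARD('n) + \<beta>) * X x r"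
    using assms R by (intro X_grow subset_ball) auto
  also have "?R / r = 1 + norm (x - y) / r" using assms by (simp add: add_divide_distrib)
  also have "D * (1 + norm (x - y) / r) powr (real CARD('n) + \<beta>) * X x r \<le> D * (1 + norm (x - y) / r) powr real (CARD('n) + 1) * X x r"
    using assms beta D_pos X_pos[OF assms, of x] by (intro mult_right_mono mult_left_mono powr_mono) auto
  also have "(1 + norm (x - y) / r) powr real (CARD('n) + 1) = (1 + norm (x - y) / r) ^ (CARD('n) + 1)"
    using assms by (intro powr_realpow add_pos_nonneg) auto
  finally have "X y r / r ^ CARD('n) \<le> D * (1 + norm (x - y) / r) ^ (CARD('n) + 1) * X x r / r ^ CARD('n)"
    using assms by (intro divide_right_mono) auto
  then show ?thesis by (simp only: Y_def times_divide_eq_right times_divide_eq_left mult_ac)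
qed

text \<open>Double integration over pairs (y, z) at distance less than r. Every z in
  \<open>ball x R\<close> is counted for a set of centres y of measure V r^n, all of them in
  \<open>ball x (R + r)\<close>; for fixed y the hypothesis bounds the integral over z, and
  \<open>X_int\<close> adds these bounds up.\<close>

lemma covering:
  fixes u :: "real^'n \<Rightarrow> ennreal"
  assumes u [measurable]: "u \<in> borel_measurable lebesgue" and N: "N > 0" and r: "r > 0" and R: "R > 0"
    and bnd: "\<And>y. (\<integral>\<^sup>+z\<in>ball y r. u z \<partial>lebesgue) \<le> ennreal (N * X y r)"
  shows "(\<integral>\<^sup>+z\<in>ball x R. u z \<partial>lebesgue) \<le> ennreal (D / V * N * X x (R + 2 * r))"
proof -
  let ?W = "V * r ^ CARD('n)"
  have W: "?W > 0" using V_pos r by simp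
  have dm: "(\<lambda>p. indicator {p :: (real^'n) \<times> (real^'n). dist (fst p) (snd p) < r} p :: ennreal)
      \<in> borel_measurable (lebesgue \<Otimes>\<^sub>M lebesgue)"
  proof -
    have "{p \<in> space (lebesgue \<Otimes>\<^sub>M lebesgue). dist (fst p) (snd p :: real^'n) < r} \<in> sets (lebesgue \<Otimes>\<^sub>M lebesgue)"
      by (intro borel_measurable_less borel_measurable_dist measurable_fst_lebesgue_borel measurable_snd_lebesgue_borel borel_measurable_const)
    then show ?thesis by (intro borel_measurable_indicator) (simp add: space_pair_measure)
  qed
  define g where "g y z = u z * indicator (ball x (R + r)) y * indicator {p :: (real^'n) \<times> (real^'n). dist (fst p) (snd p) < r} (y, z)" for y z :: "real^'n"
  have g: "case_prod g \<in> borel_measurable (lebesgue \<Otimes>\<^sub>M lebesgue)"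
    unfolding g_def case_prod_unfold using dm
    by (intro borel_measurable_times_ennreal measurable_compose[OF measurable_snd u]
        measurable_compose[OF measurable_fst borel_measurable_indicator]) (simp_all add: case_prod_unfold)
  have "ennreal ?W * (\<integral>\<^sup>+z\<in>ball x R. u z \<partial>lebesgue) = (\<integral>\<^sup>+z. ennreal ?W * (u z * indicator (ball x R) z) \<partial>lebesgue)"
    by (rule nn_integral_cmult[symmetric]) measurable
  also have "\<dots> \<le> (\<integral>\<^sup>+z. (\<integral>\<^sup>+y. g y z \<partial>lebesgue) \<partial>lebesgue)"
  proof (rule nn_integral_mono)
    fix z :: "real^'n"
    show "ennreal ?W * (u z * indicator (ball x R) z) \<le> (\<integral>\<^sup>+y. g y z \<partial>lebesgue)"
    proof (cases "z \<in> ball x R")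
      case True
      have "ennreal ?W * (u z * indicator (ball x R) z) = u z * emeasure lebesgue (ball z r)"
      proof -
        have e: "emeasure lebesgue (ball z r) = ennreal ?W"
          unfolding V_def using r by (intro emeasure_lebesgue_ball) simp
        show ?thesis unfolding e using True by (simp add: mult.commute)
      qed
      also have "\<dots> = (\<integral>\<^sup>+y. u z * indicator (ball z r) y \<partial>lebesgue)"
        by (rule nn_integral_cmult_indicator[symmetric]) simp
      also have "\<dots> \<le> (\<integral>\<^sup>+y. g y z \<partial>lebesgue)"
      proof (rule nn_integral_mono)
        fix y :: "real^'n"
        have "dist x y < R + r" if "dist z y < r"
          using True that dist_triangle[of x y z] by simp
        then show "u z * indicator (ball z r) y \<le> g y z"
          by (auto simp: g_def indicator_def dist_commute)
      qed
      finally show ?thesis .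
    qed simp
  qed
  also have "\<dots> = (\<integral>\<^sup>+y. (\<integral>\<^sup>+z. g y z \<partial>lebesgue) \<partial>lebesgue)"
    by (rule lebesgue_pair.Fubini'[OF g])
  \<comment> \<open>N is pulled out while the integrand is still the inner integral, which is
    measurable in y by Fubini; afterwards the integrand is \<open>X y r\<close>, for which
    measurability is unknown.\<close>
  also have "\<dots> = (\<integral>\<^sup>+y. ennreal N * (ennreal (1 / N) * (\<integral>\<^sup>+z. g y z \<partial>lebesgue)) \<partial>lebesgue)"
    using N by (simp add: mult.assoc[symmetric] ennreal_mult[symmetric])
  also have "\<dots> = ennreal N * (\<integral>\<^sup>+y. ennreal (1 / N) * (\<integral>\<^sup>+z. g y z \<partial>lebesgue) \<partial>lebesgue)"
    using lebesgue.borel_measurable_nn_integral[OF g] by (intro nn_integral_cmult borel_measurable_times_ennreal) auto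
  also have "\<dots> \<le> ennreal N * (\<integral>\<^sup>+y\<in>ball x (R + r). ennreal (X y r) \<partial>lebesgue)"
  proof (intro mult_left_mono nn_integral_mono)
    fix y :: "real^'n"
    have "(\<integral>\<^sup>+z. g y z \<partial>lebesgue) = (\<integral>\<^sup>+z. (u z * indicator (ball y r) z) * indicator (ball x (R + r)) y \<partial>lebesgue)"
      by (intro nn_integral_cong) (auto simp: g_def indicator_def)
    also have "\<dots> = (\<integral>\<^sup>+z\<in>ball y r. u z \<partial>lebesgue) * indicator (ball x (R + r)) y"
      by (rule nn_integral_multc) measurable
    also have "\<dots> \<le> ennreal (N * X y r) * indicator (ball x (R + r)) y"
      by (intro mult_right_mono bnd) auto
    finally have "ennreal (1 / N) * (\<integral>\<^sup>+z. g y z \<partial>lebesgue) \<le> ennreal (1 / N) * (ennreal (N * X y r) * indicator (ball x (R + r)) y)"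
      by (intro mult_left_mono) auto
    also have "\<dots> = ennreal (1 / N * (N * X y r)) * indicator (ball x (R + r)) y"
      using N X_pos[OF r, of y] by (subst ennreal_mult) (auto simp: mult.assoc)
    also have "1 / N * (N * X y r) = X y r" using N by simp
    finally show "ennreal (1 / N) * (\<integral>\<^sup>+z. g y z \<partial>lebesgue) \<le> ennreal (X y r) * indicator (ball x (R + r)) y" .
  qed simp
  also have "\<dots> \<le> ennreal N * ennreal (D * r ^ CARD('n) * X x (R + r + r))"
    using r R by (intro mult_left_mono X_int) auto
  also have "\<dots> = ennreal (N * (D * r ^ CARD('n) * X x (R + r + r)))"
    using N D_pos r R X_pos[of "R + r + r" x] by (intro ennreal_mult[symmetric]) auto
  also have "N * (D * r ^ CARD('n) * X x (R + r + r)) = ?W * (D / V * N * X x (R + 2 * r))"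
    using V_pos by (simp add: field_simps)
  also have "ennreal \<dots> = ennreal ?W * ennreal (D / V * N * X x (R + 2 * r))"
    using N D_pos r R V_pos X_pos[of "R + 2 * r" x] by (intro ennreal_mult) auto
  finally have *: "ennreal ?W * (\<integral>\<^sup>+z\<in>ball x R. u z \<partial>lebesgue) \<le> ennreal ?W * ennreal (D / V * N * X x (R + 2 * r))" .
  have "ennreal (1 / w) * ennreal w = 1" if "w > 0" for w :: real
    using that by (subst ennreal_mult[symmetric]) auto
  from this[OF W] show ?thesis
    using mult_left_mono[OF *, of "ennreal (1 / ?W)"] by (simp only: mult.assoc[symmetric] mult_1_left zero_le)
qed

text \<open>Bounds on balls of one small radius s control the majorant integral at each larger scale
  r, since R + 2 s is at most 3 R for R at least r. The result has the size expected at scale r,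
  independently of s.\<close>

lemma maj_covering:
  "\<exists>C>0. \<forall>(u :: real^'n \<Rightarrow> ennreal) N s r x. u \<in> borel_measurable lebesgue \<longrightarrow> 0 < N \<longrightarrow> 0 < s \<longrightarrow> s \<le> r \<longrightarrow>
    (\<forall>y. (\<integral>\<^sup>+z\<in>ball y s. u z \<partial>lebesgue) \<le> ennreal (N * X y s)) \<longrightarrow>
    (\<integral>\<^sup>+y. ennreal (maj r (x - y)) * u y \<partial>lebesgue) \<le> ennreal (C * N * Y x r)"
proof -
  let ?n = "CARD('n)"
  have "\<beta> < 1" using beta by simp
  from nn_integral_maj_le[OF this, where 'n = 'n] obtain C where C: "C > 0"
    "\<And>(u :: real^'n \<Rightarrow> ennreal) r x a. \<lbrakk>u \<in> borel_measurable lebesgue; 0 < r; 0 \<le> a;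
    \<forall>R\<ge>r. (\<integral>\<^sup>+y\<in>ball x R. u y \<partial>lebesgue) \<le> ennreal (a * R ^ ?n * (R / r) powr \<beta>)\<rbrakk> \<Longrightarrow>
    (\<integral>\<^sup>+y. ennreal (maj r (x - y)) * u y \<partial>lebesgue) \<le> ennreal (C * a)"
    by blast
  define K where "K = D / V * D * (3 ^ ?n * 3 powr \<beta>)"
  have K: "K > 0" using D_pos V_pos by (simp add: K_def)
  have "(\<integral>\<^sup>+y. ennreal (maj r (x - y)) * u y \<partial>lebesgue) \<le> ennreal (C * K * N * Y x r)"
    if u: "u \<in> borel_measurable lebesgue" and N: "0 < N" and s: "0 < s" "s \<le> r"
      and b: "\<forall>y. (\<integral>\<^sup>+z\<in>ball y s. u z \<partial>lebesgue) \<le> ennreal (N * X y s)" for u :: "real^'n \<Rightarrow> ennreal" and N s r x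
  proof -
    have r: "r > 0" using s by simp
    have "(\<integral>\<^sup>+y. ennreal (maj r (x - y)) * u y \<partial>lebesgue) \<le> ennreal (C * (K * N * Y x r))"
    proof (rule C(2)[OF u r])
      show "0 \<le> K * N * Y x r" using K N Y_pos[OF r, of x] by simp
      show "\<forall>R\<ge>r. (\<integral>\<^sup>+y\<in>ball x R. u y \<partial>lebesgue) \<le> ennreal (K * N * Y x r * R ^ ?n * (R / r) powr \<beta>)"
      proof (intro allI impI)
        fix R assume R: "R \<ge> r"
        have "(\<integral>\<^sup>+y\<in>ball x R. u y \<partial>lebesgue) \<le> ennreal (D / V * N * X x (R + 2 * s))"
          using u N s R r b by (intro covering) auto
        also have "\<dots> \<le> ennreal (K * N * Y x r * R ^ ?n * (R / r) powr \<beta>)"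
        proof (rule ennreal_leI)
          have "X x (R + 2 * s) \<le> X x (3 * R)" using s r R by (intro X_mono subset_ball) auto
          also have "\<dots> \<le> D * Y x r * (3 * R) ^ ?n * (3 * R / r) powr \<beta>" using r R by (intro X_grow_concentric) auto
          also have "(3 * R) ^ ?n = 3 ^ ?n * R ^ ?n" by (rule power_mult_distrib)
          also have "(3 * R / r) powr \<beta> = 3 powr \<beta> * (R / r) powr \<beta>" by (metis powr_mult times_divide_eq_right)
          finally have "D / V * N * X x (R + 2 * s) \<le> D / V * N * (D * Y x r * (3 ^ ?n * R ^ ?n) * (3 powr \<beta> * (R / r) powr \<beta>))"
            using D_pos V_pos N by (intro mult_left_mono) auto
          also have "\<dots> = K * N * Y x r * R ^ ?n * (R / r) powr \<beta>" unfolding K_def by (simp only: mult_ac)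
          finally show "D / V * N * X x (R + 2 * s) \<le> K * N * Y x r * R ^ ?n * (R / r) powr \<beta>" .
        qed
        finally show "(\<integral>\<^sup>+y\<in>ball x R. u y \<partial>lebesgue) \<le> ennreal (K * N * Y x r * R ^ ?n * (R / r) powr \<beta>)" .
      qed
    qed
    then show ?thesis by (simp only: mult.assoc)
  qed
  then show ?thesis using C(1) K by (intro exI[of _ "C * K"]) (auto simp: mult.assoc)
qed

section \<open>From mean oscillation to oscillation against the semigroup\<close>

definition gen_bdd :: "generator \<Rightarrow> real \<Rightarrow> (real^'n \<Rightarrow> complex) \<Rightarrow> bool" where
  "gen_bdd A N f \<longleftrightarrow> (\<forall>c. \<forall>r>0. nint (ball c r) (\<lambda>x. f x - semigroup_op A (r ^ gen_order A) f x) \<le> ennreal (N * X c r))"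

definition bmo_bdd :: "real \<Rightarrow> (real^'n \<Rightarrow> complex) \<Rightarrow> bool" where
  "bmo_bdd N f \<longleftrightarrow> locally_integrable f \<and>
    (\<forall>c. \<forall>r>0. nint (ball c r) (\<lambda>x. f x - ball_mean f c r) \<le> ennreal (N * X c r))"

text \<open>Any constants a may replace the means, at the price of a factor 2, because the mean
  differs from a by at most the average of |g - a|. Local integrability comes along, as constants
  are integrable on balls.\<close>

lemma bmo_bddI:
  assumes g: "g \<in> borel_measurable lebesgue" and N: "N > 0"
    and bnd: "\<And>c r. r > 0 \<Longrightarrow> \<exists>a. nint (ball c r) (\<lambda>x. g x - a) \<le> ennreal (N * X c r)"
  shows "bmo_bdd (2 * N) g"
proof -
  have li: "locally_integrable g"
    unfolding locally_integrable_iff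
  proof (intro conjI g allI impI)
    fix c :: "real^'n" and r :: real assume r: "r > 0"
    obtain a where a: "nint (ball c r) (\<lambda>x. g x - a) \<le> ennreal (N * X c r)" using bnd[OF r] by blast
    have "nint (ball c r) (\<lambda>x. g x - 0) \<le> nint (ball c r) (\<lambda>x. g x - a) + nint (ball c r) (\<lambda>x. a - 0)"
      using g by (intro nint_triangle) auto
    also have "\<dots> \<le> ennreal (N * X c r) + ennreal (norm a * (unit_ball_vol (real CARD('n)) * r ^ CARD('n)))"
      using a r by (intro add_mono nint_ball_le) auto
    also have "\<dots> < \<infinity>" by simp
    finally show "nint (ball c r) g < \<infinity>" by simp
  qed
  have "nint (ball c r) (\<lambda>x. g x - ball_mean g c r) \<le> ennreal (2 * N * X c r)" if r: "r > 0" for c r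
  proof -
    obtain a where a: "nint (ball c r) (\<lambda>x. g x - a) \<le> ennreal (N * X c r)" using bnd[OF r] by blast
    have "nint (ball c r) (\<lambda>x. g x - ball_mean g c r) \<le> nint (ball c r) (\<lambda>x. g x - a) + nint (ball c r) (\<lambda>x. a - ball_mean g c r)"
      using g by (intro nint_triangle) auto
    also have "nint (ball c r) (\<lambda>x. a - ball_mean g c r) \<le> ennreal (norm (ball_mean g c r - a) * (unit_ball_vol (real CARD('n)) * r ^ CARD('n)))"
      using r by (intro nint_ball_le) (auto simp: norm_minus_commute)
    also have "\<dots> \<le> nint (ball c r) (\<lambda>x. g x - a)" by (rule norm_ball_mean_diff_le[OF li r])
    also have "nint (ball c r) (\<lambda>x. g x - a) + nint (ball c r) (\<lambda>x. g x - a) \<le> ennreal (N * X c r) + ennreal (N * X c r)"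
      by (intro add_mono a)
    also have "\<dots> = ennreal (2 * N * X c r)" using N X_pos[OF r, of c] by (simp flip: ennreal_plus)
    finally show ?thesis by (simp add: add_left_mono)
  qed
  then show ?thesis using li by (simp add: bmo_bdd_def)
qed

text \<open>Means over concentric balls of radii T and at most 2 T differ by a multiple of N Y(x,
  T), and Y grows with exponent \<beta>; dyadic summation keeps this exponent.\<close>

lemma ball_mean_growth:
  "\<exists>C>0. \<forall>f N x r R. bmo_bdd N f \<longrightarrow> 0 < N \<longrightarrow> 0 < r \<longrightarrow> r \<le> R \<longrightarrow>
    norm (ball_mean f x R - ball_mean f x r) \<le> C * N * Y x r * (R / r) powr \<beta>"
proof -
  let ?n = "CARD('n)"
  define C where "C = 1 + 1 / (2 powr \<beta> - 1)"
  have C: "C > 0" proof -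
    have "1 < (2::real) powr \<beta>" using beta by simp
    then show ?thesis by (auto simp: C_def intro!: add_pos_nonneg)
  qed
  define c0 where "c0 = D * (2 ^ ?n * 2 powr \<beta>) / V"
  have c0: "c0 > 0" using D_pos V_pos by (simp add: c0_def)
  have "norm (ball_mean f x R - ball_mean f x r) \<le> C * c0 * D * N * Y x r * (R / r) powr \<beta>"
    if f: "bmo_bdd N f" and N: "0 < N" and r: "0 < r" and R: "r \<le> R" for f N x r R
  proof -
    \<comment> \<open>Divided by r^\<beta>, so that a T^\<beta> is the bound c0 N D Y(x, r) (T /
      r)^\<beta> that holds at scale T.\<close>
    define a where "a = c0 * N * (D * Y x r / r powr \<beta>)"
    have a: "a \<ge> 0" using c0 N D_pos Y_pos[OF r, of x] by (simp add: a_def)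
    have li: "locally_integrable f" using f by (simp add: bmo_bdd_def)
    have "norm (ball_mean f x R - ball_mean f x r) \<le> C * a * R powr \<beta>"
      unfolding C_def
    proof (rule dyadic_growth[OF beta(1) r a R])
      show "norm (ball_mean f x T' - ball_mean f x T) \<le> a * T powr \<beta>" if T: "r \<le> T" and T1: "T \<le> T'" "T' \<le> 2 * T" for T T'
      proof -
        have T': "T \<le> T' \<and> T' \<le> 2 * T" using T1 by simp
        have T0: "T > 0" using r T by simp
        let ?W = "V * T ^ ?n"
        have W: "?W > 0" using V_pos T0 by simp
        have "ennreal (norm (ball_mean f x T - ball_mean f x T') * ?W) \<le> nint (ball x T) (\<lambda>y. f y - ball_mean f x T')"
          unfolding V_def by (rule norm_ball_mean_diff_le[OF li T0])
        also have "\<dots> \<le> nint (ball x T') (\<lambda>y. f y - ball_mean f x T')"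
          using T' by (intro nint_mono_set subset_ball) auto
        also have "\<dots> \<le> ennreal (N * X x T')" using f T0 T' by (auto simp: bmo_bdd_def)
        finally have "norm (ball_mean f x T - ball_mean f x T') * ?W \<le> N * X x T'"
          using N X_pos[of T' x] T0 T' by (subst (asm) ennreal_le_iff) auto
        also have "\<dots> \<le> N * X x (2 * T)" using N T0 T' by (intro mult_left_mono X_mono subset_ball) auto
        also have "\<dots> \<le> N * (D * Y x T * (2 * T) ^ ?n * (2 * T / T) powr \<beta>)"
          using N T0 by (intro mult_left_mono X_grow_concentric) auto
        also have "\<dots> = (c0 * N * Y x T) * ?W"
          using V_pos T0 by (simp add: c0_def power_mult_distrib)
        finally have "norm (ball_mean f x T - ball_mean f x T') \<le> c0 * N * Y x T"
          using W mult_le_cancel_right_pos by blast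
        also have "\<dots> \<le> c0 * N * (D * Y x r * (T / r) powr \<beta>)"
          using c0 N r T by (intro mult_left_mono Y_grow) auto
        also have "\<dots> = a * T powr \<beta>" using r T0 by (simp add: a_def powr_divide)
        finally show "norm (ball_mean f x T' - ball_mean f x T) \<le> a * T powr \<beta>" by (simp add: norm_minus_commute)
      qed
    qed
    also have "C * a * R powr \<beta> = C * c0 * D * N * Y x r * (R / r) powr \<beta>"
      using r R by (simp add: a_def powr_divide)
    finally show ?thesis .
  qed
  then show ?thesis using C c0 D_pos by (intro exI[of _ "C * c0 * D"]) auto
qed

text \<open>On the ball of radius R, f minus its mean at scale r splits into the oscillation at
  scale R and the drift of the means. Both are of order R^n (R / r)^\<beta>, and \<beta> < 1 lets
  the majorant absorb them.\<close>

lemma mint_bmo: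
  "\<exists>C>0. \<forall>f N x r. bmo_bdd N f \<longrightarrow> 0 < N \<longrightarrow> 0 < r \<longrightarrow>
    mint r x (\<lambda>y. f y - ball_mean f x r) \<le> ennreal (C * N * Y x r)"
proof -
  let ?n = "CARD('n)"
  have "\<beta> < 1" using beta by simp
  from nn_integral_maj_le[OF this, where 'n = 'n] obtain C where C: "C > 0"
    "\<And>(u :: real^'n \<Rightarrow> ennreal) r x a. \<lbrakk>u \<in> borel_measurable lebesgue; 0 < r; 0 \<le> a;
    \<forall>R\<ge>r. (\<integral>\<^sup>+y\<in>ball x R. u y \<partial>lebesgue) \<le> ennreal (a * R ^ ?n * (R / r) powr \<beta>)\<rbrakk> \<Longrightarrow>
    (\<integral>\<^sup>+y. ennreal (maj r (x - y)) * u y \<partial>lebesgue) \<le> ennreal (C * a)"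
    by blast
  obtain G where G: "G > 0" "\<And>f N x r R. \<lbrakk>bmo_bdd N f; 0 < N; 0 < r; r \<le> R\<rbrakk> \<Longrightarrow>
    norm (ball_mean f x R - ball_mean f x r) \<le> G * N * Y x r * (R / r) powr \<beta>"
    using ball_mean_growth by blast
  define K where "K = D + G * V"
  have K: "K > 0" using D_pos G V_pos by (simp add: K_def add_pos_pos)
  have "mint r x (\<lambda>y. f y - ball_mean f x r) \<le> ennreal (C * K * N * Y x r)"
    if f: "bmo_bdd N f" and N: "0 < N" and r: "0 < r" for f N x r
  proof -
    have li: "locally_integrable f" using f by (simp add: bmo_bdd_def)
    have fm: "f \<in> borel_measurable lebesgue" by (rule locally_integrable_measurable[OF li])
    have "mint r x (\<lambda>y. f y - ball_mean f x r) \<le> ennreal (C * (K * N * Y x r))"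
    proof (rule C(2))
      show "(\<lambda>y. ennreal (norm (f y - ball_mean f x r))) \<in> borel_measurable lebesgue" using fm by measurable
      show "0 \<le> K * N * Y x r" using K N Y_pos[OF r, of x] by simp
      show "\<forall>R\<ge>r. nint (ball x R) (\<lambda>y. f y - ball_mean f x r) \<le> ennreal (K * N * Y x r * R ^ ?n * (R / r) powr \<beta>)"
      proof (intro allI impI)
        fix R assume R: "r \<le> R"
        have R0: "R > 0" using r R by simp
        have "nint (ball x R) (\<lambda>y. f y - ball_mean f x r) \<le> nint (ball x R) (\<lambda>y. f y - ball_mean f x R) + nint (ball x R) (\<lambda>y. ball_mean f x R - ball_mean f x r)"
          using fm by (intro nint_triangle) auto
        also have "\<dots> \<le> ennreal (N * X x R) + ennreal ((G * N * Y x r * (R / r) powr \<beta>) * (V * R ^ ?n))"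
          unfolding V_def using f N R0 G(2)[OF f N r R, of x] G(1) Y_pos[OF r, of x]
          by (intro add_mono nint_ball_le) (auto simp: bmo_bdd_def)
        also have "\<dots> = ennreal (N * X x R + (G * N * Y x r * (R / r) powr \<beta>) * (V * R ^ ?n))"
          using N X_pos[OF R0, of x] G(1) Y_pos[OF r, of x] V_pos R0 by (intro ennreal_plus[symmetric]) auto
        also have "\<dots> \<le> ennreal (K * N * Y x r * R ^ ?n * (R / r) powr \<beta>)"
        proof (rule ennreal_leI)
          have "N * X x R \<le> N * (D * Y x r * R ^ ?n * (R / r) powr \<beta>)"
            using N r R by (intro mult_left_mono X_grow_concentric) auto
          then show "N * X x R + (G * N * Y x r * (R / r) powr \<beta>) * (V * R ^ ?n) \<le> K * N * Y x r * R ^ ?n * (R / r) powr \<beta>"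
            unfolding K_def by (simp add: algebra_simps)
        qed
        finally show "nint (ball x R) (\<lambda>y. f y - ball_mean f x r) \<le> ennreal (K * N * Y x r * R ^ ?n * (R / r) powr \<beta>)" .
      qed
    qed (rule r)
    then show ?thesis by (simp only: mult.assoc)
  qed
  then show ?thesis using C(1) K by (intro exI[of _ "C * K"]) (auto simp: mult.assoc)
qed

lemma bmo_in_dom_class:
  assumes f: "bmo_bdd N f" and N: "0 < N"
  shows "f \<in> dom_class A"
proof -
  obtain C where C: "C > 0" "\<And>f N x r. \<lbrakk>bmo_bdd N f; 0 < N; 0 < r\<rbrakk> \<Longrightarrow>
    mint r x (\<lambda>y. f y - ball_mean f x r) \<le> ennreal (C * N * Y x r)"
    using mint_bmo by blast
  have fm: "f \<in> borel_measurable lebesgue" using f by (auto simp: bmo_bdd_def intro: locally_integrable_measurable)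
  have "(\<lambda>y. f y - ball_mean f 0 1) \<in> dom_class A"
  proof (rule dom_classI_maj[where r = 1 and x = 0])
    show "(\<lambda>y. f y - ball_mean f 0 1) \<in> borel_measurable lebesgue" using fm by measurable
    show "mint 1 0 (\<lambda>y. f y - ball_mean f 0 1) < \<infinity>" using C(2)[OF f N, of 1 0] by (auto intro: le_less_trans)
  qed simp
  from dom_class_add[OF this dom_class_const[of "ball_mean f 0 1"]] show ?thesis by simp
qed

text \<open>Since A_t preserves constants, the difference is A_t applied to f minus its mean. The
  point x may range over the ball, because the majorant can be recentred at c.\<close>

lemma semigroup_op_near_mean:
  "\<exists>C>0. \<forall>f N x c r. bmo_bdd N f \<longrightarrow> 0 < N \<longrightarrow> 0 < r \<longrightarrow> norm (c - x) \<le> r \<longrightarrow>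
    norm (semigroup_op A (r ^ gen_order A) f x - ball_mean f c r) \<le> C * N * Y c r"
proof -
  obtain C where C: "C > 0" "\<And>f N x r. \<lbrakk>bmo_bdd N f; 0 < N; 0 < r\<rbrakk> \<Longrightarrow>
    mint r x (\<lambda>y. f y - ball_mean f x r) \<le> ennreal (C * N * Y x r)"
    using mint_bmo by blast
  obtain K where K: "K > 0" "\<And>r (f :: real^'n \<Rightarrow> complex) x. \<lbrakk>r > 0; f \<in> borel_measurable lebesgue\<rbrakk> \<Longrightarrow>
     ennreal (norm (semigroup_op A (r ^ gen_order A) f x)) \<le> ennreal K * mint r x f"
    using norm_semigroup_op_le_maj[of A, where 'n = 'n] by blast
  let ?q = "2 ^ (CARD('n) + 1) :: real"
  have "norm (semigroup_op A (r ^ gen_order A) f x - ball_mean f c r) \<le> K * ?q * C * N * Y c r"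
    if f: "bmo_bdd N f" and N: "0 < N" and r: "0 < r" and xc: "norm (c - x) \<le> r" for f N x c r
  proof -
    have fm: "f \<in> borel_measurable lebesgue" using f by (auto simp: bmo_bdd_def intro: locally_integrable_measurable)
    have gm: "(\<lambda>y. f y - ball_mean f c r) \<in> borel_measurable lebesgue" using fm by measurable
    have r': "r ^ gen_order A > 0" using r by simp
    have "semigroup_op A (r ^ gen_order A) f x - ball_mean f c r = semigroup_op A (r ^ gen_order A) (\<lambda>y. f y - ball_mean f c r) x"
      using semigroup_op_diff[OF bmo_in_dom_class[OF f N] dom_class_const r', of A "ball_mean f c r" x]
        semigroup_op_const[OF r', of A "ball_mean f c r" x] by simp
    then have "ennreal (norm (semigroup_op A (r ^ gen_order A) f x - ball_mean f c r)) \<le> ennreal K * mint r x (\<lambda>y. f y - ball_mean f c r)"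
      using K(2)[OF r gm, of x] by simp
    also have "\<dots> \<le> ennreal K * (ennreal ?q * mint r c (\<lambda>y. f y - ball_mean f c r))"
      by (intro mult_left_mono mint_shift r xc gm) simp
    also have "\<dots> \<le> ennreal K * (ennreal ?q * ennreal (C * N * Y c r))"
      by (intro mult_left_mono C f N r) auto
    also have "\<dots> = ennreal (K * (?q * (C * N * Y c r)))"
      using K(1) C(1) N Y_pos[OF r, of c] by (simp only: ennreal_mult mult_nonneg_nonneg less_imp_le zero_le_power zero_le_numeral)
    finally show ?thesis
      using K(1) C(1) N Y_pos[OF r, of c] by (subst (asm) ennreal_le_iff) (auto simp: mult.assoc)
  qed
  then show ?thesis using K(1) C(1) by (intro exI[of _ "K * ?q * C"]) auto
qed

lemma bmo_imp_gen:
  "\<exists>C>0. \<forall>f N. bmo_bdd N f \<longrightarrow> 0 < N \<longrightarrow> gen_bdd A (C * N) f"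
proof -
  obtain C where C: "C > 0" "\<And>f N x c r. \<lbrakk>bmo_bdd N f; 0 < N; 0 < r; norm (c - x) \<le> r\<rbrakk> \<Longrightarrow>
    norm (semigroup_op A (r ^ gen_order A) f x - ball_mean f c r) \<le> C * N * Y c r"
    using semigroup_op_near_mean[of A] by blast
  have "nint (ball c r) (\<lambda>x. f x - semigroup_op A (r ^ gen_order A) f x) \<le> ennreal ((1 + C * V) * N * X c r)"
    if f: "bmo_bdd N f" and N: "0 < N" and r: "0 < r" for f N c r
  proof -
    have fm: "f \<in> borel_measurable lebesgue" using f by (auto simp: bmo_bdd_def intro: locally_integrable_measurable)
    have sm: "semigroup_op A (r ^ gen_order A) f \<in> borel_measurable lebesgue"
      by (rule measurable_lebesgue_compose[OF borel_measurable_semigroup_op[OF fm]])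
    have "nint (ball c r) (\<lambda>x. f x - semigroup_op A (r ^ gen_order A) f x)
      \<le> nint (ball c r) (\<lambda>x. f x - ball_mean f c r) + nint (ball c r) (\<lambda>x. ball_mean f c r - semigroup_op A (r ^ gen_order A) f x)"
      using fm sm by (intro nint_triangle) auto
    also have "\<dots> \<le> ennreal (N * X c r) + ennreal (C * N * Y c r * (V * r ^ CARD('n)))"
      unfolding V_def
      using f r N C(1) C(2)[OF f N r] Y_pos[OF r, of c]
      by (intro add_mono nint_ball_le) (auto simp: bmo_bdd_def norm_minus_commute dist_norm less_imp_le)
    also have "\<dots> = ennreal (N * X c r + C * N * Y c r * (V * r ^ CARD('n)))"
      using N C(1) V_pos r X_pos[OF r, of c] Y_pos[OF r, of c] by (intro ennreal_plus[symmetric]) auto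
    also have "N * X c r + C * N * Y c r * (V * r ^ CARD('n)) = (1 + C * V) * N * X c r"
      unfolding X_eq_Y[OF r] by (simp add: algebra_simps)
    finally show ?thesis .
  qed
  then show ?thesis using C(1) V_pos by (intro exI[of _ "1 + C * V"]) (auto simp: gen_bdd_def add_pos_pos)
qed

lemma bmo_semigroup_growth:
  "\<exists>C>0. \<forall>f N x r R. bmo_bdd N f \<longrightarrow> 0 < N \<longrightarrow> 0 < r \<longrightarrow> r \<le> R \<longrightarrow>
    norm (semigroup_op A (R ^ gen_order A) f x - semigroup_op A (r ^ gen_order A) f x) \<le> C * N * Y x r * (R / r) powr \<beta>"
proof -
  obtain C where C: "C > 0" "\<And>f N x c r. \<lbrakk>bmo_bdd N f; 0 < N; 0 < r; norm (c - x) \<le> r\<rbrakk> \<Longrightarrow>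
    norm (semigroup_op A (r ^ gen_order A) f x - ball_mean f c r) \<le> C * N * Y c r"
    using semigroup_op_near_mean[of A] by blast
  obtain G where G: "G > 0" "\<And>f N x r R. \<lbrakk>bmo_bdd N f; 0 < N; 0 < r; r \<le> R\<rbrakk> \<Longrightarrow>
    norm (ball_mean f x R - ball_mean f x r) \<le> G * N * Y x r * (R / r) powr \<beta>"
    using ball_mean_growth by blast
  have "norm (semigroup_op A (R ^ gen_order A) f x - semigroup_op A (r ^ gen_order A) f x) \<le> (C * D + G + C) * N * Y x r * (R / r) powr \<beta>"
    if f: "bmo_bdd N f" and N: "0 < N" and r: "0 < r" and R: "r \<le> R" for f N x r R
  proof -
    let ?S = "\<lambda>r. semigroup_op A (r ^ gen_order A) f x" and ?m = "ball_mean f x"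
    have R0: "R > 0" using r R by simp
    have "norm (?S R - ?m R) \<le> C * N * (D * Y x r * (R / r) powr \<beta>)"
    proof -
      have "norm (?S R - ?m R) \<le> C * N * Y x R" using R0 by (intro C(2)[OF f N R0]) simp
      also have "\<dots> \<le> C * N * (D * Y x r * (R / r) powr \<beta>)" using C(1) N by (intro mult_left_mono Y_grow[OF r R]) auto
      finally show ?thesis .
    qed
    moreover have "norm (?m R - ?m r) \<le> G * N * Y x r * (R / r) powr \<beta>" by (rule G(2)[OF f N r R])
    moreover have "norm (?S r - ?m r) \<le> C * N * Y x r * (R / r) powr \<beta>"
    proof -
      have "norm (?S r - ?m r) \<le> C * N * Y x r * 1" using C(2)[OF f N r, of x x] r by simp
      also have "\<dots> \<le> C * N * Y x r * (R / r) powr \<beta>"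
        using C(1) N Y_pos[OF r, of x] r R beta by (intro mult_left_mono ge_one_powr_ge_zero) auto
      finally show ?thesis .
    qed
    moreover have "norm (?S R - ?S r) \<le> norm (?S R - ?m R) + norm (?m R - ?m r) + norm (?S r - ?m r)"
    proof -
      have "?S R - ?S r = (?S R - ?m R) + (?m R - ?m r) + (?m r - ?S r)" by simp
      then show ?thesis
        by (metis add_right_mono norm_minus_commute norm_triangle_ineq norm_triangle_le order_trans)
    qed
    ultimately have "norm (?S R - ?S r) \<le> C * N * (D * Y x r * (R / r) powr \<beta>) + G * N * Y x r * (R / r) powr \<beta> + C * N * Y x r * (R / r) powr \<beta>"
      by linarith
    then show ?thesis by (simp add: algebra_simps)
  qed
  then show ?thesis using C(1) G(1) D_pos by (intro exI[of _ "C * D + G + C"]) (auto intro!: add_pos_pos)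
qed

text \<open>The time s^m and the scale r of the majorant are decoupled. This freedom is essential
  for time increments shorter than the current time.\<close>

lemma gen_imp_mint:
  "\<exists>C>0. \<forall>f N x s r. f \<in> borel_measurable lebesgue \<longrightarrow> gen_bdd A N f \<longrightarrow> 0 < N \<longrightarrow> 0 < s \<longrightarrow> s \<le> r \<longrightarrow>
    mint r x (\<lambda>y. f y - semigroup_op A (s ^ gen_order A) f y) \<le> ennreal (C * N * Y x r)"
proof -
  obtain C where C: "C > 0" "\<And>(u :: real^'n \<Rightarrow> ennreal) N s r x. \<lbrakk>u \<in> borel_measurable lebesgue; 0 < N; 0 < s; s \<le> r;
    \<forall>y. (\<integral>\<^sup>+z\<in>ball y s. u z \<partial>lebesgue) \<le> ennreal (N * X y s)\<rbrakk> \<Longrightarrow>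
    (\<integral>\<^sup>+y. ennreal (maj r (x - y)) * u y \<partial>lebesgue) \<le> ennreal (C * N * Y x r)"
    using maj_covering by blast
  have "mint r x (\<lambda>y. f y - semigroup_op A (s ^ gen_order A) f y) \<le> ennreal (C * N * Y x r)"
    if fm: "f \<in> borel_measurable lebesgue" and g: "gen_bdd A N f" and "0 < N" and s: "0 < s" and "s \<le> r" for f N x s r
  proof (rule C(2))
    have "semigroup_op A (s ^ gen_order A) f \<in> borel_measurable lebesgue"
      by (rule measurable_lebesgue_compose[OF borel_measurable_semigroup_op[OF fm]])
    then show "(\<lambda>y. ennreal (norm (f y - semigroup_op A (s ^ gen_order A) f y))) \<in> borel_measurable lebesgue"
      using fm by measurable
    show "\<forall>y. nint (ball y s) (\<lambda>y. f y - semigroup_op A (s ^ gen_order A) f y) \<le> ennreal (N * X y s)"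
      using g s by (simp add: gen_bdd_def)
  qed fact+
  then show ?thesis using C(1) by blast
qed

lemma gen_diff_in_dom_class:
  assumes "f \<in> borel_measurable lebesgue" "gen_bdd A N f" "0 < N" "0 < s"
  shows "(\<lambda>y. f y - semigroup_op A (s ^ gen_order A) f y) \<in> dom_class A'"
proof -
  obtain C where C: "\<And>f N x s r. \<lbrakk>f \<in> borel_measurable lebesgue; gen_bdd A N f; 0 < N; 0 < s; s \<le> r\<rbrakk> \<Longrightarrow>
    mint r x (\<lambda>y. f y - semigroup_op A (s ^ gen_order A) f y) \<le> ennreal (C * N * Y x r)"
    using gen_imp_mint[of A] by blast
  show ?thesis
  proof (rule dom_classI_maj[OF _ assms(4), of _ 0])
    have "semigroup_op A (s ^ gen_order A) f \<in> borel_measurable lebesgue"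
      by (rule measurable_lebesgue_compose[OF borel_measurable_semigroup_op[OF assms(1)]])
    then show "(\<lambda>y. f y - semigroup_op A (s ^ gen_order A) f y) \<in> borel_measurable lebesgue" using assms(1) by measurable
    show "mint s 0 (\<lambda>y. f y - semigroup_op A (s ^ gen_order A) f y) < \<infinity>"
      using C[OF assms order_refl, of 0] by (auto intro: le_less_trans)
  qed
qed

end

section \<open>Comparison with the maximal norm\<close>

context ball_gauge
begin

lemma gen_imp_max:
  "\<exists>C>0. \<forall>f N x r. f \<in> borel_measurable lebesgue \<longrightarrow> gen_bdd A N f \<longrightarrow> 0 < N \<longrightarrow> 0 < r \<longrightarrow>
    semigroup_nn A (r ^ gen_order A) (\<lambda>y. norm (f y - semigroup_op A (r ^ gen_order A) f y)) x \<le> ennreal (C * N * Y x r)"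
proof -
  obtain C where C: "C > 0" "\<And>f N x s r. \<lbrakk>f \<in> borel_measurable lebesgue; gen_bdd A N f; 0 < N; 0 < s; s \<le> r\<rbrakk> \<Longrightarrow>
    mint r x (\<lambda>y. f y - semigroup_op A (s ^ gen_order A) f y) \<le> ennreal (C * N * Y x r)"
    using gen_imp_mint[of A] by blast
  obtain K where K: "K > 0" "\<And>r x y::real^'n. r > 0 \<Longrightarrow> kernel A (r ^ gen_order A) x y \<le> K * maj r (x - y)"
    using kernel_le_maj[of A, where 'n = 'n] by blast
  have "semigroup_nn A (r ^ gen_order A) (\<lambda>y. norm (f y - semigroup_op A (r ^ gen_order A) f y)) x \<le> ennreal (K * C * N * Y x r)"
    if fm: "f \<in> borel_measurable lebesgue" and g: "gen_bdd A N f" and N: "0 < N" and r: "0 < r" for f N x r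
  proof -
    let ?g = "\<lambda>y. f y - semigroup_op A (r ^ gen_order A) f y"
    have "semigroup_op A (r ^ gen_order A) f \<in> borel_measurable lebesgue"
      by (rule measurable_lebesgue_compose[OF borel_measurable_semigroup_op[OF fm]])
    then have gm: "?g \<in> borel_measurable lebesgue" using fm by measurable
    have "semigroup_nn A (r ^ gen_order A) (\<lambda>y. norm (?g y)) x \<le> (\<integral>\<^sup>+y. ennreal K * (ennreal (maj r (x - y)) * ennreal (norm (?g y))) \<partial>lebesgue)"
      unfolding semigroup_nn_def
    proof (rule nn_integral_mono)
      fix y
      have "kernel A (r ^ gen_order A) x y * norm (?g y) \<le> K * maj r (x - y) * norm (?g y)"
        by (intro mult_right_mono K r) simp
      then have "ennreal (kernel A (r ^ gen_order A) x y * norm (?g y)) \<le> ennreal (K * (maj r (x - y) * norm (?g y)))"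
        by (intro ennreal_leI) (simp only: mult.assoc)
      also have "\<dots> = ennreal K * (ennreal (maj r (x - y)) * ennreal (norm (?g y)))"
        using K(1) maj_pos[OF r, of "x - y"] by (simp only: ennreal_mult mult_nonneg_nonneg norm_ge_zero less_imp_le)
      finally show "ennreal (kernel A (r ^ gen_order A) x y * norm (?g y)) \<le> \<dots>" .
    qed
    also have "\<dots> = ennreal K * mint r x ?g"
      by (intro nn_integral_cmult borel_measurable_maj_mult_norm gm)
    also have "\<dots> \<le> ennreal K * ennreal (C * N * Y x r)"
      by (intro mult_left_mono C fm g N r) auto
    also have "\<dots> = ennreal (K * (C * N * Y x r))"
      using K(1) C(1) N Y_pos[OF r, of x] by (intro ennreal_mult[symmetric]) auto
    finally show ?thesis by (simp only: mult.assoc)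
  qed
  then show ?thesis using C(1) K(1) by (intro exI[of _ "K * C"]) (auto simp: mult.assoc)
qed

text \<open>On the ball of radius r the kernel at time r^m centred at c is at least a constant over
  r^n, so the value at c of the semigroup controls the integral over the ball.\<close>

lemma max_imp_gen:
  "\<exists>C>0. \<forall>f N. f \<in> borel_measurable lebesgue \<longrightarrow> 0 < N \<longrightarrow>
    (\<forall>x. \<forall>r>0. semigroup_nn A (r ^ gen_order A) (\<lambda>y. norm (f y - semigroup_op A (r ^ gen_order A) f y)) x \<le> ennreal (N * Y x r)) \<longrightarrow>
    gen_bdd A (C * N) f"
proof -
  obtain k where k: "k > 0" "\<And>r x y::real^'n. r > 0 \<Longrightarrow> norm (x - y) \<le> r \<Longrightarrow> k / r ^ CARD('n) \<le> kernel A (r ^ gen_order A) x y"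
    using kernel_ge[of A, where 'n = 'n] by blast
  have "nint (ball c r) (\<lambda>x. f x - semigroup_op A (r ^ gen_order A) f x) \<le> ennreal (1 / k * N * X c r)"
    if fm: "f \<in> borel_measurable lebesgue" and N: "0 < N" and r: "r > 0"
      and b: "\<forall>x. \<forall>r>0. semigroup_nn A (r ^ gen_order A) (\<lambda>y. norm (f y - semigroup_op A (r ^ gen_order A) f y)) x \<le> ennreal (N * Y x r)"
    for f N c r
  proof -
    let ?g = "\<lambda>y. f y - semigroup_op A (r ^ gen_order A) f y"
    have "semigroup_op A (r ^ gen_order A) f \<in> borel_measurable lebesgue"
      by (rule measurable_lebesgue_compose[OF borel_measurable_semigroup_op[OF fm]])
    then have gm: "?g \<in> borel_measurable lebesgue" using fm by measurable
    have "nint (ball c r) ?g \<le> (\<integral>\<^sup>+y. ennreal (r ^ CARD('n) / k) * ennreal (kernel A (r ^ gen_order A) c y * norm (?g y)) \<partial>lebesgue)"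
    proof (rule nn_integral_mono)
      fix y
      show "ennreal (norm (?g y)) * indicator (ball c r) y \<le> ennreal (r ^ CARD('n) / k) * ennreal (kernel A (r ^ gen_order A) c y * norm (?g y))"
      proof (cases "y \<in> ball c r")
        case True
        then have "k / r ^ CARD('n) \<le> kernel A (r ^ gen_order A) c y"
          using r by (intro k) (auto simp: dist_norm)
        then have "r ^ CARD('n) / k * (k / r ^ CARD('n)) \<le> r ^ CARD('n) / k * kernel A (r ^ gen_order A) c y"
          using r k(1) by (intro mult_left_mono) auto
        moreover have "r ^ CARD('n) / k * (k / r ^ CARD('n)) = 1" using r k(1) by simp
        ultimately have "1 * norm (?g y) \<le> r ^ CARD('n) / k * kernel A (r ^ gen_order A) c y * norm (?g y)"
          by (intro mult_right_mono) auto
        then have "ennreal (norm (?g y)) \<le> ennreal (r ^ CARD('n) / k * (kernel A (r ^ gen_order A) c y * norm (?g y)))"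
          by (intro ennreal_leI) (simp only: mult.assoc mult_1_left)
        also have "\<dots> = ennreal (r ^ CARD('n) / k) * ennreal (kernel A (r ^ gen_order A) c y * norm (?g y))"
          using r k(1) by (intro ennreal_mult mult_nonneg_nonneg kernel_nonneg) auto
        finally show ?thesis using True by simp
      qed simp
    qed
    also have "\<dots> = ennreal (r ^ CARD('n) / k) * semigroup_nn A (r ^ gen_order A) (\<lambda>y. norm (?g y)) c"
      unfolding semigroup_nn_def
    proof (rule nn_integral_cmult)
      have "(\<lambda>y. norm (?g y)) \<in> borel_measurable lebesgue" using gm by measurable
      then show "(\<lambda>y. ennreal (kernel A (r ^ gen_order A) c y * norm (?g y))) \<in> borel_measurable lebesgue"
        by (intro measurable_compose[OF _ measurable_ennreal] borel_measurable_times borel_measurable_kernel_lebesgue)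
    qed
    also have "\<dots> \<le> ennreal (r ^ CARD('n) / k) * ennreal (N * Y c r)"
      using b r by (intro mult_left_mono) auto
    also have "\<dots> = ennreal (r ^ CARD('n) / k * (N * Y c r))"
      using r k(1) N Y_pos[OF r, of c] by (intro ennreal_mult[symmetric]) auto
    also have "r ^ CARD('n) / k * (N * Y c r) = 1 / k * N * X c r" unfolding X_eq_Y[OF r] by simp
    finally show ?thesis .
  qed
  then show ?thesis using k(1) by (intro exI[of _ "1 / k"]) (auto simp: gen_bdd_def)
qed

lemma root_gen_order_power: "t > 0 \<Longrightarrow> root (gen_order A) t ^ gen_order A = t"
  by (cases A) (auto intro: real_root_pow_pos2)

lemma gen_order_pos: "gen_order A > 0"
  by (cases A) auto

lemma filterlim_root_gen_order: "filterlim (\<lambda>j::nat. root (gen_order A) (real j)) at_top sequentially"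
  unfolding filterlim_at_top
proof
  fix Z :: real
  obtain M :: nat where M: "max Z 1 ^ gen_order A \<le> real M" using real_arch_simple by blast
  show "eventually (\<lambda>j. Z \<le> root (gen_order A) (real j)) sequentially"
  proof (rule eventually_sequentiallyI[of M])
    fix j assume "M \<le> j"
    then have "max Z 1 ^ gen_order A \<le> real j" using M by linarith
    then have "root (gen_order A) (max Z 1 ^ gen_order A) \<le> root (gen_order A) (real j)"
      using gen_order_pos by (intro real_root_le_mono) auto
    then show "Z \<le> root (gen_order A) (real j)"
      using gen_order_pos[of A] by (simp add: real_root_power_cancel)
  qed
qed

section \<open>The limit of A_t f - A_t f(0)\<close>

text \<open>By the semigroup law A_{\<rho>^m} f - A_{T'} f = A_{\<rho>^m} (f - A_{s^m} f) with s^m =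
  T' - \<rho>^m. The Lipschitz estimate at scale \<rho> supplies the factor |x - x'| / \<rho>, and f
  - A_{s^m} f has a majorant integral of order Y(x, \<rho>).\<close>

lemma semigroup_difference_step:
  "\<exists>C>0. \<forall>f N x x' \<rho> T'. f \<in> dom_class A \<longrightarrow> gen_bdd A N f \<longrightarrow> 0 < N \<longrightarrow> 0 < \<rho> \<longrightarrow> norm (x - x') \<le> \<rho> \<longrightarrow>
    \<rho> ^ gen_order A \<le> T' \<longrightarrow> T' \<le> 2 * \<rho> ^ gen_order A \<longrightarrow>
    norm ((semigroup_op A T' f x - semigroup_op A T' f x')
      - (semigroup_op A (\<rho> ^ gen_order A) f x - semigroup_op A (\<rho> ^ gen_order A) f x')) \<le> C * N * norm (x - x') * (Y x \<rho> / \<rho>)"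
proof -
  obtain C where C: "C > 0" "\<And>f N x s r. \<lbrakk>f \<in> borel_measurable lebesgue; gen_bdd A N f; 0 < N; 0 < s; s \<le> r\<rbrakk> \<Longrightarrow>
    mint r x (\<lambda>y. f y - semigroup_op A (s ^ gen_order A) f y) \<le> ennreal (C * N * Y x r)"
    using gen_imp_mint[of A] by blast
  obtain L where L: "L > 0" "\<And>r (f :: real^'n \<Rightarrow> complex) x x'. \<lbrakk>r > 0; f \<in> dom_class A; norm (x - x') \<le> r\<rbrakk> \<Longrightarrow>
     ennreal (norm (semigroup_op A (r ^ gen_order A) f x - semigroup_op A (r ^ gen_order A) f x')) \<le> ennreal (L * (norm (x - x') / r)) * mint r x f"
    using semigroup_op_Lipschitz[of A, where 'n = 'n] by blast
  let ?m = "gen_order A"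
  have "norm ((semigroup_op A T' f x - semigroup_op A T' f x')
      - (semigroup_op A (\<rho> ^ ?m) f x - semigroup_op A (\<rho> ^ ?m) f x')) \<le> L * C * N * norm (x - x') * (Y x \<rho> / \<rho>)"
    if f: "f \<in> dom_class A" and g: "gen_bdd A N f" and N: "0 < N" and \<rho>: "0 < \<rho>" and xx: "norm (x - x') \<le> \<rho>"
      and T: "\<rho> ^ ?m \<le> T'" "T' \<le> 2 * \<rho> ^ ?m" for f N x x' \<rho> T'
  proof (cases "T' = \<rho> ^ ?m")
    case True
    then show ?thesis using L(1) C(1) N Y_pos[OF \<rho>, of x] \<rho> by simp
  next
    case False
    \<comment> \<open>The restriction T' \<le> 2 \<rho>^m enters here: it gives s \<le> \<rho>, as
      required for the majorant bound at scale \<rho>.\<close>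
    define s where "s = root ?m (T' - \<rho> ^ ?m)"
    have Tp: "T' - \<rho> ^ ?m > 0" using False T by simp
    have sm: "s ^ ?m = T' - \<rho> ^ ?m" unfolding s_def by (rule root_gen_order_power[OF Tp])
    have m0: "?m > 0" by (cases A) auto
    have s: "s > 0" unfolding s_def using Tp m0 by simp
    have s\<rho>: "s \<le> \<rho>"
    proof -
      have "s ^ ?m \<le> \<rho> ^ ?m" using T sm by simp
      then show ?thesis using \<rho> s m0 by (simp add: power_mono_iff)
    qed
    let ?g = "\<lambda>y. f y - semigroup_op A (s ^ ?m) f y"
    have fm: "f \<in> borel_measurable lebesgue" by (rule dom_class_measurable[OF f])
    have gd: "?g \<in> dom_class A" by (rule gen_diff_in_dom_class[OF fm g N s])
    have \<rho>m: "\<rho> ^ ?m > 0" using \<rho> by simp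
    have eq: "semigroup_op A (\<rho> ^ ?m) ?g z = semigroup_op A (\<rho> ^ ?m) f z - semigroup_op A T' f z" for z
      using semigroup_op_diff_semigroup_op[OF f \<rho>m, of "s ^ ?m" z] Tp by (simp add: sm)
    have "norm ((semigroup_op A T' f x - semigroup_op A T' f x') - (semigroup_op A (\<rho> ^ ?m) f x - semigroup_op A (\<rho> ^ ?m) f x'))
      = norm (semigroup_op A (\<rho> ^ ?m) ?g x - semigroup_op A (\<rho> ^ ?m) ?g x')"
      unfolding eq by (subst norm_minus_commute) (simp add: algebra_simps)
    also have "ennreal \<dots> \<le> ennreal (L * (norm (x - x') / \<rho>)) * mint \<rho> x ?g" by (rule L(2)[OF \<rho> gd xx])
    also have "\<dots> \<le> ennreal (L * (norm (x - x') / \<rho>)) * ennreal (C * N * Y x \<rho>)"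
      by (intro mult_left_mono C(2)[OF fm g N s s\<rho>]) simp
    also have "\<dots> = ennreal (L * (norm (x - x') / \<rho>) * (C * N * Y x \<rho>))"
      using L(1) C(1) N Y_pos[OF \<rho>, of x] \<rho> by (intro ennreal_mult[symmetric]) auto
    also have "L * (norm (x - x') / \<rho>) * (C * N * Y x \<rho>) = L * C * N * norm (x - x') * (Y x \<rho> / \<rho>)" by simp
    finally show ?thesis
      using L(1) C(1) N Y_pos[OF \<rho>, of x] \<rho> by (subst (asm) ennreal_le_iff) auto
  qed
  then show ?thesis using C(1) L(1) by (intro exI[of _ "L * C"]) auto
qed

text \<open>A step starting at time S = \<sigma>^m costs Y(x, \<sigma>) / \<sigma>, hence at most a
  multiple of \<sigma>^(\<beta> - 1) = S^(- \<gamma>). As \<beta> < 1, the dyadic steps are summable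
  and all later times cost no more than a multiple of the first step.\<close>

lemma semigroup_difference:
  "\<exists>C>0. \<forall>f N x x' \<rho> T'. f \<in> dom_class A \<longrightarrow> gen_bdd A N f \<longrightarrow> 0 < N \<longrightarrow> 0 < \<rho> \<longrightarrow> norm (x - x') \<le> \<rho> \<longrightarrow>
    \<rho> ^ gen_order A \<le> T' \<longrightarrow>
    norm ((semigroup_op A T' f x - semigroup_op A T' f x')
      - (semigroup_op A (\<rho> ^ gen_order A) f x - semigroup_op A (\<rho> ^ gen_order A) f x')) \<le> C * N * norm (x - x') * (Y x \<rho> / \<rho>)"
proof -
  let ?m = "gen_order A"
  obtain C where C: "C > 0" "\<And>f N x x' \<rho> T'. \<lbrakk>f \<in> dom_class A; gen_bdd A N f; 0 < N; 0 < \<rho>; norm (x - x') \<le> \<rho>;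
    \<rho> ^ ?m \<le> T'; T' \<le> 2 * \<rho> ^ ?m\<rbrakk> \<Longrightarrow>
    norm ((semigroup_op A T' f x - semigroup_op A T' f x')
      - (semigroup_op A (\<rho> ^ ?m) f x - semigroup_op A (\<rho> ^ ?m) f x')) \<le> C * N * norm (x - x') * (Y x \<rho> / \<rho>)"
    using semigroup_difference_step[of A] by blast
  have m0: "?m > 0" by (cases A) auto
  define \<gamma> where "\<gamma> = (1 - \<beta>) / real ?m"
  have \<gamma>: "\<gamma> > 0" using beta m0 by (simp add: \<gamma>_def)
  define q where "q = 1 / (1 - 2 powr (- \<gamma>))"
  have q: "q > 0" unfolding q_def using \<gamma> powr_less_one[of 2 "- \<gamma>"] by simp
  have "norm ((semigroup_op A T' f x - semigroup_op A T' f x')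
      - (semigroup_op A (\<rho> ^ ?m) f x - semigroup_op A (\<rho> ^ ?m) f x')) \<le> q * C * D * N * norm (x - x') * (Y x \<rho> / \<rho>)"
    if f: "f \<in> dom_class A" and g: "gen_bdd A N f" and N: "0 < N" and \<rho>: "0 < \<rho>" and xx: "norm (x - x') \<le> \<rho>"
      and T: "\<rho> ^ ?m \<le> T'" for f N x x' \<rho> T'
  proof -
    define d where "d T = semigroup_op A T f x - semigroup_op A T f x'" for T
    have pw: "(\<sigma> ^ ?m) powr (- \<gamma>) = \<sigma> powr (\<beta> - 1)" if "\<sigma> > 0" for \<sigma> :: real
    proof -
      have "\<sigma> ^ ?m = \<sigma> powr real ?m" using that by (simp add: powr_realpow)
      then have "(\<sigma> ^ ?m) powr (- \<gamma>) = \<sigma> powr (real ?m * (- \<gamma>))" by (simp only: powr_powr)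
      also have "real ?m * (- \<gamma>) = \<beta> - 1" using m0 by (simp add: \<gamma>_def)
      finally show ?thesis .
    qed
    define a where "a = C * N * norm (x - x') * D * (Y x \<rho> / \<rho> powr \<beta>)"
    have a: "a \<ge> 0" using C(1) N D_pos Y_pos[OF \<rho>, of x] by (simp add: a_def)
    have \<rho>m: "\<rho> ^ ?m > 0" using \<rho> by simp
    have "norm (d T' - d (\<rho> ^ ?m)) \<le> q * a * (\<rho> ^ ?m) powr (- \<gamma>)"
      unfolding q_def
    proof (rule dyadic_decay[OF \<gamma> \<rho>m a order_refl T])
      fix S S' assume S: "\<rho> ^ ?m \<le> S" "S \<le> S'" "S' \<le> 2 * S"
      define \<sigma> where "\<sigma> = root ?m S"
      have S0: "S > 0" using S \<rho>m by simp
      have \<sigma>m: "\<sigma> ^ ?m = S" unfolding \<sigma>_def by (rule root_gen_order_power[OF S0])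
      have \<sigma>: "\<sigma> > 0" unfolding \<sigma>_def using S0 m0 by simp
      have \<rho>\<sigma>: "\<rho> \<le> \<sigma>"
      proof -
        have "\<rho> ^ ?m \<le> \<sigma> ^ ?m" using S \<sigma>m by simp
        then show ?thesis using \<rho> \<sigma> m0 by (simp add: power_mono_iff)
      qed
      have "norm (d S' - d S) \<le> C * N * norm (x - x') * (Y x \<sigma> / \<sigma>)"
        unfolding d_def \<sigma>m[symmetric] using S \<sigma>m \<rho>\<sigma> xx by (intro C(2)[OF f g N \<sigma>]) auto
      also have "\<dots> \<le> C * N * norm (x - x') * (D * Y x \<rho> * (\<sigma> / \<rho>) powr \<beta> / \<sigma>)"
        using C(1) N \<sigma> by (intro mult_left_mono divide_right_mono Y_grow[OF \<rho> \<rho>\<sigma>]) auto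
      also have "\<dots> = a * (\<sigma> powr \<beta> / \<sigma>)"
        using \<rho> \<sigma> by (simp add: a_def powr_divide)
      also have "\<sigma> powr \<beta> / \<sigma> = S powr (- \<gamma>)"
        unfolding \<sigma>m[symmetric] pw[OF \<sigma>] using \<sigma> by (simp add: powr_diff)
      finally show "norm (d S' - d S) \<le> a * S powr (- \<gamma>)" .
    qed
    also have "q * a * (\<rho> ^ ?m) powr (- \<gamma>) = q * C * D * N * norm (x - x') * (Y x \<rho> / \<rho>)"
      unfolding pw[OF \<rho>] a_def using \<rho> by (simp add: powr_diff)
    finally show ?thesis unfolding d_def .
  qed
  then show ?thesis using C(1) q D_pos by (intro exI[of _ "q * C * D"]) auto
qed

lemma Y_over_radius_tendsto: "((\<lambda>\<rho>. Y x \<rho> / \<rho>) \<longlongrightarrow> 0) at_top"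
proof (rule tendsto_sandwich[where f = "\<lambda>_. 0"])
  show "eventually (\<lambda>\<rho>. 0 \<le> Y x \<rho> / \<rho>) at_top"
    using eventually_gt_at_top[of 0] by eventually_elim (simp add: Y_pos less_imp_le)
  show "eventually (\<lambda>\<rho>. Y x \<rho> / \<rho> \<le> D * Y x 1 * \<rho> powr (\<beta> - 1)) at_top"
    using eventually_ge_at_top[of 1]
  proof eventually_elim
    case (elim \<rho>)
    then have "Y x \<rho> \<le> D * Y x 1 * (\<rho> / 1) powr \<beta>" by (intro Y_grow) auto
    then show ?case using elim by (simp add: powr_diff divide_right_mono)
  qed
  have "((\<lambda>\<rho>. \<rho> powr (\<beta> - 1)) \<longlongrightarrow> 0) at_top"
    using beta by (intro tendsto_neg_powr filterlim_ident) auto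
  then show "((\<lambda>\<rho>. D * Y x 1 * \<rho> powr (\<beta> - 1)) \<longlongrightarrow> 0) at_top"
    using tendsto_mult_right_zero by blast
qed simp

lemma Y_over_radius_tendsto': "((\<lambda>\<rho>. K * (Y x \<rho> / \<rho>)) \<longlongrightarrow> 0) at_top"
  using tendsto_mult_right_zero[OF Y_over_radius_tendsto] by blast

text \<open>Integer times are enough, because \<open>semigroup_difference\<close> controls every
  later time uniformly. The value of \<open>lim\<close> is meaningful for f in the domain with
  \<open>gen_bdd\<close>, where the sequence is Cauchy. The limit is normalized to vanish at
  0.\<close>

definition limit_fun :: "generator \<Rightarrow> (real^'n \<Rightarrow> complex) \<Rightarrow> real^'n \<Rightarrow> complex" where
  "limit_fun A f x = lim (\<lambda>j::nat. semigroup_op A (real j) f x - semigroup_op A (real j) f 0)"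

lemma limit_fun_tendsto:
  assumes f: "f \<in> dom_class A" and g: "gen_bdd A N f" and N: "0 < N"
  shows "(\<lambda>j::nat. semigroup_op A (real j) f x - semigroup_op A (real j) f 0) \<longlonglongrightarrow> limit_fun A f x"
proof -
  let ?m = "gen_order A"
  obtain C where C: "C > 0" "\<And>f N x x' \<rho> T'. \<lbrakk>f \<in> dom_class A; gen_bdd A N f; 0 < N; 0 < \<rho>; norm (x - x') \<le> \<rho>;
    \<rho> ^ ?m \<le> T'\<rbrakk> \<Longrightarrow>
    norm ((semigroup_op A T' f x - semigroup_op A T' f x')
      - (semigroup_op A (\<rho> ^ ?m) f x - semigroup_op A (\<rho> ^ ?m) f x')) \<le> C * N * norm (x - x') * (Y x \<rho> / \<rho>)"
    using semigroup_difference[of A] by blast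
  let ?d = "\<lambda>T. semigroup_op A T f x - semigroup_op A T f 0"
  have "Cauchy (\<lambda>j::nat. ?d (real j))"
  proof (rule metric_CauchyI)
    fix e :: real assume e: "e > 0"
    have "eventually (\<lambda>\<rho>. C * N * norm (x - 0) * (Y x \<rho> / \<rho>) < e / 2) at_top"
      using Y_over_radius_tendsto'[of "C * N * norm (x - 0)" x] e by (intro order_tendstoD) auto
    then have "eventually (\<lambda>\<rho>. C * N * norm (x - 0) * (Y x \<rho> / \<rho>) < e / 2 \<and> \<rho> > 0 \<and> \<rho> \<ge> norm (x - 0)) at_top"
      using eventually_gt_at_top[of 0] eventually_ge_at_top[of "norm (x - 0)"] by eventually_elim simp
    then obtain \<rho> where \<rho>: "C * N * norm (x - 0) * (Y x \<rho> / \<rho>) < e / 2" "\<rho> > 0" "norm (x - 0) \<le> \<rho>"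
      using eventually_happens'[OF trivial_limit_at_top_linorder] by blast
    obtain M :: nat where M: "\<rho> ^ ?m \<le> real M" using real_arch_simple by blast
    have b: "norm (?d (real j) - ?d (\<rho> ^ ?m)) < e / 2" if "j \<ge> M" for j
    proof -
      have "\<rho> ^ ?m \<le> real j" using M that by linarith
      from C(2)[OF f g N \<rho>(2,3) this] \<rho>(1) show ?thesis by linarith
    qed
    show "\<exists>M. \<forall>m\<ge>M. \<forall>n\<ge>M. dist (?d (real m)) (?d (real n)) < e"
    proof (intro exI[of _ M] allI impI)
      fix i j assume "M \<le> i" "M \<le> j"
      then show "dist (?d (real i)) (?d (real j)) < e"
        using b[of i] b[of j] dist_triangle_half_l[of "?d (real i)" "?d (\<rho> ^ ?m)" e "?d (real j)"] unfolding dist_norm by blast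
    qed
  qed
  then show ?thesis
    unfolding limit_fun_def using Cauchy_convergent_iff convergent_LIMSEQ_iff by blast
qed

lemma limit_fun_diff_tendsto:
  assumes f: "f \<in> dom_class A" and g: "gen_bdd A N f" and N: "0 < N"
  shows "(\<lambda>j::nat. semigroup_op A (real j) f x - semigroup_op A (real j) f x') \<longlonglongrightarrow> limit_fun A f x - limit_fun A f x'"
  using tendsto_diff[OF limit_fun_tendsto[OF assms, of x] limit_fun_tendsto[OF assms, of x']] by simp

lemma limit_fun_approx:
  "\<exists>C>0. \<forall>f N x x' \<rho>. f \<in> dom_class A \<longrightarrow> gen_bdd A N f \<longrightarrow> 0 < N \<longrightarrow> 0 < \<rho> \<longrightarrow> norm (x - x') \<le> \<rho> \<longrightarrow>
    norm ((limit_fun A f x - limit_fun A f x')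
      - (semigroup_op A (\<rho> ^ gen_order A) f x - semigroup_op A (\<rho> ^ gen_order A) f x')) \<le> C * N * norm (x - x') * (Y x \<rho> / \<rho>)"
proof -
  let ?m = "gen_order A"
  obtain C where C: "C > 0" "\<And>f N x x' \<rho> T'. \<lbrakk>f \<in> dom_class A; gen_bdd A N f; 0 < N; 0 < \<rho>; norm (x - x') \<le> \<rho>;
    \<rho> ^ ?m \<le> T'\<rbrakk> \<Longrightarrow>
    norm ((semigroup_op A T' f x - semigroup_op A T' f x')
      - (semigroup_op A (\<rho> ^ ?m) f x - semigroup_op A (\<rho> ^ ?m) f x')) \<le> C * N * norm (x - x') * (Y x \<rho> / \<rho>)"
    using semigroup_difference[of A] by blast
  have "norm ((limit_fun A f x - limit_fun A f x')
      - (semigroup_op A (\<rho> ^ ?m) f x - semigroup_op A (\<rho> ^ ?m) f x')) \<le> C * N * norm (x - x') * (Y x \<rho> / \<rho>)"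
    if f: "f \<in> dom_class A" and g: "gen_bdd A N f" and N: "0 < N" and \<rho>: "0 < \<rho>" "norm (x - x') \<le> \<rho>" for f N x x' \<rho>
  proof (rule tendsto_upperbound)
    show "(\<lambda>j::nat. norm ((semigroup_op A (real j) f x - semigroup_op A (real j) f x')
      - (semigroup_op A (\<rho> ^ ?m) f x - semigroup_op A (\<rho> ^ ?m) f x')))
      \<longlonglongrightarrow> norm ((limit_fun A f x - limit_fun A f x') - (semigroup_op A (\<rho> ^ ?m) f x - semigroup_op A (\<rho> ^ ?m) f x'))"
      by (intro tendsto_norm tendsto_diff[OF limit_fun_diff_tendsto[OF f g N] tendsto_const])
    obtain M :: nat where M: "\<rho> ^ ?m \<le> real M" using real_arch_simple by blast
    show "eventually (\<lambda>j. norm ((semigroup_op A (real j) f x - semigroup_op A (real j) f x')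
      - (semigroup_op A (\<rho> ^ ?m) f x - semigroup_op A (\<rho> ^ ?m) f x')) \<le> C * N * norm (x - x') * (Y x \<rho> / \<rho>)) sequentially"
    proof (rule eventually_sequentiallyI[of M])
      fix j assume "M \<le> j"
      then have "\<rho> ^ ?m \<le> real j" using M by linarith
      then show "norm ((semigroup_op A (real j) f x - semigroup_op A (real j) f x')
      - (semigroup_op A (\<rho> ^ ?m) f x - semigroup_op A (\<rho> ^ ?m) f x')) \<le> C * N * norm (x - x') * (Y x \<rho> / \<rho>)"
        by (rule C(2)[OF f g N \<rho>])
    qed
  qed simp
  then show ?thesis using C(1) by blast
qed

lemma borel_measurable_limit_fun:
  assumes f: "f \<in> dom_class A" and g: "gen_bdd A N f" and N: "0 < N"
  shows "limit_fun A f \<in> borel_measurable borel"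
proof (rule borel_measurable_LIMSEQ_metric)
  show "(\<lambda>x. semigroup_op A (real j) f x - semigroup_op A (real j) f 0) \<in> borel_measurable borel" for j
    using borel_measurable_semigroup_op[OF dom_class_measurable[OF f], of A "real j"] by measurable
  show "(\<lambda>j. semigroup_op A (real j) f x - semigroup_op A (real j) f 0) \<longlonglongrightarrow> limit_fun A f x" for x
    by (rule limit_fun_tendsto[OF assms])
qed

text \<open>On the ball around c the constant is a = A_t f(c) - h(c) with t = r^m. Then f - h - a is
  f - A_t f plus the error of replacing differences of h by differences of A_t f, which is at most a
  multiple of Y(c, r) on the whole ball.\<close>

lemma gen_imp_bmo_diff_limit:
  "\<exists>C>0. \<forall>f N. f \<in> dom_class A \<longrightarrow> gen_bdd A N f \<longrightarrow> 0 < N \<longrightarrow> bmo_bdd (C * N) (\<lambda>x. f x - limit_fun A f x)"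
proof -
  let ?m = "gen_order A"
  obtain C where C: "C > 0" "\<And>f N x x' \<rho>. \<lbrakk>f \<in> dom_class A; gen_bdd A N f; 0 < N; 0 < \<rho>; norm (x - x') \<le> \<rho>\<rbrakk> \<Longrightarrow>
    norm ((limit_fun A f x - limit_fun A f x')
      - (semigroup_op A (\<rho> ^ ?m) f x - semigroup_op A (\<rho> ^ ?m) f x')) \<le> C * N * norm (x - x') * (Y x \<rho> / \<rho>)"
    using limit_fun_approx[of A] by blast
  define K where "K = 1 + C * V"
  have K: "K > 0" using C(1) V_pos by (simp add: K_def add_pos_pos)
  have "bmo_bdd (2 * (K * N)) (\<lambda>x. f x - limit_fun A f x)"
    if f: "f \<in> dom_class A" and g: "gen_bdd A N f" and N: "0 < N" for f N
  proof (rule bmo_bddI)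
    have fm: "f \<in> borel_measurable lebesgue" by (rule dom_class_measurable[OF f])
    have hm: "limit_fun A f \<in> borel_measurable lebesgue"
      by (rule measurable_lebesgue_compose[OF borel_measurable_limit_fun[OF f g N]])
    show "(\<lambda>x. f x - limit_fun A f x) \<in> borel_measurable lebesgue" using fm hm by measurable
    show "K * N > 0" using K N by simp
    fix c :: "real^'n" and r :: real assume r: "r > 0"
    let ?S = "semigroup_op A (r ^ ?m) f" and ?h = "limit_fun A f"
    have sm: "?S \<in> borel_measurable lebesgue"
      by (rule measurable_lebesgue_compose[OF borel_measurable_semigroup_op[OF fm]])
    define a where "a = ?S c - ?h c"
    have "nint (ball c r) (\<lambda>x. f x - ?h x - a) = nint (ball c r) (\<lambda>x. f x - (?h x + a))"
      by (simp add: algebra_simps)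
    also have "\<dots> \<le> nint (ball c r) (\<lambda>x. f x - ?S x) + nint (ball c r) (\<lambda>x. ?S x - (?h x + a))"
      using fm sm hm by (intro nint_triangle) auto
    also have "\<dots> \<le> ennreal (N * X c r) + ennreal (C * N * Y c r * (V * r ^ CARD('n)))"
    proof (rule add_mono)
      show "nint (ball c r) (\<lambda>x. f x - ?S x) \<le> ennreal (N * X c r)" using g r by (simp add: gen_bdd_def)
      show "nint (ball c r) (\<lambda>x. ?S x - (?h x + a)) \<le> ennreal (C * N * Y c r * (V * r ^ CARD('n)))"
        unfolding V_def
      proof (rule nint_ball_le[OF r])
        show "0 \<le> C * N * Y c r" using C(1) N Y_pos[OF r, of c] by simp
        fix x assume "x \<in> ball c r"
        then have cx: "norm (c - x) \<le> r" by (simp add: dist_norm)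
        have "norm (?S x - (?h x + a)) = norm ((?h c - ?h x) - (?S c - ?S x))"
          by (simp add: a_def algebra_simps)
        also have "\<dots> \<le> C * N * norm (c - x) * (Y c r / r)" by (rule C(2)[OF f g N r cx])
        also have "\<dots> \<le> C * N * r * (Y c r / r)"
          using C(1) N Y_pos[OF r, of c] r cx by (intro mult_right_mono mult_left_mono) auto
        also have "\<dots> = C * N * Y c r" using r by simp
        finally show "norm (?S x - (?h x + a)) \<le> C * N * Y c r" .
      qed
    qed
    also have "\<dots> = ennreal (N * X c r + C * N * Y c r * (V * r ^ CARD('n)))"
      using N C(1) V_pos r X_pos[OF r, of c] Y_pos[OF r, of c] by (intro ennreal_plus[symmetric]) auto
    also have "N * X c r + C * N * Y c r * (V * r ^ CARD('n)) = K * N * X c r"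
      unfolding X_eq_Y[OF r] K_def by (simp add: algebra_simps)
    finally show "\<exists>a. nint (ball c r) (\<lambda>x. f x - ?h x - a) \<le> ennreal (K * N * X c r)" by blast
  qed
  then show ?thesis using K by (intro exI[of _ "2 * K"]) (auto simp: mult.assoc)
qed

lemma limit_fun_eq_0:
  assumes f: "f \<in> dom_class A" and g: "gen_bdd A N f" and N: "0 < N"
    and lim: "\<And>x. (\<lambda>j::nat. semigroup_op A (real j) f x - semigroup_op A (real j) f 0) \<longlonglongrightarrow> 0"
  shows "limit_fun A f = (\<lambda>_. 0)"
  using LIMSEQ_unique[OF limit_fun_tendsto[OF f g N] lim] by auto

text \<open>A purely qualitative bound N' suffices to show that the limit function is 0: A_j f(x) -
  A_j f(0) is the same with f replaced by f minus a mean, so the Lipschitz estimate bounds it by a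
  multiple of Y(x, \<rho>) / \<rho>, which tends to 0. The resulting bound depends on N
  only.\<close>

lemma gen_imp_bmo_bmo:
  "\<exists>C>0. \<forall>f N N'. bmo_bdd N' f \<longrightarrow> 0 < N' \<longrightarrow> gen_bdd A N f \<longrightarrow> 0 < N \<longrightarrow> bmo_bdd (C * N) f"
proof -
  let ?m = "gen_order A"
  have m0: "?m > 0" by (cases A) auto
  obtain C where C: "C > 0" "\<And>f N. \<lbrakk>f \<in> dom_class A; gen_bdd A N f; 0 < N\<rbrakk> \<Longrightarrow> bmo_bdd (C * N) (\<lambda>x. f x - limit_fun A f x)"
    using gen_imp_bmo_diff_limit[of A] by blast
  obtain L where L: "L > 0" "\<And>r (f :: real^'n \<Rightarrow> complex) x x'. \<lbrakk>r > 0; f \<in> dom_class A; norm (x - x') \<le> r\<rbrakk> \<Longrightarrow>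
     ennreal (norm (semigroup_op A (r ^ ?m) f x - semigroup_op A (r ^ ?m) f x')) \<le> ennreal (L * (norm (x - x') / r)) * mint r x f"
    using semigroup_op_Lipschitz[of A, where 'n = 'n] by blast
  obtain K where K: "K > 0" "\<And>f N x r. \<lbrakk>bmo_bdd N f; 0 < N; 0 < r\<rbrakk> \<Longrightarrow>
    mint r x (\<lambda>y. f y - ball_mean f x r) \<le> ennreal (K * N * Y x r)"
    using mint_bmo by blast
  have "bmo_bdd (C * N) f" if b: "bmo_bdd N' f" and N': "0 < N'" and g: "gen_bdd A N f" and N: "0 < N" for f N N'
  proof -
    have f: "f \<in> dom_class A" by (rule bmo_in_dom_class[OF b N'])
    have "limit_fun A f = (\<lambda>_. 0)"
    proof (rule limit_fun_eq_0[OF f g N])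
      fix x :: "real^'n"
      let ?\<rho> = "\<lambda>j::nat. root ?m (real j)"
      have lim\<rho>: "filterlim ?\<rho> at_top sequentially"
        by (rule filterlim_root_gen_order)
      show "(\<lambda>j::nat. semigroup_op A (real j) f x - semigroup_op A (real j) f 0) \<longlonglongrightarrow> 0"
      proof (rule Lim_null_comparison)
        show "(\<lambda>j. L * K * N' * norm x * (Y x (?\<rho> j) / ?\<rho> j)) \<longlonglongrightarrow> 0"
          by (rule filterlim_compose[OF Y_over_radius_tendsto' lim\<rho>])
        have "eventually (\<lambda>j. max 1 (norm x) \<le> ?\<rho> j) sequentially"
          using lim\<rho> unfolding filterlim_at_top by blast
        then show "eventually (\<lambda>j. norm (semigroup_op A (real j) f x - semigroup_op A (real j) f 0)
            \<le> L * K * N' * norm x * (Y x (?\<rho> j) / ?\<rho> j)) sequentially"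
        proof eventually_elim
          case (elim j)
          then have \<rho>: "?\<rho> j > 0" "norm (x - 0) \<le> ?\<rho> j" by auto
          then have j: "real j > 0" using m0 by (metis real_root_gt_0_iff)
          have \<rho>m: "?\<rho> j ^ ?m = real j" by (rule root_gen_order_power[OF j])
          let ?a = "ball_mean f x (?\<rho> j)"
          have d: "(\<lambda>y. f y - ?a) \<in> dom_class A" by (intro dom_class_diff f dom_class_const)
          have "semigroup_op A (real j) (\<lambda>y. f y - ?a) z = semigroup_op A (real j) f z - ?a" for z
            using semigroup_op_diff[OF f dom_class_const j, of ?a z] semigroup_op_const[OF j, of A ?a z] by simp
          then have "semigroup_op A (real j) f x - semigroup_op A (real j) f 0
            = semigroup_op A (real j) (\<lambda>y. f y - ?a) x - semigroup_op A (real j) (\<lambda>y. f y - ?a) 0" by simp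
          then have "ennreal (norm (semigroup_op A (real j) f x - semigroup_op A (real j) f 0))
            \<le> ennreal (L * (norm (x - 0) / ?\<rho> j)) * mint (?\<rho> j) x (\<lambda>y. f y - ?a)"
            using L(2)[OF \<rho>(1) d \<rho>(2)] unfolding \<rho>m by simp
          also have "\<dots> \<le> ennreal (L * (norm (x - 0) / ?\<rho> j)) * ennreal (K * N' * Y x (?\<rho> j))"
            by (intro mult_left_mono K(2)[OF b N' \<rho>(1)]) simp
          also have "\<dots> = ennreal (L * (norm (x - 0) / ?\<rho> j) * (K * N' * Y x (?\<rho> j)))"
            using L(1) K(1) N' Y_pos[OF \<rho>(1), of x] \<rho> by (intro ennreal_mult[symmetric]) auto
          also have "L * (norm (x - 0) / ?\<rho> j) * (K * N' * Y x (?\<rho> j)) = L * K * N' * norm x * (Y x (?\<rho> j) / ?\<rho> j)" by simp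
          finally show ?case
            using L(1) K(1) N' Y_pos[OF \<rho>(1), of x] \<rho>(1) by (subst (asm) ennreal_le_iff) auto
        qed
      qed
    qed
    then show ?thesis using C(2)[OF f g N] by simp
  qed
  then show ?thesis using C(1) by blast
qed

text \<open>The Lipschitz estimate leaves the integral of |f(y)| / (j + |x - y|)^(n + 1). The
  integrand decreases to 0 in j and is integrable for j = 1 by the domain condition, so dominated
  convergence applies. The extra factor 1 / j of the Lipschitz estimate cancels the factor j of the
  majorant.\<close>

lemma poisson_difference_tendsto:
  fixes f :: "real^'n \<Rightarrow> complex"
  assumes f: "f \<in> dom_class Sqrt_Laplacian"
  shows "(\<lambda>j::nat. semigroup_op Sqrt_Laplacian (real j) f x - semigroup_op Sqrt_Laplacian (real j) f 0) \<longlonglongrightarrow> 0"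
proof -
  let ?d = "CARD('n) + 1"
  have fm: "f \<in> borel_measurable lebesgue" by (rule dom_class_measurable[OF f])
  obtain L where L: "L > 0" "\<And>r (f :: real^'n \<Rightarrow> complex) x x'. \<lbrakk>r > 0; f \<in> dom_class Sqrt_Laplacian; norm (x - x') \<le> r\<rbrakk> \<Longrightarrow>
     ennreal (norm (semigroup_op Sqrt_Laplacian (r ^ gen_order Sqrt_Laplacian) f x - semigroup_op Sqrt_Laplacian (r ^ gen_order Sqrt_Laplacian) f x'))
     \<le> ennreal (L * (norm (x - x') / r)) * mint r x f"
    using semigroup_op_Lipschitz[of Sqrt_Laplacian, where 'n = 'n] by blast
  define u where "u j y = ennreal (maj (real j) (x - y) / real j) * ennreal (norm (f y))" for j :: nat and y
  have um: "u j \<in> borel_measurable lebesgue" for j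
  proof -
    have "(\<lambda>y. maj (real j) (x - y) / real j) \<in> borel_measurable lebesgue"
      by (rule measurable_lebesgue_compose) measurable
    moreover have "(\<lambda>y. norm (f y)) \<in> borel_measurable lebesgue" using fm by measurable
    ultimately show ?thesis unfolding u_def
      by (intro borel_measurable_times_ennreal measurable_compose[OF _ measurable_ennreal])
  qed
  have ueq: "maj (real j) z / real j = 1 / (real j + norm z) ^ ?d" if "j \<ge> 1" for j :: nat and z :: "real^'n"
    using that by (simp add: maj_def)
  have fin: "(\<integral>\<^sup>+y. ennreal (maj 1 (x - y)) * ennreal (norm (f y)) \<partial>lebesgue) < \<infinity>"
  proof -
    obtain C where C: "C > 0" "\<And>y. maj 1 (x - y) \<le> C * maj 1 (0 - y)"
      using maj_comparable[of 1 1 x 0] by auto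
    have le: "maj 1 (x - y) \<le> C * dom_weight Sqrt_Laplacian y" for y :: "real^'n"
    proof -
      have "1 + norm y ^ ?d \<le> (1 + norm y) ^ ?d" using one_plus_power_ge[of "norm y" "CARD('n)"] by simp
      then have "1 / (1 + norm y) ^ ?d \<le> inverse (1 + norm y ^ ?d)"
        unfolding inverse_eq_divide by (intro divide_left_mono mult_pos_pos add_norm_power_pos add_pos_nonneg zero_le_power) auto
      then have "maj 1 (0 - y) \<le> dom_weight Sqrt_Laplacian y"
        by (simp only: dom_weight.simps maj_def diff_0 norm_minus_cancel)
      then have "C * maj 1 (0 - y) \<le> C * dom_weight Sqrt_Laplacian y" using C(1) by (intro mult_left_mono) auto
      then show ?thesis using C(2)[of y] by linarith
    qed
    have "integrable lebesgue (\<lambda>y. C *\<^sub>R (dom_weight Sqrt_Laplacian y *\<^sub>R f y))"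
      using f unfolding dom_class_iff by (rule integrable_scaleR_right)
    then have "(\<integral>\<^sup>+y. ennreal (norm (C *\<^sub>R (dom_weight Sqrt_Laplacian y *\<^sub>R f y))) \<partial>lebesgue) < \<infinity>"
      by (simp add: integrable_iff_bounded)
    moreover have "(\<integral>\<^sup>+y. ennreal (maj 1 (x - y)) * ennreal (norm (f y)) \<partial>lebesgue)
      \<le> (\<integral>\<^sup>+y. ennreal (norm (C *\<^sub>R (dom_weight Sqrt_Laplacian y *\<^sub>R f y))) \<partial>lebesgue)"
    proof (rule nn_integral_mono)
      fix y
      have "ennreal (maj 1 (x - y)) * ennreal (norm (f y)) = ennreal (maj 1 (x - y) * norm (f y))"
        using maj_pos[of 1 "x - y"] by (intro ennreal_mult[symmetric]) auto
      also have "\<dots> \<le> ennreal (C * dom_weight Sqrt_Laplacian y * norm (f y))"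
        by (intro ennreal_leI mult_right_mono le) simp
      also have "C * dom_weight Sqrt_Laplacian y * norm (f y) = norm (C *\<^sub>R (dom_weight Sqrt_Laplacian y *\<^sub>R f y))"
        using C(1) dom_weight_pos[of Sqrt_Laplacian y] by (simp add: abs_mult del: dom_weight.simps)
      finally show "ennreal (maj 1 (x - y)) * ennreal (norm (f y)) \<le> ennreal (norm (C *\<^sub>R (dom_weight Sqrt_Laplacian y *\<^sub>R f y)))" .
    qed
    ultimately show ?thesis by (rule le_less_trans[rotated])
  qed
  have I: "(\<lambda>j. (\<integral>\<^sup>+y. u (Suc j) y \<partial>lebesgue)) \<longlonglongrightarrow> (\<integral>\<^sup>+y. 0 \<partial>(lebesgue :: (real^'n) measure))"
  proof (rule nn_integral_dominated_convergence[where w = "\<lambda>y. ennreal (maj 1 (x - y)) * ennreal (norm (f y))"])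
    show "AE y in lebesgue. u (Suc j) y \<le> ennreal (maj 1 (x - y)) * ennreal (norm (f y))" for j
    proof (rule AE_I2)
      fix y
      have "maj (real (Suc j)) (x - y) / real (Suc j) = 1 / (real (Suc j) + norm (x - y)) ^ ?d"
        by (rule ueq) simp
      also have "\<dots> \<le> 1 / (1 + norm (x - y)) ^ ?d"
        by (intro divide_left_mono power_mono mult_pos_pos add_norm_power_pos) auto
      also have "\<dots> = maj 1 (x - y)" by (simp only: maj_def)
      finally show "u (Suc j) y \<le> ennreal (maj 1 (x - y)) * ennreal (norm (f y))"
        unfolding u_def by (intro mult_right_mono ennreal_leI) auto
    qed
    show "AE y in lebesgue. (\<lambda>j. u (Suc j) y) \<longlonglongrightarrow> 0"
    proof (rule AE_I2)
      fix y
      have "(\<lambda>j. maj (real (Suc j)) (x - y) / real (Suc j)) \<longlonglongrightarrow> 0"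
      proof (rule Lim_null_comparison)
        show "(\<lambda>j. 1 / real (Suc j)) \<longlonglongrightarrow> 0" using LIMSEQ_inverse_real_of_nat by (simp add: inverse_eq_divide)
        show "eventually (\<lambda>j. norm (maj (real (Suc j)) (x - y) / real (Suc j)) \<le> 1 / real (Suc j)) sequentially"
        proof (rule always_eventually, rule allI)
          fix j
          let ?s = "real (Suc j) + norm (x - y)"
          have s: "?s \<ge> real (Suc j)" "real (Suc j) \<ge> 1" by auto
          have "?s ^ 1 \<le> ?s ^ ?d" using s by (intro power_increasing) auto
          then have "real (Suc j) \<le> ?s ^ ?d" using s unfolding power_one_right by linarith
          then have "1 / ?s ^ ?d \<le> 1 / real (Suc j)"
            using s by (intro divide_left_mono mult_pos_pos add_norm_power_pos) auto
          moreover have "maj (real (Suc j)) (x - y) / real (Suc j) = 1 / ?s ^ ?d" by (rule ueq) simp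
          moreover have "0 \<le> maj (real (Suc j)) (x - y) / real (Suc j)"
            using maj_pos[of "real (Suc j)" "x - y"] s by simp
          ultimately show "norm (maj (real (Suc j)) (x - y) / real (Suc j)) \<le> 1 / real (Suc j)"
            by (simp only: real_norm_def abs_of_nonneg)
        qed
      qed
      then have "(\<lambda>j. ennreal (norm (f y)) * ennreal (maj (real (Suc j)) (x - y) / real (Suc j))) \<longlonglongrightarrow> ennreal (norm (f y)) * ennreal 0"
        by (intro ennreal_tendsto_cmult tendsto_ennrealI) auto
      then show "(\<lambda>j. u (Suc j) y) \<longlonglongrightarrow> 0" by (simp add: u_def mult.commute)
    qed
  qed (use um fin borel_measurable_maj_mult_norm[OF fm] in auto)
  have lim: "(\<lambda>j. enn2real (ennreal (L * norm x) * (\<integral>\<^sup>+y. u j y \<partial>lebesgue))) \<longlonglongrightarrow> 0"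
  proof -
    have "(\<lambda>j. (\<integral>\<^sup>+y. u j y \<partial>lebesgue)) \<longlonglongrightarrow> 0" using I by (subst filterlim_sequentially_Suc[symmetric]) simp
    then have "(\<lambda>j. ennreal (L * norm x) * (\<integral>\<^sup>+y. u j y \<partial>lebesgue)) \<longlonglongrightarrow> ennreal (L * norm x) * 0"
      by (intro ennreal_tendsto_cmult) auto
    then have "(\<lambda>j. enn2real (ennreal (L * norm x) * (\<integral>\<^sup>+y. u j y \<partial>lebesgue))) \<longlonglongrightarrow> enn2real 0"
      by (intro tendsto_enn2real) auto
    then show ?thesis by simp
  qed
  show ?thesis
  proof (rule Lim_null_comparison[OF _ lim])
    obtain M :: nat where M: "norm x \<le> real M" using real_arch_simple by blast
    show "eventually (\<lambda>j. norm (semigroup_op Sqrt_Laplacian (real j) f x - semigroup_op Sqrt_Laplacian (real j) f 0)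
      \<le> enn2real (ennreal (L * norm x) * (\<integral>\<^sup>+y. u j y \<partial>lebesgue))) sequentially"
    proof (rule eventually_sequentiallyI[of "Suc M"])
      fix j assume j: "Suc M \<le> j"
      have j0: "real j > 0" "norm (x - 0) \<le> real j" using j M by auto
      have "ennreal (norm (semigroup_op Sqrt_Laplacian (real j) f x - semigroup_op Sqrt_Laplacian (real j) f 0))
        \<le> ennreal (L * (norm (x - 0) / real j)) * mint (real j) x f"
        using L(2)[OF j0(1) f j0(2)] by simp
      also have "\<dots> = (\<integral>\<^sup>+y. ennreal (L * (norm (x - 0) / real j)) * (ennreal (maj (real j) (x - y)) * ennreal (norm (f y))) \<partial>lebesgue)"
        by (intro nn_integral_cmult[symmetric] borel_measurable_maj_mult_norm fm)
      also have "\<dots> = (\<integral>\<^sup>+y. ennreal (L * norm x) * u j y \<partial>lebesgue)"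
      proof (rule nn_integral_cong)
        fix y
        have "ennreal (L * (norm (x - 0) / real j)) * ennreal (maj (real j) (x - y)) = ennreal (L * norm x * (maj (real j) (x - y) / real j))"
          using L(1) j0(1) maj_pos[OF j0(1), of "x - y"] by (subst ennreal_mult[symmetric]) auto
        also have "\<dots> = ennreal (L * norm x) * ennreal (maj (real j) (x - y) / real j)"
          using L(1) j0(1) maj_pos[OF j0(1), of "x - y"] by (intro ennreal_mult) auto
        finally show "ennreal (L * (norm (x - 0) / real j)) * (ennreal (maj (real j) (x - y)) * ennreal (norm (f y))) = ennreal (L * norm x) * u j y"
          unfolding u_def mult.assoc[symmetric] by simp
      qed
      also have "\<dots> = ennreal (L * norm x) * (\<integral>\<^sup>+y. u j y \<partial>lebesgue)"
        by (rule nn_integral_cmult[OF um])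
      finally have le: "ennreal (norm (semigroup_op Sqrt_Laplacian (real j) f x - semigroup_op Sqrt_Laplacian (real j) f 0))
        \<le> ennreal (L * norm x) * (\<integral>\<^sup>+y. u j y \<partial>lebesgue)" .
      have "(\<integral>\<^sup>+y. u j y \<partial>lebesgue) \<le> (\<integral>\<^sup>+y. ennreal (maj 1 (x - y)) * ennreal (norm (f y)) \<partial>lebesgue)"
      proof (rule nn_integral_mono)
        fix y
        have "maj (real j) (x - y) / real j = 1 / (real j + norm (x - y)) ^ ?d"
          using j by (intro ueq) simp
        also have "\<dots> \<le> 1 / (1 + norm (x - y)) ^ ?d"
          using j by (intro divide_left_mono power_mono mult_pos_pos add_norm_power_pos) auto
        also have "\<dots> = maj 1 (x - y)" by (simp only: maj_def)
        finally show "u j y \<le> ennreal (maj 1 (x - y)) * ennreal (norm (f y))"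
          unfolding u_def by (intro mult_right_mono ennreal_leI) auto
      qed
      then have "(\<integral>\<^sup>+y. u j y \<partial>lebesgue) < \<infinity>" using fin by (rule le_less_trans)
      then have "ennreal (L * norm x) * (\<integral>\<^sup>+y. u j y \<partial>lebesgue) < top" by (simp add: ennreal_mult_less_top)
      from enn2real_mono[OF le this]
      show "norm (semigroup_op Sqrt_Laplacian (real j) f x - semigroup_op Sqrt_Laplacian (real j) f 0)
        \<le> enn2real (ennreal (L * norm x) * (\<integral>\<^sup>+y. u j y \<partial>lebesgue))" by simp
    qed
  qed
qed

lemma poisson_gen_imp_bmo:
  "\<exists>C>0. \<forall>f N. f \<in> dom_class Sqrt_Laplacian \<longrightarrow> gen_bdd Sqrt_Laplacian N f \<longrightarrow> 0 < N \<longrightarrow> bmo_bdd (C * N) f"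
proof -
  obtain C where C: "C > 0" "\<And>f N. \<lbrakk>f \<in> dom_class Sqrt_Laplacian; gen_bdd Sqrt_Laplacian N f; 0 < N\<rbrakk> \<Longrightarrow>
      bmo_bdd (C * N) (\<lambda>x. f x - limit_fun Sqrt_Laplacian f x)"
    using gen_imp_bmo_diff_limit[of Sqrt_Laplacian] by blast
  have "bmo_bdd (C * N) f" if f: "f \<in> dom_class Sqrt_Laplacian" and g: "gen_bdd Sqrt_Laplacian N f" and N: "0 < N" for f N
    using C(2)[OF f g N] limit_fun_eq_0[OF f g N poisson_difference_tendsto[OF f]] by simp
  then show ?thesis using C(1) by blast
qed

end

section \<open>Heat invariance of the limit function\<close>

lemma kernel_translate: "kernel A t x (x + y) = kernel A t 0 y"
  by (cases A) simp_all

text \<open>Translation invariance of \<open>lborel\<close>, transferred to the completion for Borel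
  functions. The functions to be translated are A_t f and the limit function, and both are
  Borel.\<close>

lemma has_bochner_integral_translate:
  fixes F :: "real^'n \<Rightarrow> complex"
  assumes F: "F \<in> borel_measurable borel"
  shows "integrable lebesgue F \<longleftrightarrow> integrable lebesgue (\<lambda>y. F (x + y))"
    and "(LINT y|lebesgue. F y) = (LINT y|lebesgue. F (x + y))"
proof -
  have F': "F \<in> borel_measurable lborel" "(\<lambda>y. F (x + y)) \<in> borel_measurable lborel"
    using F by measurable
  have d: "distr lborel borel ((+) x) = (lborel :: (real^'n) measure)" by (rule lborel_distr_plus)
  have "integrable lborel F \<longleftrightarrow> integrable (distr lborel borel ((+) x)) F" by (simp only: d)
  also have "\<dots> \<longleftrightarrow> integrable lborel (\<lambda>y. F (x + y))" using F by (intro integrable_distr_eq) auto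
  finally show "integrable lebesgue F \<longleftrightarrow> integrable lebesgue (\<lambda>y. F (x + y))"
    by (simp only: integrable_completion[OF F'(1)] integrable_completion[OF F'(2)])
  have "(LINT y|lborel. F y) = (LINT y|distr lborel borel ((+) x). F y)" by (simp only: d)
  also have "\<dots> = (LINT y|lborel. F (x + y))" using F by (intro integral_distr) auto
  finally show "(LINT y|lebesgue. F y) = (LINT y|lebesgue. F (x + y))"
    by (simp only: integral_completion[OF F'(1)] integral_completion[OF F'(2)])
qed

lemma semigroup_op_translate:
  fixes F :: "real^'n \<Rightarrow> complex"
  assumes F: "F \<in> borel_measurable borel"
  shows "semigroup_op A t F x = (LINT y|lebesgue. kernel A t 0 y *\<^sub>R F (x + y))"
    and "integrable lebesgue (\<lambda>y. kernel A t x y *\<^sub>R F y) \<Longrightarrow> integrable lebesgue (\<lambda>y. kernel A t 0 y *\<^sub>R F (x + y))"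
proof -
  have m: "(\<lambda>y. kernel A t x y *\<^sub>R F y) \<in> borel_measurable borel" using F by measurable
  show "semigroup_op A t F x = (LINT y|lebesgue. kernel A t 0 y *\<^sub>R F (x + y))"
    unfolding semigroup_op_def using has_bochner_integral_translate(2)[OF m, of x] by (simp only: kernel_translate)
  show "integrable lebesgue (\<lambda>y. kernel A t x y *\<^sub>R F y) \<Longrightarrow> integrable lebesgue (\<lambda>y. kernel A t 0 y *\<^sub>R F (x + y))"
    using has_bochner_integral_translate(1)[OF m, of x] by (simp only: kernel_translate)
qed

lemma heat_moment_bounded:
  assumes s: "s > 0"
  shows "\<exists>M>0. (\<integral>\<^sup>+(y::real^'n). ennreal (heat s 0 y * (1 + norm y) ^ (CARD('n) + 1)) \<partial>lebesgue) \<le> ennreal M"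
proof -
  let ?d = "CARD('n) + 1"
  \<comment> \<open>The power is used twice: one half pays for the moment weight, the other half is
    the decay of the integrable majorant.\<close>
  obtain B where B: "B > 0" "\<And>u::real. u \<ge> 0 \<Longrightarrow> (1 + u) ^ (?d + ?d) * exp (- (1 / (4 * s) * u\<^sup>2)) \<le> B"
    using power_mult_exp_neg_square_bounded[of "1 / (4 * s)" "?d + ?d"] s by auto
  obtain C where C: "C > 0" "\<And>r x. r > 0 \<Longrightarrow> (\<integral>\<^sup>+y. ennreal (maj r (x - y :: real^'n)) \<partial>lebesgue) \<le> ennreal C"
    using nn_integral_maj_bounded by blast
  define c where "c = (4 * pi * s) powr (- real CARD('n) / 2)"
  have c: "c > 0" using s by (simp add: c_def)
  have le: "heat s 0 y * (1 + norm y) ^ ?d \<le> c * B * maj 1 (0 - y)" for y :: "real^'n"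
  proof -
    let ?u = "norm y"
    let ?E = "exp (- (1 / (4 * s) * ?u\<^sup>2))"
    have P: "(1 + ?u) ^ ?d > 0" by (rule add_norm_power_pos) simp
    have "(1 + ?u) ^ ?d * ((1 + ?u) ^ ?d * ?E) \<le> B"
      using B(2)[of ?u] by (simp only: power_add mult.assoc norm_ge_zero)
    then have "(1 + ?u) ^ ?d * ?E \<le> B / (1 + ?u) ^ ?d"
      using P by (metis mult.commute pos_le_divide_eq)
    then have "c * ((1 + ?u) ^ ?d * ?E) \<le> c * (B / (1 + ?u) ^ ?d)" using c by (intro mult_left_mono) auto
    moreover have "heat s 0 y = c * ?E" by (simp add: c_def)
    moreover have "c * (B / (1 + ?u) ^ ?d) = c * B * maj 1 (0 - y)" by (simp add: maj_def)
    ultimately show ?thesis by (simp only: mult_ac)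
  qed
  have "(\<integral>\<^sup>+(y::real^'n). ennreal (heat s 0 y * (1 + norm y) ^ ?d) \<partial>lebesgue) \<le> (\<integral>\<^sup>+(y::real^'n). ennreal (c * B) * ennreal (maj 1 (0 - y)) \<partial>lebesgue)"
  proof (rule nn_integral_mono)
    fix y :: "real^'n"
    have "ennreal (heat s 0 y * (1 + norm y) ^ ?d) \<le> ennreal (c * B * maj 1 (0 - y))" by (intro ennreal_leI le)
    also have "\<dots> = ennreal (c * B) * ennreal (maj 1 (0 - y))"
      using c B(1) maj_pos[of 1 "0 - y"] by (intro ennreal_mult) auto
    finally show "ennreal (heat s 0 y * (1 + norm y) ^ ?d) \<le> \<dots>" .
  qed
  also have "\<dots> = ennreal (c * B) * (\<integral>\<^sup>+(y::real^'n). ennreal (maj 1 (0 - y)) \<partial>lebesgue)"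
    by (intro nn_integral_cmult measurable_compose[OF _ measurable_ennreal] borel_measurable_maj borel_measurable_diff
        borel_measurable_const measurable_ident_lebesgue)
  also have "\<dots> \<le> ennreal (c * B) * ennreal C" using C(2)[of 1 0] by (intro mult_left_mono) auto
  also have "\<dots> = ennreal (c * B * C)" using c B(1) C(1) by (intro ennreal_mult[symmetric]) auto
  finally show ?thesis using c B(1) C(1) by (intro exI[of _ "c * B * C"]) auto
qed

lemma nint_ball_const:
  fixes a :: complex and c :: "real^'n"
  assumes "r > 0"
  shows "nint (ball c r) (\<lambda>_. a) = ennreal (norm a * (unit_ball_vol (real CARD('n)) * r ^ CARD('n)))"
proof -
  have "nint (ball c r) (\<lambda>_. a) = ennreal (norm a) * emeasure lebesgue (ball c r)"
    by (rule nn_integral_cmult_indicator) simp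
  then show ?thesis using assms by (subst (asm) emeasure_lebesgue_ball) (auto simp: ennreal_mult)
qed

context ball_gauge
begin

lemma eq_0_if_le_Y_over_radius:
  fixes a :: complex
  assumes "\<And>\<rho>. \<rho> \<ge> \<rho>\<^sub>0 \<Longrightarrow> norm a \<le> K * (Y x \<rho> / \<rho>)"
  shows "a = 0"
proof -
  have "norm a \<le> 0"
  proof (rule tendsto_lowerbound[OF Y_over_radius_tendsto'])
    show "eventually (\<lambda>\<rho>. norm a \<le> K * (Y x \<rho> / \<rho>)) at_top"
      using eventually_ge_at_top[of \<rho>\<^sub>0] by eventually_elim (rule assms)
  qed simp
  then show ?thesis by simp
qed

lemma limit_fun_in_dom_class:
  assumes f: "f \<in> dom_class A" and g: "gen_bdd A N f" and N: "0 < N"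
  shows "limit_fun A f \<in> dom_class A"
proof -
  obtain C where C: "C > 0" "bmo_bdd (C * N) (\<lambda>x. f x - limit_fun A f x)"
    using gen_imp_bmo_diff_limit[of A] f g N by blast
  have "(\<lambda>x. f x - (f x - limit_fun A f x)) \<in> dom_class A"
    using C N by (intro dom_class_diff f bmo_in_dom_class[OF C(2)]) auto
  then show ?thesis by simp
qed

text \<open>With T = \<rho>^m the differences h(x + y) - h(x' + y) agree with those of A_T f up to a
  multiple of |x - x'| Y(x + y, \<rho>) / \<rho>. The dependence on y is at most (1 + |y|)^(n + 1),
  a weight with a finite integral against the heat kernel. Averaging in y turns A_T f into A_{s + T}
  f, and passing from s + T back to T and from A_T f back to h costs errors of the same order, so
  \<rho> \<rightarrow> \<infinity> gives equality.\<close>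

lemma heat_limit_fun_diff:
  assumes f: "f \<in> dom_class Laplacian" and g: "gen_bdd Laplacian N f" and N: "0 < N" and s: "s > 0"
  shows "semigroup_op Laplacian s (limit_fun Laplacian f) x - semigroup_op Laplacian s (limit_fun Laplacian f) x'
    = limit_fun Laplacian f x - limit_fun Laplacian f x'"
proof -
  let ?A = Laplacian and ?d = "CARD('n) + 1"
  let ?S = "semigroup_op Laplacian"
  define h where "h = limit_fun ?A f"
  have hd: "h \<in> dom_class ?A" unfolding h_def by (rule limit_fun_in_dom_class[OF f g N])
  have hb: "h \<in> borel_measurable borel" unfolding h_def by (rule borel_measurable_limit_fun[OF f g N])
  obtain C where C: "C > 0" "\<And>f N x x' \<rho>. \<lbrakk>f \<in> dom_class ?A; gen_bdd ?A N f; 0 < N; 0 < \<rho>; norm (x - x') \<le> \<rho>\<rbrakk> \<Longrightarrow>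
    norm ((limit_fun ?A f x - limit_fun ?A f x') - (?S (\<rho> ^ gen_order ?A) f x - ?S (\<rho> ^ gen_order ?A) f x')) \<le> C * N * norm (x - x') * (Y x \<rho> / \<rho>)"
    using limit_fun_approx[of ?A] by blast
  obtain E where E: "E > 0" "\<And>f N x x' \<rho> T'. \<lbrakk>f \<in> dom_class ?A; gen_bdd ?A N f; 0 < N; 0 < \<rho>; norm (x - x') \<le> \<rho>;
    \<rho> ^ gen_order ?A \<le> T'\<rbrakk> \<Longrightarrow>
    norm ((?S T' f x - ?S T' f x') - (?S (\<rho> ^ gen_order ?A) f x - ?S (\<rho> ^ gen_order ?A) f x')) \<le> E * N * norm (x - x') * (Y x \<rho> / \<rho>)"
    using semigroup_difference[of ?A] by blast
  obtain M where M: "M > 0" "(\<integral>\<^sup>+(y::real^'n). ennreal (heat s 0 y * (1 + norm y) ^ ?d) \<partial>lebesgue) \<le> ennreal M"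
    using heat_moment_bounded[OF s] by blast
  let ?l = "norm (x - x')"
  have "(?S s h x - ?S s h x') - (h x - h x') = 0"
  proof (rule eq_0_if_le_Y_over_radius)
    fix \<rho> :: real assume "max 1 ?l \<le> \<rho>"
    then have \<rho>: "\<rho> \<ge> 1" "?l \<le> \<rho>" "\<rho> > 0" by auto
    let ?T = "\<rho> ^ gen_order ?A"
    have T: "?T > 0" using \<rho> by simp
    have Sb: "?S ?T f \<in> borel_measurable borel" by (rule borel_measurable_semigroup_op[OF dom_class_measurable[OF f]])
    define e where "e y = (h (x + y) - h (x' + y)) - (?S ?T f (x + y) - ?S ?T f (x' + y))" for y
    have ih: "integrable lebesgue (\<lambda>y. heat s 0 y *\<^sub>R h (z + y))" for z
      by (rule semigroup_op_translate(2)[OF hb integrable_kernel[OF hd s]])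
    have iS: "integrable lebesgue (\<lambda>y. heat s 0 y *\<^sub>R ?S ?T f (z + y))" for z
      by (rule semigroup_op_translate(2)[OF Sb semigroup_op_semigroup_op(1)[OF f s T]])
    have ie: "integrable lebesgue (\<lambda>y. heat s 0 y *\<^sub>R e y)"
      unfolding e_def scaleR_diff_right by (intro Bochner_Integration.integrable_diff ih iS)
    have Sz: "?S (s + ?T) f z = (LINT y|lebesgue. heat s 0 y *\<^sub>R ?S ?T f (z + y))" for z
      by (simp only: semigroup_op_semigroup_op(2)[OF f s T, symmetric] semigroup_op_translate(1)[OF Sb])
    have "(LINT y|lebesgue. heat s 0 y *\<^sub>R e y) = (?S s h x - ?S s h x') - (?S (s + ?T) f x - ?S (s + ?T) f x')"
      unfolding e_def scaleR_diff_right Sz semigroup_op_translate(1)[OF hb]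
      by (simp only: Bochner_Integration.integral_diff Bochner_Integration.integrable_diff ih iS)
    moreover have "ennreal (norm (LINT y|lebesgue. heat s 0 y *\<^sub>R e y)) \<le> ennreal (C * N * ?l * D * M * (Y x \<rho> / \<rho>))"
    proof -
      define K where "K = C * N * ?l * (D * (Y x \<rho> / \<rho>))"
      have K: "K \<ge> 0" using C(1) N D_pos Y_pos[OF \<rho>(3), of x] \<rho> by (simp add: K_def)
      have "ennreal (norm (LINT y|lebesgue. heat s 0 y *\<^sub>R e y)) \<le> (\<integral>\<^sup>+y. ennreal (norm (heat s 0 y *\<^sub>R e y)) \<partial>lebesgue)"
        by (rule integral_norm_bound_ennreal[OF ie])
      also have "\<dots> \<le> (\<integral>\<^sup>+(y::real^'n). ennreal K * ennreal (heat s 0 y * (1 + norm y) ^ ?d) \<partial>lebesgue)"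
      proof (rule nn_integral_mono)
        fix y :: "real^'n"
        have k0: "0 \<le> heat s 0 y" by (rule kernel_nonneg[OF s])
        have "norm (e y) \<le> C * N * norm ((x + y) - (x' + y)) * (Y (x + y) \<rho> / \<rho>)"
          unfolding e_def h_def using \<rho> by (intro C(2)[OF f g N]) auto
        also have "\<dots> \<le> C * N * ?l * ((D * Y x \<rho> * (1 + norm (x - (x + y)) / \<rho>) ^ ?d) / \<rho>)"
          using C(1) N \<rho> Y_shift[OF \<rho>(3), of "x + y" x] by (auto intro!: mult_left_mono divide_right_mono simp del: power_Suc)
        also have "\<dots> \<le> C * N * ?l * ((D * Y x \<rho> * (1 + norm y) ^ ?d) / \<rho>)"
        proof -
          have "norm y / \<rho> \<le> norm y" using \<rho> mult_left_mono[of 1 \<rho> "norm y"] by (simp add: divide_le_eq)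
          then have "(1 + norm (x - (x + y)) / \<rho>) ^ ?d \<le> (1 + norm y) ^ ?d"
            using \<rho> by (intro power_mono) auto
          then show ?thesis using C(1) N \<rho> D_pos Y_pos[OF \<rho>(3), of x]
            by (intro mult_left_mono divide_right_mono) auto
        qed
        also have "\<dots> = K * (1 + norm y) ^ ?d" unfolding K_def by simp
        finally have "heat s 0 y * norm (e y) \<le> heat s 0 y * (K * (1 + norm y) ^ ?d)" using k0 by (rule mult_left_mono)
        then have "norm (heat s 0 y *\<^sub>R e y) \<le> K * (heat s 0 y * (1 + norm y) ^ ?d)"
          using k0 by (simp only: norm_scaleR abs_of_nonneg mult_ac)
        then have "ennreal (norm (heat s 0 y *\<^sub>R e y)) \<le> ennreal (K * (heat s 0 y * (1 + norm y) ^ ?d))" by (rule ennreal_leI)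
        also have "\<dots> = ennreal K * ennreal (heat s 0 y * (1 + norm y) ^ ?d)"
          using K k0 by (intro ennreal_mult mult_nonneg_nonneg zero_le_power) auto
        finally show "ennreal (norm (heat s 0 y *\<^sub>R e y)) \<le> ennreal K * ennreal (heat s 0 y * (1 + norm y) ^ ?d)" .
      qed
      also have "\<dots> = ennreal K * (\<integral>\<^sup>+(y::real^'n). ennreal (heat s 0 y * (1 + norm y) ^ ?d) \<partial>lebesgue)"
      proof (rule nn_integral_cmult)
        have "(\<lambda>y::real^'n. ennreal (heat s 0 y * (1 + norm y) ^ ?d)) \<in> borel_measurable borel" by measurable
        then show "(\<lambda>y::real^'n. ennreal (heat s 0 y * (1 + norm y) ^ ?d)) \<in> borel_measurable lebesgue"
          by (rule measurable_compose[OF measurable_ident_lebesgue])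
      qed
      also have "\<dots> \<le> ennreal K * ennreal M" by (intro mult_left_mono M) simp
      also have "\<dots> = ennreal (K * M)" using K M(1) by (intro ennreal_mult[symmetric]) auto
      also have "K * M = C * N * ?l * D * M * (Y x \<rho> / \<rho>)" unfolding K_def by simp
      finally show ?thesis .
    qed
    then have "norm (LINT y|lebesgue. heat s 0 y *\<^sub>R e y) \<le> C * N * ?l * D * M * (Y x \<rho> / \<rho>)"
      using C(1) N D_pos Y_pos[OF \<rho>(3), of x] \<rho> M(1) by (subst (asm) ennreal_le_iff) auto
    moreover have "norm ((?S (s + ?T) f x - ?S (s + ?T) f x') - (?S ?T f x - ?S ?T f x')) \<le> E * N * ?l * (Y x \<rho> / \<rho>)"
      using \<rho> s by (intro E(2)[OF f g N]) auto
    moreover have "norm ((h x - h x') - (?S ?T f x - ?S ?T f x')) \<le> C * N * ?l * (Y x \<rho> / \<rho>)"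
      unfolding h_def using \<rho> by (intro C(2)[OF f g N]) auto
    moreover have "norm (p - w) \<le> norm (p - q) + norm (q - v) + norm (w - v)" for p q v w :: complex
    proof -
      have "p - w = (p - q) + (q - v) + (v - w)" by simp
      then show ?thesis by (metis add_right_mono norm_minus_commute norm_triangle_ineq norm_triangle_le order_trans)
    qed
    ultimately have "norm ((?S s h x - ?S s h x') - (h x - h x'))
      \<le> C * N * ?l * D * M * (Y x \<rho> / \<rho>) + E * N * ?l * (Y x \<rho> / \<rho>) + C * N * ?l * (Y x \<rho> / \<rho>)"
      by (smt (verit))
    then show "norm ((?S s h x - ?S s h x') - (h x - h x')) \<le> (C * N * ?l * D * M + E * N * ?l + C * N * ?l) * (Y x \<rho> / \<rho>)"
      by (simp only: distrib_right)
  qed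
  then show ?thesis by (simp add: h_def)
qed

lemma gen_bdd_diff:
  assumes f: "f \<in> dom_class A" "gen_bdd A N f" "0 \<le> N" and g: "g \<in> dom_class A" "gen_bdd A N' g" "0 \<le> N'"
  shows "gen_bdd A (N + N') (\<lambda>x. f x - g x)"
  unfolding gen_bdd_def
proof (intro allI impI)
  fix c :: "real^'n" and r :: real assume r: "r > 0"
  let ?t = "r ^ gen_order A"
  have t: "?t > 0" using r by simp
  have fm: "f \<in> borel_measurable lebesgue" "g \<in> borel_measurable lebesgue"
    using f g by (auto intro: dom_class_measurable)
  have sm: "semigroup_op A ?t f \<in> borel_measurable lebesgue" "semigroup_op A ?t g \<in> borel_measurable lebesgue"
    by (auto intro!: measurable_lebesgue_compose borel_measurable_semigroup_op fm)
  have "nint (ball c r) (\<lambda>x. (f x - g x) - semigroup_op A ?t (\<lambda>x. f x - g x) x)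
    = nint (ball c r) (\<lambda>x. (f x - semigroup_op A ?t f x) - (g x - semigroup_op A ?t g x))"
    by (simp add: semigroup_op_diff[OF f(1) g(1) t] algebra_simps)
  also have "\<dots> \<le> nint (ball c r) (\<lambda>x. (f x - semigroup_op A ?t f x) - 0) + nint (ball c r) (\<lambda>x. 0 - (g x - semigroup_op A ?t g x))"
    using fm sm by (intro nint_triangle) auto
  also have "\<dots> = nint (ball c r) (\<lambda>x. f x - semigroup_op A ?t f x) + nint (ball c r) (\<lambda>x. g x - semigroup_op A ?t g x)"
    by (simp add: norm_minus_commute)
  also have "\<dots> \<le> ennreal (N * X c r) + ennreal (N' * X c r)"
    using f g r by (intro add_mono) (auto simp: gen_bdd_def)
  also have "\<dots> = ennreal ((N + N') * X c r)"
    using f(3) g(3) X_pos[OF r, of c] by (simp flip: ennreal_plus add: distrib_right)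
  finally show "nint (ball c r) (\<lambda>x. (f x - g x) - semigroup_op A ?t (\<lambda>x. f x - g x) x) \<le> ennreal ((N + N') * X c r)" .
qed

text \<open>The constant increments of \<open>t \<mapsto> A\<^sub>t h\<close> add up to linear growth in \<open>t\<close>, which exceeds the growth
  of order \<open>t\<^sup>\<beta>\<^sup>/\<^sup>2\<close> permitted by the gauge unless they vanish.\<close>

lemma heat_limit_fun_invariant:
  assumes f: "f \<in> dom_class Laplacian" and g: "gen_bdd Laplacian N f" and N: "0 < N" and s: "s > 0"
  shows "semigroup_op Laplacian s (limit_fun Laplacian f) x = limit_fun Laplacian f x"
proof -
  let ?A = Laplacian
  let ?S = "semigroup_op Laplacian"
  define h where "h = limit_fun ?A f"
  define c where "c = ?S s h 0 - h 0"
  have hd: "h \<in> dom_class ?A" unfolding h_def by (rule limit_fun_in_dom_class[OF f g N])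
  have step: "?S s h x = h x + c" for x
    using heat_limit_fun_diff[OF f g N s, of x 0] unfolding h_def[symmetric] c_def by (simp add: algebra_simps)
  \<comment> \<open>Each further application of A_s adds c once more, as A_s leaves constants
    fixed.\<close>
  have iter: "?S (real (Suc k) * s) h x = h x + of_nat (Suc k) * c" for k x
  proof (induction k arbitrary: x)
    case 0
    then show ?case by (simp add: step)
  next
    case (Suc k)
    have ks: "real (Suc k) * s > 0" using s by simp
    have "real (Suc (Suc k)) * s = s + real (Suc k) * s" by (simp add: algebra_simps)
    then have "?S (real (Suc (Suc k)) * s) h x = ?S s (?S (real (Suc k) * s) h) x"
      by (simp only: semigroup_op_semigroup_op(2)[OF hd s ks])
    also have "?S (real (Suc k) * s) h = (\<lambda>x. h x + of_nat (Suc k) * c)" using Suc by auto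
    also have "?S s (\<lambda>x. h x + of_nat (Suc k) * c) x = ?S s h x + of_nat (Suc k) * c"
      by (simp only: semigroup_op_add[OF hd dom_class_const s] semigroup_op_const[OF s])
    also have "\<dots> = h x + of_nat (Suc (Suc k)) * c" by (simp add: step algebra_simps)
    finally show ?case .
  qed
  \<comment> \<open>The limit function is f minus f - h, and both of these have bounded oscillation
    against the semigroup.\<close>
  obtain N' where N': "N' > 0" "gen_bdd ?A N' h"
  proof -
    obtain C where C: "C > 0" "bmo_bdd (C * N) (\<lambda>x. f x - limit_fun ?A f x)"
      using gen_imp_bmo_diff_limit[of ?A] f g N by blast
    obtain C' where C': "C' > 0" "\<And>f N. \<lbrakk>bmo_bdd N f; 0 < N\<rbrakk> \<Longrightarrow> gen_bdd ?A (C' * N) f"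
      using bmo_imp_gen[of ?A] by blast
    have CN: "C * N > 0" using C(1) N by simp
    have "gen_bdd ?A (N + C' * (C * N)) (\<lambda>x. f x - (f x - limit_fun ?A f x))"
      using C'(1) CN N by (intro gen_bdd_diff f g bmo_in_dom_class[OF C(2) CN] C'(2)[OF C(2) CN]) auto
    then have "gen_bdd ?A (N + C' * (C * N)) h" by (simp add: h_def)
    moreover have "N + C' * (C * N) > 0" using N C'(1) CN by (simp add: add_pos_pos)
    ultimately show ?thesis using that by blast
  qed
  \<comment> \<open>The radius whose square is the time (k + 1) s. On the ball of this radius h -
    A_t h is the constant - (k + 1) c, so the oscillation bound becomes a bound on c.\<close>
  let ?r = "\<lambda>k::nat. sqrt (real (Suc k) * s)"
  have bound: "norm c \<le> N' / V * s * (Y 0 (?r k) / (?r k)\<^sup>2)" for k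
  proof -
    have r: "?r k > 0" using s by simp
    have r2: "?r k ^ gen_order ?A = real (Suc k) * s" using s by simp
    have "nint (ball (0 :: real^'n) (?r k)) (\<lambda>x. - (of_nat (Suc k) * c)) = nint (ball 0 (?r k)) (\<lambda>x. h x - ?S (?r k ^ gen_order ?A) h x)"
      unfolding r2 iter by simp
    also have "\<dots> \<le> ennreal (N' * X 0 (?r k))" using N'(2) r unfolding gen_bdd_def by blast
    finally have "ennreal (norm (- (of_nat (Suc k) * c)) * (V * ?r k ^ CARD('n))) \<le> ennreal (N' * X 0 (?r k))"
      unfolding V_def nint_ball_const[OF r] .
    then have "norm (- (of_nat (Suc k) * c)) * (V * ?r k ^ CARD('n)) \<le> N' * X 0 (?r k)"
      using N'(1) X_pos[OF r, of 0] by (subst (asm) ennreal_le_iff) auto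
    also have "\<dots> = (N' / V * Y 0 (?r k)) * (V * ?r k ^ CARD('n))"
      unfolding X_eq_Y[OF r] using V_pos by simp
    finally have "norm (- (of_nat (Suc k) * c)) \<le> N' / V * Y 0 (?r k)"
      using V_pos r by (metis mult_le_cancel_right_pos mult_pos_pos zero_less_power)
    then have 1: "real (Suc k) * norm c \<le> N' / V * Y 0 (?r k)"
      by (simp only: norm_minus_cancel norm_mult norm_of_nat)
    have "(?r k)\<^sup>2 = real (Suc k) * s" using s by simp
    then have "N' / V * s * (Y 0 (?r k) / (?r k)\<^sup>2) = N' / V * Y 0 (?r k) / real (Suc k)" using s by simp
    then show ?thesis using 1 by (metis mult.commute of_nat_0_less_iff pos_le_divide_eq zero_less_Suc)
  qed
  have "norm c \<le> 0"
  proof (rule tendsto_lowerbound)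
    have rlim: "filterlim ?r at_top sequentially"
    proof (rule filterlim_compose[OF sqrt_at_top])
      have "filterlim (\<lambda>k. real (Suc k)) at_top sequentially"
        using filterlim_real_sequentially filterlim_sequentially_Suc by blast
      then show "filterlim (\<lambda>k. real (Suc k) * s) at_top sequentially"
        using s by (intro filterlim_at_top_mult_tendsto_pos[OF tendsto_const]) auto
    qed
    show "(\<lambda>k. N' / V * s * (Y 0 (?r k) / ?r k)) \<longlonglongrightarrow> 0"
      by (rule filterlim_compose[OF Y_over_radius_tendsto' rlim])
    have "eventually (\<lambda>k. 1 \<le> ?r k) sequentially" using rlim unfolding filterlim_at_top by blast
    then show "eventually (\<lambda>k. norm c \<le> N' / V * s * (Y 0 (?r k) / ?r k)) sequentially"
    proof eventually_elim
      case (elim k)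
      have r: "?r k > 0" using s by simp
      \<comment> \<open>For r at least 1 the quotient Y / r^2 is below Y / r, whose convergence to 0
        is already available.\<close>
      have "?r k * 1 \<le> ?r k * ?r k" using elim r by (intro mult_left_mono) auto
      then have "Y 0 (?r k) / (?r k)\<^sup>2 \<le> Y 0 (?r k) / ?r k"
        using r Y_pos[OF r, of 0] unfolding power2_eq_square by (intro divide_left_mono) auto
      then have "N' / V * s * (Y 0 (?r k) / (?r k)\<^sup>2) \<le> N' / V * s * (Y 0 (?r k) / ?r k)"
        using N'(1) V_pos s by (intro mult_left_mono) auto
      then show ?case using bound[of k] by linarith
    qed
  qed simp
  then have "c = 0" by simp
  then show ?thesis using step[of x] by (simp add: h_def)
qed

section \<open>Approximating families indexed by balls\<close>

text \<open>The conditions of \<open>tilde_family\<close> in terms of the gauge: Y / V is the norm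
  of the indicator divided by the measure of the ball, and \<beta> is the exponent \<nu> p1 / p -
  \<alpha> of the parameters.\<close>

definition tilde_bdd :: "generator \<Rightarrow> real \<Rightarrow> (real^'n \<Rightarrow> complex) \<Rightarrow> (real^'n \<Rightarrow> real \<Rightarrow> real^'n \<Rightarrow> complex) \<Rightarrow> bool" where
  "tilde_bdd A N f F \<longleftrightarrow>
     (\<forall>c. \<forall>r>0. F c r \<in> dom_class A) \<and>
     (\<forall>c. \<forall>r>0. nint (ball c r) (\<lambda>x. f x - F c r x) \<le> ennreal (N * X c r)) \<and>
     (\<forall>c\<^sub>1 c\<^sub>2. \<forall>r\<^sub>1>0. \<forall>r\<^sub>2>0. ball c\<^sub>1 r\<^sub>1 \<subseteq> ball c\<^sub>2 r\<^sub>2 \<longrightarrow>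
        (AE x in lebesgue. norm (F c\<^sub>2 r\<^sub>2 x - F c\<^sub>1 r\<^sub>1 x) \<le> N * (Y x r\<^sub>1 / V) * (r\<^sub>2 / r\<^sub>1) powr \<beta>)) \<and>
     (\<forall>c. \<forall>r>0. AE x in lebesgue. norm (F c r x - semigroup_op A (r ^ gen_order A) (F c r) x) \<le> N * (Y x r / V))"

text \<open>The family is A_{t_B} f, which depends on the radius of B alone. Compatibility is the
  growth of t \<mapsto> A_t f between two radii, and the last condition holds because A_t f - A_t
  A_t f is A_t applied to f - A_t f.\<close>

lemma bmo_imp_tilde:
  "\<exists>C>0. \<forall>f N. bmo_bdd N f \<longrightarrow> 0 < N \<longrightarrow> (\<exists>F. tilde_bdd A (C * N) f F)"
proof -
  let ?m = "gen_order A"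
  obtain C1 where C1: "C1 > 0" "\<And>f N. \<lbrakk>bmo_bdd N f; 0 < N\<rbrakk> \<Longrightarrow> gen_bdd A (C1 * N) f"
    using bmo_imp_gen[of A] by blast
  obtain C2 where C2: "C2 > 0" "\<And>f N x r R. \<lbrakk>bmo_bdd N f; 0 < N; 0 < r; r \<le> R\<rbrakk> \<Longrightarrow>
    norm (semigroup_op A (R ^ ?m) f x - semigroup_op A (r ^ ?m) f x) \<le> C2 * N * Y x r * (R / r) powr \<beta>"
    using bmo_semigroup_growth[of A] by blast
  obtain C3 where C3: "C3 > 0" "\<And>f N x s r. \<lbrakk>f \<in> borel_measurable lebesgue; gen_bdd A N f; 0 < N; 0 < s; s \<le> r\<rbrakk> \<Longrightarrow>
    mint r x (\<lambda>y. f y - semigroup_op A (s ^ ?m) f y) \<le> ennreal (C3 * N * Y x r)"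
    using gen_imp_mint[of A] by blast
  obtain K where K: "K > 0" "\<And>r (f :: real^'n \<Rightarrow> complex) x. \<lbrakk>r > 0; f \<in> borel_measurable lebesgue\<rbrakk> \<Longrightarrow>
     ennreal (norm (semigroup_op A (r ^ ?m) f x)) \<le> ennreal K * mint r x f"
    using norm_semigroup_op_le_maj[of A, where 'n = 'n] by blast
  define C where "C = C1 + C2 * V + K * C3 * C1 * V"
  have Cp: "C > 0" "C1 \<le> C" "C2 * V \<le> C" "K * C3 * C1 * V \<le> C"
    using C1(1) C2(1) C3(1) K(1) V_pos by (auto simp: C_def add_pos_pos add_nonneg_nonneg)
  have "tilde_bdd A (C * N) f (\<lambda>c r. semigroup_op A (r ^ ?m) f)" if f: "bmo_bdd N f" and N: "0 < N" for f N
    unfolding tilde_bdd_def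
  proof (intro conjI allI impI)
    have fd: "f \<in> dom_class A" by (rule bmo_in_dom_class[OF f N])
    have fm: "f \<in> borel_measurable lebesgue" by (rule dom_class_measurable[OF fd])
    have g: "gen_bdd A (C1 * N) f" by (rule C1(2)[OF f N])
    have C1N: "C1 * N > 0" using C1(1) N by simp
    fix c :: "real^'n" and r :: real assume r: "r > 0"
    have t: "r ^ ?m > 0" using r by simp
    have gd: "(\<lambda>y. f y - semigroup_op A (r ^ ?m) f y) \<in> dom_class A"
      by (rule gen_diff_in_dom_class[OF fm g C1N r])
    \<comment> \<open>A_t f belongs to the domain as the difference of f and f - A_t f; the latter
      passes the majorant test.\<close>
    from dom_class_diff[OF fd gd] show Sd: "semigroup_op A (r ^ ?m) f \<in> dom_class A" by simp
    have "nint (ball c r) (\<lambda>x. f x - semigroup_op A (r ^ ?m) f x) \<le> ennreal (C1 * N * X c r)"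
      using g r by (simp add: gen_bdd_def)
    also have "\<dots> \<le> ennreal (C * N * X c r)"
      using Cp N X_pos[OF r, of c] by (intro ennreal_leI mult_right_mono) auto
    finally show "nint (ball c r) (\<lambda>x. f x - semigroup_op A (r ^ ?m) f x) \<le> ennreal (C * N * X c r)" .
    show "AE x in lebesgue. norm (semigroup_op A (r ^ ?m) f x - semigroup_op A (r ^ ?m) (semigroup_op A (r ^ ?m) f) x) \<le> C * N * (Y x r / V)"
    proof (rule AE_I2)
      fix x
      have "semigroup_op A (r ^ ?m) f x - semigroup_op A (r ^ ?m) (semigroup_op A (r ^ ?m) f) x
        = semigroup_op A (r ^ ?m) (\<lambda>y. f y - semigroup_op A (r ^ ?m) f y) x"
        by (rule semigroup_op_diff[OF fd Sd t, symmetric])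
      also have "ennreal (norm \<dots>) \<le> ennreal K * mint r x (\<lambda>y. f y - semigroup_op A (r ^ ?m) f y)"
        by (rule K(2)[OF r dom_class_measurable[OF gd]])
      also have "\<dots> \<le> ennreal K * ennreal (C3 * (C1 * N) * Y x r)"
        by (intro mult_left_mono C3(2)[OF fm g C1N r order_refl]) simp
      also have "\<dots> = ennreal (K * (C3 * (C1 * N) * Y x r))"
        using K(1) C3(1) C1N Y_pos[OF r, of x] by (intro ennreal_mult[symmetric]) auto
      finally have "norm (semigroup_op A (r ^ ?m) f x - semigroup_op A (r ^ ?m) (semigroup_op A (r ^ ?m) f) x) \<le> K * (C3 * (C1 * N) * Y x r)"
        using K(1) C3(1) C1N Y_pos[OF r, of x] by (subst (asm) ennreal_le_iff) auto
      also have "\<dots> = (K * C3 * C1 * V) * N * (Y x r / V)" using V_pos by simp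
      also have "\<dots> \<le> C * N * (Y x r / V)"
        using Cp N V_pos Y_pos[OF r, of x] by (intro mult_right_mono) auto
      finally show "norm (semigroup_op A (r ^ ?m) f x - semigroup_op A (r ^ ?m) (semigroup_op A (r ^ ?m) f) x) \<le> C * N * (Y x r / V)" .
    qed
  next
    fix c\<^sub>1 c\<^sub>2 :: "real^'n" and r\<^sub>1 r\<^sub>2 :: real
    assume r: "r\<^sub>1 > 0" "r\<^sub>2 > 0" "ball c\<^sub>1 r\<^sub>1 \<subseteq> ball c\<^sub>2 r\<^sub>2"
    have r12: "r\<^sub>1 \<le> r\<^sub>2"
      using r ball_subset_ball_iff[of c\<^sub>1 r\<^sub>1 c\<^sub>2 r\<^sub>2] zero_le_dist[of c\<^sub>1 c\<^sub>2] by linarith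
    show "AE x in lebesgue. norm (semigroup_op A (r\<^sub>2 ^ ?m) f x - semigroup_op A (r\<^sub>1 ^ ?m) f x) \<le> C * N * (Y x r\<^sub>1 / V) * (r\<^sub>2 / r\<^sub>1) powr \<beta>"
    proof (rule AE_I2)
      fix x
      have "norm (semigroup_op A (r\<^sub>2 ^ ?m) f x - semigroup_op A (r\<^sub>1 ^ ?m) f x) \<le> C2 * N * Y x r\<^sub>1 * (r\<^sub>2 / r\<^sub>1) powr \<beta>"
        by (rule C2(2)[OF f N r(1) r12])
      also have "\<dots> = (C2 * V) * N * (Y x r\<^sub>1 / V) * (r\<^sub>2 / r\<^sub>1) powr \<beta>" using V_pos by simp
      also have "\<dots> \<le> C * N * (Y x r\<^sub>1 / V) * (r\<^sub>2 / r\<^sub>1) powr \<beta>"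
        using Cp N V_pos Y_pos[OF r(1), of x] by (intro mult_right_mono) auto
      finally show "norm (semigroup_op A (r\<^sub>2 ^ ?m) f x - semigroup_op A (r\<^sub>1 ^ ?m) f x) \<le> C * N * (Y x r\<^sub>1 / V) * (r\<^sub>2 / r\<^sub>1) powr \<beta>" .
    qed
  qed
  then show ?thesis using Cp(1) by blast
qed

text \<open>Adding h to f and to every member of the family cancels in all differences. This
  transports families from f - h, where they are known to exist, back to f.\<close>

lemma tilde_bdd_add_invariant:
  assumes F: "tilde_bdd A N f F" and h: "h \<in> invariant_class A"
  shows "tilde_bdd A N (\<lambda>x. f x + h x) (\<lambda>c r x. F c r x + h x)"
  unfolding tilde_bdd_def
proof (intro conjI allI impI)
  have hd: "h \<in> dom_class A" using h by (simp add: invariant_class_def)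
  fix c :: "real^'n" and r :: real assume r: "r > 0"
  have t: "r ^ gen_order A > 0" using r by simp
  have Fd: "F c r \<in> dom_class A" using F r by (simp add: tilde_bdd_def)
  show "(\<lambda>x. F c r x + h x) \<in> dom_class A" by (rule dom_class_add[OF Fd hd])
  show "nint (ball c r) (\<lambda>x. f x + h x - (F c r x + h x)) \<le> ennreal (N * X c r)"
    using F r by (simp add: tilde_bdd_def)
  have "AE x in lebesgue. semigroup_op A (r ^ gen_order A) h x = h x" using h t by (simp add: invariant_class_def)
  moreover have "AE x in lebesgue. norm (F c r x - semigroup_op A (r ^ gen_order A) (F c r) x) \<le> N * (Y x r / V)"
    using F r by (simp add: tilde_bdd_def)
  ultimately show "AE x in lebesgue. norm (F c r x + h x - semigroup_op A (r ^ gen_order A) (\<lambda>x. F c r x + h x) x) \<le> N * (Y x r / V)"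
    by eventually_elim (simp add: semigroup_op_add[OF Fd hd t])
next
  fix c\<^sub>1 c\<^sub>2 :: "real^'n" and r\<^sub>1 r\<^sub>2 :: real
  assume r: "r\<^sub>1 > 0" "r\<^sub>2 > 0" "ball c\<^sub>1 r\<^sub>1 \<subseteq> ball c\<^sub>2 r\<^sub>2"
  then show "AE x in lebesgue. norm (F c\<^sub>2 r\<^sub>2 x + h x - (F c\<^sub>1 r\<^sub>1 x + h x)) \<le> N * (Y x r\<^sub>1 / V) * (r\<^sub>2 / r\<^sub>1) powr \<beta>"
    using F by (simp add: tilde_bdd_def)
qed

text \<open>The pointwise bound by the gauge is integrated with \<open>X_int\<close>. The constant
  is taken out of the integral of p, which is measurable, before p is compared with X.\<close>

lemma nint_ball_le_gauge:
  assumes p: "p \<in> borel_measurable lebesgue" and \<kappa>: "\<kappa> > 0" and r: "r > 0" and R: "R > 0"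
    and le: "AE x in lebesgue. norm (p x) \<le> \<kappa> * X x r"
  shows "nint (ball c R) p \<le> ennreal (\<kappa> * (D * r ^ CARD('n) * X c (R + r)))"
proof -
  note p [measurable]
  have "nint (ball c R) p = (\<integral>\<^sup>+x. ennreal \<kappa> * (ennreal (norm (p x) / \<kappa>) * indicator (ball c R) x) \<partial>lebesgue)"
  proof (rule nn_integral_cong)
    fix x
    have "ennreal \<kappa> * ennreal (norm (p x) / \<kappa>) = ennreal (norm (p x))"
      using \<kappa> by (subst ennreal_mult[symmetric]) auto
    then show "ennreal (norm (p x)) * indicator (ball c R) x = ennreal \<kappa> * (ennreal (norm (p x) / \<kappa>) * indicator (ball c R) x)"
      by (simp only: mult.assoc[symmetric])
  qed
  also have "\<dots> = ennreal \<kappa> * (\<integral>\<^sup>+x\<in>ball c R. ennreal (norm (p x) / \<kappa>) \<partial>lebesgue)"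
    by (rule nn_integral_cmult) measurable
  also have "\<dots> \<le> ennreal \<kappa> * (\<integral>\<^sup>+x\<in>ball c R. ennreal (X x r) \<partial>lebesgue)"
  proof (intro mult_left_mono nn_integral_mono_AE)
    show "AE x in lebesgue. ennreal (norm (p x) / \<kappa>) * indicator (ball c R) x \<le> ennreal (X x r) * indicator (ball c R) x"
      using le
    proof eventually_elim
      case (elim x)
      then have "norm (p x) / \<kappa> \<le> X x r" using \<kappa> by (simp add: divide_le_eq mult.commute)
      then show ?case by (intro mult_right_mono ennreal_leI) auto
    qed
  qed simp
  also have "\<dots> \<le> ennreal \<kappa> * ennreal (D * r ^ CARD('n) * X c (R + r))"
    by (intro mult_left_mono X_int r R) simp
  also have "\<dots> = ennreal (\<kappa> * (D * r ^ CARD('n) * X c (R + r)))"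
    using \<kappa> D_pos r R X_pos[of "R + r" c] by (intro ennreal_mult[symmetric]) auto
  finally show ?thesis .
qed

text \<open>On a ball B, f - A_t f is the sum of f - f^B, f^B - A_t f^B and A_t (f^B - f). The last
  term needs f - f^B on concentric balls of radius R, reached through the member of the family for
  that larger ball. Compatibility costs (R / r)^\<beta> and the gauge of the larger ball another (R
  / r)^\<beta>, so the majorant is applied with \<gamma> = 2 \<beta>.\<close>

lemma tilde_imp_gen:
  "\<exists>C>0. \<forall>f N F. f \<in> dom_class A \<longrightarrow> tilde_bdd A N f F \<longrightarrow> 0 < N \<longrightarrow> gen_bdd A (C * N) f"
proof -
  let ?n = "CARD('n)" and ?m = "gen_order A"
  from nn_integral_maj_le[OF beta(2), where 'n = 'n] obtain C where C: "C > 0"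
    "\<And>(u :: real^'n \<Rightarrow> ennreal) r x a. \<lbrakk>u \<in> borel_measurable lebesgue; 0 < r; 0 \<le> a;
    \<forall>R\<ge>r. (\<integral>\<^sup>+y\<in>ball x R. u y \<partial>lebesgue) \<le> ennreal (a * R ^ ?n * (R / r) powr (2 * \<beta>))\<rbrakk> \<Longrightarrow>
    (\<integral>\<^sup>+y. ennreal (maj r (x - y)) * u y \<partial>lebesgue) \<le> ennreal (C * a)"
    by blast
  obtain K where K: "K > 0" "\<And>r (f :: real^'n \<Rightarrow> complex) x. \<lbrakk>r > 0; f \<in> borel_measurable lebesgue\<rbrakk> \<Longrightarrow>
     ennreal (norm (semigroup_op A (r ^ ?m) f x)) \<le> ennreal K * mint r x f"
    using norm_semigroup_op_le_maj[of A, where 'n = 'n] by blast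
  let ?q = "2 ^ (?n + 1) :: real"
  define G where "G = D / V * D * (2 ^ ?n * 2 powr \<beta>)"
  have G: "G > 0" using D_pos V_pos by (simp add: G_def)
  define E where "E = K * (?q * (C * (D + G))) * V"
  have E: "E > 0" using K(1) C(1) D_pos G V_pos by (simp add: E_def add_pos_pos)
  have "gen_bdd A ((1 + G + E) * N) f" if f: "f \<in> dom_class A" and F: "tilde_bdd A N f F" and N: "0 < N" for f N F
    unfolding gen_bdd_def
  proof (intro allI impI)
    fix c :: "real^'n" and r :: real assume r: "r > 0"
    have t: "r ^ ?m > 0" using r by simp
    have fm: "f \<in> borel_measurable lebesgue" by (rule dom_class_measurable[OF f])
    have Fd: "F c R \<in> dom_class A" if "R > 0" for R using F that by (simp add: tilde_bdd_def)
    have Fm: "F c R \<in> borel_measurable lebesgue" if "R > 0" for R by (rule dom_class_measurable[OF Fd[OF that]])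
    have Fr: "F c r \<in> borel_measurable lebesgue" by (rule Fm[OF r])
    have sm: "semigroup_op A (r ^ ?m) g \<in> borel_measurable lebesgue" if "g \<in> borel_measurable lebesgue" for g
      by (rule measurable_lebesgue_compose[OF borel_measurable_semigroup_op[OF that]])
    have G2: "D / V * X c (2 * R) \<le> G * Y c r * R ^ ?n * (R / r) powr \<beta>" if "r \<le> R" for R
    proof -
      have "X c (2 * R) \<le> D * Y c r * (2 * R) ^ ?n * (2 * R / r) powr \<beta>"
        using r that by (intro X_grow_concentric) auto
      also have "(2 * R) ^ ?n = 2 ^ ?n * R ^ ?n" by (rule power_mult_distrib)
      also have "(2 * R / r) powr \<beta> = 2 powr \<beta> * (R / r) powr \<beta>" by (metis powr_mult times_divide_eq_right)
      finally have "D / V * X c (2 * R) \<le> D / V * (D * Y c r * (2 ^ ?n * R ^ ?n) * (2 powr \<beta> * (R / r) powr \<beta>))"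
        using D_pos V_pos by (intro mult_left_mono) auto
      then show ?thesis unfolding G_def by (simp only: mult_ac)
    qed
    let ?u = "\<lambda>y. f y - F c r y"
    have um: "?u \<in> borel_measurable lebesgue" using fm Fr by measurable
    have mu: "mint r c ?u \<le> ennreal (C * ((D + G) * N * Y c r))"
    proof (rule C(2))
      show "(\<lambda>y. ennreal (norm (?u y))) \<in> borel_measurable lebesgue" using um by measurable
      show "0 \<le> (D + G) * N * Y c r" using D_pos G N Y_pos[OF r, of c] by simp
      show "\<forall>R\<ge>r. nint (ball c R) ?u \<le> ennreal ((D + G) * N * Y c r * R ^ ?n * (R / r) powr (2 * \<beta>))"
      proof (intro allI impI)
        fix R assume R: "r \<le> R"
        have R0: "R > 0" using r R by simp
        have q: "1 \<le> (R / r) powr \<beta>" using r R beta by (intro ge_one_powr_ge_zero) auto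
        have q2: "(R / r) powr (2 * \<beta>) = (R / r) powr \<beta> * (R / r) powr \<beta>" by (simp add: powr_add[symmetric])
        have FR: "F c R \<in> borel_measurable lebesgue" by (rule Fm[OF R0])
        have "nint (ball c R) ?u \<le> nint (ball c R) (\<lambda>x. f x - F c R x) + nint (ball c R) (\<lambda>x. F c R x - F c r x)"
          using fm Fr FR by (intro nint_triangle) auto
        also have "\<dots> \<le> ennreal (N * X c R) + ennreal (N / V / r ^ ?n * (R / r) powr \<beta> * (D * r ^ ?n * X c (R + r)))"
        proof (rule add_mono)
          show "nint (ball c R) (\<lambda>x. f x - F c R x) \<le> ennreal (N * X c R)" using F R0 by (simp add: tilde_bdd_def)
          show "nint (ball c R) (\<lambda>x. F c R x - F c r x) \<le> ennreal (N / V / r ^ ?n * (R / r) powr \<beta> * (D * r ^ ?n * X c (R + r)))"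
          proof (rule nint_ball_le_gauge)
            have "AE x in lebesgue. norm (F c R x - F c r x) \<le> N * (Y x r / V) * (R / r) powr \<beta>"
              using F r R0 R by (simp add: tilde_bdd_def subset_ball)
            then show "AE x in lebesgue. norm (F c R x - F c r x) \<le> N / V / r ^ ?n * (R / r) powr \<beta> * X x r"
              by eventually_elim (simp add: Y_def mult_ac)
            show "(\<lambda>x. F c R x - F c r x) \<in> borel_measurable lebesgue" using Fr FR by measurable
            show "N / V / r ^ ?n * (R / r) powr \<beta> > 0" using N V_pos r R0 by simp
          qed fact+
        qed
        also have "\<dots> = ennreal (N * X c R + N / V / r ^ ?n * (R / r) powr \<beta> * (D * r ^ ?n * X c (R + r)))"
          using N V_pos r R0 D_pos X_pos[OF R0, of c] X_pos[of "R + r" c] by (intro ennreal_plus[symmetric]) auto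
        also have "\<dots> \<le> ennreal ((D + G) * N * Y c r * R ^ ?n * (R / r) powr (2 * \<beta>))"
        proof (rule ennreal_leI)
          have y: "Y c r > 0" by (rule Y_pos[OF r])
          have "N * X c R \<le> N * (D * Y c r * R ^ ?n * (R / r) powr \<beta>)"
            using N r R by (intro mult_left_mono X_grow_concentric) auto
          \<comment> \<open>The first term only needs the exponent \<beta>; it is enlarged to match
            the exponent 2 \<beta> of the compatibility term.\<close>
          also have "\<dots> \<le> N * (D * Y c r * R ^ ?n * (R / r) powr (2 * \<beta>))"
            unfolding q2 using N D_pos y R0 q mult_right_mono[of 1 "(R / r) powr \<beta>" "(R / r) powr \<beta>"]
            by (intro mult_left_mono) auto
          finally have 1: "N * X c R \<le> N * (D * Y c r * R ^ ?n * (R / r) powr (2 * \<beta>))" .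
          have "N / V / r ^ ?n * (R / r) powr \<beta> * (D * r ^ ?n * X c (R + r)) = N * (R / r) powr \<beta> * (D / V * X c (R + r))"
            using r by simp
          also have "\<dots> \<le> N * (R / r) powr \<beta> * (D / V * X c (2 * R))"
            using N D_pos V_pos r R by (intro mult_left_mono X_mono subset_ball) auto
          also have "\<dots> \<le> N * (R / r) powr \<beta> * (G * Y c r * R ^ ?n * (R / r) powr \<beta>)"
            using N by (intro mult_left_mono G2[OF R]) auto
          also have "\<dots> = N * (G * Y c r * R ^ ?n * (R / r) powr (2 * \<beta>))" unfolding q2 by (simp only: mult_ac)
          finally have 2: "N / V / r ^ ?n * (R / r) powr \<beta> * (D * r ^ ?n * X c (R + r)) \<le> N * (G * Y c r * R ^ ?n * (R / r) powr (2 * \<beta>))" .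
          show "N * X c R + N / V / r ^ ?n * (R / r) powr \<beta> * (D * r ^ ?n * X c (R + r)) \<le> (D + G) * N * Y c r * R ^ ?n * (R / r) powr (2 * \<beta>)"
            using add_mono[OF 1 2] by (simp add: algebra_simps)
        qed
        finally show "nint (ball c R) ?u \<le> ennreal ((D + G) * N * Y c r * R ^ ?n * (R / r) powr (2 * \<beta>))" .
      qed
    qed (rule r)
    have "nint (ball c r) (\<lambda>x. f x - semigroup_op A (r ^ ?m) f x)
      \<le> nint (ball c r) (\<lambda>x. f x - F c r x) + nint (ball c r) (\<lambda>x. F c r x - semigroup_op A (r ^ ?m) f x)"
      using fm Fr sm[OF fm] by (intro nint_triangle) auto
    also have "\<dots> \<le> nint (ball c r) (\<lambda>x. f x - F c r x) + (nint (ball c r) (\<lambda>x. F c r x - semigroup_op A (r ^ ?m) (F c r) x)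
        + nint (ball c r) (\<lambda>x. semigroup_op A (r ^ ?m) (F c r) x - semigroup_op A (r ^ ?m) f x))"
      using sm[OF Fr] Fr sm[OF fm] by (intro add_left_mono nint_triangle) auto
    also have "\<dots> \<le> ennreal (N * X c r) + (ennreal (G * N * X c r) + ennreal (E * N * X c r))"
    proof (intro add_mono)
      show "nint (ball c r) ?u \<le> ennreal (N * X c r)" using F r by (simp add: tilde_bdd_def)
      have "nint (ball c r) (\<lambda>x. F c r x - semigroup_op A (r ^ ?m) (F c r) x) \<le> ennreal (N / V / r ^ ?n * (D * r ^ ?n * X c (r + r)))"
      proof (rule nint_ball_le_gauge)
        have "AE x in lebesgue. norm (F c r x - semigroup_op A (r ^ ?m) (F c r) x) \<le> N * (Y x r / V)"
          using F r by (simp add: tilde_bdd_def)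
        then show "AE x in lebesgue. norm (F c r x - semigroup_op A (r ^ ?m) (F c r) x) \<le> N / V / r ^ ?n * X x r"
          by eventually_elim (simp add: Y_def mult_ac)
        show "(\<lambda>x. F c r x - semigroup_op A (r ^ ?m) (F c r) x) \<in> borel_measurable lebesgue" using Fr sm[OF Fr] by measurable
        show "N / V / r ^ ?n > 0" using N V_pos r by simp
      qed fact+
      also have "N / V / r ^ ?n * (D * r ^ ?n * X c (r + r)) = N * (D / V * X c (2 * r))" using r by simp
      also have "ennreal \<dots> \<le> ennreal (G * N * X c r)"
      proof (rule ennreal_leI)
        have "D / V * X c (2 * r) \<le> G * X c r" using G2[of r] r by (simp add: X_eq_Y[OF r] mult.assoc)
        then have "N * (D / V * X c (2 * r)) \<le> N * (G * X c r)" using N by (intro mult_left_mono) auto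
        then show "N * (D / V * X c (2 * r)) \<le> G * N * X c r" by (simp only: mult_ac)
      qed
      finally show "nint (ball c r) (\<lambda>x. F c r x - semigroup_op A (r ^ ?m) (F c r) x) \<le> ennreal (G * N * X c r)" .
      have "nint (ball c r) (\<lambda>x. semigroup_op A (r ^ ?m) (F c r) x - semigroup_op A (r ^ ?m) f x)
        \<le> ennreal (K * (?q * (C * ((D + G) * N * Y c r))) * (V * r ^ ?n))"
        unfolding V_def
      proof (rule nint_ball_le[OF r])
        show "0 \<le> K * (?q * (C * ((D + G) * N * Y c r)))" using K(1) C(1) D_pos G N Y_pos[OF r, of c] by simp
        fix x assume "x \<in> ball c r"
        then have cx: "norm (c - x) \<le> r" by (simp add: dist_norm)
        have "norm (semigroup_op A (r ^ ?m) (F c r) x - semigroup_op A (r ^ ?m) f x) = norm (semigroup_op A (r ^ ?m) ?u x)"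
          unfolding semigroup_op_diff[OF f Fd[OF r] t] by (rule norm_minus_commute)
        also have "ennreal \<dots> \<le> ennreal K * mint r x ?u" by (rule K(2)[OF r um])
        also have "\<dots> \<le> ennreal K * (ennreal ?q * mint r c ?u)" by (intro mult_left_mono mint_shift r cx um) simp
        also have "\<dots> \<le> ennreal K * (ennreal ?q * ennreal (C * ((D + G) * N * Y c r)))" by (intro mult_left_mono mu) auto
        also have "\<dots> = ennreal (K * (?q * (C * ((D + G) * N * Y c r))))"
        proof -
          have "0 \<le> C * ((D + G) * N * Y c r)" using C(1) D_pos G N Y_pos[OF r, of c] by simp
          then show ?thesis using K(1) by (simp only: ennreal_mult mult_nonneg_nonneg less_imp_le zero_le_power zero_le_numeral)
        qed
        finally show "norm (semigroup_op A (r ^ ?m) (F c r) x - semigroup_op A (r ^ ?m) f x) \<le> K * (?q * (C * ((D + G) * N * Y c r)))"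
          using K(1) C(1) D_pos G N Y_pos[OF r, of c] by (subst (asm) ennreal_le_iff) auto
      qed
      also have "K * (?q * (C * ((D + G) * N * Y c r))) * (V * r ^ ?n) = E * N * X c r"
        unfolding E_def X_eq_Y[OF r] by (simp only: mult_ac)
      finally show "nint (ball c r) (\<lambda>x. semigroup_op A (r ^ ?m) (F c r) x - semigroup_op A (r ^ ?m) f x) \<le> ennreal (E * N * X c r)" .
    qed
    also have "\<dots> = ennreal ((1 + G + E) * N * X c r)"
      using N G E X_pos[OF r, of c] by (simp flip: ennreal_plus add: algebra_simps)
    finally show "nint (ball c r) (\<lambda>x. f x - semigroup_op A (r ^ ?m) f x) \<le> ennreal ((1 + G + E) * N * X c r)" .
  qed
  then show ?thesis using G E by (intro exI[of _ "1 + G + E"]) (auto intro!: add_pos_pos)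
qed

end

section \<open>Norms of characteristic functions of balls\<close>

text \<open>Fubini over pairs at distance less than r, now for an upper bound: each z is met by
  centres y from a set of measure at most that of a ball of radius r, and only if z lies within R +
  r of x.\<close>

lemma nn_integral_ball_average_le:
  fixes u :: "real^'n \<Rightarrow> ennreal"
  assumes u [measurable]: "u \<in> borel_measurable lebesgue" and r: "r > 0" and R: "R > 0"
  shows "(\<integral>\<^sup>+y\<in>ball x R. (\<integral>\<^sup>+z\<in>ball y r. u z \<partial>lebesgue) \<partial>lebesgue)
    \<le> ennreal (unit_ball_vol (real CARD('n)) * r ^ CARD('n)) * (\<integral>\<^sup>+z\<in>ball x (R + r). u z \<partial>lebesgue)"
proof -
  let ?I = "indicator {p :: (real^'n) \<times> (real^'n). dist (fst p) (snd p) < r}"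
  have dm: "(\<lambda>p. ?I p :: ennreal) \<in> borel_measurable (lebesgue \<Otimes>\<^sub>M lebesgue)"
  proof -
    have "{p \<in> space (lebesgue \<Otimes>\<^sub>M lebesgue). dist (fst p) (snd p :: real^'n) < r} \<in> sets (lebesgue \<Otimes>\<^sub>M lebesgue)"
      by (intro borel_measurable_less borel_measurable_dist measurable_fst_lebesgue_borel measurable_snd_lebesgue_borel borel_measurable_const)
    then show ?thesis by (intro borel_measurable_indicator) (simp add: space_pair_measure)
  qed
  define g where "g y z = u z * indicator (ball x R) y * ?I (y, z)" for y z :: "real^'n"
  have g: "case_prod g \<in> borel_measurable (lebesgue \<Otimes>\<^sub>M lebesgue)"
    unfolding g_def case_prod_unfold using dm
    by (intro borel_measurable_times_ennreal measurable_compose[OF measurable_snd u]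
        measurable_compose[OF measurable_fst borel_measurable_indicator]) (simp_all add: case_prod_unfold)
  have "(\<integral>\<^sup>+y\<in>ball x R. (\<integral>\<^sup>+z\<in>ball y r. u z \<partial>lebesgue) \<partial>lebesgue) = (\<integral>\<^sup>+y. (\<integral>\<^sup>+z. g y z \<partial>lebesgue) \<partial>lebesgue)"
  proof (rule nn_integral_cong)
    fix y :: "real^'n"
    have "(\<integral>\<^sup>+z. g y z \<partial>lebesgue) = (\<integral>\<^sup>+z. (u z * indicator (ball y r) z) * indicator (ball x R) y \<partial>lebesgue)"
      by (intro nn_integral_cong) (auto simp: g_def indicator_def)
    also have "\<dots> = (\<integral>\<^sup>+z\<in>ball y r. u z \<partial>lebesgue) * indicator (ball x R) y"
      by (rule nn_integral_multc) measurable
    finally show "(\<integral>\<^sup>+z\<in>ball y r. u z \<partial>lebesgue) * indicator (ball x R) y = (\<integral>\<^sup>+z. g y z \<partial>lebesgue)" by simp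
  qed
  also have "\<dots> = (\<integral>\<^sup>+z. (\<integral>\<^sup>+y. g y z \<partial>lebesgue) \<partial>lebesgue)"
    by (rule lebesgue_pair.Fubini'[OF g, symmetric])
  also have "\<dots> \<le> (\<integral>\<^sup>+z. ennreal (unit_ball_vol (real CARD('n)) * r ^ CARD('n)) * (u z * indicator (ball x (R + r)) z) \<partial>lebesgue)"
  proof (rule nn_integral_mono)
    fix z :: "real^'n"
    have "(\<integral>\<^sup>+y. g y z \<partial>lebesgue) \<le> (\<integral>\<^sup>+y. (u z * indicator (ball x (R + r)) z) * indicator (ball z r) y \<partial>lebesgue)"
    proof (rule nn_integral_mono)
      fix y :: "real^'n"
      have "dist x z < R + r" if "dist x y < R" "dist y z < r"
        using that dist_triangle[of x z y] by simp
      then show "g y z \<le> (u z * indicator (ball x (R + r)) z) * indicator (ball z r) y"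
        by (auto simp: g_def indicator_def dist_commute)
    qed
    also have "\<dots> = (u z * indicator (ball x (R + r)) z) * emeasure lebesgue (ball z r)"
      by (rule nn_integral_cmult_indicator) simp
    also have "\<dots> = ennreal (unit_ball_vol (real CARD('n)) * r ^ CARD('n)) * (u z * indicator (ball x (R + r)) z)"
      using emeasure_lebesgue_ball[of r z] r by (simp only: less_imp_le mult.commute)
    finally show "(\<integral>\<^sup>+y. g y z \<partial>lebesgue) \<le> \<dots>" .
  qed
  also have "\<dots> = ennreal (unit_ball_vol (real CARD('n)) * r ^ CARD('n)) * (\<integral>\<^sup>+z\<in>ball x (R + r). u z \<partial>lebesgue)"
    by (rule nn_integral_cmult) measurable
  finally show ?thesis .
qed

section \<open>Ball integrals of \<phi> at a fixed level\<close>

locale growth =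
  fixes \<phi> :: "real^'n \<Rightarrow> real \<Rightarrow> real" and p\<^sub>1 p :: real
  assumes growth: "growth_function \<phi>" and p1: "1 \<le> p\<^sub>1" "Muckenhoupt p\<^sub>1 \<phi>"
    and p: "0 < p" "uniformly_lower_type p \<phi>"
begin

lemma phi_pos: "t > 0 \<Longrightarrow> 0 < \<phi> x t"
  and phi_0: "\<phi> x 0 = 0"
  and phi_measurable: "t \<ge> 0 \<Longrightarrow> (\<lambda>x. \<phi> x t) \<in> borel_measurable lebesgue"
  using growth by (auto simp: growth_function_def)

lemma phi_nonneg: "t \<ge> 0 \<Longrightarrow> 0 \<le> \<phi> x t"
  using phi_pos[of t x] phi_0[of x] by (cases "t = 0") (auto simp: less_imp_le)

definition \<Phi> :: "real^'n \<Rightarrow> real \<Rightarrow> real \<Rightarrow> ennreal" where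
  "\<Phi> c r t = (\<integral>\<^sup>+x\<in>ball c r. ennreal (\<phi> x t) \<partial>lebesgue)"

definition \<Psi> :: "real^'n \<Rightarrow> real \<Rightarrow> real \<Rightarrow> real" where
  "\<Psi> c r t = (LINT x:ball c r|lebesgue. \<phi> x t)"

lemma phi_set_integrable:
  assumes "t > 0" "r > 0"
  shows "set_integrable lebesgue (ball c r) (\<lambda>x. \<phi> x t)"
  using p1 assms unfolding Muckenhoupt_def by (auto split: if_splits)

lemma Phi_eq:
  assumes "t > 0" "r > 0"
  shows "\<Phi> c r t = ennreal (\<Psi> c r t)"
proof -
  have "\<Phi> c r t = (\<integral>\<^sup>+x. ennreal (indicat_real (ball c r) x *\<^sub>R \<phi> x t) \<partial>lebesgue)"
    unfolding \<Phi>_def by (intro nn_integral_cong) (auto simp: indicator_def)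
  also have "\<dots> = ennreal (\<Psi> c r t)"
    unfolding \<Psi>_def set_lebesgue_integral_def
    using phi_set_integrable[OF assms, of c] phi_nonneg[of t] assms(1)
    by (intro nn_integral_eq_integral) (auto simp: set_integrable_def)
  finally show ?thesis .
qed

lemma set_integral_pos:
  fixes g :: "real^'n \<Rightarrow> real"
  assumes g: "set_integrable lebesgue (ball c r) g" and pos: "\<And>x. 0 < g x" and r: "r > 0"
  shows "0 < (LINT x:ball c r|lebesgue. g x)"
proof -
  have i: "integrable lebesgue (\<lambda>x. indicat_real (ball c r) x *\<^sub>R g x)" using g by (simp add: set_integrable_def)
  have nn: "AE x in lebesgue. 0 \<le> indicat_real (ball c r) x *\<^sub>R g x"
    using pos by (intro AE_I2) (auto simp: indicator_def less_imp_le)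
  have "(LINT x:ball c r|lebesgue. g x) \<noteq> 0"
  proof
    assume "(LINT x:ball c r|lebesgue. g x) = 0"
    then have "AE x in lebesgue. indicat_real (ball c r) x *\<^sub>R g x = 0"
      using integral_nonneg_eq_0_iff_AE[OF i nn] by (simp add: set_lebesgue_integral_def)
    then have "AE x in lebesgue. x \<notin> ball c r"
      by eventually_elim (use pos in \<open>auto simp: indicator_def less_le split: if_splits\<close>)
    then have "emeasure lebesgue (ball c r) = 0"
      by (subst (asm) AE_iff_measurable[OF _ refl]) (auto simp: space_completion ball_def)
    moreover have "unit_ball_vol (real CARD('n)) * r ^ CARD('n) > 0" using r by simp
    ultimately show False
      using emeasure_lebesgue_ball[of r c] r by (simp only: ennreal_eq_0_iff not_le less_imp_le)
  qed
  moreover have "0 \<le> (LINT x:ball c r|lebesgue. g x)"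
    unfolding set_lebesgue_integral_def by (rule integral_nonneg_AE[OF nn])
  ultimately show ?thesis by simp
qed

lemma Psi_pos: "t > 0 \<Longrightarrow> r > 0 \<Longrightarrow> 0 < \<Psi> c r t"
  unfolding \<Psi>_def by (intro set_integral_pos phi_set_integrable phi_pos)

text \<open>The constant is raised to at least 1, which extends the inequality to s = 1 and makes it
  convenient to divide by.\<close>

lemma lower_type: "\<exists>L\<ge>1. \<forall>x. \<forall>t\<ge>0. \<forall>s. 0 < s \<and> s \<le> 1 \<longrightarrow> \<phi> x (s * t) \<le> L * s powr p * \<phi> x t"
proof -
  obtain C where C: "\<And>x t s. t \<ge> 0 \<Longrightarrow> 0 < s \<Longrightarrow> s < 1 \<Longrightarrow> \<phi> x (s * t) \<le> C * s powr p * \<phi> x t"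
    using p(2) unfolding uniformly_lower_type_def by blast
  have "\<phi> x (s * t) \<le> max C 1 * s powr p * \<phi> x t" if "t \<ge> 0" "0 < s" "s \<le> 1" for x t s
  proof (cases "s = 1")
    case True
    then show ?thesis using phi_nonneg[OF that(1), of x] mult_right_mono[of 1 "max C 1" "\<phi> x t"] by simp
  next
    case False
    then have "\<phi> x (s * t) \<le> C * s powr p * \<phi> x t" using that by (intro C) auto
    also have "\<dots> \<le> max C 1 * s powr p * \<phi> x t"
      using phi_nonneg[OF that(1), of x] by (intro mult_right_mono) auto
    finally show ?thesis .
  qed
  then show ?thesis by (intro exI[of _ "max C 1"]) auto
qed

lemma upper_type: "\<exists>U\<ge>1. \<forall>x. \<forall>t\<ge>0. \<forall>s\<ge>1. \<phi> x (s * t) \<le> U * s * \<phi> x t"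
proof -
  obtain C where C: "\<And>x t s. t \<ge> 0 \<Longrightarrow> 1 \<le> s \<Longrightarrow> \<phi> x (s * t) \<le> C * s powr 1 * \<phi> x t"
    using growth unfolding growth_function_def uniformly_upper_type_def by blast
  have "\<phi> x (s * t) \<le> max C 1 * s * \<phi> x t" if "t \<ge> 0" "1 \<le> s" for x t s
  proof -
    have "\<phi> x (s * t) \<le> C * s powr 1 * \<phi> x t" using that by (intro C) auto
    also have "\<dots> = C * s * \<phi> x t" using that by simp
    also have "\<dots> \<le> max C 1 * s * \<phi> x t"
      using phi_nonneg[OF that(1), of x] that by (intro mult_right_mono) auto
    finally show ?thesis .
  qed
  then show ?thesis by (intro exI[of _ "max C 1"]) auto
qed

lemma Psi_mono_scale:
  assumes le: "\<And>x. \<phi> x s \<le> k * \<phi> x t" and "s > 0" "t > 0" "r > 0"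
  shows "\<Psi> c r s \<le> k * \<Psi> c r t"
proof -
  have "\<Psi> c r s \<le> (LINT x:ball c r|lebesgue. k * \<phi> x t)"
    unfolding \<Psi>_def using assms by (intro set_integral_mono phi_set_integrable set_integrable_mult_right) auto
  then show ?thesis by (simp add: \<Psi>_def)
qed

lemma Psi_mono_ball:
  assumes "ball c\<^sub>1 r\<^sub>1 \<subseteq> ball c\<^sub>2 r\<^sub>2" "r\<^sub>1 > 0" "r\<^sub>2 > 0" "t > 0"
  shows "\<Psi> c\<^sub>1 r\<^sub>1 t \<le> \<Psi> c\<^sub>2 r\<^sub>2 t"
proof -
  have "\<Phi> c\<^sub>1 r\<^sub>1 t \<le> \<Phi> c\<^sub>2 r\<^sub>2 t"
    unfolding \<Phi>_def using assms by (intro nn_integral_mono) (auto simp: indicator_def)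
  then show ?thesis
    unfolding Phi_eq[OF assms(4,2)] Phi_eq[OF assms(4,3)] using Psi_pos[OF assms(4,3), of c\<^sub>2] by (simp add: ennreal_le_iff)
qed

text \<open>For exponent 1 the average over the larger ball is at most a constant times \<phi> at
  almost every point of that ball. Integrating this over the smaller ball gives the ratio of
  measures to the first power.\<close>

lemma Muckenhoupt_ratio_1:
  assumes "p\<^sub>1 = 1"
  shows "\<exists>K\<ge>1. \<forall>t>0. \<forall>c\<^sub>1 c\<^sub>2 r\<^sub>1 r\<^sub>2. 0 < r\<^sub>1 \<longrightarrow> 0 < r\<^sub>2 \<longrightarrow> ball c\<^sub>1 r\<^sub>1 \<subseteq> ball c\<^sub>2 r\<^sub>2 \<longrightarrow>
    \<Psi> c\<^sub>2 r\<^sub>2 t \<le> K * ((r\<^sub>2 / r\<^sub>1) ^ CARD('n)) powr p\<^sub>1 * \<Psi> c\<^sub>1 r\<^sub>1 t"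
proof -
  let ?v = "unit_ball_vol (real CARD('n))"
  obtain C where C: "\<And>t c r. t > 0 \<Longrightarrow> r > 0 \<Longrightarrow> ereal (avg_on (ball c r) (\<lambda>x. \<phi> x t))
             * esssup (restrict_space lebesgue (ball c r)) (\<lambda>y. ereal (inverse (\<phi> y t))) \<le> ereal C"
    using p1(2) assms unfolding Muckenhoupt_def by auto
  have "\<Psi> c\<^sub>2 r\<^sub>2 t \<le> max C 1 * ((r\<^sub>2 / r\<^sub>1) ^ CARD('n)) powr p\<^sub>1 * \<Psi> c\<^sub>1 r\<^sub>1 t"
    if t: "t > 0" and r: "0 < r\<^sub>1" "0 < r\<^sub>2" and sub: "ball c\<^sub>1 r\<^sub>1 \<subseteq> ball c\<^sub>2 r\<^sub>2" for t c\<^sub>1 c\<^sub>2 r\<^sub>1 r\<^sub>2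
  proof -
    have m: "measure lebesgue (ball c\<^sub>1 r\<^sub>1) = ?v * r\<^sub>1 ^ CARD('n)" "measure lebesgue (ball c\<^sub>2 r\<^sub>2) = ?v * r\<^sub>2 ^ CARD('n)"
      using r by (intro measure_lebesgue_ball; simp)+
    define a where "a = avg_on (ball c\<^sub>2 r\<^sub>2) (\<lambda>x. \<phi> x t)"
    have a_eq: "a = \<Psi> c\<^sub>2 r\<^sub>2 t / (?v * r\<^sub>2 ^ CARD('n))" by (simp only: a_def avg_on_def \<Psi>_def m)
    have a: "a > 0" unfolding a_eq using Psi_pos[OF t r(2), of c\<^sub>2] r by simp
    define e where "e = esssup (restrict_space lebesgue (ball c\<^sub>2 r\<^sub>2)) (\<lambda>y. ereal (inverse (\<phi> y t)))"
    have ae: "ereal a * e \<le> ereal C" unfolding a_def e_def by (rule C[OF t r(2)])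
    have "AE y in restrict_space lebesgue (ball c\<^sub>2 r\<^sub>2). ereal (inverse (\<phi> y t)) \<le> e"
      unfolding e_def by (rule esssup_AE)
    then have "AE y in lebesgue. y \<in> ball c\<^sub>2 r\<^sub>2 \<longrightarrow> ereal (inverse (\<phi> y t)) \<le> e"
      by (subst (asm) AE_restrict_space_iff) auto
    then have AE: "AE y in lebesgue. y \<in> ball c\<^sub>2 r\<^sub>2 \<longrightarrow> a \<le> max C 1 * \<phi> y t"
    proof eventually_elim
      case (elim y)
      show ?case
      proof
        assume "y \<in> ball c\<^sub>2 r\<^sub>2"
        then have "ereal a * ereal (inverse (\<phi> y t)) \<le> ereal a * e"
          using elim a by (intro ereal_mult_left_mono) auto
        then have "a * inverse (\<phi> y t) \<le> C" using ae by (metis ereal_less_eq(3) order_trans times_ereal.simps(1))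
        then have "a \<le> C * \<phi> y t" using phi_pos[OF t, of y] by (simp add: field_simps)
        also have "\<dots> \<le> max C 1 * \<phi> y t" using phi_pos[OF t, of y] by (intro mult_right_mono) auto
        finally show "a \<le> max C 1 * \<phi> y t" .
      qed
    qed
    have "ennreal (a * (?v * r\<^sub>1 ^ CARD('n))) = ennreal a * emeasure lebesgue (ball c\<^sub>1 r\<^sub>1)"
      using a r by (subst emeasure_lebesgue_ball) (auto intro: ennreal_mult)
    also have "\<dots> = (\<integral>\<^sup>+x. ennreal a * indicator (ball c\<^sub>1 r\<^sub>1) x \<partial>lebesgue)"
      by (rule nn_integral_cmult_indicator[symmetric]) simp
    also have "\<dots> \<le> (\<integral>\<^sup>+x. ennreal (max C 1) * (ennreal (\<phi> x t) * indicator (ball c\<^sub>1 r\<^sub>1) x) \<partial>lebesgue)"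
    proof (rule nn_integral_mono_AE)
      show "AE x in lebesgue. ennreal a * indicator (ball c\<^sub>1 r\<^sub>1) x \<le> ennreal (max C 1) * (ennreal (\<phi> x t) * indicator (ball c\<^sub>1 r\<^sub>1) x)"
        using AE
      proof eventually_elim
        case (elim x)
        show ?case
        proof (cases "x \<in> ball c\<^sub>1 r\<^sub>1")
          case True
          then have "ennreal a \<le> ennreal (max C 1 * \<phi> x t)" using elim sub by (intro ennreal_leI) auto
          also have "\<dots> = ennreal (max C 1) * ennreal (\<phi> x t)" using phi_pos[OF t, of x] by (intro ennreal_mult) auto
          finally show ?thesis using True by simp
        qed simp
      qed
    qed
    also have "\<dots> = ennreal (max C 1) * \<Phi> c\<^sub>1 r\<^sub>1 t"
      unfolding \<Phi>_def using phi_measurable[of t] t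
      by (intro nn_integral_cmult borel_measurable_times_ennreal borel_measurable_indicator measurable_compose[OF _ measurable_ennreal]) auto
    also have "\<dots> = ennreal (max C 1 * \<Psi> c\<^sub>1 r\<^sub>1 t)"
      unfolding Phi_eq[OF t r(1)] using Psi_pos[OF t r(1), of c\<^sub>1] by (intro ennreal_mult[symmetric]) auto
    finally have "a * (?v * r\<^sub>1 ^ CARD('n)) \<le> max C 1 * \<Psi> c\<^sub>1 r\<^sub>1 t"
      using Psi_pos[OF t r(1), of c\<^sub>1] by (subst (asm) ennreal_le_iff) auto
    then have "a * (?v * r\<^sub>1 ^ CARD('n)) * (r\<^sub>2 / r\<^sub>1) ^ CARD('n) \<le> max C 1 * \<Psi> c\<^sub>1 r\<^sub>1 t * (r\<^sub>2 / r\<^sub>1) ^ CARD('n)"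
      using r by (intro mult_right_mono) auto
    moreover have "a * (?v * r\<^sub>1 ^ CARD('n)) * (r\<^sub>2 / r\<^sub>1) ^ CARD('n) = \<Psi> c\<^sub>2 r\<^sub>2 t"
    proof -
      have "?v \<noteq> 0" by (simp add: less_imp_neq[symmetric])
      then show ?thesis unfolding a_eq using r by (simp add: power_divide)
    qed
    moreover have "((r\<^sub>2 / r\<^sub>1) ^ CARD('n)) powr p\<^sub>1 = (r\<^sub>2 / r\<^sub>1) ^ CARD('n)" using assms r by simp
    ultimately show ?thesis by (simp only: mult_ac)
  qed
  then show ?thesis by (intro exI[of _ "max C 1"]) auto
qed

text \<open>Hoelder's inequality is replaced by Young's inequality with a parameter \<open>lam\<close>, which is chosen
  so that the term with the negative power of \<open>\<phi>\<close> contributes at most \<open>|B\<^sub>1| / 2\<close>.\<close>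

lemma Muckenhoupt_ratio_gt_1:
  assumes gt: "1 < p\<^sub>1"
  shows "\<exists>K\<ge>1. \<forall>t>0. \<forall>c\<^sub>1 c\<^sub>2 r\<^sub>1 r\<^sub>2. 0 < r\<^sub>1 \<longrightarrow> 0 < r\<^sub>2 \<longrightarrow> ball c\<^sub>1 r\<^sub>1 \<subseteq> ball c\<^sub>2 r\<^sub>2 \<longrightarrow>
    \<Psi> c\<^sub>2 r\<^sub>2 t \<le> K * ((r\<^sub>2 / r\<^sub>1) ^ CARD('n)) powr p\<^sub>1 * \<Psi> c\<^sub>1 r\<^sub>1 t"
proof -
  let ?v = "unit_ball_vol (real CARD('n))"
  define q where "q = p\<^sub>1 - 1"
  have q: "q > 0" "p\<^sub>1 = q + 1" using gt by (auto simp: q_def)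
  obtain C where C: "\<And>t c r. t > 0 \<Longrightarrow> r > 0 \<Longrightarrow>
      set_integrable lebesgue (ball c r) (\<lambda>x. \<phi> x t powr (- 1 / q)) \<and>
      avg_on (ball c r) (\<lambda>x. \<phi> x t) * avg_on (ball c r) (\<lambda>x. \<phi> x t powr (- 1 / q)) powr q \<le> C"
    using p1(2) gt unfolding Muckenhoupt_def q_def by auto
  define K where "K = max 1 (2 powr p\<^sub>1 * C)"
  have "\<Psi> c\<^sub>2 r\<^sub>2 t \<le> K * ((r\<^sub>2 / r\<^sub>1) ^ CARD('n)) powr p\<^sub>1 * \<Psi> c\<^sub>1 r\<^sub>1 t"
    if t: "t > 0" and r: "0 < r\<^sub>1" "0 < r\<^sub>2" and sub: "ball c\<^sub>1 r\<^sub>1 \<subseteq> ball c\<^sub>2 r\<^sub>2" for t c\<^sub>1 c\<^sub>2 r\<^sub>1 r\<^sub>2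
  proof -
    define b\<^sub>1 where "b\<^sub>1 = ?v * r\<^sub>1 ^ CARD('n)"
    define b\<^sub>2 where "b\<^sub>2 = ?v * r\<^sub>2 ^ CARD('n)"
    have b: "b\<^sub>1 > 0" "b\<^sub>2 > 0" using r by (auto simp: b\<^sub>1_def b\<^sub>2_def)
    have m: "measure lebesgue (ball c\<^sub>1 r\<^sub>1) = b\<^sub>1" "measure lebesgue (ball c\<^sub>2 r\<^sub>2) = b\<^sub>2"
      unfolding b\<^sub>1_def b\<^sub>2_def using r by (intro measure_lebesgue_ball; simp)+
    let ?g = "\<lambda>x. \<phi> x t powr (- 1 / q)"
    define J\<^sub>1 where "J\<^sub>1 = (LINT x:ball c\<^sub>1 r\<^sub>1|lebesgue. ?g x)"
    define J\<^sub>2 where "J\<^sub>2 = (LINT x:ball c\<^sub>2 r\<^sub>2|lebesgue. ?g x)"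
    have gi: "set_integrable lebesgue (ball c\<^sub>1 r\<^sub>1) ?g" "set_integrable lebesgue (ball c\<^sub>2 r\<^sub>2) ?g"
      using C[OF t r(1), of c\<^sub>1] C[OF t r(2), of c\<^sub>2] by auto
    have gpos: "0 < ?g x" for x using phi_pos[OF t, of x] by simp
    have J: "J\<^sub>1 > 0" "J\<^sub>2 > 0" unfolding J\<^sub>1_def J\<^sub>2_def
      using gi gpos r by (intro set_integral_pos; simp)+
    have J12: "J\<^sub>1 \<le> J\<^sub>2"
      unfolding J\<^sub>1_def J\<^sub>2_def set_lebesgue_integral_def using gi sub gpos
      by (intro integral_mono) (auto simp: set_integrable_def indicator_def less_imp_le)
    define I\<^sub>1 where "I\<^sub>1 = \<Psi> c\<^sub>1 r\<^sub>1 t"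
    define I\<^sub>2 where "I\<^sub>2 = \<Psi> c\<^sub>2 r\<^sub>2 t"
    have I: "I\<^sub>1 > 0" "I\<^sub>2 > 0" unfolding I\<^sub>1_def I\<^sub>2_def using Psi_pos t r by auto
    have AC: "I\<^sub>2 / b\<^sub>2 * (J\<^sub>2 / b\<^sub>2) powr q \<le> C"
      using C[OF t r(2), of c\<^sub>2] unfolding avg_on_def m I\<^sub>2_def \<Psi>_def J\<^sub>2_def by simp
    \<comment> \<open>Solves lam^(- 1 / q) = b1 / (2 J2), where b1 is the measure of the small ball
      and J2 the integral of the negative power over the large one. The second term of the
      inequality below then integrates to at most b1 / 2.\<close>
    define lam where "lam = (2 * J\<^sub>2 / b\<^sub>1) powr q"
    have l: "lam > 0" using J b by (simp add: lam_def)
    have lq: "lam powr (- 1 / q) = b\<^sub>1 / (2 * J\<^sub>2)"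
    proof -
      have "lam powr (- 1 / q) = (2 * J\<^sub>2 / b\<^sub>1) powr (- 1)" unfolding lam_def powr_powr using q by simp
      also have "\<dots> = b\<^sub>1 / (2 * J\<^sub>2)" using J b by (simp add: powr_minus_divide)
      finally show ?thesis .
    qed
    \<comment> \<open>Weights 1 / p1 and q / p1, applied to a = lam \<phi> and its power a^(- 1 /
      q): the weighted geometric mean is exactly 1. Both weights are then enlarged to 1.\<close>
    have young: "1 \<le> lam * \<phi> x t + b\<^sub>1 / (2 * J\<^sub>2) * ?g x" for x
    proof -
      let ?a = "lam * \<phi> x t"
      have a: "?a > 0" using l phi_pos[OF t, of x] by simp
      have "?a powr (1 / p\<^sub>1) * (?a powr (- 1 / q)) powr (q / p\<^sub>1) \<le> 1 / p\<^sub>1 * ?a + q / p\<^sub>1 * ?a powr (- 1 / q)"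
        using a q by (intro Youngs_inequality_0) (auto simp: add_divide_distrib[symmetric])
      moreover have "?a powr (1 / p\<^sub>1) * (?a powr (- 1 / q)) powr (q / p\<^sub>1) = 1"
        using less_imp_neq[OF a] q by (simp add: powr_powr powr_add[symmetric])
      moreover have "1 / p\<^sub>1 * ?a \<le> 1 * ?a" using a q by (intro mult_right_mono) auto
      moreover have "q / p\<^sub>1 * ?a powr (- 1 / q) \<le> 1 * ?a powr (- 1 / q)" using q by (intro mult_right_mono) auto
      moreover have "?a powr (- 1 / q) = b\<^sub>1 / (2 * J\<^sub>2) * ?g x" unfolding powr_mult lq ..
      ultimately show ?thesis by linarith
    qed
    have one: "set_integrable lebesgue (ball c\<^sub>1 r\<^sub>1) (\<lambda>_. 1 :: real)"
      unfolding set_integrable_def using r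
      by (simp add: integrable_real_indicator emeasure_ball)
    have "b\<^sub>1 = (LINT x:ball c\<^sub>1 r\<^sub>1|lebesgue. 1 :: real)"
      unfolding m(1)[symmetric] set_lebesgue_integral_def by simp
    also have "\<dots> \<le> (LINT x:ball c\<^sub>1 r\<^sub>1|lebesgue. lam * \<phi> x t + b\<^sub>1 / (2 * J\<^sub>2) * ?g x)"
      using one gi(1) phi_set_integrable[OF t r(1), of c\<^sub>1] young
      by (intro set_integral_mono set_integral_add set_integrable_mult_right) auto
    also have "\<dots> = (LINT x:ball c\<^sub>1 r\<^sub>1|lebesgue. lam * \<phi> x t) + (LINT x:ball c\<^sub>1 r\<^sub>1|lebesgue. b\<^sub>1 / (2 * J\<^sub>2) * ?g x)"
      using gi(1) phi_set_integrable[OF t r(1), of c\<^sub>1] by (intro set_integral_add set_integrable_mult_right) auto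
    also have "\<dots> = lam * I\<^sub>1 + b\<^sub>1 / (2 * J\<^sub>2) * J\<^sub>1"
      unfolding I\<^sub>1_def \<Psi>_def J\<^sub>1_def by (simp only: set_integral_mult_right)
    also have "b\<^sub>1 / (2 * J\<^sub>2) * J\<^sub>1 \<le> b\<^sub>1 / (2 * J\<^sub>2) * J\<^sub>2" using b J J12 by (intro mult_left_mono) auto
    also have "\<dots> = b\<^sub>1 / 2" using J by simp
    finally have 1: "b\<^sub>1 / 2 \<le> lam * I\<^sub>1" by simp
    have bp: "x * x powr q = x powr p\<^sub>1" if "x > 0" for x :: real
      unfolding q(2) using that by (simp add: powr_mult_base add.commute)
    have "I\<^sub>2 * (b\<^sub>1 / 2) \<le> I\<^sub>2 * (lam * I\<^sub>1)" using 1 I by (intro mult_left_mono) auto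
    also have "I\<^sub>2 * (lam * I\<^sub>1) = (I\<^sub>2 / b\<^sub>2 * (J\<^sub>2 / b\<^sub>2) powr q) * (b\<^sub>2 * (2 * b\<^sub>2 / b\<^sub>1) powr q) * I\<^sub>1"
    proof -
      have "(J\<^sub>2 / b\<^sub>2) powr q * (2 * b\<^sub>2 / b\<^sub>1) powr q = lam"
        unfolding lam_def powr_mult[symmetric] using b by (simp add: mult.commute)
      then have "I\<^sub>2 * (lam * I\<^sub>1) = I\<^sub>2 * (((J\<^sub>2 / b\<^sub>2) powr q * (2 * b\<^sub>2 / b\<^sub>1) powr q) * I\<^sub>1)" by simp
      then show ?thesis using b by simp
    qed
    also have "\<dots> \<le> C * (b\<^sub>2 * (2 * b\<^sub>2 / b\<^sub>1) powr q) * I\<^sub>1"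
      using AC b I by (intro mult_right_mono) auto
    finally have "I\<^sub>2 * (b\<^sub>1 / 2) * (2 / b\<^sub>1) \<le> C * (b\<^sub>2 * (2 * b\<^sub>2 / b\<^sub>1) powr q) * I\<^sub>1 * (2 / b\<^sub>1)"
      using b by (intro mult_right_mono) auto
    then have "I\<^sub>2 \<le> C * ((2 * b\<^sub>2 / b\<^sub>1) * (2 * b\<^sub>2 / b\<^sub>1) powr q) * I\<^sub>1"
      using b by (simp add: mult_ac)
    also have "(2 * b\<^sub>2 / b\<^sub>1) * (2 * b\<^sub>2 / b\<^sub>1) powr q = (2 * b\<^sub>2 / b\<^sub>1) powr p\<^sub>1" using b by (intro bp) simp
    also have "2 * b\<^sub>2 / b\<^sub>1 = 2 * (r\<^sub>2 / r\<^sub>1) ^ CARD('n)" using r less_imp_neq[OF b(1)] by (simp add: b\<^sub>1_def b\<^sub>2_def power_divide)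
    also have "C * (2 * (r\<^sub>2 / r\<^sub>1) ^ CARD('n)) powr p\<^sub>1 * I\<^sub>1 = (2 powr p\<^sub>1 * C) * ((r\<^sub>2 / r\<^sub>1) ^ CARD('n)) powr p\<^sub>1 * I\<^sub>1"
      unfolding powr_mult by simp
    also have "\<dots> \<le> K * ((r\<^sub>2 / r\<^sub>1) ^ CARD('n)) powr p\<^sub>1 * I\<^sub>1"
      using I unfolding K_def by (intro mult_right_mono) auto
    finally show ?thesis unfolding I\<^sub>1_def I\<^sub>2_def .
  qed
  then show ?thesis by (intro exI[of _ K]) (auto simp: K_def)
qed

lemma Muckenhoupt_ratio:
  "\<exists>K\<ge>1. \<forall>t>0. \<forall>c\<^sub>1 c\<^sub>2 r\<^sub>1 r\<^sub>2. 0 < r\<^sub>1 \<longrightarrow> 0 < r\<^sub>2 \<longrightarrow> ball c\<^sub>1 r\<^sub>1 \<subseteq> ball c\<^sub>2 r\<^sub>2 \<longrightarrow>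
    \<Psi> c\<^sub>2 r\<^sub>2 t \<le> K * ((r\<^sub>2 / r\<^sub>1) ^ CARD('n)) powr p\<^sub>1 * \<Psi> c\<^sub>1 r\<^sub>1 t"
  using Muckenhoupt_ratio_1 Muckenhoupt_ratio_gt_1 p1(1) by (cases "p\<^sub>1 = 1") auto

section \<open>The Luxemburg norm of the indicator of a ball\<close>

definition chi_set :: "real^'n \<Rightarrow> real \<Rightarrow> real set" where
  "chi_set c r = {s. 0 < s \<and> \<Psi> c r (1 / s) \<le> 1}"

text \<open>The indicator takes the values 0 and 1 and \<phi> vanishes at level 0, so the defining
  integral is that of \<phi> at level 1 / s over the ball.\<close>

lemma chi_norm_eq:
  assumes r: "r > 0"
  shows "chi_norm \<phi> c r = Inf (chi_set c r)"
proof -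
  have "(\<integral>\<^sup>+x. ennreal (\<phi> x (\<bar>indicat_real (ball c r) x\<bar> / s)) \<partial>lebesgue) \<le> 1 \<longleftrightarrow> \<Psi> c r (1 / s) \<le> 1" if s: "s > 0" for s
  proof -
    have "(\<integral>\<^sup>+x. ennreal (\<phi> x (\<bar>indicat_real (ball c r) x\<bar> / s)) \<partial>lebesgue) = \<Phi> c r (1 / s)"
      unfolding \<Phi>_def by (intro nn_integral_cong) (auto simp: indicator_def phi_0)
    also have "\<dots> = ennreal (\<Psi> c r (1 / s))" using s r by (intro Phi_eq) auto
    finally show ?thesis by (simp add: ennreal_le_1)
  qed
  then show ?thesis unfolding chi_norm_def Lphi_norm_def chi_set_def by (intro arg_cong[of _ _ Inf] Collect_cong) auto
qed

lemma chi_set_nonempty: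
  assumes r: "r > 0"
  shows "chi_set c r \<noteq> {}"
proof -
  obtain L where L: "L \<ge> 1" "\<And>x t s. \<lbrakk>t \<ge> 0; 0 < s; s \<le> 1\<rbrakk> \<Longrightarrow> \<phi> x (s * t) \<le> L * s powr p * \<phi> x t"
    using lower_type by blast
  define a where "a = \<Psi> c r 1"
  have a: "a > 0" unfolding a_def using r by (intro Psi_pos) auto
  \<comment> \<open>Makes L \<sigma>^p a equal to L a / (L a + 1), which is below 1; the summand 1
    also keeps \<sigma> at most 1, as lower type requires.\<close>
  define \<sigma> where "\<sigma> = (1 / (L * a + 1)) powr (1 / p)"
  have La: "L * a > 0" using L a by (intro mult_pos_pos) auto
  have \<sigma>: "\<sigma> > 0" "\<sigma> \<le> 1" unfolding \<sigma>_def using La p by (auto intro!: powr_le1)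
  have \<sigma>p: "\<sigma> powr p = 1 / (L * a + 1)" unfolding \<sigma>_def powr_powr using p La by simp
  have "\<Psi> c r (\<sigma> * 1) \<le> (L * \<sigma> powr p) * \<Psi> c r 1"
    using \<sigma> r by (intro Psi_mono_scale L) auto
  also have "\<dots> = L * a / (L * a + 1)" unfolding \<sigma>p a_def by simp
  also have "\<dots> \<le> 1" using La by simp
  finally have "\<Psi> c r (1 / (1 / \<sigma>)) \<le> 1" by simp
  then have "1 / \<sigma> \<in> chi_set c r" using \<sigma> by (simp add: chi_set_def)
  then show ?thesis by blast
qed

lemma chi_set_bdd_below: "bdd_below (chi_set c r)"
  by (rule bdd_belowI[of _ 0]) (simp add: chi_set_def)

lemma chi_norm_pos:
  assumes r: "r > 0"
  shows "0 < chi_norm \<phi> c r"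
proof -
  obtain L where L: "L \<ge> 1" "\<And>x t s. \<lbrakk>t \<ge> 0; 0 < s; s \<le> 1\<rbrakk> \<Longrightarrow> \<phi> x (s * t) \<le> L * s powr p * \<phi> x t"
    using lower_type by blast
  define a where "a = \<Psi> c r 1"
  have a: "a > 0" unfolding a_def using r by (intro Psi_pos) auto
  \<comment> \<open>For s < 1 in \<open>chi_set c r\<close> lower type from level 1 / s down to
    level 1 gives a \<le> L s^p, hence s is at least (a / L)^(1 / p).\<close>
  define s\<^sub>0 where "s\<^sub>0 = min 1 ((a / L) powr (1 / p))"
  have s0: "s\<^sub>0 > 0" using a L by (simp add: s\<^sub>0_def)
  have "s\<^sub>0 \<le> s" if "s \<in> chi_set c r" for s
  proof (cases "s < 1")
    case True
    have s: "s > 0" "\<Psi> c r (1 / s) \<le> 1" using that by (auto simp: chi_set_def)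
    have "\<phi> x 1 \<le> (L * s powr p) * \<phi> x (1 / s)" for x
      using L(2)[of "1 / s" s x] s True by simp
    then have "a \<le> (L * s powr p) * \<Psi> c r (1 / s)"
      unfolding a_def using s r by (intro Psi_mono_scale) auto
    also have "\<dots> \<le> (L * s powr p) * 1" using s L by (intro mult_left_mono) auto
    finally have "a / L \<le> s powr p" using L by (simp add: divide_le_eq mult.commute)
    then have "(a / L) powr (1 / p) \<le> (s powr p) powr (1 / p)" using a L p by (intro powr_mono2) auto
    also have "\<dots> = s" unfolding powr_powr using p s by simp
    finally show ?thesis by (simp add: s\<^sub>0_def)
  qed (simp add: s\<^sub>0_def)
  then have "s\<^sub>0 \<le> Inf (chi_set c r)" using chi_set_nonempty[OF r] by (intro cInf_greatest) auto
  then show ?thesis using s0 by (simp add: chi_norm_eq[OF r])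
qed

lemma chi_norm_le: "r > 0 \<Longrightarrow> s \<in> chi_set c r \<Longrightarrow> chi_norm \<phi> c r \<le> s"
  unfolding chi_norm_eq by (intro cInf_lower chi_set_bdd_below)

lemma chi_set_mono:
  assumes "0 < r\<^sub>1" "0 < r\<^sub>2" "ball c\<^sub>1 r\<^sub>1 \<subseteq> ball c\<^sub>2 r\<^sub>2"
  shows "chi_set c\<^sub>2 r\<^sub>2 \<subseteq> chi_set c\<^sub>1 r\<^sub>1"
proof
  fix s assume "s \<in> chi_set c\<^sub>2 r\<^sub>2"
  then have s: "s > 0" "\<Psi> c\<^sub>2 r\<^sub>2 (1 / s) \<le> 1" by (auto simp: chi_set_def)
  have "\<Psi> c\<^sub>1 r\<^sub>1 (1 / s) \<le> \<Psi> c\<^sub>2 r\<^sub>2 (1 / s)" using assms s by (intro Psi_mono_ball) auto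
  then show "s \<in> chi_set c\<^sub>1 r\<^sub>1" using s by (simp add: chi_set_def)
qed

lemma chi_norm_mono:
  assumes "0 < r\<^sub>1" "0 < r\<^sub>2" "ball c\<^sub>1 r\<^sub>1 \<subseteq> ball c\<^sub>2 r\<^sub>2"
  shows "chi_norm \<phi> c\<^sub>1 r\<^sub>1 \<le> chi_norm \<phi> c\<^sub>2 r\<^sub>2"
  unfolding chi_norm_eq[OF assms(1)] chi_norm_eq[OF assms(2)]
  by (intro cInf_superset_mono chi_set_nonempty chi_set_bdd_below chi_set_mono assms)

text \<open>If s is a permitted scale for the small ball, then k s is one for the large ball, where
  k^p is L K times the ratio of measures to the power p1: lower type gains k^(- p), and this offsets
  exactly the loss in the Muckenhoupt ratio.\<close>

lemma chi_norm_growth: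
  "\<exists>D\<ge>1. \<forall>c\<^sub>1 c\<^sub>2 r\<^sub>1 r\<^sub>2. 0 < r\<^sub>1 \<longrightarrow> 0 < r\<^sub>2 \<longrightarrow> ball c\<^sub>1 r\<^sub>1 \<subseteq> ball c\<^sub>2 r\<^sub>2 \<longrightarrow>
    chi_norm \<phi> c\<^sub>2 r\<^sub>2 \<le> D * (r\<^sub>2 / r\<^sub>1) powr (real CARD('n) * p\<^sub>1 / p) * chi_norm \<phi> c\<^sub>1 r\<^sub>1"
proof -
  let ?n = "CARD('n)"
  obtain L where L: "L \<ge> 1" "\<And>x t s. \<lbrakk>t \<ge> 0; 0 < s; s \<le> 1\<rbrakk> \<Longrightarrow> \<phi> x (s * t) \<le> L * s powr p * \<phi> x t"
    using lower_type by blast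
  obtain K where K: "K \<ge> 1" "\<And>t c\<^sub>1 c\<^sub>2 r\<^sub>1 r\<^sub>2. \<lbrakk>0 < t; 0 < r\<^sub>1; 0 < r\<^sub>2; ball c\<^sub>1 r\<^sub>1 \<subseteq> ball c\<^sub>2 r\<^sub>2\<rbrakk> \<Longrightarrow>
    \<Psi> c\<^sub>2 r\<^sub>2 t \<le> K * ((r\<^sub>2 / r\<^sub>1) ^ ?n) powr p\<^sub>1 * \<Psi> c\<^sub>1 r\<^sub>1 t"
    using Muckenhoupt_ratio by blast
  have LK: "L * K \<ge> 1" using L K mult_mono[of 1 L 1 K] by simp
  define D where "D = (L * K) powr (1 / p)"
  have D: "D \<ge> 1" unfolding D_def using LK p by (intro ge_one_powr_ge_zero) auto
  have "chi_norm \<phi> c\<^sub>2 r\<^sub>2 \<le> D * (r\<^sub>2 / r\<^sub>1) powr (real ?n * p\<^sub>1 / p) * chi_norm \<phi> c\<^sub>1 r\<^sub>1"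
    if r: "0 < r\<^sub>1" "0 < r\<^sub>2" and sub: "ball c\<^sub>1 r\<^sub>1 \<subseteq> ball c\<^sub>2 r\<^sub>2" for c\<^sub>1 c\<^sub>2 r\<^sub>1 r\<^sub>2
  proof -
    have r12: "r\<^sub>1 \<le> r\<^sub>2"
      using r sub ball_subset_ball_iff[of c\<^sub>1 r\<^sub>1 c\<^sub>2 r\<^sub>2] zero_le_dist[of c\<^sub>1 c\<^sub>2] by linarith
    define w where "w = (r\<^sub>2 / r\<^sub>1) powr (real ?n * p\<^sub>1 / p)"
    have w: "w \<ge> 1" unfolding w_def using r r12 p p1 by (intro ge_one_powr_ge_zero) auto
    define k where "k = D * w"
    have k: "k \<ge> 1" unfolding k_def using mult_mono[of 1 D 1 w] D w by simp
    have wp: "w powr p = ((r\<^sub>2 / r\<^sub>1) ^ ?n) powr p\<^sub>1"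
    proof -
      have "w powr p = (r\<^sub>2 / r\<^sub>1) powr (real ?n * p\<^sub>1)" unfolding w_def powr_powr using p by simp
      also have "\<dots> = ((r\<^sub>2 / r\<^sub>1) powr real ?n) powr p\<^sub>1" by (simp only: powr_powr)
      also have "(r\<^sub>2 / r\<^sub>1) powr real ?n = (r\<^sub>2 / r\<^sub>1) ^ ?n" using r by (intro powr_realpow) simp
      finally show ?thesis .
    qed
    have Dp: "D powr p = L * K" unfolding D_def powr_powr using p LK by simp
    have kp: "k powr p = L * K * ((r\<^sub>2 / r\<^sub>1) ^ ?n) powr p\<^sub>1" unfolding k_def powr_mult Dp wp ..
    have "chi_norm \<phi> c\<^sub>2 r\<^sub>2 \<le> k * s" if "s \<in> chi_set c\<^sub>1 r\<^sub>1" for s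
    proof (rule chi_norm_le[OF r(2)])
      have s: "s > 0" "\<Psi> c\<^sub>1 r\<^sub>1 (1 / s) \<le> 1" using that by (auto simp: chi_set_def)
      have "\<phi> x (1 / (k * s)) \<le> (L * (1 / k) powr p) * \<phi> x (1 / s)" for x
        using L(2)[of "1 / s" "1 / k" x] s k by simp
      then have "\<Psi> c\<^sub>2 r\<^sub>2 (1 / (k * s)) \<le> (L * (1 / k) powr p) * \<Psi> c\<^sub>2 r\<^sub>2 (1 / s)"
        using s k r by (intro Psi_mono_scale) auto
      also have "\<dots> \<le> (L * (1 / k) powr p) * (K * ((r\<^sub>2 / r\<^sub>1) ^ ?n) powr p\<^sub>1 * \<Psi> c\<^sub>1 r\<^sub>1 (1 / s))"
        using s L r sub by (intro mult_left_mono K) auto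
      also have "\<dots> = (1 / k) powr p * k powr p * \<Psi> c\<^sub>1 r\<^sub>1 (1 / s)" unfolding kp by simp
      also have "(1 / k) powr p * k powr p = 1" unfolding powr_mult[symmetric] using k by simp
      finally have "\<Psi> c\<^sub>2 r\<^sub>2 (1 / (k * s)) \<le> 1" using s by simp
      then show "k * s \<in> chi_set c\<^sub>2 r\<^sub>2" using s k by (simp add: chi_set_def)
    qed
    then have "\<forall>s\<in>chi_set c\<^sub>1 r\<^sub>1. chi_norm \<phi> c\<^sub>2 r\<^sub>2 \<le> k * s" by blast
    then have "chi_norm \<phi> c\<^sub>2 r\<^sub>2 / k \<le> s" if "s \<in> chi_set c\<^sub>1 r\<^sub>1" for s
      using that k by (auto simp: divide_le_eq mult.commute[of k])
    then have "chi_norm \<phi> c\<^sub>2 r\<^sub>2 / k \<le> chi_norm \<phi> c\<^sub>1 r\<^sub>1"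
      unfolding chi_norm_eq[OF r(1)] by (intro cInf_greatest chi_set_nonempty r)
    then show ?thesis using k unfolding k_def w_def by (simp add: divide_le_eq mult.commute)
  qed
  then show ?thesis using D by blast
qed

text \<open>Upper type 1 makes the norms of small balls additive at the scale of a larger one.\<close>

lemma chi_norm_integral:
  "\<exists>D\<ge>1. \<forall>x r R. 0 < r \<longrightarrow> 0 < R \<longrightarrow>
    (\<integral>\<^sup>+y\<in>ball x R. ennreal (chi_norm \<phi> y r) \<partial>lebesgue) \<le> ennreal (D * r ^ CARD('n) * chi_norm \<phi> x (R + r))"
proof -
  let ?v = "unit_ball_vol (real CARD('n))"
  obtain U where U: "U \<ge> 1" "\<And>x t s. \<lbrakk>t \<ge> 0; 1 \<le> s\<rbrakk> \<Longrightarrow> \<phi> x (s * t) \<le> U * s * \<phi> x t"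
    using upper_type by blast
  have "(\<integral>\<^sup>+y\<in>ball x R. ennreal (chi_norm \<phi> y r) \<partial>lebesgue) \<le> ennreal (max 1 (U * ?v) * r ^ CARD('n) * chi_norm \<phi> x (R + r))"
    if r: "0 < r" and R: "0 < R" for x r R
  proof -
    let ?k = "U * ?v * r ^ CARD('n)"
    have k: "?k > 0" using U r by simp
    have main: "(\<integral>\<^sup>+y\<in>ball x R. ennreal (chi_norm \<phi> y r) \<partial>lebesgue) \<le> ennreal (?k * l)" if l: "l \<in> chi_set x (R + r)" for l
    proof -
      have l0: "l > 0" "\<Psi> x (R + r) (1 / l) \<le> 1" using l by (auto simp: chi_set_def)
      \<comment> \<open>If this fails, some s lies strictly between the two sides. It is below the
        norm, so the integral at level 1 / s exceeds 1; upper type 1 from level 1 / l to level 1 / s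
        then forces s below U l times the integral at level 1 / l, a contradiction.\<close>
      have pw: "chi_norm \<phi> y r \<le> U * l * \<Psi> y r (1 / l)" if y: "y \<in> ball x R" for y
      proof (rule ccontr)
        assume nle: "\<not> chi_norm \<phi> y r \<le> U * l * \<Psi> y r (1 / l)"
        have sub: "ball y r \<subseteq> ball x (R + r)"
        proof
          fix z assume "z \<in> ball y r"
          then show "z \<in> ball x (R + r)" using y dist_triangle[of x z y] by simp
        qed
        have ly: "l \<in> chi_set y r" using chi_set_mono[OF r _ sub] l r R by auto
        define s where "s = (U * l * \<Psi> y r (1 / l) + chi_norm \<phi> y r) / 2"
        have w: "0 < U * l * \<Psi> y r (1 / l)" using U l0 Psi_pos[of "1 / l" r y] r by simp
        have s: "U * l * \<Psi> y r (1 / l) < s" "s < chi_norm \<phi> y r" using nle by (auto simp: s_def)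
        have s0: "s > 0" using w s by linarith
        have sl: "s \<le> l" using s chi_norm_le[OF r ly] by linarith
        have "s \<notin> chi_set y r" using s(2) chi_norm_le[OF r, of s y] by auto
        then have "1 < \<Psi> y r (1 / s)" using s0 by (auto simp: chi_set_def)
        also have "\<dots> \<le> (U * (l / s)) * \<Psi> y r (1 / l)"
        proof (rule Psi_mono_scale)
          fix z
          show "\<phi> z (1 / s) \<le> U * (l / s) * \<phi> z (1 / l)"
            using U(2)[of "1 / l" "l / s" z] l0 s0 sl by simp
        qed (use s0 l0 r in auto)
        finally have "s < U * l * \<Psi> y r (1 / l)" using s0 by (simp add: field_simps)
        then show False using s by linarith
      qed
      have "(\<integral>\<^sup>+y\<in>ball x R. ennreal (chi_norm \<phi> y r) \<partial>lebesgue) \<le> (\<integral>\<^sup>+y. ennreal (U * l) * ((\<integral>\<^sup>+z\<in>ball y r. ennreal (\<phi> z (1 / l)) \<partial>lebesgue) * indicator (ball x R) y) \<partial>lebesgue)"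
      proof (rule nn_integral_mono)
        fix y
        show "ennreal (chi_norm \<phi> y r) * indicator (ball x R) y \<le> ennreal (U * l) * ((\<integral>\<^sup>+z\<in>ball y r. ennreal (\<phi> z (1 / l)) \<partial>lebesgue) * indicator (ball x R) y)"
        proof (cases "y \<in> ball x R")
          case True
          have "ennreal (chi_norm \<phi> y r) \<le> ennreal (U * l * \<Psi> y r (1 / l))" by (intro ennreal_leI pw True)
          also have "\<dots> = ennreal (U * l) * ennreal (\<Psi> y r (1 / l))"
            using U l0 Psi_pos[of "1 / l" r y] r by (intro ennreal_mult) auto
          also have "ennreal (\<Psi> y r (1 / l)) = \<Phi> y r (1 / l)" using l0 r by (intro Phi_eq[symmetric]) auto
          finally show ?thesis using True by (simp add: \<Phi>_def)
        qed simp
      qed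
      also have "\<dots> \<le> ennreal (U * l) * (ennreal (?v * r ^ CARD('n)) * (\<integral>\<^sup>+z\<in>ball x (R + r). ennreal (\<phi> z (1 / l)) \<partial>lebesgue))"
      proof -
        have m: "(\<lambda>z. ennreal (\<phi> z (1 / l))) \<in> borel_measurable lebesgue"
          using phi_measurable[of "1 / l"] l0 by (intro measurable_compose[OF _ measurable_ennreal]) auto
        have "(\<lambda>y. \<integral>\<^sup>+z\<in>ball y r. ennreal (\<phi> z (1 / l)) \<partial>lebesgue) \<in> borel_measurable lebesgue"
        proof (rule lebesgue.borel_measurable_nn_integral)
          have "{p \<in> space (lebesgue \<Otimes>\<^sub>M lebesgue). dist (fst p) (snd p :: real^'n) < r} \<in> sets (lebesgue \<Otimes>\<^sub>M lebesgue)"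
            by (intro borel_measurable_less borel_measurable_dist measurable_fst_lebesgue_borel measurable_snd_lebesgue_borel borel_measurable_const)
          then have "(\<lambda>p. indicator {p :: (real^'n) \<times> (real^'n). dist (fst p) (snd p) < r} p :: ennreal) \<in> borel_measurable (lebesgue \<Otimes>\<^sub>M lebesgue)"
            by (intro borel_measurable_indicator) (simp add: space_pair_measure)
          then have "(\<lambda>p. ennreal (\<phi> (snd p) (1 / l)) * indicator {p :: (real^'n) \<times> (real^'n). dist (fst p) (snd p) < r} p) \<in> borel_measurable (lebesgue \<Otimes>\<^sub>M lebesgue)"
            by (intro borel_measurable_times_ennreal measurable_compose[OF measurable_snd m])
          moreover have "ennreal (\<phi> (snd p) (1 / l)) * indicator {p :: (real^'n) \<times> (real^'n). dist (fst p) (snd p) < r} p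
            = (case p of (y, z) \<Rightarrow> ennreal (\<phi> z (1 / l)) * indicator (ball y r) z)" for p
            by (cases p) (auto simp: indicator_def)
          ultimately show "(\<lambda>(y, z). ennreal (\<phi> z (1 / l)) * indicator (ball y r) z) \<in> borel_measurable (lebesgue \<Otimes>\<^sub>M lebesgue)"
            by (simp only:)
        qed
        then have "(\<integral>\<^sup>+y. ennreal (U * l) * ((\<integral>\<^sup>+z\<in>ball y r. ennreal (\<phi> z (1 / l)) \<partial>lebesgue) * indicator (ball x R) y) \<partial>lebesgue)
          = ennreal (U * l) * (\<integral>\<^sup>+y\<in>ball x R. (\<integral>\<^sup>+z\<in>ball y r. ennreal (\<phi> z (1 / l)) \<partial>lebesgue) \<partial>lebesgue)"
          by (intro nn_integral_cmult borel_measurable_times_ennreal borel_measurable_indicator) auto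
        also have "\<dots> \<le> ennreal (U * l) * (ennreal (?v * r ^ CARD('n)) * (\<integral>\<^sup>+z\<in>ball x (R + r). ennreal (\<phi> z (1 / l)) \<partial>lebesgue))"
          by (intro mult_left_mono nn_integral_ball_average_le m r R) simp
        finally show ?thesis .
      qed
      also have "(\<integral>\<^sup>+z\<in>ball x (R + r). ennreal (\<phi> z (1 / l)) \<partial>lebesgue) = ennreal (\<Psi> x (R + r) (1 / l))"
        using Phi_eq[of "1 / l" "R + r" x] l0 r R by (simp add: \<Phi>_def)
      also have "ennreal (U * l) * (ennreal (?v * r ^ CARD('n)) * ennreal (\<Psi> x (R + r) (1 / l)))
        \<le> ennreal (U * l) * (ennreal (?v * r ^ CARD('n)) * ennreal 1)"
        by (intro mult_left_mono ennreal_leI l0) auto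
      also have "\<dots> = ennreal (U * l * (?v * r ^ CARD('n)))"
        using U l0 r by (simp add: ennreal_mult)
      also have "U * l * (?v * r ^ CARD('n)) = ?k * l" by (simp only: mult_ac)
      finally show ?thesis .
    qed
    have Rr: "R + r > 0" using R r by simp
    \<comment> \<open>The infimum is approached by members l of the set, with an error of e / k that
      the factor k turns into e.\<close>
    have "(\<integral>\<^sup>+y\<in>ball x R. ennreal (chi_norm \<phi> y r) \<partial>lebesgue) \<le> ennreal (?k * chi_norm \<phi> x (R + r))"
    proof (rule ennreal_le_epsilon)
      fix e :: real assume e: "e > 0"
      have "Inf (chi_set x (R + r)) < chi_norm \<phi> x (R + r) + e / ?k"
        unfolding chi_norm_eq[OF Rr] using divide_pos_pos[OF e k] by (simp only: less_add_same_cancel1)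
      then obtain l where l: "l \<in> chi_set x (R + r)" "l < chi_norm \<phi> x (R + r) + e / ?k"
        using cInf_lessD[OF chi_set_nonempty[OF Rr]] by blast
      have "?k * l \<le> ?k * (chi_norm \<phi> x (R + r) + e / ?k)" using l(2) k by (intro mult_left_mono) auto
      also have "\<dots> = ?k * chi_norm \<phi> x (R + r) + e"
        using nonzero_mult_div_cancel_left[of ?k e] k by (simp only: distrib_left times_divide_eq_right less_imp_neq[symmetric] not_False_eq_True)
      finally have "ennreal (?k * l) \<le> ennreal (?k * chi_norm \<phi> x (R + r) + e)" by (rule ennreal_leI)
      also have "\<dots> = ennreal (?k * chi_norm \<phi> x (R + r)) + ennreal e"
        using e k chi_norm_pos[OF Rr, of x] by (intro ennreal_plus) auto
      finally show "(\<integral>\<^sup>+y\<in>ball x R. ennreal (chi_norm \<phi> y r) \<partial>lebesgue) \<le> ennreal (?k * chi_norm \<phi> x (R + r)) + ennreal e"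
        using main[OF l(1)] by (rule order_trans[rotated])
    qed
    also have "\<dots> \<le> ennreal (max 1 (U * ?v) * r ^ CARD('n) * chi_norm \<phi> x (R + r))"
      using r chi_norm_pos[OF Rr, of x] by (intro ennreal_leI mult_right_mono) auto
    finally show ?thesis .
  qed
  then show ?thesis by (intro exI[of _ "max 1 (U * ?v)"]) auto
qed

lemma ball_gauge_chi_norm:
  assumes \<beta>: "\<beta> = real CARD('n) * p\<^sub>1 / p - real CARD('n)" "0 < \<beta>" "2 * \<beta> < 1"
  shows "\<exists>D. ball_gauge (chi_norm \<phi>) D \<beta>"
proof -
  obtain D1 where D1: "D1 \<ge> 1" "\<And>c\<^sub>1 c\<^sub>2 r\<^sub>1 r\<^sub>2. \<lbrakk>0 < r\<^sub>1; 0 < r\<^sub>2; ball c\<^sub>1 r\<^sub>1 \<subseteq> ball c\<^sub>2 r\<^sub>2\<rbrakk> \<Longrightarrow>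
    chi_norm \<phi> c\<^sub>2 r\<^sub>2 \<le> D1 * (r\<^sub>2 / r\<^sub>1) powr (real CARD('n) * p\<^sub>1 / p) * chi_norm \<phi> c\<^sub>1 r\<^sub>1"
    using chi_norm_growth by blast
  obtain D2 where D2: "D2 \<ge> 1" "\<And>x r R. \<lbrakk>0 < r; 0 < R\<rbrakk> \<Longrightarrow>
    (\<integral>\<^sup>+y\<in>ball x R. ennreal (chi_norm \<phi> y r) \<partial>lebesgue) \<le> ennreal (D2 * r ^ CARD('n) * chi_norm \<phi> x (R + r))"
    using chi_norm_integral by blast
  let ?D = "max D1 D2"
  have "ball_gauge (chi_norm \<phi>) ?D \<beta>"
  proof
    show "1 \<le> ?D" using D1 by simp
    show "0 < chi_norm \<phi> c r" if "r > 0" for c r using that by (rule chi_norm_pos)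
    show "chi_norm \<phi> c\<^sub>1 r\<^sub>1 \<le> chi_norm \<phi> c\<^sub>2 r\<^sub>2" if "0 < r\<^sub>1" "0 < r\<^sub>2" "ball c\<^sub>1 r\<^sub>1 \<subseteq> ball c\<^sub>2 r\<^sub>2" for c\<^sub>1 c\<^sub>2 r\<^sub>1 r\<^sub>2
      using that by (rule chi_norm_mono)
    show "chi_norm \<phi> c\<^sub>2 r\<^sub>2 \<le> ?D * (r\<^sub>2 / r\<^sub>1) powr (real CARD('n) + \<beta>) * chi_norm \<phi> c\<^sub>1 r\<^sub>1"
      if "0 < r\<^sub>1" "0 < r\<^sub>2" "ball c\<^sub>1 r\<^sub>1 \<subseteq> ball c\<^sub>2 r\<^sub>2" for c\<^sub>1 c\<^sub>2 r\<^sub>1 r\<^sub>2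
    proof -
      have "chi_norm \<phi> c\<^sub>2 r\<^sub>2 \<le> D1 * (r\<^sub>2 / r\<^sub>1) powr (real CARD('n) * p\<^sub>1 / p) * chi_norm \<phi> c\<^sub>1 r\<^sub>1"
        by (rule D1(2)[OF that])
      also have "\<dots> \<le> ?D * (r\<^sub>2 / r\<^sub>1) powr (real CARD('n) * p\<^sub>1 / p) * chi_norm \<phi> c\<^sub>1 r\<^sub>1"
        using chi_norm_pos[OF that(1), of c\<^sub>1] by (intro mult_right_mono) auto
      finally show ?thesis using \<beta>(1) by simp
    qed
    show "(\<integral>\<^sup>+y\<in>ball x R. ennreal (chi_norm \<phi> y r) \<partial>lebesgue) \<le> ennreal (?D * r ^ CARD('n) * chi_norm \<phi> x (R + r))"
      if "0 < r" "0 < R" for x r R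
    proof -
      have "D2 * r ^ CARD('n) * chi_norm \<phi> x (R + r) \<le> ?D * r ^ CARD('n) * chi_norm \<phi> x (R + r)"
        using that chi_norm_pos[of "R + r" x] by (intro mult_right_mono) auto
      then show ?thesis using D2(2)[OF that, of x] by (meson ennreal_leI order_trans)
    qed
  qed (use \<beta> in auto)
  then show ?thesis by blast
qed

end

section \<open>Comparison of the spaces\<close>

lemma ennreal_divide_le_iff:
  assumes "0 < x" "0 \<le> N"
  shows "u / ennreal x \<le> ennreal N \<longleftrightarrow> u \<le> ennreal (N * x)"
proof (cases u)
  case (real a)
  then show ?thesis using assms by (simp add: divide_ennreal ennreal_le_iff divide_le_eq)
next
  case top
  then show ?thesis by (simp add: ennreal_top_divide top_unique)
qed

lemma ennreal_mult_le_iff: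
  assumes "0 < k" "0 \<le> N"
  shows "ennreal k * u \<le> ennreal N \<longleftrightarrow> u \<le> ennreal (N / k)"
proof (cases u)
  case (real a)
  then show ?thesis using assms by (simp add: ennreal_mult'[symmetric] ennreal_le_iff le_divide_eq mult.commute)
next
  case top
  then show ?thesis using assms by (simp add: ennreal_mult_top top_unique)
qed

lemma SUP_balls_le_iff:
  assumes "\<And>c r. r > 0 \<Longrightarrow> 0 < X c r" "0 \<le> N"
  shows "(SUP (c, r) \<in> UNIV \<times> {0<..}. u c r / ennreal (X c r)) \<le> ennreal N
    \<longleftrightarrow> (\<forall>c. \<forall>r>0. u c r \<le> ennreal (N * X c r))"
  using assms by (auto simp: SUP_le_iff ennreal_divide_le_iff)

text \<open>A description of a space by the norm bounds of its members avoids computing with suprema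
  and infima in the extended reals.\<close>

definition describes :: "(real \<Rightarrow> (real^'n \<Rightarrow> complex) \<Rightarrow> bool) \<Rightarrow> 'n fspace \<Rightarrow> bool" where
  "describes B X \<longleftrightarrow>
     (\<forall>f\<in>fst X. snd X f < \<infinity>) \<and>
     (\<forall>f\<in>fst X. \<forall>N>0. snd X f < ennreal N \<longrightarrow> B N f) \<and>
     (\<forall>f. \<forall>N>0. B N f \<longrightarrow> f \<in> fst X \<and> snd X f \<le> ennreal N)"

lemma describesI:
  assumes "\<And>f N. \<lbrakk>f \<in> S; 0 < N\<rbrakk> \<Longrightarrow> \<rho> f \<le> ennreal N \<longleftrightarrow> b N f"
  shows "describes (\<lambda>N f. f \<in> S \<and> b N f) ({f. f \<in> S \<and> \<rho> f < \<infinity>}, \<rho>)"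
proof -
  have "\<rho> f < \<infinity>" if "f \<in> S" "0 < N" "b N f" for f N
    using assms[OF that(1,2)] that(3) by (auto simp: order_le_less_trans)
  moreover have "b N f" if "f \<in> S" "0 < N" "\<rho> f < ennreal N" for f N
    using assms[OF that(1,2)] less_imp_le[OF that(3)] by blast
  ultimately show ?thesis unfolding describes_def using assms by auto
qed

section \<open>Embeddings and quotients of spaces\<close>

definition embeds :: "'n fspace \<Rightarrow> 'n fspace \<Rightarrow> bool" where
  "embeds X Y \<longleftrightarrow> fst X \<subseteq> fst Y \<and> (\<exists>C>0. \<forall>f\<in>fst X. snd Y f \<le> ennreal C * snd X f)"

lemma embeds_refl: "embeds X X"
  unfolding embeds_def by (intro conjI exI[of _ 1]) auto

lemma embeds_trans:
  assumes "embeds X Y" "embeds Y Z"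
  shows "embeds X Z"
proof -
  obtain C D where C: "C > 0" "\<And>f. f \<in> fst X \<Longrightarrow> snd Y f \<le> ennreal C * snd X f"
    and D: "D > 0" "\<And>f. f \<in> fst Y \<Longrightarrow> snd Z f \<le> ennreal D * snd Y f"
    and sub: "fst X \<subseteq> fst Y" "fst Y \<subseteq> fst Z"
    using assms unfolding embeds_def by blast
  have "snd Z f \<le> ennreal (D * C) * snd X f" if f: "f \<in> fst X" for f
  proof -
    have "snd Z f \<le> ennreal D * snd Y f" using f sub by (intro D) auto
    also have "\<dots> \<le> ennreal D * (ennreal C * snd X f)" by (intro mult_left_mono C f) simp
    also have "\<dots> = ennreal (D * C) * snd X f" using C(1) D(1) by (simp add: ennreal_mult mult.assoc)
    finally show ?thesis .
  qed
  then show ?thesis unfolding embeds_def using C(1) D(1) sub by (intro conjI exI[of _ "D * C"]) auto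
qed

text \<open>A norm strictly below N supplies the bound B N f and hence the norm at most C N in the
  target; letting N decrease to the norm of f gives the inequality without any attained
  infimum.\<close>

lemma describes_embeds:
  assumes X: "describes B X" and Y: "describes B' Y"
    and ex: "\<exists>C>0. \<forall>f N. 0 < N \<longrightarrow> B N f \<longrightarrow> B' (C * N) f"
  shows "embeds X Y"
proof -
  obtain C where C: "C > 0" "\<And>f N. \<lbrakk>0 < N; B N f\<rbrakk> \<Longrightarrow> B' (C * N) f" using ex by blast
  have le: "f \<in> fst Y \<and> snd Y f \<le> ennreal (C * N)" if "f \<in> fst X" "0 < N" "snd X f < ennreal N" for f N
  proof -
    have "B N f" using X that unfolding describes_def by blast
    then have "B' (C * N) f" using C(2) that(2) by blast
    moreover have "0 < C * N" using C(1) that(2) by simp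
    ultimately show ?thesis using Y unfolding describes_def by blast
  qed
  have "f \<in> fst Y \<and> snd Y f \<le> ennreal C * snd X f" if f: "f \<in> fst X" for f
  proof -
    have "snd X f < \<infinity>" using X f unfolding describes_def by blast
    then obtain r where r: "r \<ge> 0" "snd X f = ennreal r" by (cases "snd X f") auto
    have "snd Y f \<le> ennreal (C * r) + ennreal e" if e: "e > 0" for e
    proof -
      have "snd X f < ennreal (r + e / C)" unfolding r(2) using r(1) e C(1) by (intro ennreal_lessI) (auto simp: add_nonneg_pos)
      then have "snd Y f \<le> ennreal (C * (r + e / C))" using le[OF f] r(1) e C(1) by (simp add: add_nonneg_pos)
      also have "C * (r + e / C) = C * r + e" using C(1) by (simp add: distrib_left)
      also have "ennreal (C * r + e) = ennreal (C * r) + ennreal e" using C(1) r(1) e by (intro ennreal_plus) auto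
      finally show ?thesis .
    qed
    then have "snd Y f \<le> ennreal (C * r)" by (rule ennreal_le_epsilon)
    moreover have "f \<in> fst Y" using le[OF f, of "r + 1"] r by (auto intro: ennreal_lessI)
    ultimately show ?thesis using C(1) r by (simp add: ennreal_mult)
  qed
  then show ?thesis unfolding embeds_def using C(1) by blast
qed

text \<open>X sits inside the reference space R with an equivalent norm and meets every class of R
  modulo K. Taking for R the space with norm built on f - A_t f is natural, because that norm is
  constant on classes.\<close>

definition represents :: "(real^'n \<Rightarrow> complex) set \<Rightarrow> 'n fspace \<Rightarrow> 'n fspace \<Rightarrow> bool" where
  "represents K R X \<longleftrightarrow> embeds X R \<and> (\<exists>C>0. \<forall>f\<in>fst X. snd X f \<le> ennreal C * snd R f) \<and>
     (\<forall>f\<in>fst R. \<exists>g\<in>fst X. (\<lambda>x. f x - g x) \<in> K)"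

lemma represents_embeds:
  assumes R: "represents K R X" and XZ: "embeds X Z" and ZX: "embeds Z X"
  shows "represents K R Z"
proof -
  obtain C D where C: "C > 0" "\<And>f. f \<in> fst X \<Longrightarrow> snd X f \<le> ennreal C * snd R f"
    and D: "D > 0" "\<And>f. f \<in> fst X \<Longrightarrow> snd Z f \<le> ennreal D * snd X f"
    using R XZ unfolding represents_def embeds_def by blast
  have eq: "fst X = fst Z" using XZ ZX unfolding embeds_def by blast
  have "snd Z f \<le> ennreal (D * C) * snd R f" if f: "f \<in> fst Z" for f
  proof -
    have "snd Z f \<le> ennreal D * snd X f" using f eq by (intro D) auto
    also have "\<dots> \<le> ennreal D * (ennreal C * snd R f)" using f eq by (intro mult_left_mono C) auto
    also have "\<dots> = ennreal (D * C) * snd R f" using C(1) D(1) by (simp add: ennreal_mult mult.assoc)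
    finally show ?thesis .
  qed
  moreover have "embeds Z R" using R ZX embeds_trans unfolding represents_def by blast
  moreover have "\<forall>f\<in>fst R. \<exists>g\<in>fst Z. (\<lambda>x. f x - g x) \<in> K" using R unfolding represents_def eq by blast
  ultimately show ?thesis unfolding represents_def using C(1) D(1) by (intro conjI exI[of _ "D * C"]) auto
qed

text \<open>Representatives f in X and g in Y of one class have the same norm in R by
  \<open>inv\<close>, and each space compares its own norm with that of R. Existence of
  representatives comes from the last clause of \<open>represents\<close>.\<close>

lemma represents_coincide:
  assumes X: "represents K R X" and Y: "represents K R Y"
    and neg: "\<And>h. h \<in> K \<Longrightarrow> (\<lambda>x. - h x) \<in> K"
    and inv: "\<And>f g. \<lbrakk>f \<in> fst R; g \<in> fst R; (\<lambda>x. f x - g x) \<in> K\<rbrakk> \<Longrightarrow> snd R f = snd R g"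
  shows "coincide_modulo K X Y"
proof -
  have *: "\<exists>C>0. \<forall>f\<in>fst X. \<forall>g\<in>fst Y. (\<lambda>x. f x - g x) \<in> K \<longrightarrow> snd Y g \<le> ennreal C * snd X f"
    if X: "represents K R X" and Y: "represents K R Y" for X Y
  proof -
    have sub: "fst X \<subseteq> fst R" "fst Y \<subseteq> fst R"
      using X Y by (simp_all add: represents_def embeds_def)
    obtain C where C: "C > 0" "\<And>f. f \<in> fst X \<Longrightarrow> snd R f \<le> ennreal C * snd X f"
      using X unfolding represents_def embeds_def by blast
    obtain D where D: "D > 0" "\<And>f. f \<in> fst Y \<Longrightarrow> snd Y f \<le> ennreal D * snd R f"
      using Y unfolding represents_def embeds_def by blast
    have "snd Y g \<le> ennreal (D * C) * snd X f" if f: "f \<in> fst X" and g: "g \<in> fst Y" and K: "(\<lambda>x. f x - g x) \<in> K" for f g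
    proof -
      have "snd Y g \<le> ennreal D * snd R g" by (rule D(2)[OF g])
      also have "snd R g = snd R f" using f g K sub by (intro inv[symmetric]) auto
      also have "ennreal D * snd R f \<le> ennreal D * (ennreal C * snd X f)" by (intro mult_left_mono C f) simp
      also have "\<dots> = ennreal (D * C) * snd X f" using C(1) D(1) by (simp add: ennreal_mult mult.assoc)
      finally show ?thesis .
    qed
    then show ?thesis using C(1) D(1) by (intro exI[of _ "D * C"]) auto
  qed
  have flip: "(\<lambda>x. g x - f x) \<in> K" if "(\<lambda>x. f x - g x) \<in> K" for f g using neg[OF that] by simp
  obtain C where C: "C > 0" "\<And>f g. \<lbrakk>f \<in> fst X; g \<in> fst Y; (\<lambda>x. f x - g x) \<in> K\<rbrakk> \<Longrightarrow> snd Y g \<le> ennreal C * snd X f"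
    using *[OF X Y] by blast
  obtain D where D: "D > 0" "\<And>f g. \<lbrakk>g \<in> fst Y; f \<in> fst X; (\<lambda>x. g x - f x) \<in> K\<rbrakk> \<Longrightarrow> snd X f \<le> ennreal D * snd Y g"
    using *[OF Y X] by blast
  have "\<forall>f\<in>fst X. \<forall>g\<in>fst Y. (\<lambda>x. f x - g x) \<in> K \<longrightarrow>
      snd X f \<le> ennreal (max C D) * snd Y g \<and> snd Y g \<le> ennreal (max C D) * snd X f"
  proof (intro ballI impI conjI)
    fix f g assume fg: "f \<in> fst X" "g \<in> fst Y" "(\<lambda>x. f x - g x) \<in> K"
    have "snd X f \<le> ennreal D * snd Y g" by (rule D(2)[OF fg(2,1) flip[OF fg(3)]])
    also have "\<dots> \<le> ennreal (max C D) * snd Y g" by (intro mult_right_mono ennreal_leI) auto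
    finally show "snd X f \<le> ennreal (max C D) * snd Y g" .
    have "snd Y g \<le> ennreal C * snd X f" by (rule C(2)[OF fg])
    also have "\<dots> \<le> ennreal (max C D) * snd X f" by (intro mult_right_mono ennreal_leI) auto
    finally show "snd Y g \<le> ennreal (max C D) * snd X f" .
  qed
  moreover have "max C D > 0" using C(1) by simp
  moreover have "\<forall>f\<in>fst X. \<exists>g\<in>fst Y. (\<lambda>x. f x - g x) \<in> K"
    using X Y unfolding represents_def embeds_def by blast
  moreover have "\<forall>g\<in>fst Y. \<exists>f\<in>fst X. (\<lambda>x. f x - g x) \<in> K"
    using X Y flip unfolding represents_def embeds_def by blast
  ultimately show ?thesis unfolding coincide_modulo_def by blast
qed

lemma invariant_class_0: "(\<lambda>_. 0) \<in> invariant_class A"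
  using dom_class_const[of 0 A] by (simp add: invariant_class_def semigroup_op_def)

lemma invariant_class_minus:
  assumes "h \<in> invariant_class A"
  shows "(\<lambda>x. - h x) \<in> invariant_class A"
proof -
  have h: "h \<in> dom_class A" using assms by (simp add: invariant_class_def)
  show ?thesis using assms dom_class_minus[OF h] by (simp add: invariant_class_def semigroup_op_minus)
qed

lemma BMO_gen_norm_cong_modulo:
  assumes f: "f \<in> dom_class A" and g: "g \<in> dom_class A" and h: "(\<lambda>x. f x - g x) \<in> invariant_class A"
  shows "BMO_gen_norm A \<phi> f = BMO_gen_norm A \<phi> g"
proof -
  have "nint (ball c r) (\<lambda>x. f x - semigroup_op A (r ^ gen_order A) f x)
    = nint (ball c r) (\<lambda>x. g x - semigroup_op A (r ^ gen_order A) g x)" if r: "r > 0" for c r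
  proof (rule nn_integral_cong_AE)
    have t: "r ^ gen_order A > 0" using r by simp
    have "AE x in lebesgue. semigroup_op A (r ^ gen_order A) (\<lambda>x. f x - g x) x = f x - g x"
      using h t by (simp add: invariant_class_def)
    then show "AE x in lebesgue. ennreal (norm (f x - semigroup_op A (r ^ gen_order A) f x)) * indicator (ball c r) x
      = ennreal (norm (g x - semigroup_op A (r ^ gen_order A) g x)) * indicator (ball c r) x"
    proof eventually_elim
      case (elim x)
      then have "f x - semigroup_op A (r ^ gen_order A) f x = g x - semigroup_op A (r ^ gen_order A) g x"
        unfolding semigroup_op_diff[OF f g t] by (simp add: algebra_simps)
      then show ?case by (simp only:)
    qed
  qed
  then show ?thesis unfolding BMO_gen_norm_def by (intro SUP_cong) auto
qed

section \<open>The concrete spaces as instances of the gauge\<close>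

locale musielak_gauge = ball_gauge "chi_norm \<phi>" D \<beta> for \<phi> :: "real^'n \<Rightarrow> real \<Rightarrow> real" and D \<beta> :: real +
  fixes P :: params
  assumes exponent: "par_nu P * par_p1 P / par_p P - par_alpha P = \<beta>"
begin

lemma chi_norm_ratio: "r > 0 \<Longrightarrow> chi_norm \<phi> x r / measure lebesgue (ball x r) = Y x r / V"
  by (simp only: measure_lebesgue_ball[OF less_imp_le] Y_def V_def divide_divide_eq_left mult.commute)

lemma describes_BMO: "describes bmo_bdd (BMO \<phi>)"
proof -
  have "describes (\<lambda>N f. f \<in> Collect locally_integrable \<and>
      (\<forall>c. \<forall>r>0. nint (ball c r) (\<lambda>x. f x - ball_mean f c r) \<le> ennreal (N * chi_norm \<phi> c r)))
    ({f. f \<in> Collect locally_integrable \<and> BMO_norm \<phi> f < \<infinity>}, BMO_norm \<phi>)"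
    by (intro describesI) (simp add: BMO_norm_def SUP_balls_le_iff[OF X_pos])
  then show ?thesis by (simp add: BMO_def bmo_bdd_def[abs_def])
qed

lemma BMO_gen_norm_le_iff: "0 < N \<Longrightarrow> BMO_gen_norm A \<phi> f \<le> ennreal N \<longleftrightarrow> gen_bdd A N f"
  by (simp add: BMO_gen_norm_def gen_bdd_def SUP_balls_le_iff[OF X_pos])

lemma describes_BMO_gen: "describes (\<lambda>N f. f \<in> dom_class A \<and> gen_bdd A N f) (BMO_gen A \<phi>)"
  unfolding BMO_gen_def using BMO_gen_norm_le_iff by (intro describesI) auto

abbreviation max_bdd :: "generator \<Rightarrow> real \<Rightarrow> (real^'n \<Rightarrow> complex) \<Rightarrow> bool" where
  "max_bdd A N f \<equiv> (\<forall>x. \<forall>r>0. semigroup_nn A (r ^ gen_order A)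
      (\<lambda>y. norm (f y - semigroup_op A (r ^ gen_order A) f y)) x \<le> ennreal (N * Y x r))"

text \<open>Times t and radii r are exchanged by t = r^m, and the weight in front of the semigroup
  is V / Y; this is the origin of the factor V between the two bounds.\<close>

lemma BMO_max_norm_le_iff:
  assumes N: "0 < N"
  shows "BMO_max_norm A \<phi> f \<le> ennreal N \<longleftrightarrow> max_bdd A (N / V) f"
proof -
  have *: "ennreal (measure lebesgue (ball x r) / chi_norm \<phi> x r) * u \<le> ennreal N \<longleftrightarrow> u \<le> ennreal (N / V * Y x r)"
    if r: "r > 0" for x r u
  proof -
    have "measure lebesgue (ball x r) / chi_norm \<phi> x r = V / Y x r"
      using chi_norm_ratio[OF r, of x] by (metis inverse_divide)
    then show ?thesis using ennreal_mult_le_iff[of "V / Y x r" N u] N V_pos Y_pos[OF r, of x] by simp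
  qed
  have "BMO_max_norm A \<phi> f \<le> ennreal N \<longleftrightarrow> (\<forall>t>0. \<forall>x. semigroup_nn A t (\<lambda>y. norm (f y - semigroup_op A t f y)) x
      \<le> ennreal (N / V * Y x (root (gen_order A) t)))" (is "_ \<longleftrightarrow> ?R")
    unfolding BMO_max_norm_def using * gen_order_pos[of A] by (simp add: SUP_le_iff) blast
  also have "?R \<longleftrightarrow> max_bdd A (N / V) f"
  proof (intro iffI allI impI)
    fix x :: "real^'n" and r :: real assume R: ?R and r: "r > 0"
    have "root (gen_order A) (r ^ gen_order A) = r" using r gen_order_pos[of A] by (simp add: real_root_power_cancel)
    then show "semigroup_nn A (r ^ gen_order A) (\<lambda>y. norm (f y - semigroup_op A (r ^ gen_order A) f y)) x \<le> ennreal (N / V * Y x r)"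
      using R[rule_format, of "r ^ gen_order A" x] r by simp
  next
    fix t :: real and x :: "real^'n" assume m: "max_bdd A (N / V) f" and t: "t > 0"
    have "root (gen_order A) t > 0" using t gen_order_pos[of A] by simp
    then show "semigroup_nn A t (\<lambda>y. norm (f y - semigroup_op A t f y)) x \<le> ennreal (N / V * Y x (root (gen_order A) t))"
      using m[rule_format, of "root (gen_order A) t" x] root_gen_order_power[OF t, of A] by simp
  qed
  finally show ?thesis .
qed

lemma describes_BMO_max: "describes (\<lambda>N f. f \<in> dom_class A \<and> max_bdd A (N / V) f) (BMO_max A \<phi>)"
  unfolding BMO_max_def using BMO_max_norm_le_iff by (intro describesI) auto

lemma tilde_family_iff: "0 < N \<Longrightarrow> tilde_family A \<phi> P f N F \<longleftrightarrow> tilde_bdd A N f F"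
  unfolding tilde_family_def tilde_bdd_def exponent
  by (simp add: SUP_balls_le_iff[OF X_pos] chi_norm_ratio
      del: times_divide_eq_left times_divide_eq_right measure_completion)

text \<open>The norm is an infimum over constants of families, so a norm below N yields a family for
  some N' at most N; the description is phrased with this N'.\<close>

lemma describes_BMO_tilde:
  "describes (\<lambda>N f. f \<in> dom_class A \<and> (\<exists>N'. 0 < N' \<and> N' \<le> N \<and> (\<exists>F. tilde_bdd A N' f F))) (BMO_tilde A \<phi> P)"
proof -
  have le: "BMO_tilde_norm A \<phi> P f \<le> ennreal N" if "0 < N" "tilde_bdd A N f F" for f N F
    unfolding BMO_tilde_norm_def using that tilde_family_iff[OF that(1)] by (intro Inf_lower) blast
  have "\<exists>N'. 0 < N' \<and> N' \<le> N \<and> (\<exists>F. tilde_bdd A N' f F)" if lt: "BMO_tilde_norm A \<phi> P f < ennreal N" for f N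
  proof -
    obtain N' F where N': "ennreal N' < ennreal N" "0 < N'" "tilde_family A \<phi> P f N' F"
      using lt unfolding BMO_tilde_norm_def Inf_less_iff by blast
    then have "N' \<le> N" by (metis ennreal_less_iff less_eq_real_def)
    then show ?thesis using N' tilde_family_iff[OF N'(2)] by blast
  qed
  moreover have "f \<in> fst (BMO_tilde A \<phi> P) \<and> snd (BMO_tilde A \<phi> P) f \<le> ennreal N"
    if "f \<in> dom_class A" "0 < N'" "N' \<le> N" "tilde_bdd A N' f F" for f N N' F
  proof -
    have "\<exists>C>0. \<exists>F. tilde_family A \<phi> P f C F" using that tilde_family_iff[OF that(2)] by blast
    moreover have "BMO_tilde_norm A \<phi> P f \<le> ennreal N" using le[OF that(2,4)] ennreal_leI[OF that(3)] by (rule order_trans)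
    ultimately show ?thesis using that(1) by (simp add: BMO_tilde_def)
  qed
  moreover have "BMO_tilde_norm A \<phi> P f < \<infinity>" if "0 < N" "tilde_family A \<phi> P f N F" for f N F
  proof -
    have "BMO_tilde_norm A \<phi> P f \<le> ennreal N" using le[OF that(1)] that(2) tilde_family_iff[OF that(1)] by blast
    also have "\<dots> < \<infinity>" by simp
    finally show ?thesis .
  qed
  ultimately show ?thesis unfolding describes_def BMO_tilde_def by (auto 0 4)
qed

lemma embeds_BMO_gen: "embeds (BMO \<phi>) (BMO_gen A \<phi>)"
  using bmo_imp_gen[of A] bmo_in_dom_class
  by (intro describes_embeds[OF describes_BMO describes_BMO_gen]) blast

lemma embeds_gen_max: "embeds (BMO_gen A \<phi>) (BMO_max A \<phi>)"
proof (rule describes_embeds[OF describes_BMO_gen describes_BMO_max])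
  obtain C where C: "C > 0" "\<And>f N x r. \<lbrakk>f \<in> borel_measurable lebesgue; gen_bdd A N f; 0 < N; 0 < r\<rbrakk> \<Longrightarrow>
    semigroup_nn A (r ^ gen_order A) (\<lambda>y. norm (f y - semigroup_op A (r ^ gen_order A) f y)) x \<le> ennreal (C * N * Y x r)"
    using gen_imp_max[of A] by blast
  have "max_bdd A (C * V * N / V) f" if "0 < N" "f \<in> dom_class A" "gen_bdd A N f" for f N
    using C(2)[OF dom_class_measurable[OF that(2)] that(3,1)] V_pos by simp
  then show "\<exists>C>0. \<forall>f N. 0 < N \<longrightarrow> f \<in> dom_class A \<and> gen_bdd A N f \<longrightarrow> f \<in> dom_class A \<and> max_bdd A (C * N / V) f"
    using C(1) V_pos by (intro exI[of _ "C * V"]) auto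
qed

lemma embeds_max_gen: "embeds (BMO_max A \<phi>) (BMO_gen A \<phi>)"
proof (rule describes_embeds[OF describes_BMO_max describes_BMO_gen])
  obtain C where C: "C > 0" "\<And>f N. \<lbrakk>f \<in> borel_measurable lebesgue; 0 < N; max_bdd A N f\<rbrakk> \<Longrightarrow> gen_bdd A (C * N) f"
    using max_imp_gen[of A] by blast
  have "gen_bdd A (C / V * N) f" if "0 < N" "f \<in> dom_class A" "max_bdd A (N / V) f" for f N
    using C(2)[OF dom_class_measurable[OF that(2)] _ that(3)] that(1) V_pos by simp
  then show "\<exists>C>0. \<forall>f N. 0 < N \<longrightarrow> f \<in> dom_class A \<and> max_bdd A (N / V) f \<longrightarrow> f \<in> dom_class A \<and> gen_bdd A (C * N) f"
    using C(1) V_pos by (intro exI[of _ "C / V"]) auto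
qed

lemma gen_bdd_mono:
  assumes "gen_bdd A N f" "N \<le> N'"
  shows "gen_bdd A N' f"
proof -
  have "N * chi_norm \<phi> c r \<le> N' * chi_norm \<phi> c r" if "r > 0" for c r
    using assms(2) X_pos[OF that, of c] by (intro mult_right_mono) auto
  then show ?thesis using assms(1) unfolding gen_bdd_def by (meson ennreal_leI order_trans)
qed

lemma embeds_tilde_gen: "embeds (BMO_tilde A \<phi> P) (BMO_gen A \<phi>)"
proof (rule describes_embeds[OF describes_BMO_tilde describes_BMO_gen])
  obtain C where C: "C > 0" "\<And>f N F. \<lbrakk>f \<in> dom_class A; tilde_bdd A N f F; 0 < N\<rbrakk> \<Longrightarrow> gen_bdd A (C * N) f"
    using tilde_imp_gen[of A] by blast
  have "gen_bdd A (C * N) f" if "f \<in> dom_class A" "0 < N'" "N' \<le> N" "tilde_bdd A N' f F" for f N N' F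
    using C(2)[OF that(1,4,2)] C(1) that(3) by (auto intro: gen_bdd_mono)
  then show "\<exists>C>0. \<forall>f N. 0 < N \<longrightarrow> f \<in> dom_class A \<and> (\<exists>N'. 0 < N' \<and> N' \<le> N \<and> (\<exists>F. tilde_bdd A N' f F)) \<longrightarrow>
      f \<in> dom_class A \<and> gen_bdd A (C * N) f"
    using C(1) by blast
qed

lemma embeds_BMO_tilde: "embeds (BMO \<phi>) (BMO_tilde A \<phi> P)"
proof (rule describes_embeds[OF describes_BMO describes_BMO_tilde])
  obtain C where C: "C > 0" "\<And>f N. \<lbrakk>bmo_bdd N f; 0 < N\<rbrakk> \<Longrightarrow> \<exists>F. tilde_bdd A (C * N) f F"
    using bmo_imp_tilde[of A] by blast
  have "f \<in> dom_class A \<and> (\<exists>N'. 0 < N' \<and> N' \<le> C * N \<and> (\<exists>F. tilde_bdd A N' f F))" if "0 < N" "bmo_bdd N f" for f N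
    using C(2)[OF that(2,1)] bmo_in_dom_class[OF that(2,1)] that(1) C(1) by (intro conjI exI[of _ "C * N"]) auto
  then show "\<exists>C>0. \<forall>f N. 0 < N \<longrightarrow> bmo_bdd N f \<longrightarrow>
      f \<in> dom_class A \<and> (\<exists>N'. 0 < N' \<and> N' \<le> C * N \<and> (\<exists>F. tilde_bdd A N' f F))"
    using C(1) by blast
qed

lemma embeds_poisson_gen_BMO: "embeds (BMO_gen Sqrt_Laplacian \<phi>) (BMO \<phi>)"
  using poisson_gen_imp_bmo by (intro describes_embeds[OF describes_BMO_gen describes_BMO]) blast

lemma limit_fun_in_heat_invariant_class:
  assumes "f \<in> dom_class Laplacian" "gen_bdd Laplacian N f" "0 < N"
  shows "limit_fun Laplacian f \<in> invariant_class Laplacian"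
  using limit_fun_in_dom_class[OF assms] heat_limit_fun_invariant[OF assms] by (simp add: invariant_class_def)

text \<open>A family exists for f - h, which lies in BMO; since h is invariant, adding it to the
  family produces one for f with the same constant.\<close>

lemma embeds_heat_gen_tilde: "embeds (BMO_gen Laplacian \<phi>) (BMO_tilde Laplacian \<phi> P)"
proof (rule describes_embeds[OF describes_BMO_gen describes_BMO_tilde])
  obtain C where C: "C > 0" "\<And>f N. \<lbrakk>f \<in> dom_class Laplacian; gen_bdd Laplacian N f; 0 < N\<rbrakk> \<Longrightarrow>
      bmo_bdd (C * N) (\<lambda>x. f x - limit_fun Laplacian f x)"
    using gen_imp_bmo_diff_limit[of Laplacian] by blast
  obtain C' where C': "C' > 0" "\<And>f N. \<lbrakk>bmo_bdd N f; 0 < N\<rbrakk> \<Longrightarrow> \<exists>F. tilde_bdd Laplacian (C' * N) f F"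
    using bmo_imp_tilde[of Laplacian] by blast
  have "\<exists>N'. 0 < N' \<and> N' \<le> C' * C * N \<and> (\<exists>F. tilde_bdd Laplacian N' f F)"
    if N: "0 < N" and f: "f \<in> dom_class Laplacian" "gen_bdd Laplacian N f" for f N
  proof -
    have CN: "C * N > 0" using C(1) N by simp
    obtain F where "tilde_bdd Laplacian (C' * (C * N)) (\<lambda>x. f x - limit_fun Laplacian f x) F"
      using C'(2)[OF C(2)[OF f N] CN] by blast
    from tilde_bdd_add_invariant[OF this limit_fun_in_heat_invariant_class[OF f N]]
    have "\<exists>F. tilde_bdd Laplacian (C' * C * N) f F" by (simp add: mult.assoc) blast
    then show ?thesis using C(1) C'(1) N by (intro exI[of _ "C' * C * N"]) auto
  qed
  then show "\<exists>C>0. \<forall>f N. 0 < N \<longrightarrow> f \<in> dom_class Laplacian \<and> gen_bdd Laplacian N f \<longrightarrow>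
      f \<in> dom_class Laplacian \<and> (\<exists>N'. 0 < N' \<and> N' \<le> C * N \<and> (\<exists>F. tilde_bdd Laplacian N' f F))"
    using C(1) C'(1) by (intro exI[of _ "C' * C"]) auto
qed

text \<open>The auxiliary space has members of BMO but carries the norm built on f - A_t f. Its
  embedding into BMO expresses the norm bound on BMO functions, for which the limit function
  vanishes.\<close>

lemma BMO_norm_le_BMO_gen_norm: "\<exists>C>0. \<forall>f\<in>fst (BMO \<phi>). snd (BMO \<phi>) f \<le> ennreal C * snd (BMO_gen A \<phi>) f"
proof -
  let ?Z = "({f. f \<in> fst (BMO \<phi>) \<and> BMO_gen_norm A \<phi> f < \<infinity>}, BMO_gen_norm A \<phi>)"
  have Z: "describes (\<lambda>N f. f \<in> fst (BMO \<phi>) \<and> gen_bdd A N f) ?Z"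
    using BMO_gen_norm_le_iff by (intro describesI) auto
  have bdd: "\<exists>N>0. bmo_bdd N f" if f: "f \<in> fst (BMO \<phi>)" for f
  proof -
    have "snd (BMO \<phi>) f < \<infinity>" using f describes_BMO unfolding describes_def by blast
    then obtain r where "r \<ge> 0" "snd (BMO \<phi>) f = ennreal r" by (cases "snd (BMO \<phi>) f") auto
    then have "snd (BMO \<phi>) f < ennreal (r + 1)" "r + 1 > 0" by (auto intro: ennreal_lessI)
    then show ?thesis using f describes_BMO unfolding describes_def by blast
  qed
  have "embeds ?Z (BMO \<phi>)"
    using gen_imp_bmo_bmo[of A] bdd by (intro describes_embeds[OF Z describes_BMO]) metis
  moreover have "f \<in> fst ?Z" if "f \<in> fst (BMO \<phi>)" for f
    using that embeds_BMO_gen[of A] by (auto simp: embeds_def BMO_gen_def)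
  ultimately show ?thesis by (auto simp: embeds_def BMO_gen_def)
qed

lemma represents_poisson_BMO:
  "represents (invariant_class Sqrt_Laplacian) (BMO_gen Sqrt_Laplacian \<phi>) (BMO \<phi>)"
proof -
  have "\<exists>g\<in>fst (BMO \<phi>). (\<lambda>x. f x - g x) \<in> invariant_class Sqrt_Laplacian" if "f \<in> fst (BMO_gen Sqrt_Laplacian \<phi>)" for f
    using that embeds_poisson_gen_BMO invariant_class_0[of Sqrt_Laplacian]
    by (intro bexI[of _ f]) (auto simp: embeds_def)
  then show ?thesis
    unfolding represents_def using embeds_BMO_gen BMO_norm_le_BMO_gen_norm by blast
qed

lemma represents_heat_BMO:
  "represents (invariant_class Laplacian) (BMO_gen Laplacian \<phi>) (BMO \<phi>)"
proof -
  have "\<exists>g\<in>fst (BMO \<phi>). (\<lambda>x. f x - g x) \<in> invariant_class Laplacian" if f: "f \<in> fst (BMO_gen Laplacian \<phi>)" for f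
  proof -
    have "BMO_gen_norm Laplacian \<phi> f < \<infinity>" and fd: "f \<in> dom_class Laplacian" using f by (auto simp: BMO_gen_def)
    then obtain r where "r \<ge> 0" "BMO_gen_norm Laplacian \<phi> f = ennreal r" by (cases "BMO_gen_norm Laplacian \<phi> f") auto
    then have N: "r + 1 > 0" and g: "gen_bdd Laplacian (r + 1) f"
      using BMO_gen_norm_le_iff[of "r + 1" Laplacian f] by (auto simp: ennreal_leI)
    obtain C where "C > 0" "bmo_bdd (C * (r + 1)) (\<lambda>x. f x - limit_fun Laplacian f x)"
      using gen_imp_bmo_diff_limit[of Laplacian] fd g N by blast
    then have "(\<lambda>x. f x - limit_fun Laplacian f x) \<in> fst (BMO \<phi>)"
      using describes_BMO N unfolding describes_def by (meson mult_pos_pos)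
    then show ?thesis using limit_fun_in_heat_invariant_class[OF fd g N]
      by (intro bexI[of _ "\<lambda>x. f x - limit_fun Laplacian f x"]) auto
  qed
  then show ?thesis
    unfolding represents_def using embeds_BMO_gen BMO_norm_le_BMO_gen_norm by blast
qed

lemma represents_heat_gen: "represents (invariant_class Laplacian) (BMO_gen Laplacian \<phi>) (BMO_gen Laplacian \<phi>)"
proof -
  have "\<exists>g\<in>fst (BMO_gen Laplacian \<phi>). (\<lambda>x. f x - g x) \<in> invariant_class Laplacian" if "f \<in> fst (BMO_gen Laplacian \<phi>)" for f
    using that invariant_class_0[of Laplacian] by (intro bexI[of _ f]) auto
  then show ?thesis unfolding represents_def using embeds_refl[of "BMO_gen Laplacian \<phi>"] by (auto simp: embeds_def)
qed

text \<open>The Poisson spaces equal BMO as sets, with equivalent norms, so they represent whatever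
  BMO represents. Leaving K and R free allows them to be compared in the heat quotient as
  well.\<close>

lemma represents_poisson:
  assumes R: "represents K R (BMO \<phi>)"
    and X: "X \<in> {BMO \<phi>} \<union> {BMO_gen Sqrt_Laplacian \<phi>, BMO_max Sqrt_Laplacian \<phi>, BMO_tilde Sqrt_Laplacian \<phi> P}"
  shows "represents K R X"
proof -
  have "embeds (BMO \<phi>) X \<and> embeds X (BMO \<phi>)"
    using X embeds_refl[of X] embeds_BMO_gen embeds_poisson_gen_BMO embeds_BMO_tilde
      embeds_trans[OF embeds_BMO_gen embeds_gen_max] embeds_trans[OF embeds_max_gen embeds_poisson_gen_BMO]
      embeds_trans[OF embeds_tilde_gen embeds_poisson_gen_BMO] by auto
  then show ?thesis using R by (blast intro: represents_embeds)
qed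

lemma represents_heat:
  assumes X: "X \<in> {BMO_gen Laplacian \<phi>, BMO_max Laplacian \<phi>, BMO_tilde Laplacian \<phi> P}"
  shows "represents (invariant_class Laplacian) (BMO_gen Laplacian \<phi>) X"
proof -
  have "embeds (BMO_gen Laplacian \<phi>) X \<and> embeds X (BMO_gen Laplacian \<phi>)"
    using X embeds_refl[of X] embeds_gen_max embeds_max_gen embeds_heat_gen_tilde embeds_tilde_gen by auto
  then show ?thesis using represents_heat_gen by (blast intro: represents_embeds)
qed

lemma represents_gen_coincide:
  assumes "represents (invariant_class A) (BMO_gen A \<phi>) X" "represents (invariant_class A) (BMO_gen A \<phi>) Z"
  shows "coincide_modulo (invariant_class A) X Z"
  using assms by (rule represents_coincide) (auto intro: invariant_class_minus BMO_gen_norm_cong_modulo simp: BMO_gen_def)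

text \<open>The heat spaces enter only the second quotient: coordinate functions belong to them with
  seminorm 0 but lie outside the domain of the Poisson semigroup.\<close>

lemma spaces_coincide:
  "let poisson = {BMO_gen Sqrt_Laplacian \<phi>, BMO_max Sqrt_Laplacian \<phi>, BMO_tilde Sqrt_Laplacian \<phi> P};
       heat = {BMO_gen Laplacian \<phi>, BMO_max Laplacian \<phi>, BMO_tilde Laplacian \<phi> P}
   in (\<forall>X \<in> {BMO \<phi>} \<union> poisson. \<forall>Y \<in> {BMO \<phi>} \<union> poisson.
         coincide_modulo (invariant_class Sqrt_Laplacian) X Y) \<and>
      (\<forall>X \<in> {BMO \<phi>} \<union> poisson \<union> heat. \<forall>Y \<in> {BMO \<phi>} \<union> poisson \<union> heat.
         coincide_modulo (invariant_class Laplacian) X Y)"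
proof -
  have "represents (invariant_class Laplacian) (BMO_gen Laplacian \<phi>) X"
    if "X \<in> ({BMO \<phi>} \<union> {BMO_gen Sqrt_Laplacian \<phi>, BMO_max Sqrt_Laplacian \<phi>, BMO_tilde Sqrt_Laplacian \<phi> P})
      \<union> {BMO_gen Laplacian \<phi>, BMO_max Laplacian \<phi>, BMO_tilde Laplacian \<phi> P}" for X
    using that represents_poisson[OF represents_heat_BMO, of X] represents_heat[of X] by blast
  then show ?thesis
    unfolding Let_def using represents_poisson[OF represents_poisson_BMO] by (intro conjI ballI represents_gen_coincide) blast+
qed

end

section \<open>Admissible parameters\<close>

lemma uniformly_lower_type_mono:
  assumes g: "growth_function \<phi>" and p': "uniformly_lower_type p' \<phi>" and "p \<le> p'"
  shows "uniformly_lower_type p \<phi>"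
proof -
  obtain C where C: "\<And>x t s. \<lbrakk>t \<ge> 0; 0 < s; s < 1\<rbrakk> \<Longrightarrow> \<phi> x (s * t) \<le> C * s powr p' * \<phi> x t"
    using p' unfolding uniformly_lower_type_def by blast
  have "\<phi> x (s * t) \<le> \<bar>C\<bar> * s powr p * \<phi> x t" if "t \<ge> 0" "0 < s" "s < 1" for x t s
  proof -
    have nn: "\<phi> x t \<ge> 0" using g that(1) by (cases "t = 0") (auto simp: growth_function_def less_imp_le)
    have "\<phi> x (s * t) \<le> C * s powr p' * \<phi> x t" by (rule C[OF that])
    also have "\<dots> \<le> \<bar>C\<bar> * s powr p' * \<phi> x t" using nn by (intro mult_right_mono) auto
    also have "\<dots> \<le> \<bar>C\<bar> * s powr p * \<phi> x t"
      using nn that assms(3) by (intro mult_right_mono mult_left_mono powr_mono') auto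
    finally show ?thesis .
  qed
  then show ?thesis unfolding uniformly_lower_type_def by blast
qed

text \<open>Scaling by s and back by 1 / s gives 1 \<le> U C s^(p - 1), which is violated by small s
  when p > 1. It follows that the lower type index is a supremum over a bounded set.\<close>

lemma uniformly_lower_type_le_1:
  fixes \<phi> :: "real^'n \<Rightarrow> real \<Rightarrow> real"
  assumes g: "growth_function \<phi>" and p: "uniformly_lower_type p \<phi>"
  shows "p \<le> 1"
proof (rule ccontr)
  assume "\<not> p \<le> 1"
  then have p1: "p - 1 > 0" by simp
  obtain C where C: "\<And>x t s. \<lbrakk>t \<ge> 0; 0 < s; s < 1\<rbrakk> \<Longrightarrow> \<phi> x (s * t) \<le> C * s powr p * \<phi> x t"
    using p unfolding uniformly_lower_type_def by blast
  obtain U where U: "\<And>x t s. \<lbrakk>t \<ge> 0; 1 \<le> s\<rbrakk> \<Longrightarrow> \<phi> x (s * t) \<le> U * s powr 1 * \<phi> x t"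
    using g unfolding growth_function_def uniformly_upper_type_def by blast
  have pos: "\<phi> 0 t > 0" if "t > 0" for t using g that by (auto simp: growth_function_def)
  \<comment> \<open>Larger than both 1 and U C; s is then the scale with s^(p - 1) = 1 / k.\<close>
  define k where "k = 2 * (\<bar>U * C\<bar> + 1)"
  have k: "k > 1" by (simp add: k_def)
  define s where "s = (1 / k) powr (1 / (p - 1))"
  have s: "s > 0" "s < 1" using k p1 powr_less_mono2[of "1 / (p - 1)" "1 / k" 1] by (auto simp: s_def)
  have sp: "s powr (p - 1) = 1 / k" unfolding s_def powr_powr using p1 k by simp
  have U0: "U > 0"
  proof -
    have "\<phi> 0 (1 * 1) \<le> U * 1 powr 1 * \<phi> 0 1" by (rule U) auto
    then show ?thesis using pos[of 1] by (smt (verit) mult_1 mult_nonneg_nonneg mult_nonpos_nonneg powr_one_eq_one mult.right_neutral)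
  qed
  have "\<phi> 0 1 = \<phi> 0 (1 / s * s)" using s by simp
  also have "\<dots> \<le> U * (1 / s) powr 1 * \<phi> 0 s" using s by (intro U) auto
  also have "\<dots> = U / s * \<phi> 0 (s * 1)" using s by simp
  also have "\<dots> \<le> U / s * (C * s powr p * \<phi> 0 1)" using s U0 by (intro mult_left_mono C) auto
  also have "s powr p = s * s powr (p - 1)" using s by (simp add: powr_mult_base)
  also have "U / s * (C * (s * s powr (p - 1)) * \<phi> 0 1) = U * C / k * \<phi> 0 1" using s by (simp add: sp)
  finally have "1 * \<phi> 0 1 \<le> U * C / k * \<phi> 0 1" by simp
  then have "1 \<le> U * C / k" using pos[of 1] by (simp only: mult_le_cancel_right_pos zero_less_one)
  then have "k \<le> U * C" using k by (simp add: le_divide_eq)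
  then show False by (simp add: k_def)
qed

text \<open>If all ratios were at most \<tau> < 1, all q would be at most 1 / (1 - \<tau>), and so
  would the supremum, which bounds its ratio by \<tau> as well.\<close>

lemma minus_one_ratio_Sup:
  assumes Q: "Q \<noteq> {}" "\<And>q. q \<in> Q \<Longrightarrow> 1 < q" and \<tau>: "\<tau> < minus_one_ratio (Sup Q)"
  shows "\<exists>q\<in>Q. \<tau> < minus_one_ratio q"
proof (rule ccontr)
  assume "\<not> ?thesis"
  then have le: "minus_one_ratio q \<le> \<tau>" if "q \<in> Q" for q using that by (auto simp: not_less)
  obtain q0 where q0: "q0 \<in> Q" using Q by blast
  have S1: "1 < Sup Q" using Q(2)[OF q0] Sup_upper[OF q0] by (rule less_le_trans)
  have "minus_one_ratio (Sup Q) \<le> 1"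
    using S1 by (cases "Sup Q") (auto simp: minus_one_ratio_def divide_le_eq)
  then have \<tau>1: "\<tau> < 1" using \<tau> by simp
  have "q \<le> ereal (1 / (1 - \<tau>))" if q: "q \<in> Q" for q
  proof (cases q)
    case (real a)
    have "a > 1" using Q(2)[OF q] real by simp
    moreover have "(a - 1) / a \<le> \<tau>" using le[OF q] real by (simp add: minus_one_ratio_def)
    ultimately have "a - 1 \<le> \<tau> * a" by (simp add: divide_le_eq)
    then have "a * (1 - \<tau>) \<le> 1" by (simp add: algebra_simps)
    then show ?thesis using real \<tau>1 by (simp add: le_divide_eq)
  next
    case PInf
    then show ?thesis using le[OF q] \<tau>1 by (simp add: minus_one_ratio_def)
  next
    case MInf
    then show ?thesis by simp
  qed
  then have S: "Sup Q \<le> ereal (1 / (1 - \<tau>))" by (rule Sup_least)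
  obtain a where a: "Sup Q = ereal a" using S S1 by (cases "Sup Q") auto
  have a1: "a > 1" using S1 a by simp
  have "a \<le> 1 / (1 - \<tau>)" using S a by simp
  then have "a * (1 - \<tau>) \<le> 1" using \<tau>1 by (simp add: le_divide_eq)
  then have "a - 1 \<le> \<tau> * a" by (simp add: algebra_simps)
  then have "(a - 1) / a \<le> \<tau>" using a1 by (simp add: divide_le_eq)
  then show False using \<tau> a by (simp add: minus_one_ratio_def)
qed

text \<open>The indices are infima and suprema that need not be attained. Since the index inequality
  is strict, q, then p1 and finally p can be moved to permitted values while it is
  preserved.\<close>

lemma exists_parameters:
  fixes \<phi> :: "real^'n \<Rightarrow> real \<Rightarrow> real"
  assumes g: "growth_function \<phi>"
    and index: "2 * real CARD('n) * weight_index \<phi> / lower_type_index \<phi>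
        - real CARD('n) * minus_one_ratio (reverse_Hoelder_index \<phi>) < real CARD('n) + 1"
  obtains p\<^sub>1 p q where "1 \<le> p\<^sub>1" "Muckenhoupt p\<^sub>1 \<phi>" "weight_index \<phi> \<le> p\<^sub>1"
    "0 < p" "uniformly_lower_type p \<phi>" "p \<le> lower_type_index \<phi>"
    "1 < q" "reverse_Hoelder q \<phi>" "q \<le> reverse_Hoelder_index \<phi>"
    "p < p\<^sub>1" "2 * real CARD('n) * (p\<^sub>1 / p) < real CARD('n) + 1 + real CARD('n) * minus_one_ratio q"
proof -
  define n where "n = real CARD('n)"
  define W where "W = {p. 1 \<le> p \<and> Muckenhoupt p \<phi>}"
  define L where "L = {p. 0 < p \<and> uniformly_lower_type p \<phi>}"
  define Q where "Q = {q. 1 < q \<and> reverse_Hoelder q \<phi>}"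
  define w where "w = weight_index \<phi>"
  define l where "l = lower_type_index \<phi>"
  have n: "n \<ge> 1" by (simp add: n_def Suc_le_eq)
  have W0: "W \<noteq> {}" using g unfolding growth_function_def Muckenhoupt_infinity_def W_def by blast
  have W_bdd: "bdd_below W" by (rule bdd_belowI[of _ 1]) (simp add: W_def)
  have w: "w = Inf W" by (simp add: w_def weight_index_def W_def)
  have w1: "w \<ge> 1" unfolding w by (rule cInf_greatest[OF W0]) (simp add: W_def)
  obtain p\<^sub>0 where p0: "p\<^sub>0 \<in> L" using g unfolding growth_function_def L_def by blast
  have L_le: "p \<le> 1" if "p \<in> L" for p using that uniformly_lower_type_le_1[OF g] by (simp add: L_def)
  have L_bdd: "bdd_above L" using L_le by (rule bdd_aboveI)
  have l: "l = Sup L" by (simp add: l_def lower_type_index_def L_def)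
  have l1: "l \<le> 1" unfolding l using p0 L_le by (intro cSup_least) auto
  have l0: "l > 0" using cSup_upper[OF p0 L_bdd] p0 unfolding l L_def by simp
  have wl: "w / l \<ge> 1" using w1 l1 l0 by (simp add: le_divide_eq)
  have i: "2 * n * (w / l) - n * minus_one_ratio (Sup Q) < n + 1"
    using index by (simp add: n_def w_def l_def reverse_Hoelder_index_def Q_def)
  \<comment> \<open>The supremum of the empty set is - \<infinity>, whose ratio is 0 by the default
    values of \<open>real_of_ereal\<close> and of division. As w / l is at least 1, the index
    inequality would then give 2 n < n + 1.\<close>
  have Q0: "Q \<noteq> {}"
  proof
    assume "Q = {}"
    then have "minus_one_ratio (Sup Q) = 0" by (simp add: minus_one_ratio_def bot_ereal_def)
    moreover have "2 * n * 1 \<le> 2 * n * (w / l)" using wl n by (intro mult_left_mono) auto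
    ultimately show False using i n by simp
  qed
  obtain q where q: "q \<in> Q" "(2 * n * (w / l) - (n + 1)) / n < minus_one_ratio q"
  proof -
    have "(2 * n * (w / l) - (n + 1)) / n < minus_one_ratio (Sup Q)" using i n by (simp add: divide_less_eq mult.commute)
    then show ?thesis using minus_one_ratio_Sup[OF Q0] that by (auto simp: Q_def)
  qed
  \<comment> \<open>The threshold for p1 / p: the required inequality says p1 / p < \<rho>.\<close>
  define \<rho> where "\<rho> = (n + 1 + n * minus_one_ratio q) / (2 * n)"
  have \<rho>: "w / l < \<rho>" using q(2) n by (simp add: \<rho>_def field_simps)
  have \<rho>1: "\<rho> > 1" using \<rho> wl by simp
  have "Inf W < \<rho> * l" using \<rho> l0 w by (simp add: divide_less_eq)
  then obtain p\<^sub>1 where p1: "p\<^sub>1 \<in> W" "p\<^sub>1 < \<rho> * l" using cInf_lessD[OF W0] by blast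
  have "p\<^sub>1 / \<rho> < Sup L" using p1(2) \<rho>1 l by (simp add: divide_less_eq mult.commute)
  then obtain p' where p': "p' \<in> L" "p\<^sub>1 / \<rho> < p'" using less_cSupD[of L] p0 by blast
  \<comment> \<open>The midpoint lies strictly above p1 / \<rho> and strictly below both p' and p1.
    Strictness against p1 gives p1 / p > 1, hence \<beta> > 0, even if both indices are 1.\<close>
  define p where "p = (p\<^sub>1 / \<rho> + min p' p\<^sub>1) / 2"
  have p1_ge: "p\<^sub>1 \<ge> 1" using p1 by (simp add: W_def)
  have "p\<^sub>1 / \<rho> < p\<^sub>1" using \<rho>1 p1_ge by (simp add: divide_less_eq)
  then have "p\<^sub>1 / \<rho> < min p' p\<^sub>1" using p'(2) by simp
  then have "p\<^sub>1 / \<rho> < p" "p < min p' p\<^sub>1"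
    using less_half_sum[of "p\<^sub>1 / \<rho>" "min p' p\<^sub>1"] gt_half_sum[of "p\<^sub>1 / \<rho>" "min p' p\<^sub>1"] by (simp_all only: p_def one_add_one)
  then have p: "p\<^sub>1 / \<rho> < p" "p < p'" "p < p\<^sub>1" by simp_all
  have "0 < p\<^sub>1 / \<rho>" using p1_ge \<rho>1 by simp
  then have p_pos: "0 < p" using p(1) by simp
  have lt: "uniformly_lower_type p \<phi>" using p'(1) p(2) uniformly_lower_type_mono[OF g, of p' p] by (simp add: L_def)
  have "p\<^sub>1 / p < \<rho>" using p(1) p_pos \<rho>1 by (simp add: divide_less_eq mult.commute)
  then have "2 * n * (p\<^sub>1 / p) < 2 * n * \<rho>" using n by (intro mult_strict_left_mono) auto
  also have "2 * n * \<rho> = n + 1 + n * minus_one_ratio q" using n by (simp add: \<rho>_def)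
  finally have ineq: "2 * n * (p\<^sub>1 / p) < n + 1 + n * minus_one_ratio q" .
  show ?thesis
  proof
    show "1 \<le> p\<^sub>1" "Muckenhoupt p\<^sub>1 \<phi>" using p1 by (auto simp: W_def)
    show "weight_index \<phi> \<le> p\<^sub>1" using cInf_lower[OF p1(1) W_bdd] w by (simp add: w_def)
    show "0 < p" "uniformly_lower_type p \<phi>" "p < p\<^sub>1" by fact+
    show "p \<le> lower_type_index \<phi>" using cSup_upper[of p L] p_pos lt L_bdd l by (simp add: L_def l_def)
    show "1 < q" "reverse_Hoelder q \<phi>" using q by (auto simp: Q_def)
    show "q \<le> reverse_Hoelder_index \<phi>" using q(1) unfolding reverse_Hoelder_index_def Q_def by (rule Sup_upper)
    show "2 * real CARD('n) * (p\<^sub>1 / p) < real CARD('n) + 1 + real CARD('n) * minus_one_ratio q"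
      using ineq by (simp add: n_def)
  qed
qed

theorem corollary5p8:
  fixes \<phi> :: "real^'n \<Rightarrow> real \<Rightarrow> real"
  assumes growth: "growth_function \<phi>"
    and index1: "real CARD('n) * weight_index \<phi> < (real CARD('n) + 1) * lower_type_index \<phi>"
    and index2: "2 * real CARD('n) * weight_index \<phi> / lower_type_index \<phi>
        - real CARD('n) * minus_one_ratio (reverse_Hoelder_index \<phi>) < real CARD('n) + 1"
    and alternative:
      "(\<exists>C>0. \<forall>c\<^sub>1 c\<^sub>2. \<forall>r\<^sub>1>0. \<forall>r\<^sub>2>0. ball c\<^sub>1 r\<^sub>1 \<subseteq> ball c\<^sub>2 r\<^sub>2 \<longrightarrow>
          chi_norm \<phi> c\<^sub>1 r\<^sub>1 / measure lebesgue (ball c\<^sub>1 r\<^sub>1)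
            \<le> C * (chi_norm \<phi> c\<^sub>2 r\<^sub>2 / measure lebesgue (ball c\<^sub>2 r\<^sub>2)))
       \<or> weight_index \<phi> * conjugate_index (reverse_Hoelder_index \<phi>) \<in> {1<..<2}"
  shows "\<exists>P Q. admissible Sqrt_Laplacian \<phi> P \<and> admissible Laplacian \<phi> Q \<and>
    (let poisson = {BMO_gen Sqrt_Laplacian \<phi>, BMO_max Sqrt_Laplacian \<phi>, BMO_tilde Sqrt_Laplacian \<phi> P};
         heat = {BMO_gen Laplacian \<phi>, BMO_max Laplacian \<phi>, BMO_tilde Laplacian \<phi> Q}
     in (\<forall>X \<in> {BMO \<phi>} \<union> poisson. \<forall>Y \<in> {BMO \<phi>} \<union> poisson.
           coincide_modulo (invariant_class Sqrt_Laplacian) X Y) \<and>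
        (\<forall>X \<in> {BMO \<phi>} \<union> poisson \<union> heat. \<forall>Y \<in> {BMO \<phi>} \<union> poisson \<union> heat.
           coincide_modulo (invariant_class Laplacian) X Y))"
proof -
  let ?n = "real CARD('n)"
  obtain p\<^sub>1 p q where p1: "1 \<le> p\<^sub>1" "Muckenhoupt p\<^sub>1 \<phi>" "weight_index \<phi> \<le> p\<^sub>1"
    and p: "0 < p" "uniformly_lower_type p \<phi>" "p \<le> lower_type_index \<phi>"
    and q: "1 < q" "reverse_Hoelder q \<phi>" "q \<le> reverse_Hoelder_index \<phi>"
    and pp1: "p < p\<^sub>1" and ineq: "2 * ?n * (p\<^sub>1 / p) < ?n + 1 + ?n * minus_one_ratio q"
    using exists_parameters[OF growth index2] by blast
  \<comment> \<open>With \<nu> = \<alpha> = n and N = 0 the exponent in the compatibility condition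
    is \<beta>, and the terms \<nu> and - \<alpha> cancel in the admissibility inequality. One
    parameter set serves both semigroups.\<close>
  define P where "P = \<lparr>par_nu = ?n, par_N = 0, par_alpha = ?n, par_p1 = p\<^sub>1, par_p = p, par_q = q\<rparr>"
  define \<beta> where "\<beta> = ?n * p\<^sub>1 / p - ?n"
  \<comment> \<open>A decay order strictly below n + 1, as the Poisson kernel demands; the heat
    kernel permits the same M.\<close>
  obtain M where M: "2 * ?n * (p\<^sub>1 / p) - ?n * minus_one_ratio q < M" "M < ?n + 1"
    using dense[of "2 * ?n * (p\<^sub>1 / p) - ?n * minus_one_ratio q" "?n + 1"] ineq by auto
  have adm: "admissible A \<phi> P" for A
    unfolding admissible_def using p1 p q M
    by (cases A) (auto simp: P_def intro!: exI[of _ M])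
  interpret growth \<phi> p\<^sub>1 p using growth p1 p by unfold_locales
  have "p\<^sub>1 / p > 1" using p pp1 by simp
  then have \<beta>_pos: "\<beta> > 0" unfolding \<beta>_def by (simp add: less_divide_eq_1 flip: times_divide_eq_right)
  \<comment> \<open>This turns the parameter inequality into 2 n p1 / p < 2 n + 1, which is the
    condition 2 \<beta> < 1.\<close>
  have "minus_one_ratio q \<le> 1" using q(1) by (cases q) (auto simp: minus_one_ratio_def divide_le_eq)
  then have "?n * minus_one_ratio q \<le> ?n * 1" by (intro mult_left_mono) auto
  moreover have "2 * \<beta> = 2 * ?n * (p\<^sub>1 / p) - 2 * ?n" by (simp add: \<beta>_def)
  ultimately have \<beta>_lt: "2 * \<beta> < 1" using ineq by linarith
  obtain D where D: "ball_gauge (chi_norm \<phi>) D \<beta>" using ball_gauge_chi_norm[OF \<beta>_def \<beta>_pos \<beta>_lt] by blast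
  interpret musielak_gauge \<phi> D \<beta> P
    by (intro musielak_gauge.intro D musielak_gauge_axioms.intro) (simp add: P_def \<beta>_def)
  show ?thesis using adm spaces_coincide by blast
qed

end
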